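(* Let $n\ge1$, $p,q\ge0$, $\beta>0$ and $k\in\{1,\dots,n\}$. Let the initial condition $\Lambda_0=(\lambda^1_0,\dots,\lambda^n_0)$ be independent of the Brownian motion $\mathbf{B}$ and such that $0\le\lambda^1_0\le\dots\le\lambda^n_0\le1$ a.s. Then: (i) if $\lambda^k_0>0$ a.s., the system $J(p,q)$ (see context) has a local solution $\Lambda=(\lambda^1_t,\dots,\lambda^n_t)_t$ defined up to a stopping time $\mathcal{T}$, and $k\beta(p-n+k)\ge2$, then there is no collision of $k$ particles at zero; more precisely, $$\mathbb{P}\big(\mathcal{T}=+\infty,\ \exists t\ge0:\lambda^1_t+\lambda^2_t+\dots+\lambda^k_t=0\big)+\mathbb{P}\Big(\mathcal{T}<+\infty,\ \inf_{t\in[0,\mathcal{T})}(\lambda^1_t+\lambda^2_t+\dots+\lambda^k_t)=0\Big)=0.$$ (ii) if $\lambda^{n-k+1}_0<1$ a.s., the system $J(p,q)$ has a local solution $\Lambda=(\lambda^1_t,\dots,\lambda^n_t)_t$ defined up to a stopping time $\mathcal{T}$, and $k\beta(q-n+k)\ge2$, then there is no collision of $k$ particles at $1$; more precisely, $$\mathbb{P}\big(\mathcal{T}=+\infty,\ \exists t\ge0:\lambda^{n-k+1}_t+\lambda^{n-k+2}_t+\dots+\lambda^n_t=k\big)+\mathbb{P}\Big(\mathcal{T}<+\infty,\ \sup_{t\in[0,\mathcal{T})}(\lambda^{n-k+1}_t+\lambda^{n-k+2}_t+\dots+\lambda^n_t)=k\Big)=0.$$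
   Context: Let $\mathbf{B}=(B^1_t,\dots,B^n_t)_{t\ge0}$ be an $n$-dimensional Brownian motion. The system of SDEs $J(p,q)$ (driven by $\mathbf{B}$, with parameter $\beta$) is $$d\lambda^i_t=2\sqrt{\lambda^i_t(1-\lambda^i_t)}\,dB^i_t+\beta\Big[p-(p+q)\lambda^i_t+\sum_{j\ne i}\frac{\lambda^i_t(1-\lambda^j_t)+\lambda^j_t(1-\lambda^i_t)}{\lambda^i_t-\lambda^j_t}\Big]dt,\qquad i\in\{1,\dots,n\},$$ together with the constraint $$0\le\lambda^1_t<\dots<\lambda^n_t\le1\quad\text{a.s., }dt\text{-almost everywhere}.$$ Solutions are understood to be continuous adapted processes (so $0\le\lambda^1_t\le\dots\le\lambda^n_t\le 1$ for all $t$ a.s.), for which the drift terms are integrable on compact time subintervals of the interval of definition. A local solution defined up to a stopping time $\mathcal{T}$ satisfies the system on $[0,\mathcal{T})$. *)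

theory Defs
  imports "HOL-Probability.Probability"
begin

text \<open>
  Processes are indexed by real times \<open>t \<ge> 0\<close> (values at negative times are irrelevant), whereas
  filtrations and stopping times use \<^typ>\<open>ennreal\<close>, so that a stopping time may be infinite.
  The usual conditions are not imposed, hence path properties are only required almost surely.
\<close>

locale filtered_prob_space = prob_space M + filtration "space M" F
  for M :: "'a measure" and F :: "ennreal \<Rightarrow> 'a measure" +
  assumes subalgebra_F: "\<And>t. subalgebra M (F t)"

text \<open>Standard \<open>n\<close>-dimensional Brownian motion relative to the filtration \<open>F\<close>; the coordinates are
  \<open>B 1, \<dots>, B n\<close>. The last clause is independence of the increment vector from \<open>F s\<close>.\<close>

definition brownian_motion ::
  "'a measure \<Rightarrow> (ennreal \<Rightarrow> 'a measure) \<Rightarrow> nat \<Rightarrow> (nat \<Rightarrow> real \<Rightarrow> 'a \<Rightarrow> real) \<Rightarrow> bool" where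
  "brownian_motion M F n B \<longleftrightarrow>
     (\<forall>i\<in>{1..n}. \<forall>t\<ge>0. B i t \<in> borel_measurable (F (ennreal t))) \<and>
     (\<forall>i\<in>{1..n}. AE \<omega> in M. B i 0 \<omega> = 0 \<and> continuous_on {0..} (\<lambda>t. B i t \<omega>)) \<and>
     (\<forall>s t. 0 \<le> s \<and> s < t \<longrightarrow>
        (\<forall>i\<in>{1..n}. distributed M lborel (\<lambda>\<omega>. B i t \<omega> - B i s \<omega>)
                       (\<lambda>x. ennreal (normal_density 0 (sqrt (t - s)) x))) \<and>
        prob_space.indep_vars M (\<lambda>_. borel) (\<lambda>i \<omega>. B i t \<omega> - B i s \<omega>) {1..n} \<and>
        prob_space.indep_set M (sets (F (ennreal s)))
          (sets (vimage_algebra (space M) (\<lambda>\<omega>. \<lambda>i\<in>{1..n}. B i t \<omega> - B i s \<omega>)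
                   (\<Pi>\<^sub>M i\<in>{1..n}. borel))))"

text \<open>The outer measure makes sense of the probability without a measurability assumption (the
  filtration and \<open>M\<close> need not be complete); on measurable sets it is the probability.\<close>

definition tendsto_zero_in_prob :: "'a measure \<Rightarrow> (nat \<Rightarrow> 'a \<Rightarrow> ennreal) \<Rightarrow> bool" where
  "tendsto_zero_in_prob M Y \<longleftrightarrow>
     (\<forall>\<epsilon>>0. (\<lambda>r. outer_measure_of M {\<omega>\<in>space M. \<epsilon> < Y r \<omega>}) \<longlonglongrightarrow> 0)"

text \<open>A simple process is \<open>\<Sum>j<m. \<xi> j * indicator {\<tau> j<..\<tau> (Suc j)}\<close> with deterministic knots \<open>\<tau>\<close> and
  bounded weights \<open>\<xi> j\<close> known at time \<open>\<tau> j\<close>.\<close>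

definition simple_process ::
  "'a measure \<Rightarrow> (ennreal \<Rightarrow> 'a measure) \<Rightarrow> nat \<Rightarrow> (nat \<Rightarrow> real) \<Rightarrow> (nat \<Rightarrow> 'a \<Rightarrow> real) \<Rightarrow> bool" where
  "simple_process M F m \<tau> \<xi> \<longleftrightarrow>
     0 \<le> \<tau> 0 \<and> mono_on {..m} \<tau> \<and>
     (\<forall>j<m. \<xi> j \<in> borel_measurable (F (ennreal (\<tau> j))) \<and> (\<exists>C. \<forall>\<omega>\<in>space M. \<bar>\<xi> j \<omega>\<bar> \<le> C))"

definition simple_value ::
  "nat \<Rightarrow> (nat \<Rightarrow> real) \<Rightarrow> (nat \<Rightarrow> 'a \<Rightarrow> real) \<Rightarrow> real \<Rightarrow> 'a \<Rightarrow> real" where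
  "simple_value m \<tau> \<xi> t \<omega> = (\<Sum>j<m. \<xi> j \<omega> * indicator {\<tau> j<..\<tau> (Suc j)} t)"

definition simple_integral_wrt ::
  "(real \<Rightarrow> 'a \<Rightarrow> real) \<Rightarrow> nat \<Rightarrow> (nat \<Rightarrow> real) \<Rightarrow> (nat \<Rightarrow> 'a \<Rightarrow> real) \<Rightarrow> real \<Rightarrow> 'a \<Rightarrow> real" where
  "simple_integral_wrt W m \<tau> \<xi> t \<omega> =
     (\<Sum>j<m. \<xi> j \<omega> * (W (min t (\<tau> (Suc j))) \<omega> - W (min t (\<tau> j)) \<omega>))"

text \<open>\<open>is_ito_integral M F W H X\<close>: the continuous process \<open>X\<close> is (a version of) the Ito integral
  \<open>X t = \<integral>\<^sub>0\<^sup>t H s dW s\<close>, \<open>t \<ge> 0\<close>, for a locally square integrable integrand \<open>H\<close>: there are simple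
  processes approximating \<open>H\<close> in \<open>L\<^sup>2([0,t], ds)\<close> in probability, whose elementary integrals
  converge to \<open>X\<close> uniformly on \<open>[0,t]\<close> in probability.\<close>

definition is_ito_integral ::
  "'a measure \<Rightarrow> (ennreal \<Rightarrow> 'a measure) \<Rightarrow> (real \<Rightarrow> 'a \<Rightarrow> real) \<Rightarrow> (real \<Rightarrow> 'a \<Rightarrow> real) \<Rightarrow>
     (real \<Rightarrow> 'a \<Rightarrow> real) \<Rightarrow> bool" where
  "is_ito_integral M F W H X \<longleftrightarrow>
     (AE \<omega> in M. set_borel_measurable lborel {0..} (\<lambda>s. H s \<omega>)) \<and>
     (AE \<omega> in M. continuous_on {0..} (\<lambda>t. X t \<omega>)) \<and>
     (\<exists>m \<tau> \<xi>.
        (\<forall>r. simple_process M F (m r) (\<tau> r) (\<xi> r)) \<and>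
        (\<forall>t\<ge>0. tendsto_zero_in_prob M (\<lambda>r \<omega>.
           \<integral>\<^sup>+s\<in>{0..t}. ennreal ((simple_value (m r) (\<tau> r) (\<xi> r) s \<omega> - H s \<omega>)\<^sup>2) \<partial>lborel)) \<and>
        (\<forall>t\<ge>0. tendsto_zero_in_prob M (\<lambda>r \<omega>.
           SUP s\<in>{0..t}. ennreal \<bar>simple_integral_wrt W (m r) (\<tau> r) (\<xi> r) s \<omega> - X s \<omega>\<bar>)))"

definition jacobi_drift ::
  "nat \<Rightarrow> real \<Rightarrow> real \<Rightarrow> real \<Rightarrow> (nat \<Rightarrow> real) \<Rightarrow> nat \<Rightarrow> real" where
  "jacobi_drift n p q \<beta> x i =
     \<beta> * (p - (p + q) * x i +
          (\<Sum>j\<in>{1..n} - {i}. (x i * (1 - x j) + x j * (1 - x i)) / (x i - x j)))"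

text \<open>Local solution of \<open>J(p,q)\<close> on \<open>[0,T)\<close> started at \<open>\<Lambda>0\<close>. The values \<open>\<Lambda> i t \<omega>\<close> with \<open>t \<ge> T \<omega>\<close>
  are irrelevant. The stochastic integral on \<open>[0,T)\<close> is the restriction of that of the (bounded)
  integrand cut off at \<open>T\<close>. The weak ordering in \<open>[0,1]\<close> for all \<open>t < T\<close> follows from the
  constraint by continuity. Division by zero occurs only on the \<open>dt\<close>-null set of collision times.\<close>

definition jacobi_local_solution ::
  "'a measure \<Rightarrow> (ennreal \<Rightarrow> 'a measure) \<Rightarrow> (nat \<Rightarrow> real \<Rightarrow> 'a \<Rightarrow> real) \<Rightarrow> nat \<Rightarrow> real \<Rightarrow> real \<Rightarrow> real \<Rightarrow>
     (nat \<Rightarrow> 'a \<Rightarrow> real) \<Rightarrow> (nat \<Rightarrow> real \<Rightarrow> 'a \<Rightarrow> real) \<Rightarrow> ('a \<Rightarrow> ennreal) \<Rightarrow> bool" where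
  "jacobi_local_solution M F B n p q \<beta> \<Lambda>0 \<Lambda> T \<longleftrightarrow>
     stopping_time F T \<and>
     (\<forall>i\<in>{1..n}. \<forall>t\<ge>0.
        (\<lambda>\<omega>. if ennreal t < T \<omega> then \<Lambda> i t \<omega> else 0) \<in> borel_measurable (F (ennreal t))) \<and>
     (\<forall>i\<in>{1..n}. AE \<omega> in M. continuous_on {t. 0 \<le> t \<and> ennreal t < T \<omega>} (\<lambda>t. \<Lambda> i t \<omega>)) \<and>
     (AE \<omega> in M. AE t in lborel. 0 \<le> t \<and> ennreal t < T \<omega> \<longrightarrow>
        0 \<le> \<Lambda> 1 t \<omega> \<and> strict_mono_on {1..n} (\<lambda>i. \<Lambda> i t \<omega>) \<and> \<Lambda> n t \<omega> \<le> 1) \<and>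
     (\<forall>i\<in>{1..n}. AE \<omega> in M. \<forall>t\<ge>0. ennreal t < T \<omega> \<longrightarrow>
        set_integrable lborel {0..t} (\<lambda>s. jacobi_drift n p q \<beta> (\<lambda>j. \<Lambda> j s \<omega>) i)) \<and>
     (\<forall>i\<in>{1..n}. \<exists>X.
        is_ito_integral M F (B i)
          (\<lambda>s \<omega>. if ennreal s < T \<omega> then 2 * sqrt (\<Lambda> i s \<omega> * (1 - \<Lambda> i s \<omega>)) else 0) X \<and>
        (AE \<omega> in M. \<forall>t\<ge>0. ennreal t < T \<omega> \<longrightarrow>
           \<Lambda> i t \<omega> = \<Lambda>0 i \<omega> + X t \<omega> +
             (LINT s:{0..t}|lborel. jacobi_drift n p q \<beta> (\<lambda>j. \<Lambda> j s \<omega>) i)))"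

end

theory Submission
  imports Defs
begin

text \<open>Let \<open>S\<close> be the sum of the \<open>k\<close> lowest particles. In its drift
  the interactions inside the group cancel by antisymmetry, and an interaction with an outer
  particle \<open>j\<close> equals -1 minus \<open>2 * (l i * (1 - l j) / (l j - l i))\<close>.
  Hence dS = dX + (c - b S - \<nu>) dt, where c = \<beta> k (p - n + k), b = \<beta> (p + q), \<nu>
  \<ge> 0 is the singular push of the outer particles, and X is a martingale whose bracket has a
  density of at most 4 S. Formally the drift of log S is then at least (c - 2) / S - b - \<nu> / S.
  The hypothesis says c \<ge> 2, so only \<nu> / S could drag log S to minus infinity.

  If particle \<open>k + 1\<close> stays above 1 / m, then \<nu> / S is at most m (2 \<beta> k (n -
  k) + 2 \<nu>) (\<open>\<nu>_le\<close>), and \<nu> is integrable in time up to and including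
  \<open>T\<close>, because S, X and the bounded part of the drift stay bounded
  (\<open>\<nu>\<^sub>0_integrable\<close>). So log S has a drift bounded below by a process of
  finite variation, and S stays away from 0 on every bounded time interval, also when approaching
  \<open>T\<close>. The assumption on particle \<open>k + 1\<close> comes from a descending
  induction: for \<open>k = n\<close> there is no outer particle, and if the sum of the
  \<open>k + 1\<close> lowest particles is bounded away from 0, so is the largest of them. The
  condition c \<ge> 2 passes from \<open>k\<close> to all larger indices
  (\<open>positive_step\<close>, \<open>positive_collision\<close>).

  Ito's formula for log S is replaced by a second order Taylor bound for a truncated logarithm along
  a grid (\<open>clog_taylor\<close>). The expectation of the increments, summed until S first drops
  below \<epsilon>, is bounded below by a constant free of \<epsilon>, and above by a constant minus
  the probability of dropping times log (2 \<kappa> / \<epsilon>). Letting \<epsilon> tend to 0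
  gives probability zero (\<open>hit_probability_bound\<close>, \<open>no_hit\<close>). The locale
  \<open>log_barrier\<close> isolates this argument; \<open>drift_lower\<close> and
  \<open>barrier\<close> show that S, with its singular drift capped, fits into it.

  About the stochastic integrals the argument needs this: increments are centred given the past,
  have conditional second moment equal to the integral of the squared integrand, are orthogonal for
  different coordinates, and have fourth moments of order (t - s)^2. These facts are derived from
  the definition by approximation. The integrand is bounded by 1, so the approximating simple
  processes may be clipped to [-1, 1]. The discarded part tends to 0 in probability by Lenglart's
  inequality, and the clipped part has Gaussian exponential moments
  (\<open>step_integral_exp\<close>), which give the uniform integrability needed to pass to the
  limit (\<open>ito_step_approximation\<close>, \<open>ito_increment\<close>,
  \<open>ito_sum_moments\<close>). Almost sure limits are measurable only up to null sets, so all of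
  this takes place in the completed measure and the augmented filtration.

  The statement at 1 follows from the one at 0 by the reflection of particle \<open>i\<close> into 1
  minus particle \<open>n + 1 - i\<close>, which exchanges \<open>p\<close> and \<open>q\<close>
  (\<open>reflect\<close>).\<close>

section \<open>Augmentation of the filtration by null sets\<close>

text \<open>Stochastic integrals are known only as almost sure limits, and \<open>F\<close> need not
  contain null sets. An augmented event may differ from an event of \<open>N\<close> on any part of
  a null set, so it is an event of the completion of \<open>M\<close> rather than of
  \<open>M\<close>.\<close>

definition augment :: "'a measure \<Rightarrow> 'a measure \<Rightarrow> 'a measure" where
  "augment M N = sigma (space M) {A. A \<subseteq> space M \<and> (\<exists>B\<in>sets N. AE \<omega> in M. \<omega> \<in> A \<longleftrightarrow> \<omega> \<in> B)}"

lemma space_augment [simp]: "space (augment M N) = space M"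
  by (simp add: augment_def space_measure_of_conv)

text \<open>The generating family is already a sigma-algebra: for a countable union, the exceptional
  null sets of the countably many witnesses combine into one.\<close>

lemma sets_augment:
  assumes "subalgebra M N"
  shows "sets (augment M N) = {A. A \<subseteq> space M \<and> (\<exists>B\<in>sets N. AE \<omega> in M. \<omega> \<in> A \<longleftrightarrow> \<omega> \<in> B)}"
    (is "_ = ?S")
proof -
  have sp: "space N = space M" using assms by (simp add: subalgebra_def)
  have "sigma_algebra (space M) ?S"
    unfolding sigma_algebra_iff2
  proof (intro conjI ballI allI impI)
    show "?S \<subseteq> Pow (space M)" by auto
    show "{} \<in> ?S" by auto
    fix s assume "s \<in> ?S"
    then obtain B where B: "B \<in> sets N" "AE \<omega> in M. \<omega> \<in> s \<longleftrightarrow> \<omega> \<in> B" by auto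
    have "AE \<omega> in M. \<omega> \<in> space M - s \<longleftrightarrow> \<omega> \<in> space N - B"
      using B(2) by eventually_elim (auto simp: sp)
    then show "space M - s \<in> ?S"
      using B(1) by blast
  next
    fix A :: "nat \<Rightarrow> 'a set" assume "range A \<subseteq> ?S"
    then have A: "\<And>i. A i \<subseteq> space M" "\<forall>i. \<exists>B\<in>sets N. AE \<omega> in M. \<omega> \<in> A i \<longleftrightarrow> \<omega> \<in> B"
      by (auto simp: subset_eq)
    then obtain B where B: "\<And>i. B i \<in> sets N" "\<And>i. AE \<omega> in M. \<omega> \<in> A i \<longleftrightarrow> \<omega> \<in> B i"
      by metis
    have "AE \<omega> in M. \<forall>i. \<omega> \<in> A i \<longleftrightarrow> \<omega> \<in> B i"
      using B(2) by (simp add: AE_all_countable)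
    then have "AE \<omega> in M. \<omega> \<in> (\<Union>i. A i) \<longleftrightarrow> \<omega> \<in> (\<Union>i. B i)"
      by eventually_elim auto
    moreover have "(\<Union>i. B i) \<in> sets N" using B(1) by auto
    moreover have "(\<Union>i. A i) \<subseteq> space M" using A(1) by auto
    ultimately show "\<Union> (range A) \<in> ?S" by blast
  qed
  then show ?thesis
    unfolding augment_def by (subst sets_measure_of) (auto simp: sigma_algebra.sigma_sets_eq)
qed

lemma augment_superset: "subalgebra M N \<Longrightarrow> sets N \<subseteq> sets (augment M N)"
  using sets.sets_into_space[of _ N] by (fastforce simp: sets_augment subalgebra_def)

lemma subalgebra_augment_mono:
  "subalgebra M N \<Longrightarrow> subalgebra M N' \<Longrightarrow> sets N \<subseteq> sets N' \<Longrightarrow> subalgebra (augment M N') (augment M N)"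
  by (auto simp: sets_augment subalgebra_def)

lemma subalgebra_completion_augment:
  assumes "subalgebra M N"
  shows "subalgebra (completion M) (augment M N)"
  unfolding subalgebra_def
proof (safe)
  fix A assume "A \<in> sets (augment M N)"
  then obtain B where AB: "A \<subseteq> space M" "B \<in> sets N" "AE \<omega> in M. \<omega> \<in> A \<longleftrightarrow> \<omega> \<in> B"
    using assms by (auto simp: sets_augment)
  from AB(3) obtain Z where Z: "Z \<in> null_sets M" "{\<omega>\<in>space M. \<not> (\<omega> \<in> A \<longleftrightarrow> \<omega> \<in> B)} \<subseteq> Z"
    by (auto simp: eventually_ae_filter)
  have BM: "B \<in> sets M" using AB assms by (auto simp: subalgebra_def)
  \<comment> \<open>An augmented event is a measurable set up to a piece of the null set
    \<open>Z\<close>, which is the form in which sets of the completion are recognised.\<close>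
  have "A = (B - Z) \<union> (A \<inter> Z)"
    using Z AB(1) sets.sets_into_space[OF BM] by auto
  moreover have "(B - Z) \<union> (A \<inter> Z) \<in> sets (completion M)"
    by (rule sets_completionI[of _ "B - Z" "A \<inter> Z" Z]) (use BM Z in auto)
  ultimately show "A \<in> sets (completion M)" by simp
qed simp_all

lemma augment_measurableI: "subalgebra M N \<Longrightarrow> f \<in> measurable N K \<Longrightarrow> f \<in> measurable (augment M N) K"
  using augment_superset[of M N] by (auto simp: measurable_def subalgebra_def)

lemma augment_measurable_AE_cong:
  assumes N: "subalgebra M N" and f: "f \<in> borel_measurable (augment M N)" and "AE \<omega> in M. f \<omega> = g \<omega>"
  shows "g \<in> borel_measurable (augment M N)"
proof (rule measurableI)
  fix A :: "'b set" assume A: "A \<in> sets borel"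
  have "f -` A \<inter> space M \<in> sets (augment M N)"
    using measurable_sets[OF f A] by simp
  then obtain B where B: "B \<in> sets N" "AE \<omega> in M. \<omega> \<in> f -` A \<inter> space M \<longleftrightarrow> \<omega> \<in> B"
    using N by (auto simp: sets_augment)
  have "AE \<omega> in M. \<omega> \<in> g -` A \<inter> space M \<longleftrightarrow> \<omega> \<in> B"
    using B(2) assms(3) by eventually_elim auto
  then show "g -` A \<inter> space (augment M N) \<in> sets (augment M N)"
    using N B(1) by (auto simp: sets_augment)
qed simp

text \<open>The source of all adaptedness below: Ito integrals and time integrals are almost sure
  limits of sums that are visibly adapted.\<close>

lemma augment_measurable_AE_lim:
  fixes f :: "'a \<Rightarrow> real"
  assumes N: "subalgebra M N" and g: "\<And>r. g r \<in> borel_measurable (augment M N)"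
    and "AE \<omega> in M. (\<lambda>r. g r \<omega>) \<longlonglongrightarrow> f \<omega>"
  shows "f \<in> borel_measurable (augment M N)"
proof -
  have "(\<lambda>\<omega>. lim (\<lambda>r. g r \<omega>)) \<in> borel_measurable (augment M N)"
    using g by measurable
  moreover have "AE \<omega> in M. lim (\<lambda>r. g r \<omega>) = f \<omega>"
    using assms(3) by eventually_elim (rule limI)
  ultimately show ?thesis by (rule augment_measurable_AE_cong[OF N])
qed

lemma augment_AE_set:
  assumes "subalgebra M N" "AE \<omega> in M. Q \<omega>"
  shows "{\<omega>\<in>space M. Q \<omega>} \<in> sets (augment M N)"
proof -
  have "AE \<omega> in M. \<omega> \<in> {\<omega>\<in>space M. Q \<omega>} \<longleftrightarrow> \<omega> \<in> space N"
    using assms(2,1) by (auto simp: subalgebra_def)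
  then show ?thesis using assms(1) by (auto simp: sets_augment)
qed

section \<open>Moments of Brownian increments given the past\<close>

lemma distributed_normal_expectation:
  assumes "prob_space M" and D: "distributed M lborel X (\<lambda>x. ennreal (normal_density 0 \<sigma> x))"
    and \<sigma>: "\<sigma> > 0"
  shows "integrable M (\<lambda>\<omega>. X \<omega>)" "integral\<^sup>L M X = 0"
    "integrable M (\<lambda>\<omega>. (X \<omega>)\<^sup>2)" "integral\<^sup>L M (\<lambda>\<omega>. (X \<omega>)\<^sup>2) = \<sigma>\<^sup>2"
    "integrable M (\<lambda>\<omega>. exp (\<theta> * X \<omega>))" "integral\<^sup>L M (\<lambda>\<omega>. exp (\<theta> * X \<omega>)) = exp (\<theta>\<^sup>2 * \<sigma>\<^sup>2 / 2)"
proof -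
  note di = distributed_integrable[OF D, simplified] and de = distributed_integral[OF D, simplified]
  show "integrable M (\<lambda>\<omega>. X \<omega>)"
    using di[of "\<lambda>x. x"] integrable_normal_moment_nz_1[OF \<sigma>, of 0] by simp
  show "integral\<^sup>L M X = 0"
    using de[of "\<lambda>x. x"] integral_normal_moment_nz_1[OF \<sigma>, of 0] by simp
  show "integrable M (\<lambda>\<omega>. (X \<omega>)\<^sup>2)"
    using di[of "\<lambda>x. x\<^sup>2"] integrable_normal_moment[OF \<sigma>, of 0 2] by simp
  show "integral\<^sup>L M (\<lambda>\<omega>. (X \<omega>)\<^sup>2) = \<sigma>\<^sup>2"
    using de[of "\<lambda>x. x\<^sup>2"] integral_normal_moment_even[OF \<sigma>, of 0 1] by (simp add: power2_eq_square)
  \<comment> \<open>Completing the square: exponential tilting shifts the mean of a Gaussian density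
    to \<open>\<theta> * \<sigma>\<^sup>2\<close> and produces the factor that is its Laplace
    transform.\<close>
  have *: "normal_density 0 \<sigma> x * exp (\<theta> * x) = exp (\<theta>\<^sup>2 * \<sigma>\<^sup>2 / 2) * normal_density (\<theta> * \<sigma>\<^sup>2) \<sigma> x" for x
    using \<sigma> unfolding normal_density_def
    by (simp add: mult.assoc[symmetric] exp_add[symmetric] mult_exp_exp) (simp add: field_simps power2_eq_square)
  show "integrable M (\<lambda>\<omega>. exp (\<theta> * X \<omega>))"
    using di[of "\<lambda>x. exp (\<theta> * x)"] \<sigma> by (simp add: *)
  show "integral\<^sup>L M (\<lambda>\<omega>. exp (\<theta> * X \<omega>)) = exp (\<theta>\<^sup>2 * \<sigma>\<^sup>2 / 2)"
    using de[of "\<lambda>x. exp (\<theta> * x)"] \<sigma> by (simp add: *)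
qed

locale brownian_setup = filtered_prob_space M F
  for M :: "'a measure" and F :: "ennreal \<Rightarrow> 'a measure" +
  fixes n :: nat and B :: "nat \<Rightarrow> real \<Rightarrow> 'a \<Rightarrow> real"
  assumes brownian: "brownian_motion M F n B"
begin

text \<open>Measurability and expectations are taken in the completion \<open>P\<close>, adaptedness
  with respect to the augmented \<open>G\<close>; almost sure statements remain statements about
  \<open>M\<close>.\<close>

abbreviation P where "P \<equiv> completion M"
abbreviation G where "G t \<equiv> augment M (F (ennreal t))"
abbreviation E where "E \<equiv> integral\<^sup>L P"

sublocale P: prob_space P by (rule prob_space_completion)

lemma sets_F_le: "s \<le> t \<Longrightarrow> sets (F (ennreal s)) \<subseteq> sets (F (ennreal t))"
  by (rule sets_F_mono) (simp add: ennreal_leI)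

lemma subalgebra_G: "s \<le> t \<Longrightarrow> subalgebra (G t) (G s)"
  by (rule subalgebra_augment_mono[OF subalgebra_F subalgebra_F sets_F_le])

lemma G_mono: "f \<in> measurable (G s) K \<Longrightarrow> s \<le> t \<Longrightarrow> f \<in> measurable (G t) K"
  using subalgebra_G[of s t] by (rule measurable_from_subalg)

lemma G_P: "f \<in> measurable (G s) K \<Longrightarrow> f \<in> measurable P K"
  using subalgebra_completion_augment[OF subalgebra_F] by (rule measurable_from_subalg)

lemma F_G: "f \<in> measurable (F (ennreal s)) K \<Longrightarrow> f \<in> measurable (G s) K"
  by (rule augment_measurableI[OF subalgebra_F])

lemma B_G: "i \<in> {1..n} \<Longrightarrow> 0 \<le> s \<Longrightarrow> s \<le> t \<Longrightarrow> B i s \<in> borel_measurable (G t)"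
  using brownian unfolding brownian_motion_def by (blast intro: F_G G_mono)

lemma B_incr_P: "i \<in> {1..n} \<Longrightarrow> 0 \<le> s \<Longrightarrow> 0 \<le> t \<Longrightarrow> (\<lambda>\<omega>. B i t \<omega> - B i s \<omega>) \<in> borel_measurable P"
  using G_P[OF B_G[of i s s]] G_P[OF B_G[of i t t]] by auto

lemma B_incr_M: "i \<in> {1..n} \<Longrightarrow> 0 \<le> s \<Longrightarrow> (\<lambda>\<omega>. B i s \<omega>) \<in> borel_measurable M"
  using brownian subalgebra_F unfolding brownian_motion_def by (blast intro: measurable_from_subalg)

lemma B_incr_expectation:
  assumes "i \<in> {1..n}" "0 \<le> s" "s < t"
  shows "integrable P (\<lambda>\<omega>. B i t \<omega> - B i s \<omega>)" "E (\<lambda>\<omega>. B i t \<omega> - B i s \<omega>) = 0"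
    "integrable P (\<lambda>\<omega>. (B i t \<omega> - B i s \<omega>)\<^sup>2)" "E (\<lambda>\<omega>. (B i t \<omega> - B i s \<omega>)\<^sup>2) = t - s"
    "integrable P (\<lambda>\<omega>. exp (\<theta> * (B i t \<omega> - B i s \<omega>)))"
    "E (\<lambda>\<omega>. exp (\<theta> * (B i t \<omega> - B i s \<omega>))) = exp (\<theta>\<^sup>2 * (t - s) / 2)"
proof -
  have D: "distributed M lborel (\<lambda>\<omega>. B i t \<omega> - B i s \<omega>)
                       (\<lambda>x. ennreal (normal_density 0 (sqrt (t - s)) x))"
    using brownian assms unfolding brownian_motion_def by blast
  have m [measurable]: "(\<lambda>\<omega>. B i t \<omega> - B i s \<omega>) \<in> borel_measurable M"
    using B_incr_M[of i s] B_incr_M[of i t] assms by auto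
  have sg: "sqrt (t - s) > 0" "(sqrt (t - s))\<^sup>2 = t - s" using assms by auto
  note d = distributed_normal_expectation[OF prob_space_axioms D sg(1), unfolded sg(2)]
  show "integrable P (\<lambda>\<omega>. B i t \<omega> - B i s \<omega>)" "integrable P (\<lambda>\<omega>. (B i t \<omega> - B i s \<omega>)\<^sup>2)"
     "integrable P (\<lambda>\<omega>. exp (\<theta> * (B i t \<omega> - B i s \<omega>)))"
    using d by (auto simp: integrable_completion)
  show "E (\<lambda>\<omega>. B i t \<omega> - B i s \<omega>) = 0" "E (\<lambda>\<omega>. (B i t \<omega> - B i s \<omega>)\<^sup>2) = t - s"
    "E (\<lambda>\<omega>. exp (\<theta> * (B i t \<omega> - B i s \<omega>))) = exp (\<theta>\<^sup>2 * (t - s) / 2)"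
    using d by (auto simp: integral_completion)
qed

text \<open>Independence of the increment vector from \<open>F s\<close> survives augmentation,
  because every event of \<open>G s\<close> agrees almost surely with an event of
  \<open>F s\<close>. The function \<open>f\<close> of the whole vector allows products of two
  coordinates.\<close>

lemma B_incr_indep:
  fixes Z :: "'a \<Rightarrow> real" and f :: "(nat \<Rightarrow> real) \<Rightarrow> real"
  assumes "0 \<le> s" "s < t" and Z: "Z \<in> borel_measurable (G s)"
    and f: "f \<in> borel_measurable (\<Pi>\<^sub>M i\<in>{1..n}. borel)"
  shows "P.indep_var borel Z borel (\<lambda>\<omega>. f (\<lambda>i\<in>{1..n}. B i t \<omega> - B i s \<omega>))"
proof -
  let ?V = "\<lambda>\<omega>. \<lambda>i\<in>{1..n}. B i t \<omega> - B i s \<omega>" and ?K = "\<Pi>\<^sub>M i\<in>{1..n}. (borel :: real measure)"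
  have V: "?V \<in> measurable P ?K"
    using assms by (intro measurable_restrict B_incr_P) auto
  have fV: "(\<lambda>\<omega>. f (?V \<omega>)) \<in> borel_measurable P"
    using measurable_compose[OF V f] .
  have ind: "indep_set (sets (F (ennreal s))) (sets (vimage_algebra (space M) ?V ?K))"
    using brownian assms unfolding brownian_motion_def by blast
  have "f \<circ> ?V \<in> borel_measurable (vimage_algebra (space M) ?V ?K)"
    using V by (intro measurable_comp[OF measurable_vimage_algebra1 f]) (auto simp: measurable_def)
  then have fm: "(\<lambda>\<omega>. f (?V \<omega>)) \<in> borel_measurable (vimage_algebra (space M) ?V ?K)"
    by (simp add: comp_def)
  have sV: "sigma_sets (space M) {(\<lambda>\<omega>. f (?V \<omega>)) -` A \<inter> space M |A. A \<in> sets borel} \<subseteq> sets (vimage_algebra (space M) ?V ?K)"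
    using measurable_sets[OF fm] sets.sigma_sets_subset[of "{(\<lambda>\<omega>. f (?V \<omega>)) -` A \<inter> space M |A. A \<in> sets borel}"
      "vimage_algebra (space M) ?V ?K"]
    by auto
  have sZ: "sigma_sets (space M) {Z -` A \<inter> space M |A. A \<in> sets borel} \<subseteq> sets (G s)"
    using measurable_sets[OF Z] sets.sigma_sets_subset[of "{Z -` A \<inter> space M |A. A \<in> sets borel}" "G s"]
    by auto
  have 1: "P.indep_set (sets (G s)) (sets (vimage_algebra (space M) ?V ?K))"
    unfolding P.indep_sets2_eq
  proof (intro conjI ballI)
    show "sets (G s) \<subseteq> P.events"
      using subalgebra_completion_augment[OF subalgebra_F] by (simp add: subalgebra_def)
    show "sets (vimage_algebra (space M) ?V ?K) \<subseteq> P.events"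
      using ind unfolding indep_sets2_eq by auto
    fix a b assume a: "a \<in> sets (G s)" and b: "b \<in> sets (vimage_algebra (space M) ?V ?K)"
    from a obtain c where c: "c \<in> sets (F (ennreal s))" "AE \<omega> in M. \<omega> \<in> a \<longleftrightarrow> \<omega> \<in> c"
      using subalgebra_F by (auto simp: sets_augment)
    have m: "a \<in> P.events" "b \<in> events" "c \<in> events"
      using a b c ind subalgebra_completion_augment[OF subalgebra_F, of "ennreal s"] subalgebra_F[of "ennreal s"]
      unfolding indep_sets2_eq subalgebra_def by blast+
    have AEP: "AE \<omega> in P. \<omega> \<in> a \<longleftrightarrow> \<omega> \<in> c" using c(2) by (rule AE_completion)
    have "P.prob (a \<inter> b) = P.prob (c \<inter> b)"
      by (rule measure_eq_AE) (use AEP m in auto)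
    also have "\<dots> = prob (c \<inter> b)" using m by (intro measure_completion) auto
    also have "\<dots> = prob c * prob b" using ind b c unfolding indep_sets2_eq by auto
    also have "prob c = P.prob c" using m by simp
    also have "P.prob c = P.prob a"
      by (rule measure_eq_AE) (use AEP m in auto)
    finally show "P.prob (a \<inter> b) = P.prob a * P.prob b" using m by simp
  qed
  have 2: "P.indep_set (sigma_sets (space M) {Z -` A \<inter> space M |A. A \<in> sets borel})
     (sigma_sets (space M) {(\<lambda>\<omega>. f (?V \<omega>)) -` A \<inter> space M |A. A \<in> sets borel})"
    unfolding P.indep_set_def
    by (rule P.indep_sets_mono_sets[OF 1[unfolded P.indep_set_def]]) (use sZ sV in \<open>auto split: bool.split\<close>)
  show ?thesis
    unfolding P.indep_var_eq space_completion using G_P[OF Z] fV 2 by auto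
qed

lemma B_incr_product:
  fixes f :: "(nat \<Rightarrow> real) \<Rightarrow> real"
  assumes s: "0 \<le> s" "s < t" and Z: "Z \<in> borel_measurable (G s)" "integrable P Z"
    and f: "f \<in> borel_measurable (\<Pi>\<^sub>M i\<in>{1..n}. borel)"
      "integrable P (\<lambda>\<omega>. f (\<lambda>i\<in>{1..n}. B i t \<omega> - B i s \<omega>))"
  shows "integrable P (\<lambda>\<omega>. Z \<omega> * f (\<lambda>i\<in>{1..n}. B i t \<omega> - B i s \<omega>))"
    "E (\<lambda>\<omega>. Z \<omega> * f (\<lambda>i\<in>{1..n}. B i t \<omega> - B i s \<omega>)) = E Z * E (\<lambda>\<omega>. f (\<lambda>i\<in>{1..n}. B i t \<omega> - B i s \<omega>))"
proof -
  note iv = B_incr_indep[OF s Z(1) f(1)]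
  show "integrable P (\<lambda>\<omega>. Z \<omega> * f (\<lambda>i\<in>{1..n}. B i t \<omega> - B i s \<omega>))"
    "E (\<lambda>\<omega>. Z \<omega> * f (\<lambda>i\<in>{1..n}. B i t \<omega> - B i s \<omega>)) = E Z * E (\<lambda>\<omega>. f (\<lambda>i\<in>{1..n}. B i t \<omega> - B i s \<omega>))"
    using P.indep_var_integrable[OF iv Z(2) f(2)] P.indep_var_lebesgue_integral[OF iv Z(2) f(2)] by auto
qed

text \<open>These are the conditional moments of an increment given the past, written without
  conditional expectations: testing against an arbitrary integrable \<open>Z\<close> known at time
  \<open>s\<close> replaces conditioning.\<close>

lemma B_incr_moments:
  assumes i: "i \<in> {1..n}" and s: "0 \<le> s" "s \<le> t" and Z: "Z \<in> borel_measurable (G s)" "integrable P Z"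
  shows "integrable P (\<lambda>\<omega>. Z \<omega> * (B i t \<omega> - B i s \<omega>))" "E (\<lambda>\<omega>. Z \<omega> * (B i t \<omega> - B i s \<omega>)) = 0"
    "integrable P (\<lambda>\<omega>. Z \<omega> * (B i t \<omega> - B i s \<omega>)\<^sup>2)"
    "E (\<lambda>\<omega>. Z \<omega> * (B i t \<omega> - B i s \<omega>)\<^sup>2) = (t - s) * E Z"
    "integrable P (\<lambda>\<omega>. Z \<omega> * exp (\<theta> * (B i t \<omega> - B i s \<omega>)))"
    "E (\<lambda>\<omega>. Z \<omega> * exp (\<theta> * (B i t \<omega> - B i s \<omega>))) = exp (\<theta>\<^sup>2 * (t - s) / 2) * E Z"
proof -
  have conj: "integrable P (\<lambda>\<omega>. Z \<omega> * (B i t \<omega> - B i s \<omega>)) \<and> E (\<lambda>\<omega>. Z \<omega> * (B i t \<omega> - B i s \<omega>)) = 0 \<and>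
    integrable P (\<lambda>\<omega>. Z \<omega> * (B i t \<omega> - B i s \<omega>)\<^sup>2) \<and>
    E (\<lambda>\<omega>. Z \<omega> * (B i t \<omega> - B i s \<omega>)\<^sup>2) = (t - s) * E Z \<and>
    integrable P (\<lambda>\<omega>. Z \<omega> * exp (\<theta> * (B i t \<omega> - B i s \<omega>))) \<and>
    E (\<lambda>\<omega>. Z \<omega> * exp (\<theta> * (B i t \<omega> - B i s \<omega>))) = exp (\<theta>\<^sup>2 * (t - s) / 2) * E Z"
proof (cases "s = t")
  case False
  then have st: "s < t" using s by simp
  note b = B_incr_expectation[OF i s(1) st]
  have m: "(\<lambda>v. v i) \<in> borel_measurable (\<Pi>\<^sub>M i\<in>{1..n}. borel)" using i by measurable
  have e: "(\<lambda>i\<in>{1..n}. B i t \<omega> - B i s \<omega>) i = B i t \<omega> - B i s \<omega>" for \<omega> using i by simp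
  note p1 = B_incr_product[OF s(1) st Z, of "\<lambda>v. v i", unfolded e, OF m b(1)]
  note p2 = B_incr_product[OF s(1) st Z, of "\<lambda>v. (v i)\<^sup>2", unfolded e, OF borel_measurable_power[OF m] b(3)]
  have m3: "(\<lambda>v. exp (\<theta> * v i)) \<in> borel_measurable (\<Pi>\<^sub>M i\<in>{1..n}. borel)" using m by measurable
  note p3 = B_incr_product[OF s(1) st Z, of "\<lambda>v. exp (\<theta> * v i)", unfolded e, OF m3 b(5)]
  show ?thesis
    using p1 p2 p3 b by simp
  qed (use Z in simp)
  then show "integrable P (\<lambda>\<omega>. Z \<omega> * (B i t \<omega> - B i s \<omega>))" "E (\<lambda>\<omega>. Z \<omega> * (B i t \<omega> - B i s \<omega>)) = 0"
    "integrable P (\<lambda>\<omega>. Z \<omega> * (B i t \<omega> - B i s \<omega>)\<^sup>2)"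
    "E (\<lambda>\<omega>. Z \<omega> * (B i t \<omega> - B i s \<omega>)\<^sup>2) = (t - s) * E Z"
    "integrable P (\<lambda>\<omega>. Z \<omega> * exp (\<theta> * (B i t \<omega> - B i s \<omega>)))"
    "E (\<lambda>\<omega>. Z \<omega> * exp (\<theta> * (B i t \<omega> - B i s \<omega>))) = exp (\<theta>\<^sup>2 * (t - s) / 2) * E Z"
    by blast+
qed

text \<open>Over the same interval two coordinates are independent and centred, so their product is
  centred; independence from the past then allows the factor \<open>Z\<close>.\<close>

lemma B_incr_cross:
  assumes il: "i \<in> {1..n}" "l \<in> {1..n}" "i \<noteq> l" and s: "0 \<le> s" "s \<le> t"
    and Z: "Z \<in> borel_measurable (G s)" "integrable P Z"
  shows "integrable P (\<lambda>\<omega>. Z \<omega> * ((B i t \<omega> - B i s \<omega>) * (B l t \<omega> - B l s \<omega>)))"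
    "E (\<lambda>\<omega>. Z \<omega> * ((B i t \<omega> - B i s \<omega>) * (B l t \<omega> - B l s \<omega>))) = 0"
proof (atomize (full), cases "s = t")
  case False
  then have st: "s < t" using s by simp
  note bi = B_incr_expectation[OF il(1) s(1) st] and bl = B_incr_expectation[OF il(2) s(1) st]
  have iM: "integrable M (\<lambda>\<omega>. B i t \<omega> - B i s \<omega>)" "integrable M (\<lambda>\<omega>. B l t \<omega> - B l s \<omega>)"
    using bi(1) bl(1) B_incr_M[of i s] B_incr_M[of i t] B_incr_M[of l s] B_incr_M[of l t] il s
    by (auto simp: integrable_completion)
  have iv: "indep_vars (\<lambda>_. borel) (\<lambda>i \<omega>. B i t \<omega> - B i s \<omega>) {1..n}"
    using brownian s st unfolding brownian_motion_def by blast
  have iv2: "indep_vars (\<lambda>_. borel) (\<lambda>i \<omega>. B i t \<omega> - B i s \<omega>) {i, l}"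
    using indep_vars_subset[OF iv, of "{i, l}"] il by auto
  have int2: "integrable M (\<lambda>\<omega>. B j t \<omega> - B j s \<omega>)" if "j \<in> {i, l}" for j
    using that iM by auto
  have "integrable M (\<lambda>\<omega>. (B i t \<omega> - B i s \<omega>) * (B l t \<omega> - B l s \<omega>))"
    "expectation (\<lambda>\<omega>. (B i t \<omega> - B i s \<omega>) * (B l t \<omega> - B l s \<omega>)) =
     expectation (\<lambda>\<omega>. (B i t \<omega> - B i s \<omega>)) * expectation (\<lambda>\<omega>. (B l t \<omega> - B l s \<omega>))"
    using indep_vars_integrable[OF _ iv2 int2] indep_vars_lebesgue_integral[OF _ iv2 int2] il(3) by auto
  then have x: "integrable P (\<lambda>\<omega>. (B i t \<omega> - B i s \<omega>) * (B l t \<omega> - B l s \<omega>))"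
    "E (\<lambda>\<omega>. (B i t \<omega> - B i s \<omega>) * (B l t \<omega> - B l s \<omega>)) = 0"
    using bi(2) iM by (auto simp: integrable_completion integral_completion)
  have m: "(\<lambda>v. v i * v l :: real) \<in> borel_measurable (\<Pi>\<^sub>M i\<in>{1..n}. borel)" using il by measurable
  have e: "(\<lambda>i\<in>{1..n}. B i t \<omega> - B i s \<omega>) i = B i t \<omega> - B i s \<omega>"
     "(\<lambda>i\<in>{1..n}. B i t \<omega> - B i s \<omega>) l = B l t \<omega> - B l s \<omega>" for \<omega> using il by auto
  note p1 = B_incr_product[OF s(1) st Z, of "\<lambda>v. v i * v l", unfolded e, OF m x(1)]
  show "integrable P (\<lambda>\<omega>. Z \<omega> * ((B i t \<omega> - B i s \<omega>) * (B l t \<omega> - B l s \<omega>))) \<and>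
    E (\<lambda>\<omega>. Z \<omega> * ((B i t \<omega> - B i s \<omega>) * (B l t \<omega> - B l s \<omega>))) = 0"
    using p1 x by simp
qed (use Z in simp)

end

section \<open>Elementary stochastic integrals: exponential moments, isometry, orthogonality,
  Lenglart\<close>

text \<open>A single term of the exponential series of the absolute value of \<open>x\<close> is at
  most its sum. This turns exponential moments into polynomial ones.\<close>

lemma power_le_fact_exp:
  fixes x :: real
  shows "\<bar>x\<bar> ^ p \<le> fact p * (exp x + exp (- x))"
proof -
  have "\<bar>x\<bar> ^ p / fact p \<le> exp \<bar>x\<bar>"
    using sum_le_suminf[OF summable_exp_generic[of "\<bar>x\<bar>"], of "{p}"]
    by (simp add: exp_def divide_inverse mult.commute)
  also have "\<dots> \<le> exp x + exp (- x)" by (cases "x \<ge> 0") auto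
  finally show ?thesis by (simp add: field_simps)
qed

lemma integrable_bounded_mult:
  fixes f Z :: "'a \<Rightarrow> real"
  assumes "integrable M f" "Z \<in> borel_measurable M" "\<And>\<omega>. \<omega> \<in> space M \<Longrightarrow> \<bar>Z \<omega>\<bar> \<le> C"
  shows "integrable M (\<lambda>\<omega>. Z \<omega> * f \<omega>)"
proof (rule Bochner_Integration.integrable_bound)
  show "integrable M (\<lambda>\<omega>. C * f \<omega>)" using assms by simp
  show "AE \<omega> in M. norm (Z \<omega> * f \<omega>) \<le> norm (C * f \<omega>)"
  proof (rule AE_I2)
    fix \<omega> assume "\<omega> \<in> space M"
    then have "\<bar>Z \<omega>\<bar> \<le> \<bar>C\<bar>" using assms(3)[of \<omega>] by simp
    then show "norm (Z \<omega> * f \<omega>) \<le> norm (C * f \<omega>)" by (simp add: abs_mult mult_right_mono)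
  qed
qed (use assms in simp)

lemma integrable_power_of_exp:
  fixes f :: "'a \<Rightarrow> real"
  assumes "integrable M (\<lambda>\<omega>. exp (f \<omega>))" "integrable M (\<lambda>\<omega>. exp (- f \<omega>))" "f \<in> borel_measurable M"
  shows "integrable M (\<lambda>\<omega>. f \<omega> ^ p)"
proof (rule Bochner_Integration.integrable_bound)
  show "integrable M (\<lambda>\<omega>. fact p * (exp (f \<omega>) + exp (- f \<omega>)))" using assms by simp
  show "AE \<omega> in M. norm (f \<omega> ^ p) \<le> norm (fact p * (exp (f \<omega>) + exp (- f \<omega>)))"
    using power_le_fact_exp[of "f _" p] by (auto simp: power_abs intro!: AE_I2 order_trans[OF _ abs_ge_self])
qed (use assms in simp)

text \<open>The partial sums increase, so the retained indices form an initial segment whose last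
  partial sum is at most \<open>\<delta>\<close>.\<close>

lemma sum_truncated_le:
  fixes c :: "nat \<Rightarrow> real"
  assumes "\<And>j. c j \<ge> 0" "\<delta> \<ge> 0"
  shows "(\<Sum>j<m. if (\<Sum>l\<le>j. c l) \<le> \<delta> then c j else 0) \<le> \<delta>"
proof (induction m)
  case (Suc m)
  show ?case
  proof (cases "(\<Sum>l\<le>m. c l) \<le> \<delta>")
    case True
    have "(\<Sum>j<Suc m. if (\<Sum>l\<le>j. c l) \<le> \<delta> then c j else 0) \<le> (\<Sum>j<Suc m. c j)"
      using assms by (intro sum_mono) auto
    then show ?thesis using True by (simp add: lessThan_Suc_atMost)
  qed (use Suc in simp)
qed (use assms in simp)

context brownian_setup
begin

text \<open>Unlike \<open>simple_process\<close>, the weights are only required to be adapted to the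
  augmented filtration, and one explicit constant bounds all of them; the moment estimates are
  uniform in this constant.\<close>

definition step_process :: "real \<Rightarrow> nat \<Rightarrow> (nat \<Rightarrow> real) \<Rightarrow> (nat \<Rightarrow> 'a \<Rightarrow> real) \<Rightarrow> bool" where
  "step_process C m a \<xi> \<longleftrightarrow> 0 < C \<and> 0 \<le> a 0 \<and> mono_on {..m} a \<and>
     (\<forall>j<m. \<xi> j \<in> borel_measurable (G (a j)) \<and> (\<forall>\<omega>\<in>space M. \<bar>\<xi> j \<omega>\<bar> \<le> C))"

definition step_integral :: "nat \<Rightarrow> nat \<Rightarrow> (nat \<Rightarrow> real) \<Rightarrow> (nat \<Rightarrow> 'a \<Rightarrow> real) \<Rightarrow> 'a \<Rightarrow> real" where
  "step_integral i m a \<xi> \<omega> = (\<Sum>j<m. \<xi> j \<omega> * (B i (a (Suc j)) \<omega> - B i (a j) \<omega>))"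

lemma step_process_Suc: "step_process C (Suc m) a \<xi> \<Longrightarrow> step_process C m a \<xi>"
  by (auto simp: step_process_def mono_on_def)

lemma step_process_mono: "step_process C m a \<xi> \<Longrightarrow> j \<le> k \<Longrightarrow> k \<le> m \<Longrightarrow> 0 \<le> a j \<and> a j \<le> a k"
  unfolding step_process_def mono_on_def
  by (metis atMost_iff le_trans order_trans zero_le)

lemma step_integral_G:
  assumes i: "i \<in> {1..n}" and st: "step_process C m a \<xi>"
  shows "step_integral i m a \<xi> \<in> borel_measurable (G (a m))"
  unfolding step_integral_def
proof (intro borel_measurable_sum borel_measurable_times borel_measurable_diff)
  fix j assume j: "j \<in> {..<m}"
  note mo = step_process_mono[OF st]
  show "\<xi> j \<in> borel_measurable (G (a m))"
    by (rule G_mono[of _ "a j"]) (use st j mo[of j m] in \<open>auto simp: step_process_def\<close>)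
  show "B i (a (Suc j)) \<in> borel_measurable (G (a m))"
    using j mo[of "Suc j" m] by (intro B_G[OF i]) auto
  show "B i (a j) \<in> borel_measurable (G (a m))"
    using j mo[of j m] by (intro B_G[OF i]) auto
qed

text \<open>A weight with values in [-C, C] is a convex combination of -C and C with coefficients
  known at the start of the interval. By convexity of the exponential each step is dominated by the
  two extreme cases, and both have the same Gaussian Laplace transform, so the coefficients add up
  again to 1.\<close>

lemma step_integral_exp:
  assumes i: "i \<in> {1..n}" and "step_process C m a \<xi>"
  shows "integrable P (\<lambda>\<omega>. exp (\<theta> * step_integral i m a \<xi> \<omega>)) \<and>
    E (\<lambda>\<omega>. exp (\<theta> * step_integral i m a \<xi> \<omega>)) \<le> exp (\<theta>\<^sup>2 * C\<^sup>2 * (a m - a 0) / 2)"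
  using assms(2)
proof (induction m)
  case 0
  then show ?case by (simp add: step_integral_def P.prob_space)
next
  case (Suc m)
  note st = Suc.prems and IH = Suc.IH[OF step_process_Suc[OF Suc.prems]]
  have C: "C > 0" using st by (simp add: step_process_def)
  have am: "0 \<le> a m" "a m \<le> a (Suc m)" using step_process_mono[OF st, of m "Suc m"] by auto
  let ?I = "step_integral i m a \<xi>" and ?D = "\<lambda>\<omega>. B i (a (Suc m)) \<omega> - B i (a m) \<omega>"
  have IG: "?I \<in> borel_measurable (G (a m))"
    by (rule step_integral_G[OF i step_process_Suc[OF st]])
  have xG: "\<xi> m \<in> borel_measurable (G (a m))" using st by (simp add: step_process_def)
  note [measurable] = G_P[OF IG] G_P[OF xG] B_incr_P[OF i, of "a m" "a (Suc m)", simplified, OF am(1) order_trans[OF am]]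
  \<comment> \<open>For \<open>e = 1\<close> and \<open>e = -1\<close> this is the coefficient of
    the endpoint C or -C, times the exponential already accumulated. Both are known at time
    \<open>a m\<close>.\<close>
  define Z where "Z e \<omega> = (1 + e * \<xi> m \<omega> / C) / 2 * exp (\<theta> * ?I \<omega>)" for e \<omega>
  have xC: "\<bar>\<xi> m \<omega>\<bar> \<le> C" if "\<omega> \<in> space M" for \<omega> using st that by (auto simp: step_process_def)
  have ZG: "Z e \<in> borel_measurable (G (a m))" for e
    unfolding Z_def using IG xG by measurable
  have Zi: "integrable P (Z e)" if "\<bar>e\<bar> \<le> 1" for e
    unfolding Z_def
  proof (rule integrable_bounded_mult[where C=1])
    fix \<omega> assume "\<omega> \<in> space P"
    then have "\<bar>e * \<xi> m \<omega> / C\<bar> \<le> 1"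
      using xC[of \<omega>] C that mult_mono[of "\<bar>e\<bar>" 1 "\<bar>\<xi> m \<omega>\<bar>" C] by (simp add: abs_mult)
    then show "\<bar>(1 + e * \<xi> m \<omega> / C) / 2\<bar> \<le> 1" by (auto simp: abs_if split: if_splits)
  qed (use IH in auto)
  let ?R = "\<lambda>\<omega>. Z 1 \<omega> * exp ((\<theta> * C) * ?D \<omega>) + Z (-1) \<omega> * exp ((- \<theta> * C) * ?D \<omega>)"
  note m1 = B_incr_moments(5,6)[OF i am ZG[of 1] Zi[of 1], simplified, where \<theta>="\<theta> * C"]
  note m2 = B_incr_moments(5,6)[OF i am ZG[of "-1"] Zi[of "-1"], simplified, where \<theta>="- \<theta> * C"]
  have Ri: "integrable P ?R" using m1 m2 by simp
  have ER: "E ?R = exp (\<theta>\<^sup>2 * C\<^sup>2 * (a (Suc m) - a m) / 2) * E (\<lambda>\<omega>. exp (\<theta> * ?I \<omega>))"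
  proof -
    have "E ?R = exp ((\<theta> * C)\<^sup>2 * (a (Suc m) - a m) / 2) * (E (Z 1) + E (Z (-1)))"
      using m1 m2 by (simp add: algebra_simps)
    also have "E (Z 1) + E (Z (-1)) = E (\<lambda>\<omega>. Z 1 \<omega> + Z (-1) \<omega>)" using Zi by simp
    also have "(\<lambda>\<omega>. Z 1 \<omega> + Z (-1) \<omega>) = (\<lambda>\<omega>. exp (\<theta> * ?I \<omega>))"
      unfolding Z_def by (auto simp: field_simps)
    finally show ?thesis by (simp add: power_mult_distrib)
  qed
  have le: "exp (\<theta> * step_integral i (Suc m) a \<xi> \<omega>) \<le> ?R \<omega>" if "\<omega> \<in> space P" for \<omega>
  proof -
    let ?u = "(1 + \<xi> m \<omega> / C) / 2" and ?w = "\<theta> * C * ?D \<omega>"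
    have u: "0 \<le> ?u" "?u \<le> 1" using xC[of \<omega>] that C by (auto simp: field_simps abs_le_iff)
    have "exp ((1 - ?u) *\<^sub>R (- ?w) + ?u *\<^sub>R ?w) \<le> (1 - ?u) * exp (- ?w) + ?u * exp ?w"
      using convex_onD[OF exp_convex, of ?u "- ?w" ?w] u by simp
    also have "(1 - ?u) *\<^sub>R (- ?w) + ?u *\<^sub>R ?w = \<theta> * (\<xi> m \<omega> * ?D \<omega>)"
      using C by (simp add: field_simps)
    finally have "exp (\<theta> * ?I \<omega>) * exp (\<theta> * (\<xi> m \<omega> * ?D \<omega>)) \<le>
       exp (\<theta> * ?I \<omega>) * ((1 - ?u) * exp (- ?w) + ?u * exp ?w)" by simp
    also have "\<dots> = ?R \<omega>"
      by (simp add: Z_def algebra_simps diff_divide_distrib add_divide_distrib)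
    finally show ?thesis by (simp add: step_integral_def exp_add distrib_left)
  qed
  have I: "integrable P (\<lambda>\<omega>. exp (\<theta> * step_integral i (Suc m) a \<xi> \<omega>))"
  proof (rule Bochner_Integration.integrable_bound[OF Ri])
    show "AE \<omega> in P. norm (exp (\<theta> * step_integral i (Suc m) a \<xi> \<omega>)) \<le> norm (?R \<omega>)"
      using le by (intro AE_I2) force
    show "(\<lambda>\<omega>. exp (\<theta> * step_integral i (Suc m) a \<xi> \<omega>)) \<in> borel_measurable P"
      using G_P[OF step_integral_G[OF i st]] by measurable
  qed
  have "E (\<lambda>\<omega>. exp (\<theta> * step_integral i (Suc m) a \<xi> \<omega>)) \<le> E ?R"
    by (rule integral_mono[OF I Ri le])
  also have "\<dots> \<le> exp (\<theta>\<^sup>2 * C\<^sup>2 * (a (Suc m) - a m) / 2) * exp (\<theta>\<^sup>2 * C\<^sup>2 * (a m - a 0) / 2)"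
    unfolding ER using IH by simp
  also have "\<dots> = exp (\<theta>\<^sup>2 * C\<^sup>2 * (a (Suc m) - a 0) / 2)"
    by (simp add: exp_add[symmetric] field_simps)
  finally show ?case using I by blast
qed

lemma step_integral_power_integrable:
  assumes i: "i \<in> {1..n}" and "step_process C m a \<xi>"
  shows "integrable P (\<lambda>\<omega>. step_integral i m a \<xi> \<omega> ^ p)"
  using step_integral_exp[OF assms, of 1] step_integral_exp[OF assms, of "-1"] G_P[OF step_integral_G[OF assms]]
  by (intro integrable_power_of_exp) auto

text \<open>With exponent \<theta> such that
  \<open>\<theta>\<^sup>2 * C\<^sup>2 * \<delta> = 1\<close>, both exponential moments are at most
  exp (1/2) \<le> 2, and the fourth power of x is at most 24 (exp x + exp (-x)); hence 96 = 24 (2 +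
  2).\<close>

lemma step_integral_fourth_moment:
  assumes i: "i \<in> {1..n}" and st: "step_process C m a \<xi>" and \<delta>: "\<delta> > 0" "a m - a 0 \<le> \<delta>"
  shows "E (\<lambda>\<omega>. step_integral i m a \<xi> \<omega> ^ 4) \<le> 96 * C ^ 4 * \<delta>\<^sup>2"
proof -
  have C: "C > 0" using st by (simp add: step_process_def)
  define \<theta> where "\<theta> = 1 / (C * sqrt \<delta>)"
  have "sqrt \<delta> ^ 4 = ((sqrt \<delta>)\<^sup>2)\<^sup>2" by (simp flip: power_mult)
  then have sq: "sqrt \<delta> ^ 4 = \<delta>\<^sup>2" using \<delta> by simp
  have th: "\<theta> > 0" "\<theta>\<^sup>2 * C\<^sup>2 = 1 / \<delta>" "\<theta> ^ 4 = 1 / (C ^ 4 * \<delta>\<^sup>2)"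
    using C \<delta> by (auto simp: \<theta>_def power_divide power_mult_distrib sq)
  let ?I = "step_integral i m a \<xi>"
  have e1: "exp (1 / \<delta> * (a m - a 0) / 2) \<le> 2"
  proof -
    have "exp (1 / \<delta> * (a m - a 0) / 2) \<le> exp (1 / 2 :: real)"
      using \<delta> by (simp add: field_simps)
    also have "\<dots> \<le> 2" using exp_bound_half[of "1/2::real"] by simp
    finally show ?thesis .
  qed
  note ex = step_integral_exp[OF i st, of \<theta>] step_integral_exp[OF i st, of "-\<theta>"]
  have "\<theta> ^ 4 * E (\<lambda>\<omega>. ?I \<omega> ^ 4) = E (\<lambda>\<omega>. (\<theta> * ?I \<omega>) ^ 4)"
    by (simp add: power_mult_distrib)
  also have "\<dots> \<le> E (\<lambda>\<omega>. 24 * (exp (\<theta> * ?I \<omega>) + exp (- \<theta> * ?I \<omega>)))"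
  proof (rule integral_mono)
    show "integrable P (\<lambda>\<omega>. (\<theta> * ?I \<omega>) ^ 4)"
      using step_integral_power_integrable[OF i st] by (simp add: power_mult_distrib)
    show "integrable P (\<lambda>\<omega>. 24 * (exp (\<theta> * ?I \<omega>) + exp (- \<theta> * ?I \<omega>)))" using ex by simp
    show "(\<theta> * ?I \<omega>) ^ 4 \<le> 24 * (exp (\<theta> * ?I \<omega>) + exp (- \<theta> * ?I \<omega>))" for \<omega>
      using power_le_fact_exp[of "\<theta> * ?I \<omega>" 4] by (simp add: fact_numeral)
  qed
  also have "\<dots> = 24 * (E (\<lambda>\<omega>. exp (\<theta> * ?I \<omega>)) + E (\<lambda>\<omega>. exp (- \<theta> * ?I \<omega>)))"
    using ex by simp
  also have "\<dots> \<le> 24 * (2 + 2)"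
    using ex e1 unfolding power2_minus th(2) by (intro mult_left_mono add_mono) auto
  finally show ?thesis using C \<delta> unfolding th(3) by (simp add: field_simps)
qed

text \<open>Martingale property and Ito isometry, both in conditional form with respect to the
  starting time. In the induction the last increment is independent of everything else, so the mixed
  term vanishes and its square contributes its length.\<close>

lemma step_integral_moments:
  assumes i: "i \<in> {1..n}" and "step_process C m a \<xi>"
    and Z: "Z \<in> borel_measurable (G (a 0))" "\<And>\<omega>. \<omega> \<in> space M \<Longrightarrow> \<bar>Z \<omega>\<bar> \<le> K"
  shows "E (\<lambda>\<omega>. Z \<omega> * step_integral i m a \<xi> \<omega>) = 0 \<and>
    E (\<lambda>\<omega>. Z \<omega> * (step_integral i m a \<xi> \<omega>)\<^sup>2) = E (\<lambda>\<omega>. Z \<omega> * (\<Sum>j<m. (\<xi> j \<omega>)\<^sup>2 * (a (Suc j) - a j)))"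
  using assms(2)
proof (induction m)
  case 0
  then show ?case by (simp add: step_integral_def)
next
  case (Suc m)
  note st = Suc.prems and IH = Suc.IH[OF step_process_Suc[OF Suc.prems]]
  have am: "0 \<le> a m" "a m \<le> a (Suc m)" "a 0 \<le> a m"
    using step_process_mono[OF st, of m "Suc m"] step_process_mono[OF st, of 0 m] by auto
  let ?I = "step_integral i m a \<xi>" and ?D = "\<lambda>\<omega>. B i (a (Suc m)) \<omega> - B i (a m) \<omega>"
    and ?Q = "\<lambda>\<omega>. (\<Sum>j<m. (\<xi> j \<omega>)\<^sup>2 * (a (Suc j) - a j))"
  note IG = step_integral_G[OF i step_process_Suc[OF st]]
  have xG: "\<xi> m \<in> borel_measurable (G (a m))" using st by (simp add: step_process_def)
  have ZG: "Z \<in> borel_measurable (G (a m))" using G_mono[OF Z(1) am(3)] .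
  have xC: "\<bar>\<xi> j \<omega>\<bar> \<le> C" if "\<omega> \<in> space M" "j \<le> m" for \<omega> j using st that by (auto simp: step_process_def)
  have xP: "\<xi> j \<in> borel_measurable P" if "j \<le> m" for j using st that G_P[of "\<xi> j" "a j"] by (auto simp: step_process_def)
  note [measurable] = G_P[OF IG] G_P[OF ZG] G_P[OF xG]
  have ZI: "integrable P (\<lambda>\<omega>. Z \<omega> * ?I \<omega>)"
    using step_integral_power_integrable[OF i step_process_Suc[OF st], of 1] Z(2)
    by - (rule integrable_bounded_mult[where C=K], auto)
  have ZI2: "integrable P (\<lambda>\<omega>. Z \<omega> * (?I \<omega>)\<^sup>2)"
    using step_integral_power_integrable[OF i step_process_Suc[OF st], of 2] Z(2)
    by - (rule integrable_bounded_mult[where C=K], auto)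
  have Zc: "integrable P Z" using Z(2) by (intro P.integrable_const_bound[where B=K]) auto
  have Zx: "integrable P (\<lambda>\<omega>. \<xi> m \<omega> * Z \<omega>)"
    using Zc xC by - (rule integrable_bounded_mult[where C=C], auto)
  have Zxx: "integrable P (\<lambda>\<omega>. \<xi> m \<omega> * (\<xi> m \<omega> * Z \<omega>))"
    using Zx xC by - (rule integrable_bounded_mult[where C=C], auto)
  have ZxI: "integrable P (\<lambda>\<omega>. \<xi> m \<omega> * (Z \<omega> * ?I \<omega>))"
    using ZI xC by - (rule integrable_bounded_mult[where C=C], auto)
  have ZQ: "integrable P (\<lambda>\<omega>. Z \<omega> * ?Q \<omega>)"
    unfolding sum_distrib_left
  proof (intro Bochner_Integration.integrable_sum)
    fix j assume j: "j \<in> {..<m}"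
    have "integrable P (\<lambda>\<omega>. \<xi> j \<omega> * (\<xi> j \<omega> * Z \<omega>))"
      using Zc xC j xP[of j]
      by - (rule integrable_bounded_mult[where C=C], rule integrable_bounded_mult[where C=C], auto)
    then have "integrable P (\<lambda>\<omega>. \<xi> j \<omega> * (\<xi> j \<omega> * Z \<omega>) * (a (Suc j) - a j))" by simp
    then show "integrable P (\<lambda>\<omega>. Z \<omega> * ((\<xi> j \<omega>)\<^sup>2 * (a (Suc j) - a j)))"
      by (simp add: power2_eq_square mult_ac)
  qed
  have G1: "(\<lambda>\<omega>. \<xi> m \<omega> * Z \<omega>) \<in> borel_measurable (G (a m))"
    "(\<lambda>\<omega>. \<xi> m \<omega> * (\<xi> m \<omega> * Z \<omega>)) \<in> borel_measurable (G (a m))"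
    "(\<lambda>\<omega>. \<xi> m \<omega> * (Z \<omega> * ?I \<omega>)) \<in> borel_measurable (G (a m))"
    using xG ZG IG by measurable
  note d1 = B_incr_moments(1,2)[OF i am(1,2) G1(1) Zx]
  note d2 = B_incr_moments(3,4)[OF i am(1,2) G1(2) Zxx]
  note d3 = B_incr_moments(1,2)[OF i am(1,2) G1(3) ZxI]
  have "E (\<lambda>\<omega>. Z \<omega> * step_integral i (Suc m) a \<xi> \<omega>) = E (\<lambda>\<omega>. Z \<omega> * ?I \<omega> + \<xi> m \<omega> * Z \<omega> * ?D \<omega>)"
    by (simp add: step_integral_def algebra_simps)
  also have "\<dots> = 0" using ZI d1 IH by simp
  finally have 1: "E (\<lambda>\<omega>. Z \<omega> * step_integral i (Suc m) a \<xi> \<omega>) = 0" .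
  have "E (\<lambda>\<omega>. Z \<omega> * (step_integral i (Suc m) a \<xi> \<omega>)\<^sup>2) =
    E (\<lambda>\<omega>. (Z \<omega> * (?I \<omega>)\<^sup>2 + 2 * (\<xi> m \<omega> * (Z \<omega> * ?I \<omega>) * ?D \<omega>)) + \<xi> m \<omega> * (\<xi> m \<omega> * Z \<omega>) * (?D \<omega>)\<^sup>2)"
    by (rule arg_cong[where f=E]) (auto simp: step_integral_def power2_eq_square algebra_simps)
  also have "\<dots> = E (\<lambda>\<omega>. Z \<omega> * (?I \<omega>)\<^sup>2) + (a (Suc m) - a m) * E (\<lambda>\<omega>. \<xi> m \<omega> * (\<xi> m \<omega> * Z \<omega>))"
    using ZI2 d2 d3 by simp
  also have "\<dots> = E (\<lambda>\<omega>. Z \<omega> * ?Q \<omega>) + E (\<lambda>\<omega>. (a (Suc m) - a m) * (\<xi> m \<omega> * (\<xi> m \<omega> * Z \<omega>)))"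
    using IH by simp
  also have "\<dots> = E (\<lambda>\<omega>. Z \<omega> * ?Q \<omega> + (a (Suc m) - a m) * (\<xi> m \<omega> * (\<xi> m \<omega> * Z \<omega>)))"
    using ZQ Zxx by simp
  also have "\<dots> = E (\<lambda>\<omega>. Z \<omega> * (\<Sum>j<Suc m. (\<xi> j \<omega>)\<^sup>2 * (a (Suc j) - a j)))"
    by (rule arg_cong[where f=E]) (auto simp: power2_eq_square algebra_simps)
  finally show ?case using 1 by blast
qed

text \<open>Both increments are split at \<open>x\<close> and \<open>min v y\<close>; every resulting product either has a factor that
  is a future increment of a single coordinate, or consists of two coordinates over the same interval.\<close>

lemma B_incr_cross_intervals:
  assumes il: "i \<in> {1..n}" "l \<in> {1..n}" "i \<noteq> l" and u: "0 \<le> u" "u \<le> v" "u \<le> x" "x \<le> y"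
    and Z: "Z \<in> borel_measurable (G x)" "\<And>\<omega>. \<omega> \<in> space M \<Longrightarrow> \<bar>Z \<omega>\<bar> \<le> K"
  shows "integrable P (\<lambda>\<omega>. Z \<omega> * ((B i v \<omega> - B i u \<omega>) * (B l y \<omega> - B l x \<omega>))) \<and>
    E (\<lambda>\<omega>. Z \<omega> * ((B i v \<omega> - B i u \<omega>) * (B l y \<omega> - B l x \<omega>))) = 0"
proof -
  have Zc: "integrable P Z" using Z G_P[OF Z(1)] by (intro P.integrable_const_bound[where B=K]) auto
  have A: "integrable P (\<lambda>\<omega>. Z \<omega> * ((B i v \<omega> - B i u \<omega>) * (B l y \<omega> - B l x \<omega>))) \<and>
    E (\<lambda>\<omega>. Z \<omega> * ((B i v \<omega> - B i u \<omega>) * (B l y \<omega> - B l x \<omega>))) = 0"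
    if i: "i \<in> {1..n}" "l \<in> {1..n}" and u: "0 \<le> u" "u \<le> v" "v \<le> x" "x \<le> y"
      and Z: "Z \<in> borel_measurable (G x)" "\<And>\<omega>. \<omega> \<in> space M \<Longrightarrow> \<bar>Z \<omega>\<bar> \<le> K" for i l u v x y Z
  proof -
    have Bi: "integrable P (\<lambda>\<omega>. B i v \<omega> - B i u \<omega>)"
      using B_incr_expectation(1)[of i u v] i u by (cases "u = v") auto
    have 1: "integrable P (\<lambda>\<omega>. Z \<omega> * (B i v \<omega> - B i u \<omega>))"
      using Bi Z G_P[OF Z(1)] by - (rule integrable_bounded_mult[where C=K], auto)
    have 2: "(\<lambda>\<omega>. Z \<omega> * (B i v \<omega> - B i u \<omega>)) \<in> borel_measurable (G x)"
      using Z(1) B_G[OF i(1), of v x] B_G[OF i(1), of u x] u by auto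
    show ?thesis
      using B_incr_moments(1,2)[OF i(2) _ u(4) 2 1] u by (simp add: mult.assoc)
  qed
  show ?thesis
  proof (cases "v \<le> x")
    case True
    then show ?thesis using A[of i l u v x y Z] il u Z by auto
  next
    case False
    define z where "z = min v y"
    have z: "x \<le> z" "z \<le> v" "z \<le> y" "z = v \<or> z = y" using False u by (auto simp: z_def)
    have Zz: "Z \<in> borel_measurable (G z)" using G_mono[OF Z(1) z(1)] .
    note a1 = A[of i l u x x y Z, OF il(1,2) u(1,3) order_refl u(4) Z]
    have a2: "integrable P (\<lambda>\<omega>. Z \<omega> * ((B i z \<omega> - B i x \<omega>) * (B l z \<omega> - B l x \<omega>)))"
      "E (\<lambda>\<omega>. Z \<omega> * ((B i z \<omega> - B i x \<omega>) * (B l z \<omega> - B l x \<omega>))) = 0"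
      using B_incr_cross[OF il _ z(1) Z(1) Zc] u by auto
    note a3 = A[of i l x z z y Z, OF il(1,2) _ z(1) order_refl z(3) Zz Z(2)]
    note a4 = A[of l i x z z v Z, OF il(2,1) _ z(1) order_refl z(2) Zz Z(2)]
    have eq: "Z \<omega> * ((B i v \<omega> - B i u \<omega>) * (B l y \<omega> - B l x \<omega>)) =
      (Z \<omega> * ((B i x \<omega> - B i u \<omega>) * (B l y \<omega> - B l x \<omega>)) +
       Z \<omega> * ((B i z \<omega> - B i x \<omega>) * (B l z \<omega> - B l x \<omega>))) +
      (Z \<omega> * ((B i z \<omega> - B i x \<omega>) * (B l y \<omega> - B l z \<omega>)) +
       Z \<omega> * ((B l z \<omega> - B l x \<omega>) * (B i v \<omega> - B i z \<omega>)))" for \<omega>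
    proof -
      have "(B i v \<omega> - B i z \<omega>) * (B l y \<omega> - B l z \<omega>) = 0" using z(4) by auto
      then have "Z \<omega> * ((B i v \<omega> - B i z \<omega>) * (B l y \<omega> - B l z \<omega>)) = 0" by simp
      then show ?thesis by (simp add: algebra_simps)
    qed
    show ?thesis unfolding eq using a1 a2 a3 a4 u by simp
  qed
qed

text \<open>After expansion into pairs of increments, the one whose interval starts later decides at
  which time the coefficients are known; \<open>B_incr_cross_intervals\<close> then annihilates each
  pair.\<close>

lemma step_integral_cross:
  assumes il: "i \<in> {1..n}" "l \<in> {1..n}" "i \<noteq> l"
    and st: "step_process C m a \<xi>" "step_process C' m' a' \<xi>'"
    and Z: "Z \<in> borel_measurable (G s)" "\<And>\<omega>. \<omega> \<in> space M \<Longrightarrow> \<bar>Z \<omega>\<bar> \<le> K"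
    and s: "s \<le> a 0" "s \<le> a' 0"
  shows "E (\<lambda>\<omega>. Z \<omega> * (step_integral i m a \<xi> \<omega> * step_integral l m' a' \<xi>' \<omega>)) = 0"
proof -
  let ?T = "\<lambda>j h \<omega>. (Z \<omega> * \<xi> j \<omega> * \<xi>' h \<omega>) *
    ((B i (a (Suc j)) \<omega> - B i (a j) \<omega>) * (B l (a' (Suc h)) \<omega> - B l (a' h) \<omega>))"
  have T: "integrable P (?T j h) \<and> E (?T j h) = 0" if j: "j < m" "h < m'" for j h
  proof -
    have a: "0 \<le> a j" "a j \<le> a (Suc j)" "s \<le> a j" "0 \<le> a' h" "a' h \<le> a' (Suc h)" "s \<le> a' h"
      using step_process_mono[OF st(1), of j "Suc j"] step_process_mono[OF st(2), of h "Suc h"]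
        step_process_mono[OF st(1), of 0 j] step_process_mono[OF st(2), of 0 h] s j by auto
    have K: "\<bar>Z \<omega> * \<xi> j \<omega> * \<xi>' h \<omega>\<bar> \<le> K * C * C'" if "\<omega> \<in> space M" for \<omega>
      unfolding abs_mult using st j Z(2)[OF that] that
      by (intro mult_mono) (auto simp: step_process_def intro: order_trans[OF abs_ge_zero])
    have xm: "\<xi> j \<in> borel_measurable (G (a j))" "\<xi>' h \<in> borel_measurable (G (a' h))"
      using st j by (auto simp: step_process_def)
    show ?thesis
    proof (cases "a j \<le> a' h")
      case True
      have "(\<lambda>\<omega>. Z \<omega> * \<xi> j \<omega> * \<xi>' h \<omega>) \<in> borel_measurable (G (a' h))"
        using xm(2) G_mono[OF xm(1) True] G_mono[OF Z(1) a(6)] by auto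
      from B_incr_cross_intervals[OF il a(1,2) True a(5) this K] show ?thesis by simp
    next
      case False
      then have le: "a' h \<le> a j" by simp
      have "(\<lambda>\<omega>. Z \<omega> * \<xi> j \<omega> * \<xi>' h \<omega>) \<in> borel_measurable (G (a j))"
        using xm(1) G_mono[OF xm(2) le] G_mono[OF Z(1) a(3)] by auto
      from B_incr_cross_intervals[OF il(2,1) il(3)[symmetric] a(4,5) le a(2) this K]
      show ?thesis by (simp add: mult.commute[of "B i _ _ - _"])
    qed
  qed
  have "E (\<lambda>\<omega>. Z \<omega> * (step_integral i m a \<xi> \<omega> * step_integral l m' a' \<xi>' \<omega>)) =
    E (\<lambda>\<omega>. \<Sum>j<m. \<Sum>h<m'. ?T j h \<omega>)"
    unfolding step_integral_def sum_product
    unfolding sum_distrib_left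
    by (intro arg_cong[where f=E] ext sum.cong refl) (simp add: mult_ac)
  also have "\<dots> = (\<Sum>j<m. \<Sum>h<m'. E (?T j h))"
    using T by (subst Bochner_Integration.integral_sum) (auto intro!: sum.cong Bochner_Integration.integral_sum)
  also have "\<dots> = 0" using T by simp
  finally show ?thesis .
qed

text \<open>Lenglart's inequality: cut off the weights as soon as the quadratic variation exceeds \<open>\<delta>\<close>.\<close>

lemma step_integral_lenglart:
  assumes i: "i \<in> {1..n}" and st: "step_process C m a \<xi>" and pos: "\<epsilon> > 0" "\<delta> > 0"
  shows "P.prob {\<omega>\<in>space M. \<bar>step_integral i m a \<xi> \<omega>\<bar> \<ge> \<epsilon>} \<le>
    P.prob {\<omega>\<in>space M. (\<Sum>j<m. (\<xi> j \<omega>)\<^sup>2 * (a (Suc j) - a j)) > \<delta>} + \<delta> / \<epsilon>\<^sup>2"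
proof -
  define c where "c \<omega> j = (if j < m then (\<xi> j \<omega>)\<^sup>2 * (a (Suc j) - a j) else 0)" for \<omega> j
  have c0: "c \<omega> j \<ge> 0" for \<omega> j using step_process_mono[OF st, of j "Suc j"] by (auto simp: c_def)
  \<comment> \<open>The partial sum includes the \<open>j\<close>-th term itself. This is legitimate
    because interval lengths are deterministic, so the term is known at time \<open>a j\<close>; the
    quadratic variation that survives therefore never exceeds \<delta>.\<close>
  define \<eta> where "\<eta> j \<omega> = (if (\<Sum>l\<le>j. c \<omega> l) \<le> \<delta> then \<xi> j \<omega> else 0)" for j \<omega>
  have xG: "\<xi> l \<in> borel_measurable (G (a j))" if "l \<le> j" "j < m" for l j
    by (rule G_mono[of _ "a l"]) (use st that step_process_mono[OF st, of l j] in \<open>auto simp: step_process_def\<close>)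
  have st': "step_process C m a \<eta>"
    unfolding step_process_def
  proof (intro conjI allI impI)
    fix j assume j: "j < m"
    have "(\<lambda>\<omega>. c \<omega> l) \<in> borel_measurable (G (a j))" if "l \<le> j" for l
      unfolding c_def using xG[OF that j] by measurable
    then have [measurable]: "(\<lambda>\<omega>. \<Sum>l\<le>j. c \<omega> l) \<in> borel_measurable (G (a j))" by auto
    note [measurable] = xG[OF order_refl j]
    show "\<eta> j \<in> borel_measurable (G (a j))" unfolding \<eta>_def by measurable
    show "\<forall>\<omega>\<in>space M. \<bar>\<eta> j \<omega>\<bar> \<le> C" using st j by (auto simp: step_process_def \<eta>_def)
  qed (use st in \<open>auto simp: step_process_def\<close>)
  have xP: "\<xi> j \<in> borel_measurable P" if "j < m" for j using G_P[OF xG[OF order_refl that]] .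
  have [measurable]: "(\<lambda>\<omega>. \<Sum>j<m. (\<xi> j \<omega>)\<^sup>2 * (a (Suc j) - a j)) \<in> borel_measurable P"
    using xP by (intro borel_measurable_sum borel_measurable_times borel_measurable_power) auto
  note [measurable] = G_P[OF step_integral_G[OF i st]] G_P[OF step_integral_G[OF i st']]
  have eq: "step_integral i m a \<eta> \<omega> = step_integral i m a \<xi> \<omega>"
    if "(\<Sum>j<m. (\<xi> j \<omega>)\<^sup>2 * (a (Suc j) - a j)) \<le> \<delta>" for \<omega>
    unfolding step_integral_def
  proof (intro sum.cong refl)
    fix j assume j: "j \<in> {..<m}"
    have "(\<Sum>l\<le>j. c \<omega> l) \<le> (\<Sum>l<m. c \<omega> l)"
      using j c0 by (intro sum_mono2) auto
    also have "\<dots> \<le> \<delta>" using that by (simp add: c_def)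
    finally show "\<eta> j \<omega> * (B i (a (Suc j)) \<omega> - B i (a j) \<omega>) = \<xi> j \<omega> * (B i (a (Suc j)) \<omega> - B i (a j) \<omega>)"
      by (simp add: \<eta>_def)
  qed
  have E2: "E (\<lambda>\<omega>. (step_integral i m a \<eta> \<omega>)\<^sup>2) \<le> \<delta>"
  proof -
    have "E (\<lambda>\<omega>. (step_integral i m a \<eta> \<omega>)\<^sup>2) = E (\<lambda>\<omega>. (\<Sum>j<m. (\<eta> j \<omega>)\<^sup>2 * (a (Suc j) - a j)))"
      using step_integral_moments[OF i st', of "\<lambda>_. 1" 1] by simp
    also have "\<dots> \<le> E (\<lambda>\<omega>. \<delta>)"
    proof (rule integral_mono')
      fix \<omega>
      have "(\<Sum>j<m. (\<eta> j \<omega>)\<^sup>2 * (a (Suc j) - a j)) = (\<Sum>j<m. if (\<Sum>l\<le>j. c \<omega> l) \<le> \<delta> then c \<omega> j else 0)"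
        by (intro sum.cong) (auto simp: \<eta>_def c_def)
      also have "\<dots> \<le> \<delta>" using sum_truncated_le[of "c \<omega>" \<delta> m] c0 pos by auto
      finally show "(\<Sum>j<m. (\<eta> j \<omega>)\<^sup>2 * (a (Suc j) - a j)) \<le> \<delta>" .
    qed (use pos in auto)
    finally show ?thesis by (simp add: prob_space)
  qed
  let ?A = "{\<omega>\<in>space M. (\<Sum>j<m. (\<xi> j \<omega>)\<^sup>2 * (a (Suc j) - a j)) > \<delta>}"
    and ?B = "{\<omega>\<in>space M. \<epsilon>\<^sup>2 \<le> (step_integral i m a \<eta> \<omega>)\<^sup>2}"
  have mA: "?A \<in> sets P" "?B \<in> sets P"
    using borel_measurable_less[of "\<lambda>_. \<delta>" P "\<lambda>\<omega>. (\<Sum>j<m. (\<xi> j \<omega>)\<^sup>2 * (a (Suc j) - a j))"]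
      borel_measurable_le[of "\<lambda>_. \<epsilon>\<^sup>2" P "\<lambda>\<omega>. (step_integral i m a \<eta> \<omega>)\<^sup>2"] by auto
  have "P.prob {\<omega>\<in>space M. \<bar>step_integral i m a \<xi> \<omega>\<bar> \<ge> \<epsilon>} \<le> P.prob (?A \<union> ?B)"
  proof (rule P.finite_measure_mono)
    show "{\<omega> \<in> space M. \<epsilon> \<le> \<bar>step_integral i m a \<xi> \<omega>\<bar>} \<subseteq> ?A \<union> ?B"
    proof safe
      fix \<omega> assume "\<omega> \<in> space M" "\<epsilon> \<le> \<bar>step_integral i m a \<xi> \<omega>\<bar>"
        "\<not> \<epsilon>\<^sup>2 \<le> (step_integral i m a \<eta> \<omega>)\<^sup>2"
      then show "\<delta> < (\<Sum>j<m. (\<xi> j \<omega>)\<^sup>2 * (a (Suc j) - a j))"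
        using eq[of \<omega>] pos power_mono[of \<epsilon> "\<bar>step_integral i m a \<xi> \<omega>\<bar>" 2]
        by (cases "(\<Sum>j<m. (\<xi> j \<omega>)\<^sup>2 * (a (Suc j) - a j)) \<le> \<delta>") auto
    qed
  qed (use mA in auto)
  also have "\<dots> \<le> P.prob ?A + P.prob ?B" using mA by (intro measure_Un_le) auto
  also have "P.prob ?B \<le> E (\<lambda>\<omega>. (step_integral i m a \<eta> \<omega>)\<^sup>2) / \<epsilon>\<^sup>2"
    using integral_Markov_inequality_measure[of P "\<lambda>\<omega>. (step_integral i m a \<eta> \<omega>)\<^sup>2" "{}" "\<epsilon>\<^sup>2"]
      step_integral_power_integrable[OF i st', of 2] pos by simp
  also have "\<dots> \<le> \<delta> / \<epsilon>\<^sup>2" using E2 by (intro divide_right_mono) auto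
  finally show ?thesis by simp
qed

end

section \<open>Outer measure, convergence in probability, and passage to the limit in
  expectations\<close>

lemma outer_measure_of_mono_AE:
  assumes "AE \<omega> in M. \<omega> \<in> A \<longrightarrow> \<omega> \<in> A'" "A \<subseteq> space M" "A' \<subseteq> space M"
  shows "outer_measure_of M A \<le> outer_measure_of M A'"
proof -
  obtain N where N: "N \<in> null_sets M" "{\<omega>\<in>space M. \<not> (\<omega> \<in> A \<longrightarrow> \<omega> \<in> A')} \<subseteq> N"
    using assms(1) by (auto simp: eventually_ae_filter)
  obtain E where E: "E \<in> sets M" "A' \<subseteq> E" "outer_measure_of M A' = emeasure M E"
    using outer_measure_of_attain[OF assms(3)] by auto
  have "outer_measure_of M A \<le> outer_measure_of M (E \<union> N)"
    using N E assms by (intro outer_measure_of_mono) auto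
  also have "\<dots> = emeasure M (E \<union> N)" using E N by (intro outer_measure_of_eq) auto
  also have "\<dots> = emeasure M E" using E N by (simp add: emeasure_Un_null_set)
  finally show ?thesis using E by simp
qed

lemma outer_measure_of_Un_le:
  assumes "A \<subseteq> space M" "A' \<subseteq> space M"
  shows "outer_measure_of M (A \<union> A') \<le> outer_measure_of M A + outer_measure_of M A'"
proof -
  obtain E where E: "E \<in> sets M" "A \<subseteq> E" "outer_measure_of M A = emeasure M E"
    using outer_measure_of_attain[OF assms(1)] by auto
  obtain E' where E': "E' \<in> sets M" "A' \<subseteq> E'" "outer_measure_of M A' = emeasure M E'"
    using outer_measure_of_attain[OF assms(2)] by auto
  have "outer_measure_of M (A \<union> A') \<le> outer_measure_of M (E \<union> E')"
    using E E' by (intro outer_measure_of_mono) auto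
  also have "\<dots> = emeasure M (E \<union> E')" using E E' by (intro outer_measure_of_eq) auto
  also have "\<dots> \<le> emeasure M E + emeasure M E'" using E E' by (intro emeasure_subadditive)
  finally show ?thesis using E E' by simp
qed

lemma outer_measure_of_le_completion:
  assumes "A \<in> sets (completion M)"
  shows "outer_measure_of M A \<le> emeasure (completion M) A"
proof -
  obtain A' where A': "A' \<in> sets M" "A \<subseteq> A'" "emeasure (completion M) A = emeasure M A'"
    using completion_upper[OF assms] by auto
  then show ?thesis using outer_measure_of_mono[OF A'(2), of M] by simp
qed

lemma emeasure_completion_le_outer:
  assumes "A \<in> sets (completion M)" "A' \<subseteq> space M" "AE \<omega> in M. \<omega> \<in> A \<longrightarrow> \<omega> \<in> A'"
  shows "emeasure (completion M) A \<le> outer_measure_of M A'"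
proof -
  obtain E where E: "E \<in> sets M" "A' \<subseteq> E" "outer_measure_of M A' = emeasure M E"
    using outer_measure_of_attain[OF assms(2)] by auto
  have "AE \<omega> in completion M. \<omega> \<in> A \<longrightarrow> \<omega> \<in> E"
    using AE_completion[OF assms(3)] by eventually_elim (use E in auto)
  then have "emeasure (completion M) A \<le> emeasure (completion M) E"
    using E by (intro emeasure_mono_AE) auto
  then show ?thesis using E by simp
qed

lemma tendsto_zero_in_prob_le_add:
  assumes Y: "tendsto_zero_in_prob M Y" and Z: "tendsto_zero_in_prob M Z"
    and le: "\<And>r. AE \<omega> in M. W r \<omega> \<le> Y r \<omega> + Z r \<omega>"
  shows "tendsto_zero_in_prob M W"
  unfolding tendsto_zero_in_prob_def
proof (intro allI impI)
  fix \<epsilon> :: ennreal assume \<epsilon>: "\<epsilon> > 0"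
  obtain e where e: "0 < e" "e + e \<le> \<epsilon>"
  proof (cases \<epsilon>)
    case (real x)
    then show ?thesis using that[of "ennreal (x / 2)"] \<epsilon> by (simp flip: ennreal_plus)
  next
    case top
    then show ?thesis using that[of 1] by auto
  qed
  let ?A = "\<lambda>Y r. {\<omega>\<in>space M. e < Y r \<omega>}"
  have l: "(\<lambda>r. outer_measure_of M (?A Y r) + outer_measure_of M (?A Z r)) \<longlonglongrightarrow> 0 + 0"
    using Y Z e unfolding tendsto_zero_in_prob_def by (intro tendsto_add) auto
  show "(\<lambda>r. outer_measure_of M {\<omega> \<in> space M. \<epsilon> < W r \<omega>}) \<longlonglongrightarrow> 0"
  proof (rule tendsto_sandwich[OF _ _ tendsto_const l[simplified]])
    show "\<forall>\<^sub>F r in sequentially. outer_measure_of M {\<omega> \<in> space M. \<epsilon> < W r \<omega>}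
      \<le> outer_measure_of M (?A Y r) + outer_measure_of M (?A Z r)"
    proof (intro always_eventually allI)
      fix r
      have "outer_measure_of M {\<omega> \<in> space M. \<epsilon> < W r \<omega>} \<le> outer_measure_of M (?A Y r \<union> ?A Z r)"
      proof (rule outer_measure_of_mono_AE)
        show "AE \<omega> in M. \<omega> \<in> {\<omega> \<in> space M. \<epsilon> < W r \<omega>} \<longrightarrow> \<omega> \<in> ?A Y r \<union> ?A Z r"
          using le[of r]
        proof eventually_elim
          case (elim \<omega>)
          show ?case
          proof (rule impI, rule ccontr)
            assume a: "\<omega> \<in> {\<omega> \<in> space M. \<epsilon> < W r \<omega>}" "\<omega> \<notin> ?A Y r \<union> ?A Z r"
            then have "Y r \<omega> + Z r \<omega> \<le> e + e" by (intro add_mono) (auto simp: not_less)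
            with elim e(2) have "W r \<omega> \<le> \<epsilon>" by (blast intro: order_trans)
            with a(1) show False by (auto dest: leD)
          qed
        qed
      qed auto
      also have "\<dots> \<le> outer_measure_of M (?A Y r) + outer_measure_of M (?A Z r)"
        by (rule outer_measure_of_Un_le) auto
      finally show "outer_measure_of M {\<omega> \<in> space M. \<epsilon> < W r \<omega>}
        \<le> outer_measure_of M (?A Y r) + outer_measure_of M (?A Z r)" .
    qed
  qed auto
qed

text \<open>Borel-Cantelli along a subsequence on which both the level and the outer probability of
  exceeding it are below \<open>(1/2) ^ k\<close>. Measurable envelopes of the exceedance sets
  replace the sets, whose measurability is not given.\<close>

lemma tendsto_zero_in_prob_AE_subseq:
  assumes Y: "tendsto_zero_in_prob M Y"
  shows "\<exists>\<rho>. AE \<omega> in M. (\<lambda>k. Y (\<rho> k) \<omega>) \<longlonglongrightarrow> 0"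
proof -
  let ?e = "\<lambda>k. ennreal ((1/2) ^ k)"
  have "\<exists>r. outer_measure_of M {\<omega>\<in>space M. ?e k < Y r \<omega>} < ?e k" for k
    using Y order_tendstoD(2)[of "\<lambda>r. outer_measure_of M {\<omega>\<in>space M. ?e k < Y r \<omega>}" 0 sequentially "?e k"]
    unfolding tendsto_zero_in_prob_def by (auto simp: eventually_sequentially)
  then obtain \<rho> where \<rho>: "\<And>k. outer_measure_of M {\<omega>\<in>space M. ?e k < Y (\<rho> k) \<omega>} < ?e k" by metis
  have "\<exists>E\<in>sets M. {\<omega>\<in>space M. ?e k < Y (\<rho> k) \<omega>} \<subseteq> E \<and>
     outer_measure_of M {\<omega>\<in>space M. ?e k < Y (\<rho> k) \<omega>} = emeasure M E" for k
    by (rule outer_measure_of_attain) auto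
  then obtain E where E: "\<And>k. E k \<in> sets M" "\<And>k. {\<omega>\<in>space M. ?e k < Y (\<rho> k) \<omega>} \<subseteq> E k"
    "\<And>k. emeasure M (E k) < ?e k"
    using \<rho> by metis
  have fin: "emeasure M (E k) < \<infinity>" for k
    using E(3)[of k] by (rule order.strict_trans) auto
  have "AE \<omega> in M. \<forall>\<^sub>F k in sequentially. \<omega> \<in> space M - E k"
  proof (rule borel_cantelli_AE1)
    show "summable (\<lambda>k. measure M (E k))"
    proof (rule summable_comparison_test')
      show "summable (\<lambda>k. (1/2::real) ^ k)" by (rule summable_geometric) simp
      show "norm (measure M (E k)) \<le> (1/2) ^ k" for k
        using less_imp_le[OF E(3)[of k]] fin[of k]
        by (subst (asm) emeasure_eq_ennreal_measure) auto
    qed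
  qed (use E fin in \<open>auto simp: top_unique\<close>)
  then have "AE \<omega> in M. (\<lambda>k. Y (\<rho> k) \<omega>) \<longlonglongrightarrow> 0"
  proof eventually_elim
    case (elim \<omega>)
    have l: "?e \<longlonglongrightarrow> 0" using LIMSEQ_realpow_zero[of "1/2"] tendsto_ennrealI by fastforce
    show ?case
    proof (rule tendsto_sandwich[OF _ _ tendsto_const l])
      show "\<forall>\<^sub>F k in sequentially. Y (\<rho> k) \<omega> \<le> ?e k"
        using elim
      proof eventually_elim
        case (elim k)
        then show ?case using E(2)[of k] by (auto simp: not_less subset_eq)
      qed
    qed auto
  qed
  then show ?thesis by blast
qed

text \<open>Fatou's lemma, used to carry fourth moment bounds over to limits.\<close>

lemma (in prob_space) AE_lim_expectation_le:
  fixes f :: "nat \<Rightarrow> 'a \<Rightarrow> real"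
  assumes f: "\<And>r. integrable M (f r)" "\<And>r \<omega>. 0 \<le> f r \<omega>" "\<And>r. expectation (f r) \<le> K"
    and g: "g \<in> borel_measurable M" and lim: "AE \<omega> in M. (\<lambda>r. f r \<omega>) \<longlonglongrightarrow> g \<omega>"
  shows "integrable M g \<and> expectation g \<le> K"
proof -
  have K0: "0 \<le> K" using f(3)[of 0] f(2) by (intro order_trans[OF _ f(3)[of 0]] integral_nonneg) auto
  have g0: "AE \<omega> in M. 0 \<le> g \<omega>"
    using lim
  proof eventually_elim
    case (elim \<omega>)
    then show ?case by (rule LIMSEQ_le_const) (use f(2) in auto)
  qed
  have "(\<integral>\<^sup>+\<omega>. ennreal (g \<omega>) \<partial>M) = (\<integral>\<^sup>+\<omega>. liminf (\<lambda>r. ennreal (f r \<omega>)) \<partial>M)"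
  proof (rule nn_integral_cong_AE)
    show "AE \<omega> in M. ennreal (g \<omega>) = liminf (\<lambda>r. ennreal (f r \<omega>))"
      using lim
    proof eventually_elim
      case (elim \<omega>)
      then have "(\<lambda>r. ennreal (f r \<omega>)) \<longlonglongrightarrow> ennreal (g \<omega>)" by (rule tendsto_ennrealI)
      then show ?case by (simp add: lim_imp_Liminf)
    qed
  qed
  also have "\<dots> \<le> liminf (\<lambda>r. \<integral>\<^sup>+\<omega>. ennreal (f r \<omega>) \<partial>M)"
    using f(1) by (intro nn_integral_liminf) auto
  also have "\<dots> \<le> liminf (\<lambda>r. ennreal K)"
    using f by (intro Liminf_mono always_eventually allI) (simp add: nn_integral_eq_integral ennreal_leI)
  also have "\<dots> = ennreal K" by (simp add: Liminf_const)
  finally have le: "(\<integral>\<^sup>+\<omega>. ennreal (g \<omega>) \<partial>M) \<le> ennreal K" .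
  have i: "integrable M g"
  proof (rule integrableI_nonneg)
    show "(\<integral>\<^sup>+\<omega>. ennreal (g \<omega>) \<partial>M) < \<infinity>" by (rule le_less_trans[OF le]) simp
  qed (use g g0 in auto)
  moreover have "ennreal (expectation g) \<le> ennreal K"
    using nn_integral_eq_integral[OF i g0] le by simp
  ultimately show ?thesis using K0 by simp
qed

text \<open>A bound in L2 gives uniform integrability. The part truncated at \<open>R\<close>
  converges by dominated convergence, and the excess is at most the square divided by
  \<open>R\<close>.\<close>

lemma (in prob_space) AE_lim_zero_L1:
  fixes D :: "nat \<Rightarrow> 'a \<Rightarrow> real"
  assumes D: "\<And>r. D r \<in> borel_measurable M" "\<And>r. integrable M (\<lambda>\<omega>. (D r \<omega>)\<^sup>2)"
    "\<And>r. expectation (\<lambda>\<omega>. (D r \<omega>)\<^sup>2) \<le> K"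
    and lim: "AE \<omega> in M. (\<lambda>r. D r \<omega>) \<longlonglongrightarrow> 0"
  shows "(\<lambda>r. expectation (\<lambda>\<omega>. \<bar>D r \<omega>\<bar>)) \<longlonglongrightarrow> 0"
proof (rule LIMSEQ_I)
  fix e :: real assume e: "e > 0"
  have K0: "0 \<le> K" by (intro order_trans[OF _ D(3)[of 0]] integral_nonneg) auto
  \<comment> \<open>Large enough that the excess contributes at most \<open>K / R < e / 2\<close>,
    whatever the index.\<close>
  define R where "R = 2 * (K + 1) / e"
  have R: "R > 0" "K / R < e / 2" using K0 e by (auto simp: R_def field_simps)
  have "(\<lambda>r. expectation (\<lambda>\<omega>. min \<bar>D r \<omega>\<bar> R)) \<longlonglongrightarrow> expectation (\<lambda>\<omega>. 0)"
  proof (rule integral_dominated_convergence[where w="\<lambda>_. R"])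
    show "AE \<omega> in M. (\<lambda>r. min \<bar>D r \<omega>\<bar> R) \<longlonglongrightarrow> 0"
      using lim
    proof eventually_elim
      case (elim \<omega>)
      show ?case using tendsto_min[OF tendsto_rabs[OF elim] tendsto_const[of R]] R by (simp add: min_def)
    qed
  qed (use D R in auto)
  then obtain N where N: "\<And>r. r \<ge> N \<Longrightarrow> \<bar>expectation (\<lambda>\<omega>. min \<bar>D r \<omega>\<bar> R)\<bar> < e / 2"
    using LIMSEQ_D[of "\<lambda>r. expectation (\<lambda>\<omega>. min \<bar>D r \<omega>\<bar> R)" 0 "e/2"] e by auto
  have "norm (expectation (\<lambda>\<omega>. \<bar>D r \<omega>\<bar>) - 0) < e" if "r \<ge> N" for r
  proof -
    have i1: "integrable M (\<lambda>\<omega>. min \<bar>D r \<omega>\<bar> R)"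
      using D(1) R by (intro integrable_const_bound[where B=R]) auto
    have p: "\<bar>D r \<omega>\<bar> \<le> min \<bar>D r \<omega>\<bar> R + (D r \<omega>)\<^sup>2 / R" for \<omega>
    proof (cases "\<bar>D r \<omega>\<bar> \<le> R")
      case False
      then have "\<bar>D r \<omega>\<bar> * R \<le> \<bar>D r \<omega>\<bar> * \<bar>D r \<omega>\<bar>" by (intro mult_left_mono) auto
      then have "\<bar>D r \<omega>\<bar> \<le> (D r \<omega>)\<^sup>2 / R" using R by (simp add: field_simps power2_eq_square)
      then show ?thesis using R by simp
    qed (use R in auto)
    have "expectation (\<lambda>\<omega>. \<bar>D r \<omega>\<bar>) \<le> expectation (\<lambda>\<omega>. min \<bar>D r \<omega>\<bar> R + (D r \<omega>)\<^sup>2 / R)"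
      using i1 D(2)[of r] p by (intro integral_mono') (auto simp: R(1) less_imp_le)
    also have "\<dots> = expectation (\<lambda>\<omega>. min \<bar>D r \<omega>\<bar> R) + expectation (\<lambda>\<omega>. (D r \<omega>)\<^sup>2) / R"
      using i1 D(2)[of r] by simp
    also have "\<dots> < e / 2 + e / 2"
    proof (rule add_strict_mono)
      show "expectation (\<lambda>\<omega>. min \<bar>D r \<omega>\<bar> R) < e / 2" using N[OF that] by linarith
      have "expectation (\<lambda>\<omega>. (D r \<omega>)\<^sup>2) / R \<le> K / R" using D(3)[of r] R by (intro divide_right_mono) auto
      then show "expectation (\<lambda>\<omega>. (D r \<omega>)\<^sup>2) / R < e / 2" using R by linarith
    qed
    finally show ?thesis by (simp add: integral_nonneg)
  qed
  then show "\<exists>N. \<forall>r\<ge>N. norm (expectation (\<lambda>\<omega>. \<bar>D r \<omega>\<bar>) - 0) < e" by blast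
qed

text \<open>Bounded fourth moments of the factors bound the products in L2, so almost sure
  convergence improves to convergence in L1, and a bounded factor \<open>Z\<close> does no
  harm.\<close>

lemma (in prob_space) AE_lim_expectation_product:
  fixes Y W :: "nat \<Rightarrow> 'a \<Rightarrow> real"
  assumes Y: "\<And>r. Y r \<in> borel_measurable M" "\<And>r. integrable M (\<lambda>\<omega>. Y r \<omega> ^ 4)"
      "\<And>r. expectation (\<lambda>\<omega>. Y r \<omega> ^ 4) \<le> K" "Y' \<in> borel_measurable M" "AE \<omega> in M. (\<lambda>r. Y r \<omega>) \<longlonglongrightarrow> Y' \<omega>"
    and W: "\<And>r. W r \<in> borel_measurable M" "\<And>r. integrable M (\<lambda>\<omega>. W r \<omega> ^ 4)"
      "\<And>r. expectation (\<lambda>\<omega>. W r \<omega> ^ 4) \<le> K" "W' \<in> borel_measurable M" "AE \<omega> in M. (\<lambda>r. W r \<omega>) \<longlonglongrightarrow> W' \<omega>"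
    and Z: "Z \<in> borel_measurable M" "\<And>\<omega>. \<omega> \<in> space M \<Longrightarrow> \<bar>Z \<omega>\<bar> \<le> C"
  shows "(\<lambda>r. expectation (\<lambda>\<omega>. Z \<omega> * (Y r \<omega> * W r \<omega>))) \<longlonglongrightarrow> expectation (\<lambda>\<omega>. Z \<omega> * (Y' \<omega> * W' \<omega>))"
    and "integrable M (\<lambda>\<omega>. Y' \<omega> * W' \<omega>)"
proof -
  note [measurable] = Y(1,4) W(1,4) Z(1)
  have Y4: "integrable M (\<lambda>\<omega>. Y' \<omega> ^ 4) \<and> expectation (\<lambda>\<omega>. Y' \<omega> ^ 4) \<le> K"
    by (rule AE_lim_expectation_le[OF Y(2) _ Y(3)])
       (use Y(4,5) in \<open>auto elim!: eventually_mono intro: tendsto_power\<close>)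
  have W4: "integrable M (\<lambda>\<omega>. W' \<omega> ^ 4) \<and> expectation (\<lambda>\<omega>. W' \<omega> ^ 4) \<le> K"
    by (rule AE_lim_expectation_le[OF W(2) _ W(3)])
       (use W(4,5) in \<open>auto elim!: eventually_mono intro: tendsto_power\<close>)
  have sq: "(x * y)\<^sup>2 \<le> x ^ 4 + y ^ 4" for x y :: real
  proof -
    have "2 * (x * y)\<^sup>2 \<le> x ^ 4 + y ^ 4"
      using zero_le_power2[of "x\<^sup>2 - y\<^sup>2"] by (simp add: power2_diff power_mult_distrib)
    then show ?thesis using zero_le_power2[of "x * y"] by linarith
  qed
  have ip: "integrable M (\<lambda>\<omega>. u \<omega> * v \<omega>)"
    if [measurable]: "u \<in> borel_measurable M" "v \<in> borel_measurable M"
      and "integrable M (\<lambda>\<omega>. u \<omega> ^ 4)" "integrable M (\<lambda>\<omega>. v \<omega> ^ 4)" for u v :: "'a \<Rightarrow> real"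
  proof (rule Bochner_Integration.integrable_bound)
    show "integrable M (\<lambda>\<omega>. 1 + (u \<omega> ^ 4 + v \<omega> ^ 4))" using that by simp
    show "AE \<omega> in M. norm (u \<omega> * v \<omega>) \<le> norm (1 + (u \<omega> ^ 4 + v \<omega> ^ 4))"
    proof (rule AE_I2)
      fix \<omega>
      have "\<bar>u \<omega> * v \<omega>\<bar> \<le> 1 + (u \<omega> * v \<omega>)\<^sup>2"
        using zero_le_power2[of "\<bar>u \<omega> * v \<omega>\<bar> - 1"] zero_le_power2[of "u \<omega> * v \<omega>"]
        unfolding power2_diff by simp
      then show "norm (u \<omega> * v \<omega>) \<le> norm (1 + (u \<omega> ^ 4 + v \<omega> ^ 4))"
        using sq[of "u \<omega>" "v \<omega>"] by simp
    qed
  qed simp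
  show i': "integrable M (\<lambda>\<omega>. Y' \<omega> * W' \<omega>)" using ip Y4 W4 by simp
  have ir: "integrable M (\<lambda>\<omega>. Y r \<omega> * W r \<omega>)" for r using ip Y W by simp
  let ?D = "\<lambda>r \<omega>. Y r \<omega> * W r \<omega> - Y' \<omega> * W' \<omega>"
  have Dsq: "(?D r \<omega>)\<^sup>2 \<le> 2 * ((Y r \<omega> ^ 4 + W r \<omega> ^ 4) + (Y' \<omega> ^ 4 + W' \<omega> ^ 4))" for r \<omega>
  proof -
    have "(?D r \<omega>)\<^sup>2 \<le> 2 * ((Y r \<omega> * W r \<omega>)\<^sup>2 + (Y' \<omega> * W' \<omega>)\<^sup>2)"
      using zero_le_power2[of "Y r \<omega> * W r \<omega> + Y' \<omega> * W' \<omega>"]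
      by (simp add: power2_sum power2_diff algebra_simps)
    also have "\<dots> \<le> 2 * ((Y r \<omega> ^ 4 + W r \<omega> ^ 4) + (Y' \<omega> ^ 4 + W' \<omega> ^ 4))"
      using sq[of "Y r \<omega>" "W r \<omega>"] sq[of "Y' \<omega>" "W' \<omega>"] by (intro mult_left_mono add_mono) auto
    finally show ?thesis .
  qed
  let ?B = "\<lambda>r \<omega>. 2 * ((Y r \<omega> ^ 4 + W r \<omega> ^ 4) + (Y' \<omega> ^ 4 + W' \<omega> ^ 4))"
  have Bi: "integrable M (?B r)" for r using Y W Y4 W4 by simp
  have Di: "integrable M (\<lambda>\<omega>. (?D r \<omega>)\<^sup>2)" for r
    by (rule Bochner_Integration.integrable_bound[OF Bi[of r]])
       (use Dsq[of r] in \<open>auto intro!: AE_I2 order_trans[OF _ abs_ge_self]\<close>)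
  have L: "(\<lambda>r. expectation (\<lambda>\<omega>. \<bar>?D r \<omega>\<bar>)) \<longlonglongrightarrow> 0"
  proof (rule AE_lim_zero_L1[OF _ Di])
    show "expectation (\<lambda>\<omega>. (?D r \<omega>)\<^sup>2) \<le> 8 * K" for r
    proof -
      have "expectation (\<lambda>\<omega>. (?D r \<omega>)\<^sup>2) \<le> expectation (?B r)"
        by (rule integral_mono[OF Di Bi Dsq])
      also have "\<dots> = 2 * ((expectation (\<lambda>\<omega>. Y r \<omega> ^ 4) + expectation (\<lambda>\<omega>. W r \<omega> ^ 4)) +
         (expectation (\<lambda>\<omega>. Y' \<omega> ^ 4) + expectation (\<lambda>\<omega>. W' \<omega> ^ 4)))"
        using Y W Y4 W4 by simp
      also have "\<dots> \<le> 8 * K" 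
        using add_mono[OF add_mono[OF Y(3)[of r] W(3)[of r]] add_mono[OF conjunct2[OF Y4] conjunct2[OF W4]]]
        by simp
      finally show ?thesis .
    qed
    show "AE \<omega> in M. (\<lambda>r. ?D r \<omega>) \<longlonglongrightarrow> 0"
      using Y(5) W(5)
    proof eventually_elim
      case (elim \<omega>)
      then show ?case using tendsto_diff[OF tendsto_mult[OF elim] tendsto_const[of "Y' \<omega> * W' \<omega>"]] by simp
    qed
  qed measurable
  have iZ: "integrable M (\<lambda>\<omega>. Z \<omega> * (Y r \<omega> * W r \<omega>))" "integrable M (\<lambda>\<omega>. Z \<omega> * (Y' \<omega> * W' \<omega>))" for r
    by (rule integrable_bounded_mult[OF ir Z(1,2)], assumption) (rule integrable_bounded_mult[OF i' Z(1,2)])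
  have "(\<lambda>r. expectation (\<lambda>\<omega>. Z \<omega> * (Y r \<omega> * W r \<omega>)) - expectation (\<lambda>\<omega>. Z \<omega> * (Y' \<omega> * W' \<omega>))) \<longlonglongrightarrow> 0"
  proof (rule Lim_null_comparison)
    show "\<forall>\<^sub>F r in sequentially. norm (expectation (\<lambda>\<omega>. Z \<omega> * (Y r \<omega> * W r \<omega>)) - expectation (\<lambda>\<omega>. Z \<omega> * (Y' \<omega> * W' \<omega>)))
       \<le> C * expectation (\<lambda>\<omega>. \<bar>?D r \<omega>\<bar>)"
    proof (intro always_eventually allI)
      fix r
      have e: "expectation (\<lambda>\<omega>. Z \<omega> * (Y r \<omega> * W r \<omega>)) - expectation (\<lambda>\<omega>. Z \<omega> * (Y' \<omega> * W' \<omega>)) =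
        expectation (\<lambda>\<omega>. Z \<omega> * ?D r \<omega>)"
        using iZ by (simp add: right_diff_distrib)
      have "norm (expectation (\<lambda>\<omega>. Z \<omega> * (Y r \<omega> * W r \<omega>)) - expectation (\<lambda>\<omega>. Z \<omega> * (Y' \<omega> * W' \<omega>)))
        \<le> expectation (\<lambda>\<omega>. norm (Z \<omega> * ?D r \<omega>))"
        unfolding e by (rule integral_norm_bound)
      also have "\<dots> \<le> expectation (\<lambda>\<omega>. C * \<bar>?D r \<omega>\<bar>)"
        using Z(2) ir[of r] i'
        by (intro integral_mono_AE')
          (auto simp: abs_mult intro!: AE_I2 mult_right_mono mult_nonneg_nonneg intro: order_trans[OF abs_ge_zero])
      finally show "norm (expectation (\<lambda>\<omega>. Z \<omega> * (Y r \<omega> * W r \<omega>)) - expectation (\<lambda>\<omega>. Z \<omega> * (Y' \<omega> * W' \<omega>)))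
       \<le> C * expectation (\<lambda>\<omega>. \<bar>?D r \<omega>\<bar>)" by simp
    qed
    show "(\<lambda>r. C * expectation (\<lambda>\<omega>. \<bar>?D r \<omega>\<bar>)) \<longlonglongrightarrow> 0"
      using tendsto_mult_right_zero[OF L] .
  qed
  then show "(\<lambda>r. expectation (\<lambda>\<omega>. Z \<omega> * (Y r \<omega> * W r \<omega>))) \<longlonglongrightarrow> expectation (\<lambda>\<omega>. Z \<omega> * (Y' \<omega> * W' \<omega>))"
    by (simp add: LIM_zero_iff)
qed

section \<open>Clipped approximations of Ito integrals with integrands bounded by 1\<close>

text \<open>Projection onto [-1, 1]. The level 1 is the right one because the diffusion coefficient
  \<open>2 * sqrt (x * (1 - x))\<close> never exceeds 1 on the unit interval.\<close>

definition clip1 :: "real \<Rightarrow> real" where "clip1 x = max (-1) (min 1 x)"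

lemma clip1_simps: "\<bar>clip1 x\<bar> \<le> 1" "clip1 0 = 0" "(clip1 x)\<^sup>2 \<le> 1"
  by (auto simp: clip1_def abs_square_le_1)

lemma clip1_measurable [measurable]: "clip1 \<in> borel_measurable borel"
  unfolding clip1_def by measurable

lemma clip1_error: "\<bar>h\<bar> \<le> 1 \<Longrightarrow> (x - clip1 x)\<^sup>2 \<le> (x - h)\<^sup>2"
  unfolding clip1_def by (intro abs_le_square_iff[THEN iffD1]) auto

text \<open>Factor the difference of squares: the difference is at most
  \<open>\<bar>x - h\<bar>\<close> and the sum at most 2. Young's inequality with free parameter
  \<open>d\<close> then leaves the square of the error, which is what L2 approximation
  controls.\<close>

lemma clip1_square_error:
  assumes h: "\<bar>h\<bar> \<le> 1" and d: "d > 0"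
  shows "\<bar>(clip1 x)\<^sup>2 - h\<^sup>2\<bar> \<le> d + (x - h)\<^sup>2 / d"
proof -
  have 1: "\<bar>clip1 x - h\<bar> \<le> \<bar>x - h\<bar>" using h by (auto simp: clip1_def)
  have "\<bar>(clip1 x)\<^sup>2 - h\<^sup>2\<bar> = \<bar>clip1 x - h\<bar> * \<bar>clip1 x + h\<bar>"
    by (simp add: power2_eq_square abs_mult[symmetric] algebra_simps)
  also have "\<dots> \<le> \<bar>x - h\<bar> * 2"
    using 1 h clip1_simps(1)[of x] by (intro mult_mono) auto
  also have "\<dots> \<le> d + (x - h)\<^sup>2 / d"
  proof -
    have "2 * d * \<bar>x - h\<bar> \<le> d\<^sup>2 + (x - h)\<^sup>2"
      using zero_le_power2[of "d - \<bar>x - h\<bar>"] by (simp add: power2_diff)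
    then have "2 * d * \<bar>x - h\<bar> / d \<le> (d\<^sup>2 + (x - h)\<^sup>2) / d" using d by (intro divide_right_mono) auto
    then show ?thesis using d by (simp add: add_divide_distrib power2_eq_square)
  qed
  finally show ?thesis .
qed

text \<open>The half-open intervals of a monotone partition are disjoint, so at most one summand is
  nonzero and a function vanishing at 0 may be applied termwise.\<close>

lemma step_function_square_sum:
  fixes a x :: "nat \<Rightarrow> real"
  assumes mo: "mono_on {..m} a" and g0: "g 0 = 0"
  shows "g (\<Sum>j<m. x j * indicator {a j<..a (Suc j)} u) = (\<Sum>j<m. g (x j) * (indicator {a j<..a (Suc j)} u :: real))"
proof (cases "\<exists>j<m. u \<in> {a j<..a (Suc j)}")
  case True
  then obtain j where j: "j < m" "u \<in> {a j<..a (Suc j)}" by auto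
  have o: "indicator {a l<..a (Suc l)} u = (0::real)" if "l < m" "l \<noteq> j" for l
  proof (cases "l < j")
    case True
    then have "a (Suc l) \<le> a j" using mo j that by (auto simp: mono_on_def)
    then show ?thesis using j by auto
  next
    case False
    then have "a (Suc j) \<le> a l" using mo j that by (auto simp: mono_on_def)
    then show ?thesis using j by auto
  qed
  have s: "(\<Sum>l<m. f l * indicator {a l<..a (Suc l)} u) = f j" for f :: "nat \<Rightarrow> real"
  proof -
    have "(\<Sum>l<m. f l * indicator {a l<..a (Suc l)} u) = (\<Sum>l<m. if l = j then f j else 0)"
      using o j by (intro sum.cong) auto
    then show ?thesis using j by simp
  qed
  show ?thesis using s[of x] s[of "\<lambda>l. g (x l)"] by simp
qed (use g0 in \<open>auto intro!: sum.neutral[symmetric]\<close>)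

lemma step_function_integral:
  fixes a :: "nat \<Rightarrow> real"
  assumes "mono_on {..m} a"
  shows "has_bochner_integral lborel (\<lambda>u. \<Sum>j<m. c j * indicator {a j<..a (Suc j)} u) (\<Sum>j<m. c j * (a (Suc j) - a j))"
proof (intro has_bochner_integral_sum has_bochner_integral_mult_right)
  fix j assume "j \<in> {..<m}"
  then have "a j \<le> a (Suc j)" using assms by (auto simp: mono_on_def)
  then show "has_bochner_integral lborel (indicator {a j<..a (Suc j)}) (a (Suc j) - a j)"
    using has_bochner_integral_real_indicator[of "{a j<..a (Suc j)}" lborel] by simp
qed

context brownian_setup
begin

text \<open>On \<open>(s,t]\<close> the simple process is split into its clipped part \<open>\<zeta>\<close> and the remainder \<open>\<eta>\<close>.\<close>

lemma simple_integral_split: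
  fixes \<tau> :: "nat \<Rightarrow> real"
  assumes i: "i \<in> {1..n}" and sp: "simple_process M F m \<tau> \<xi>" and st: "0 \<le> s" "s \<le> t"
  defines "a \<equiv> \<lambda>j. max s (min t (\<tau> j))"
    and "\<zeta> \<equiv> \<lambda>j \<omega>. if \<tau> j \<le> t then clip1 (\<xi> j \<omega>) else 0"
    and "\<eta> \<equiv> \<lambda>j \<omega>. if \<tau> j \<le> t then \<xi> j \<omega> - clip1 (\<xi> j \<omega>) else 0"
  shows "step_process 1 m a \<zeta>" and "\<exists>C. step_process C m a \<eta>"
    and "simple_integral_wrt (B i) m \<tau> \<xi> t \<omega> - simple_integral_wrt (B i) m \<tau> \<xi> s \<omega> =
      step_integral i m a \<zeta> \<omega> + step_integral i m a \<eta> \<omega>"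
    and "has_bochner_integral lborel (\<lambda>u. indicator {s<..t} u * (clip1 (simple_value m \<tau> \<xi> u \<omega>))\<^sup>2)
       (\<Sum>j<m. (\<zeta> j \<omega>)\<^sup>2 * (a (Suc j) - a j))"
    and "has_bochner_integral lborel (\<lambda>u. indicator {s<..t} u * (simple_value m \<tau> \<xi> u \<omega> - clip1 (simple_value m \<tau> \<xi> u \<omega>))\<^sup>2)
       (\<Sum>j<m. (\<eta> j \<omega>)\<^sup>2 * (a (Suc j) - a j))"
proof -
  have mo: "mono_on {..m} \<tau>" "0 \<le> \<tau> 0" using sp by (auto simp: simple_process_def)
  have tau: "\<tau> j \<le> \<tau> k" "0 \<le> \<tau> j" if "j \<le> k" "k \<le> m" for j k
  proof -
    show "\<tau> j \<le> \<tau> k" using mo that by (auto simp: mono_on_def)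
    have "\<tau> 0 \<le> \<tau> j" using mo(1) that by (auto simp: mono_on_def)
    then show "0 \<le> \<tau> j" using mo(2) by simp
  qed
  have amo: "mono_on {..m} a" unfolding a_def mono_on_def using tau
    by (blast intro: max.mono min.mono order_refl)
  have xiG: "\<xi> j \<in> borel_measurable (G (a j))" if "j < m" "\<tau> j \<le> t" for j
    by (rule G_mono[of _ "\<tau> j"]) (use that sp in \<open>auto intro: F_G simp: simple_process_def a_def\<close>)
  show "step_process 1 m a \<zeta>"
    unfolding step_process_def
  proof (intro conjI allI impI ballI)
    fix j assume j: "j < m"
    show "\<zeta> j \<in> borel_measurable (G (a j))"
    proof (cases "\<tau> j \<le> t")
      case True
      note [measurable] = xiG[OF j True]
      show ?thesis using True by (simp add: \<zeta>_def)
    qed (simp add: \<zeta>_def)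
    show "\<bar>\<zeta> j \<omega>\<bar> \<le> 1" for \<omega> by (simp add: \<zeta>_def clip1_simps)
  qed (use amo st in \<open>auto simp: a_def\<close>)
  show "\<exists>C. step_process C m a \<eta>"
  proof -
    have "\<exists>C. \<forall>j<m. \<exists>C. \<forall>\<omega>\<in>space M. \<bar>\<xi> j \<omega>\<bar> \<le> C" using sp by (auto simp: simple_process_def)
    then obtain C where C: "\<And>j \<omega>. j < m \<Longrightarrow> \<omega> \<in> space M \<Longrightarrow> \<bar>\<xi> j \<omega>\<bar> \<le> C j" by metis
    define K where "K = (\<Sum>j<m. \<bar>C j\<bar>) + 2"
    have K: "\<bar>\<xi> j \<omega>\<bar> \<le> K - 1" if "j < m" "\<omega> \<in> space M" for j \<omega>
    proof -
      have "\<bar>C j\<bar> \<le> (\<Sum>j<m. \<bar>C j\<bar>)" using that by (intro member_le_sum) auto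
      then show ?thesis using C[OF that] by (simp add: K_def)
    qed
    have "step_process K m a \<eta>"
      unfolding step_process_def
    proof (intro conjI allI impI ballI)
      fix j assume j: "j < m"
      show "\<eta> j \<in> borel_measurable (G (a j))"
      proof (cases "\<tau> j \<le> t")
        case True
        note [measurable] = xiG[OF j True]
        show ?thesis using True by (simp add: \<eta>_def)
      qed (simp add: \<eta>_def)
      show "\<bar>\<eta> j \<omega>\<bar> \<le> K" if "\<omega> \<in> space M" for \<omega>
        using K[OF j that] clip1_simps(1)[of "\<xi> j \<omega>"] by (auto simp: \<eta>_def)
    next
      show "0 < K" by (auto simp: K_def intro!: add_nonneg_pos sum_nonneg)
    qed (use amo st in \<open>auto simp: a_def\<close>)
    then show ?thesis by blast
  qed
  show "simple_integral_wrt (B i) m \<tau> \<xi> t \<omega> - simple_integral_wrt (B i) m \<tau> \<xi> s \<omega> =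
      step_integral i m a \<zeta> \<omega> + step_integral i m a \<eta> \<omega>"
    unfolding simple_integral_wrt_def step_integral_def sum_subtractf[symmetric] sum.distrib[symmetric]
  proof (intro sum.cong refl)
    fix j assume j: "j \<in> {..<m}"
    \<comment> \<open>Restriction to (s, t]: the increment of a path stopped at knot
      \<open>x\<close> equals an increment from \<open>s\<close> to the projection of
      \<open>x\<close> onto [s, t]. The term at \<open>s\<close> cancels between neighbouring
      knots.\<close>
    have w: "B i (min t x) \<omega> - B i (min s x) \<omega> = B i (max s (min t x)) \<omega> - B i s \<omega>" for x
      using st by (cases "s \<le> x") (auto simp: max_def min_def)
    have "\<xi> j \<omega> * (B i (min t (\<tau> (Suc j))) \<omega> - B i (min t (\<tau> j)) \<omega>) -
         \<xi> j \<omega> * (B i (min s (\<tau> (Suc j))) \<omega> - B i (min s (\<tau> j)) \<omega>) =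
       \<xi> j \<omega> * ((B i (min t (\<tau> (Suc j))) \<omega> - B i (min s (\<tau> (Suc j))) \<omega>) -
         (B i (min t (\<tau> j)) \<omega> - B i (min s (\<tau> j)) \<omega>))" by (simp add: algebra_simps)
    also have "\<dots> = \<xi> j \<omega> * (B i (a (Suc j)) \<omega> - B i (a j) \<omega>)"
      unfolding w a_def by simp
    also have "\<dots> = (\<zeta> j \<omega> + \<eta> j \<omega>) * (B i (a (Suc j)) \<omega> - B i (a j) \<omega>)"
    proof (cases "\<tau> j \<le> t")
      case False
      then have "a (Suc j) = a j" using tau[of j "Suc j"] j by (auto simp: a_def)
      then show ?thesis by simp
    qed (simp add: \<zeta>_def \<eta>_def)
    finally show "\<xi> j \<omega> * (B i (min t (\<tau> (Suc j))) \<omega> - B i (min t (\<tau> j)) \<omega>) -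
         \<xi> j \<omega> * (B i (min s (\<tau> (Suc j))) \<omega> - B i (min s (\<tau> j)) \<omega>) =
      \<zeta> j \<omega> * (B i (a (Suc j)) \<omega> - B i (a j) \<omega>) + \<eta> j \<omega> * (B i (a (Suc j)) \<omega> - B i (a j) \<omega>)"
      by (simp add: algebra_simps)
  qed
  \<comment> \<open>One computation for a general \<open>g\<close> with \<open>g 0 = 0\<close>; it
    is applied to the clipping map and to its remainder.\<close>
  have key: "has_bochner_integral lborel (\<lambda>u. indicator {s<..t} u * (g (simple_value m \<tau> \<xi> u \<omega>))\<^sup>2)
       (\<Sum>j<m. (if \<tau> j \<le> t then g (\<xi> j \<omega>) else 0)\<^sup>2 * (a (Suc j) - a j))" if g: "g 0 = (0::real)" for g
  proof -
    let ?h = "\<lambda>j. (if \<tau> j \<le> t then g (\<xi> j \<omega>) else 0)\<^sup>2"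
    have "indicator {s<..t} u * (g (simple_value m \<tau> \<xi> u \<omega>))\<^sup>2 =
       (\<Sum>j<m. ?h j * indicator {a j<..a (Suc j)} u)" for u
    proof -
      have "(g (simple_value m \<tau> \<xi> u \<omega>))\<^sup>2 = (\<Sum>j<m. (g (\<xi> j \<omega>))\<^sup>2 * indicator {\<tau> j<..\<tau> (Suc j)} u)"
        unfolding simple_value_def
        by (rule step_function_square_sum[OF mo(1), where g="\<lambda>x. (g x)\<^sup>2"]) (simp add: g)
      then have "indicator {s<..t} u * (g (simple_value m \<tau> \<xi> u \<omega>))\<^sup>2 =
         (\<Sum>j<m. indicator {s<..t} u * ((g (\<xi> j \<omega>))\<^sup>2 * indicator {\<tau> j<..\<tau> (Suc j)} u))"
        by (simp only: sum_distrib_left)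
      also have "\<dots> = (\<Sum>j<m. ?h j * indicator {a j<..a (Suc j)} u)"
      proof (intro sum.cong refl)
        fix j
        show "indicator {s<..t} u * ((g (\<xi> j \<omega>))\<^sup>2 * indicator {\<tau> j<..\<tau> (Suc j)} u) = ?h j * indicator {a j<..a (Suc j)} u"
        proof (cases "u \<in> {s<..t}")
          case True
          then have "u \<in> {a j<..a (Suc j)} \<longleftrightarrow> u \<in> {\<tau> j<..\<tau> (Suc j)}"
            by (simp add: a_def le_max_iff_disj) linarith
          moreover have "\<tau> j \<le> t" if "u \<in> {\<tau> j<..\<tau> (Suc j)}" using True that by simp
          ultimately show ?thesis using True by (cases "u \<in> {\<tau> j<..\<tau> (Suc j)}") simp_all
        next
          case False
          have "s \<le> a j" "a (Suc j) \<le> t" using st by (auto simp: a_def)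
          then have "u \<notin> {a j<..a (Suc j)}" using False unfolding greaterThanAtMost_iff by linarith
          then show ?thesis using False by simp
        qed
      qed
      finally show ?thesis .
    qed
    then show ?thesis using step_function_integral[OF amo, of ?h] by simp
  qed
  show "has_bochner_integral lborel (\<lambda>u. indicator {s<..t} u * (clip1 (simple_value m \<tau> \<xi> u \<omega>))\<^sup>2)
       (\<Sum>j<m. (\<zeta> j \<omega>)\<^sup>2 * (a (Suc j) - a j))"
    using key[of clip1] by (simp add: \<zeta>_def clip1_simps)
  show "has_bochner_integral lborel (\<lambda>u. indicator {s<..t} u * (simple_value m \<tau> \<xi> u \<omega> - clip1 (simple_value m \<tau> \<xi> u \<omega>))\<^sup>2)
       (\<Sum>j<m. (\<eta> j \<omega>)\<^sup>2 * (a (Suc j) - a j))"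
    using key[of "\<lambda>x. x - clip1 x"] by (simp add: \<eta>_def clip1_simps)
qed

lemma simple_value_borel [measurable]: "(\<lambda>u. simple_value m \<tau> \<xi> u \<omega>) \<in> borel_measurable borel"
  unfolding simple_value_def by measurable

text \<open>Where the integrand lies in [-1, 1], clipping moves a value by no more than its distance
  to the integrand. So the quadratic variation of the discarded part is at most the L2 approximation
  error.\<close>

lemma clip_remainder_le:
  assumes "mono_on {..m} \<tau>" "0 \<le> s" "s \<le> t"
    and H: "set_borel_measurable lborel {0..} H" "AE u in lborel. u \<ge> 0 \<longrightarrow> \<bar>H u\<bar> \<le> 1"
    and I: "has_bochner_integral lborel (\<lambda>u. indicator {s<..t} u * (simple_value m \<tau> \<xi> u \<omega> - clip1 (simple_value m \<tau> \<xi> u \<omega>))\<^sup>2) Q"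
  shows "ennreal Q \<le> (\<integral>\<^sup>+u\<in>{0..t}. ennreal ((simple_value m \<tau> \<xi> u \<omega> - H u)\<^sup>2) \<partial>lborel)"
proof -
  let ?v = "\<lambda>u. simple_value m \<tau> \<xi> u \<omega>"
  have "ennreal Q = (\<integral>\<^sup>+u. ennreal (indicator {s<..t} u * (?v u - clip1 (?v u))\<^sup>2) \<partial>lborel)"
    using I by (subst nn_integral_eq_integral) (auto simp: has_bochner_integral_iff)
  also have "\<dots> \<le> (\<integral>\<^sup>+u\<in>{0..t}. ennreal ((?v u - H u)\<^sup>2) \<partial>lborel)"
  proof (rule nn_integral_mono_AE)
    show "AE u in lborel. ennreal (indicator {s<..t} u * (?v u - clip1 (?v u))\<^sup>2) \<le>
       ennreal ((?v u - H u)\<^sup>2) * indicator {0..t} u"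
      using H(2)
    proof eventually_elim
      case (elim u)
      show ?case
      proof (cases "u \<in> {s<..t}")
        case True
        then have "\<bar>H u\<bar> \<le> 1" using elim assms by auto
        then show ?thesis using True assms clip1_error[of "H u" "?v u"] by (simp add: ennreal_leI)
      qed simp
    qed
  qed
  finally show ?thesis .
qed

text \<open>The bracket of the clipped process is compared with the integral of the squared
  integrand. The parameter \<open>d\<close> stays free: it is fixed small while the L2 error
  \<open>D\<close> tends to 0.\<close>

lemma clip_square_error_le:
  assumes st: "0 \<le> s" "s \<le> t" and d: "d > 0"
    and H: "set_borel_measurable lborel {0..} H" "AE u in lborel. u \<ge> 0 \<longrightarrow> \<bar>H u\<bar> \<le> 1"
    and I: "has_bochner_integral lborel (\<lambda>u. indicator {s<..t} u * (clip1 (simple_value m \<tau> \<xi> u \<omega>))\<^sup>2) Q"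
    and D: "(\<integral>\<^sup>+u\<in>{0..t}. ennreal ((simple_value m \<tau> \<xi> u \<omega> - H u)\<^sup>2) \<partial>lborel) \<le> ennreal D" "D \<ge> 0"
  shows "\<bar>Q - (LINT u:{s..t}|lborel. (H u)\<^sup>2)\<bar> \<le> d * t + D / d"
    and "0 \<le> (LINT u:{s..t}|lborel. (H u)\<^sup>2)" and "(LINT u:{s..t}|lborel. (H u)\<^sup>2) \<le> t - s"
proof -
  let ?v = "\<lambda>u. simple_value m \<tau> \<xi> u \<omega>"
  let ?H = "\<lambda>u. indicator {0..} u * H u"
  have Hm [measurable]: "?H \<in> borel_measurable lborel"
    using H(1) by (simp add: set_borel_measurable_def)
  have H1: "AE u in lborel. \<bar>?H u\<bar> \<le> 1" using H(2) by eventually_elim (auto simp: indicator_def)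
  have Heq: "(LINT u:{s..t}|lborel. (H u)\<^sup>2) = (LINT u|lborel. indicator {s<..t} u * (?H u)\<^sup>2)"
    unfolding set_lebesgue_integral_def
  proof (rule integral_cong_AE)
    show "AE u in lborel. indicator {s..t} u *\<^sub>R (H u)\<^sup>2 = indicator {s<..t} u * (?H u)\<^sup>2"
      using AE_lborel_singleton[of s] by eventually_elim (use st in \<open>auto simp: indicator_def\<close>)
    have "(\<lambda>u. indicator {s..t} u *\<^sub>R (H u)\<^sup>2) = (\<lambda>u. indicator {s..t} u * (?H u)\<^sup>2)"
      using st by (auto simp: indicator_def)
    then show "(\<lambda>u. indicator {s..t} u *\<^sub>R (H u)\<^sup>2) \<in> borel_measurable lborel" by simp
  qed measurable
  have ind: "has_bochner_integral lborel (indicator {s<..t} :: real \<Rightarrow> real) (t - s)"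
    using has_bochner_integral_real_indicator[of "{s<..t}" lborel] st by simp
  then have indI: "integrable lborel (indicator {s<..t} :: real \<Rightarrow> real)"
    by (simp add: has_bochner_integral_iff)
  have HI: "integrable lborel (\<lambda>u. indicator {s<..t} u * (?H u)\<^sup>2)"
  proof (rule Bochner_Integration.integrable_bound)
    show "integrable lborel (indicator {s<..t} :: real \<Rightarrow> real)" using ind by (simp add: has_bochner_integral_iff)
    show "AE u in lborel. norm (indicator {s<..t} u * (?H u)\<^sup>2) \<le> norm (indicator {s<..t} u :: real)"
      using H1 by eventually_elim (auto simp: indicator_def abs_square_le_1)
  qed measurable
  show "0 \<le> (LINT u:{s..t}|lborel. (H u)\<^sup>2)" unfolding Heq by (intro Bochner_Integration.integral_nonneg) auto
  show "(LINT u:{s..t}|lborel. (H u)\<^sup>2) \<le> t - s"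
  proof -
    have "(LINT u|lborel. indicator {s<..t} u * (?H u)\<^sup>2) \<le> (LINT u|lborel. indicator {s<..t} u)"
    proof (rule integral_mono_AE[OF HI])
      show "integrable lborel (indicator {s<..t} :: real \<Rightarrow> real)" using ind by (simp add: has_bochner_integral_iff)
      show "AE u in lborel. indicator {s<..t} u * (?H u)\<^sup>2 \<le> (indicator {s<..t} u :: real)"
        using H1 by eventually_elim (auto simp: indicator_def abs_square_le_1)
    qed
    then show ?thesis unfolding Heq using ind by (simp add: has_bochner_integral_iff)
  qed
  let ?e = "\<lambda>u. indicator {0..t} u * (?v u - ?H u)\<^sup>2"
  have en: "(\<integral>\<^sup>+u. ennreal (?e u) \<partial>lborel) \<le> ennreal D"
  proof -
    have "(\<integral>\<^sup>+u. ennreal (?e u) \<partial>lborel) = (\<integral>\<^sup>+u\<in>{0..t}. ennreal ((?v u - H u)\<^sup>2) \<partial>lborel)"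
    proof (rule nn_integral_cong)
      fix u :: real
      show "ennreal (?e u) = ennreal ((?v u - H u)\<^sup>2) * indicator {0..t} u"
        by (cases "u \<in> {0..t}") simp_all
    qed
    also note D(1)
    finally show ?thesis .
  qed
  have eI: "integrable lborel ?e"
  proof (rule integrableI_nonneg)
    show "(\<integral>\<^sup>+u. ennreal (?e u) \<partial>lborel) < \<infinity>" by (rule le_less_trans[OF en]) simp
    show "?e \<in> borel_measurable lborel" by measurable
    show "AE u in lborel. 0 \<le> ?e u" by (rule AE_I2) simp
  qed
  have eD: "integral\<^sup>L lborel ?e \<le> D"
    using en nn_integral_eq_integral[OF eI] D(2) by simp
  have vI: "integrable lborel (\<lambda>u. indicator {s<..t} u * (clip1 (?v u))\<^sup>2)"
    "Q = (LINT u|lborel. indicator {s<..t} u * (clip1 (?v u))\<^sup>2)"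
    using I by (auto simp: has_bochner_integral_iff)
  let ?R = "\<lambda>u. indicator {s<..t} u * (clip1 (?v u))\<^sup>2 - indicator {s<..t} u * (?H u)\<^sup>2"
  have e1: "Q - (LINT u:{s..t}|lborel. (H u)\<^sup>2) = (LINT u|lborel. ?R u)"
    unfolding Heq vI(2) by (rule Bochner_Integration.integral_diff[symmetric, OF vI(1) HI])
  have "\<bar>Q - (LINT u:{s..t}|lborel. (H u)\<^sup>2)\<bar> \<le> (LINT u|lborel. \<bar>?R u\<bar>)"
    unfolding e1 by (rule integral_abs_bound)
  also have "\<dots> \<le> (LINT u|lborel. d * indicator {s<..t} u + ?e u / d)"
  proof (rule integral_mono_AE)
    show "integrable lborel (\<lambda>u. \<bar>indicator {s<..t} u * (clip1 (?v u))\<^sup>2 - indicator {s<..t} u * (?H u)\<^sup>2\<bar>)"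
      by (intro integrable_abs Bochner_Integration.integrable_diff vI(1) HI)
    show "integrable lborel (\<lambda>u. d * indicator {s<..t} u + ?e u / d)"
      by (intro Bochner_Integration.integrable_add integrable_mult_right integrable_divide eI indI)
    show "AE u in lborel. \<bar>indicator {s<..t} u * (clip1 (?v u))\<^sup>2 - indicator {s<..t} u * (?H u)\<^sup>2\<bar> \<le>
      d * indicator {s<..t} u + ?e u / d"
      using H1
    proof eventually_elim
      case (elim u)
      show ?case
      proof (cases "u \<in> {s<..t}")
        case True
        then have i: "indicator {s<..t} u = (1::real)" "indicator {0..t} u = (1::real)" using st by auto
        show ?thesis unfolding i using clip1_square_error[OF elim d, of "?v u"] by simp
      next
        case False
        then have i: "indicator {s<..t} u = (0::real)" by simp
        have "0 \<le> ?e u / d" using d by (intro divide_nonneg_pos mult_nonneg_nonneg) auto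
        then show ?thesis unfolding i by simp
      qed
    qed
  qed
  also have "\<dots> = d * integral\<^sup>L lborel (indicator {s<..t}) + integral\<^sup>L lborel ?e / d"
    by (subst Bochner_Integration.integral_add) (auto intro: indI eI simp del: integral_indicator)
  also have "\<dots> = d * (t - s) + integral\<^sup>L lborel ?e / d"
    using ind by (simp only: has_bochner_integral_iff)
  also have "\<dots> \<le> d * t + D / d"
    using d st eD by (intro add_mono divide_right_mono mult_left_mono) auto
  finally show "\<bar>Q - (LINT u:{s..t}|lborel. (H u)\<^sup>2)\<bar> \<le> d * t + D / d" .
qed

end

lemma ennreal_tendsto_zero_real:
  assumes "(\<lambda>r. ennreal \<bar>x r\<bar>) \<longlonglongrightarrow> 0"
  shows "x \<longlonglongrightarrow> (0::real)"
proof -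
  have "(\<lambda>r. enn2real (ennreal \<bar>x r\<bar>)) \<longlonglongrightarrow> 0"
    using assms by (intro tendsto_enn2real) simp_all
  then have "(\<lambda>r. \<bar>x r\<bar>) \<longlonglongrightarrow> 0" by simp
  then show ?thesis by (rule tendsto_rabs_zero_cancel)
qed

context brownian_setup
begin

text \<open>Lenglart's inequality converts smallness of the quadratic variation in probability into
  smallness of the integral, with no bound on the weights that is uniform in
  \<open>r\<close>.\<close>

lemma step_integral_to_zero_in_prob:
  assumes i: "i \<in> {1..n}" and st: "\<And>r. \<exists>C. step_process C (m r) (a r) (\<eta> r)"
    and D: "tendsto_zero_in_prob M D"
    and le: "\<And>r. AE \<omega> in M. ennreal (\<Sum>j<m r. (\<eta> r j \<omega>)\<^sup>2 * (a r (Suc j) - a r j)) \<le> D r \<omega>"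
  shows "tendsto_zero_in_prob M (\<lambda>r \<omega>. ennreal \<bar>step_integral i (m r) (a r) (\<eta> r) \<omega>\<bar>)"
  unfolding tendsto_zero_in_prob_def
proof (intro allI impI)
  fix \<epsilon> :: ennreal assume \<epsilon>: "\<epsilon> > 0"
  let ?I = "\<lambda>r. step_integral i (m r) (a r) (\<eta> r)"
  let ?Q = "\<lambda>r \<omega>. \<Sum>j<m r. (\<eta> r j \<omega>)\<^sup>2 * (a r (Suc j) - a r j)"
  show "(\<lambda>r. outer_measure_of M {\<omega> \<in> space M. \<epsilon> < ennreal \<bar>?I r \<omega>\<bar>}) \<longlonglongrightarrow> 0"
  proof (cases \<epsilon>)
    case (real e)
    then have e: "e > 0" using \<epsilon> by simp
    have Im: "?I r \<in> borel_measurable P" for r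
      using st[of r] G_P[OF step_integral_G[OF i]] by blast
    have Qm: "?Q r \<in> borel_measurable P" for r
    proof -
      obtain C where C: "step_process C (m r) (a r) (\<eta> r)" using st by blast
      have "\<eta> r j \<in> borel_measurable P" if "j < m r" for j
        by (rule G_P[of _ "a r j"]) (use C that in \<open>auto simp: step_process_def\<close>)
      then show ?thesis
        by (intro borel_measurable_sum borel_measurable_times borel_measurable_power) auto
    qed
    have bound: "outer_measure_of M {\<omega> \<in> space M. \<epsilon> < ennreal \<bar>?I r \<omega>\<bar>} \<le>
      outer_measure_of M {\<omega>\<in>space M. ennreal d < D r \<omega>} + ennreal (d / e\<^sup>2)" if d: "d > 0" for r d
    proof -
      obtain C where C: "step_process C (m r) (a r) (\<eta> r)" using st by blast
      have "outer_measure_of M {\<omega> \<in> space M. \<epsilon> < ennreal \<bar>?I r \<omega>\<bar>} \<le>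
        outer_measure_of M {\<omega> \<in> space M. e \<le> \<bar>?I r \<omega>\<bar>}"
        by (rule outer_measure_of_mono) (use real e in \<open>auto simp: ennreal_less_iff\<close>)
      also have "\<dots> \<le> emeasure P {\<omega> \<in> space M. e \<le> \<bar>?I r \<omega>\<bar>}"
      proof (rule outer_measure_of_le_completion)
        have "{\<omega> \<in> space P. e \<le> \<bar>?I r \<omega>\<bar>} \<in> sets P" using Im[of r] by measurable
        then show "{\<omega> \<in> space M. e \<le> \<bar>?I r \<omega>\<bar>} \<in> sets P" by simp
      qed
      also have "\<dots> = ennreal (P.prob {\<omega> \<in> space M. e \<le> \<bar>?I r \<omega>\<bar>})"
        by (rule P.emeasure_eq_measure)
      also have "\<dots> \<le> ennreal (P.prob {\<omega>\<in>space M. ?Q r \<omega> > d} + d / e\<^sup>2)"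
        by (intro ennreal_leI step_integral_lenglart[OF i C e d])
      also have "\<dots> = emeasure P {\<omega>\<in>space M. ?Q r \<omega> > d} + ennreal (d / e\<^sup>2)"
        using d by (simp add: ennreal_plus P.emeasure_eq_measure del: emeasure_completion)
      finally have 1: "outer_measure_of M {\<omega> \<in> space M. \<epsilon> < ennreal \<bar>?I r \<omega>\<bar>} \<le>
        emeasure P {\<omega>\<in>space M. ?Q r \<omega> > d} + ennreal (d / e\<^sup>2)" .
      have "emeasure P {\<omega>\<in>space M. ?Q r \<omega> > d} \<le> outer_measure_of M {\<omega>\<in>space M. ennreal d < D r \<omega>}"
      proof (rule emeasure_completion_le_outer)
        have "{\<omega>\<in>space P. ?Q r \<omega> > d} \<in> sets P" using Qm[of r] by measurable
        then show "{\<omega>\<in>space M. ?Q r \<omega> > d} \<in> sets P" by simp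
        show "AE \<omega> in M. \<omega> \<in> {\<omega>\<in>space M. ?Q r \<omega> > d} \<longrightarrow> \<omega> \<in> {\<omega>\<in>space M. ennreal d < D r \<omega>}"
          using le[of r]
        proof eventually_elim
          case (elim \<omega>)
          show ?case
          proof
            assume a: "\<omega> \<in> {\<omega>\<in>space M. ?Q r \<omega> > d}"
            then have "ennreal d < ennreal (?Q r \<omega>)" using d by (intro ennreal_lessI) auto
            also note elim
            finally show "\<omega> \<in> {\<omega>\<in>space M. ennreal d < D r \<omega>}" using a by simp
          qed
        qed
      qed auto
      then show ?thesis by (rule order_trans[OF 1 add_right_mono])
    qed
    show ?thesis
    proof (rule order_tendstoI)
      fix y :: ennreal assume y: "0 < y"
      obtain z where z: "0 < z" "ennreal z + ennreal z \<le> y" "0 < ennreal z"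
      proof (cases y)
        case (real x)
        then show ?thesis using that[of "x / 2"] y by (simp flip: ennreal_plus)
      next
        case top
        then show ?thesis using that[of 1] by auto
      qed
      \<comment> \<open>Makes the second term \<open>d / e\<^sup>2\<close> in Lenglart's inequality
        equal to \<open>z\<close>, half of the tolerated amount when that amount is finite.\<close>
      define d where "d = z * e\<^sup>2"
      have d: "d > 0" "d / e\<^sup>2 = z" using z e by (auto simp: d_def)
      have "(\<lambda>r. outer_measure_of M {\<omega>\<in>space M. ennreal d < D r \<omega>}) \<longlonglongrightarrow> 0"
        using D d unfolding tendsto_zero_in_prob_def by auto
      then have "\<forall>\<^sub>F r in sequentially. outer_measure_of M {\<omega>\<in>space M. ennreal d < D r \<omega>} < ennreal z"
        using z(3) by (rule order_tendstoD(2))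
      then show "\<forall>\<^sub>F r in sequentially. outer_measure_of M {\<omega> \<in> space M. \<epsilon> < ennreal \<bar>?I r \<omega>\<bar>} < y"
      proof eventually_elim
        case (elim r)
        have lt: "outer_measure_of M {\<omega>\<in>space M. ennreal d < D r \<omega>} + ennreal z < ennreal z + ennreal z"
          using elim by (simp add: ennreal_add_left_cancel_less add.commute)
        have "outer_measure_of M {\<omega> \<in> space M. \<epsilon> < ennreal \<bar>?I r \<omega>\<bar>} \<le>
          outer_measure_of M {\<omega>\<in>space M. ennreal d < D r \<omega>} + ennreal z"
          using bound[OF d(1), of r] unfolding d(2) .
        from le_less_trans[OF this lt] z(2) show ?case by (rule less_le_trans)
      qed
    qed auto
  qed simp
qed

lemma ito_integral_zero:
  assumes "is_ito_integral M F (B i) H X"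
  shows "AE \<omega> in M. X 0 \<omega> = 0"
proof -
  obtain m :: "nat \<Rightarrow> nat" and \<tau> \<xi> where sp: "\<And>r. simple_process M F (m r) (\<tau> r) (\<xi> r)"
    and X: "\<And>t. t \<ge> 0 \<Longrightarrow> tendsto_zero_in_prob M (\<lambda>r \<omega>.
           SUP s\<in>{0..t}. ennreal \<bar>simple_integral_wrt (B i) (m r) (\<tau> r) (\<xi> r) s \<omega> - X s \<omega>\<bar>)"
    using assms unfolding is_ito_integral_def by blast
  have z: "simple_integral_wrt (B i) (m r) (\<tau> r) (\<xi> r) 0 \<omega> = 0" for r \<omega>
    unfolding simple_integral_wrt_def
  proof (intro sum.neutral ballI)
    fix j assume j: "j \<in> {..<m r}"
    have "\<tau> r 0 \<le> \<tau> r j" "\<tau> r 0 \<le> \<tau> r (Suc j)" "0 \<le> \<tau> r 0"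
      using sp[of r] j by (auto simp: simple_process_def mono_on_def)
    then show "\<xi> r j \<omega> * (B i (min 0 (\<tau> r (Suc j))) \<omega> - B i (min 0 (\<tau> r j)) \<omega>) = 0" by simp
  qed
  obtain \<rho> where "AE \<omega> in M. (\<lambda>k. SUP s\<in>{0..0}. ennreal \<bar>simple_integral_wrt (B i) (m (\<rho> k)) (\<tau> (\<rho> k)) (\<xi> (\<rho> k)) s \<omega> - X s \<omega>\<bar>) \<longlonglongrightarrow> 0"
    using tendsto_zero_in_prob_AE_subseq[OF X[OF order_refl]] by blast
  then show ?thesis
    by eventually_elim (simp add: z LIMSEQ_const_iff)
qed

text \<open>This extracts from the definition of the integral everything used later: approximation
  by integrals of weights in [-1, 1], together with their brackets, almost surely along one
  subsequence. Boundedness by 1 yields moment bounds that do not depend on \<open>r\<close>.\<close>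

lemma ito_step_approximation:
  assumes i: "i \<in> {1..n}" and ito: "is_ito_integral M F (B i) H X"
    and H1: "AE \<omega> in M. AE u in lborel. u \<ge> 0 \<longrightarrow> \<bar>H u \<omega>\<bar> \<le> 1"
    and st: "0 \<le> s" "s \<le> t"
  obtains m :: "nat \<Rightarrow> nat" and a :: "nat \<Rightarrow> nat \<Rightarrow> real" and \<zeta> :: "nat \<Rightarrow> nat \<Rightarrow> 'a \<Rightarrow> real"
  where "\<And>r. step_process 1 (m r) (a r) (\<zeta> r)" "\<And>r. s \<le> a r 0" "\<And>r j. a r j \<le> t"
    "AE \<omega> in M. (\<lambda>r. step_integral i (m r) (a r) (\<zeta> r) \<omega>) \<longlonglongrightarrow> X t \<omega> - X s \<omega>"
    "AE \<omega> in M. (\<lambda>r. \<Sum>j<m r. (\<zeta> r j \<omega>)\<^sup>2 * (a r (Suc j) - a r j)) \<longlonglongrightarrow> (LINT u:{s..t}|lborel. (H u \<omega>)\<^sup>2)"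
    "AE \<omega> in M. 0 \<le> (LINT u:{s..t}|lborel. (H u \<omega>)\<^sup>2) \<and> (LINT u:{s..t}|lborel. (H u \<omega>)\<^sup>2) \<le> t - s"
proof -
  obtain m :: "nat \<Rightarrow> nat" and \<tau> \<xi> where sp: "\<And>r. simple_process M F (m r) (\<tau> r) (\<xi> r)"
    and D: "\<And>t. t \<ge> 0 \<Longrightarrow> tendsto_zero_in_prob M (\<lambda>r \<omega>.
           \<integral>\<^sup>+u\<in>{0..t}. ennreal ((simple_value (m r) (\<tau> r) (\<xi> r) u \<omega> - H u \<omega>)\<^sup>2) \<partial>lborel)"
    and X: "\<And>t. t \<ge> 0 \<Longrightarrow> tendsto_zero_in_prob M (\<lambda>r \<omega>.
           SUP s\<in>{0..t}. ennreal \<bar>simple_integral_wrt (B i) (m r) (\<tau> r) (\<xi> r) s \<omega> - X s \<omega>\<bar>)"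
    using ito unfolding is_ito_integral_def by blast
  have Hm: "AE \<omega> in M. set_borel_measurable lborel {0..} (\<lambda>u. H u \<omega>)"
    using ito unfolding is_ito_integral_def by blast
  define a where "a r j = max s (min t (\<tau> r j))" for r j
  define \<zeta> where "\<zeta> r j \<omega> = (if \<tau> r j \<le> t then clip1 (\<xi> r j \<omega>) else 0)" for r j \<omega>
  define \<eta> where "\<eta> r j \<omega> = (if \<tau> r j \<le> t then \<xi> r j \<omega> - clip1 (\<xi> r j \<omega>) else 0)" for r j \<omega>
  note split = simple_integral_split[OF i sp st, folded a_def \<zeta>_def \<eta>_def]
  have ts: "\<zeta> r = (\<lambda>j \<omega>. \<zeta> r j \<omega>)" "\<eta> r = (\<lambda>j \<omega>. \<eta> r j \<omega>)" "a r = (\<lambda>j. a r j)" for r by auto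
  let ?D = "\<lambda>r \<omega>. \<integral>\<^sup>+u\<in>{0..t}. ennreal ((simple_value (m r) (\<tau> r) (\<xi> r) u \<omega> - H u \<omega>)\<^sup>2) \<partial>lborel"
  let ?S = "\<lambda>r \<omega>. SUP s\<in>{0..t}. ennreal \<bar>simple_integral_wrt (B i) (m r) (\<tau> r) (\<xi> r) s \<omega> - X s \<omega>\<bar>"
  have t0: "0 \<le> t" using st by simp
  have mo: "mono_on {..m r} (\<tau> r)" for r using sp[of r] by (simp add: simple_process_def)
  have E: "tendsto_zero_in_prob M (\<lambda>r \<omega>. ennreal \<bar>step_integral i (m r) (a r) (\<eta> r) \<omega>\<bar>)"
  proof (rule step_integral_to_zero_in_prob[OF i split(2) D[OF t0]])
    fix r
    show "AE \<omega> in M. ennreal (\<Sum>j<m r. (\<eta> r j \<omega>)\<^sup>2 * (a r (Suc j) - a r j)) \<le> ?D r \<omega>"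
      using Hm H1
    proof eventually_elim
      case (elim \<omega>)
      show ?case by (rule clip_remainder_le[OF mo st elim split(5)])
    qed
  qed
  \<comment> \<open>The L2 error, the uniform error of the integrals and the discarded part are
    added up, so that one subsequence makes all three converge.\<close>
  define V where "V r \<omega> = ?D r \<omega> + (?S r \<omega> + ennreal \<bar>step_integral i (m r) (a r) (\<eta> r) \<omega>\<bar>)" for r \<omega>
  have "tendsto_zero_in_prob M V"
  proof (rule tendsto_zero_in_prob_le_add[OF D[OF t0]])
    show "tendsto_zero_in_prob M (\<lambda>r \<omega>. ?S r \<omega> + ennreal \<bar>step_integral i (m r) (a r) (\<eta> r) \<omega>\<bar>)"
      by (rule tendsto_zero_in_prob_le_add[OF X[OF t0] E]) simp
  qed (simp add: V_def)
  then obtain \<rho> where \<rho>: "AE \<omega> in M. (\<lambda>k. V (\<rho> k) \<omega>) \<longlonglongrightarrow> 0"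
    using tendsto_zero_in_prob_AE_subseq by blast
  show ?thesis
  proof (rule that[of "\<lambda>k. m (\<rho> k)" "\<lambda>k. a (\<rho> k)" "\<lambda>k. \<zeta> (\<rho> k)"])
    show "step_process 1 (m (\<rho> r)) (a (\<rho> r)) (\<zeta> (\<rho> r))" for r using split(1) .
    show "s \<le> a (\<rho> r) 0" "a (\<rho> r) j \<le> t" for r j using st by (auto simp: a_def)
    show "AE \<omega> in M. (\<lambda>r. step_integral i (m (\<rho> r)) (a (\<rho> r)) (\<zeta> (\<rho> r)) \<omega>) \<longlonglongrightarrow> X t \<omega> - X s \<omega>"
      using \<rho>
    proof eventually_elim
      case (elim \<omega>)
      have z: "f \<longlonglongrightarrow> 0" if "\<And>k. ennreal \<bar>f k\<bar> \<le> V (\<rho> k) \<omega>" for f :: "nat \<Rightarrow> real"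
        by (rule ennreal_tendsto_zero_real, rule tendsto_sandwich[OF _ _ tendsto_const elim]) (use that in auto)
      have S: "ennreal \<bar>simple_integral_wrt (B i) (m r) (\<tau> r) (\<xi> r) u \<omega> - X u \<omega>\<bar> \<le> V r \<omega>" if "u \<in> {0..t}" for u r
      proof -
        have "ennreal \<bar>simple_integral_wrt (B i) (m r) (\<tau> r) (\<xi> r) u \<omega> - X u \<omega>\<bar> \<le> ?S r \<omega>"
          by (rule SUP_upper[OF that])
        also have "\<dots> \<le> V r \<omega>" unfolding V_def by (simp add: add_increasing)
        finally show ?thesis .
      qed
      have 1: "(\<lambda>k. simple_integral_wrt (B i) (m (\<rho> k)) (\<tau> (\<rho> k)) (\<xi> (\<rho> k)) u \<omega> - X u \<omega>) \<longlonglongrightarrow> 0" if "u \<in> {0..t}" for u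
        by (rule z) (rule S[OF that])
      have 2: "(\<lambda>k. step_integral i (m (\<rho> k)) (a (\<rho> k)) (\<eta> (\<rho> k)) \<omega>) \<longlonglongrightarrow> 0"
        by (rule z) (simp add: V_def add_increasing)
      have "(\<lambda>k. ((simple_integral_wrt (B i) (m (\<rho> k)) (\<tau> (\<rho> k)) (\<xi> (\<rho> k)) t \<omega> - X t \<omega>) -
         (simple_integral_wrt (B i) (m (\<rho> k)) (\<tau> (\<rho> k)) (\<xi> (\<rho> k)) s \<omega> - X s \<omega>)) -
         step_integral i (m (\<rho> k)) (a (\<rho> k)) (\<eta> (\<rho> k)) \<omega> + (X t \<omega> - X s \<omega>)) \<longlonglongrightarrow> 0 - 0 - 0 + (X t \<omega> - X s \<omega>)"
        using st by (intro tendsto_add tendsto_diff 1 2 tendsto_const) auto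
      moreover have "((simple_integral_wrt (B i) (m (\<rho> k)) (\<tau> (\<rho> k)) (\<xi> (\<rho> k)) t \<omega> - X t \<omega>) -
         (simple_integral_wrt (B i) (m (\<rho> k)) (\<tau> (\<rho> k)) (\<xi> (\<rho> k)) s \<omega> - X s \<omega>)) -
         step_integral i (m (\<rho> k)) (a (\<rho> k)) (\<eta> (\<rho> k)) \<omega> + (X t \<omega> - X s \<omega>) =
         step_integral i (m (\<rho> k)) (a (\<rho> k)) (\<zeta> (\<rho> k)) \<omega>" for k
        using split(3)[of "\<rho> k" \<omega>] by linarith
      ultimately show ?case by simp
    qed
    show "AE \<omega> in M. (\<lambda>r. \<Sum>j<m (\<rho> r). (\<zeta> (\<rho> r) j \<omega>)\<^sup>2 * (a (\<rho> r) (Suc j) - a (\<rho> r) j)) \<longlonglongrightarrow> (LINT u:{s..t}|lborel. (H u \<omega>)\<^sup>2)"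
      using \<rho> Hm H1
    proof eventually_elim
      case (elim \<omega>)
      let ?q = "LINT u:{s..t}|lborel. (H u \<omega>)\<^sup>2"
      show ?case
      proof (rule LIMSEQ_I)
        fix e :: real assume e: "e > 0"
        \<comment> \<open>Gives \<open>d * t < e / 2\<close>; once the L2 error is below
          \<open>d * e / 2\<close>, its contribution after division by \<open>d\<close> is at most
          \<open>e / 2\<close>.\<close>
        define d where "d = e / (2 * (t + 1))"
        have d: "d > 0" using e t0 by (simp add: d_def)
        have dt: "d * t < e / 2" using e t0 by (simp add: d_def field_simps)
        have "\<forall>\<^sub>F k in sequentially. V (\<rho> k) \<omega> < ennreal (d * e / 2)"
          using elim(1) by (rule order_tendstoD(2)) (use d e in simp)
        then obtain N where N: "\<And>k. k \<ge> N \<Longrightarrow> V (\<rho> k) \<omega> < ennreal (d * e / 2)"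
          by (auto simp: eventually_sequentially)
        show "\<exists>no. \<forall>k\<ge>no. norm ((\<Sum>j<m (\<rho> k). (\<zeta> (\<rho> k) j \<omega>)\<^sup>2 * (a (\<rho> k) (Suc j) - a (\<rho> k) j)) - ?q) < e"
        proof (intro exI allI impI)
          fix k assume k: "k \<ge> N"
          have "?D (\<rho> k) \<omega> \<le> V (\<rho> k) \<omega>" unfolding V_def by simp
          then have Dk: "?D (\<rho> k) \<omega> \<le> ennreal (d * e / 2)" using N[OF k] by simp
          have "\<bar>(\<Sum>j<m (\<rho> k). (\<zeta> (\<rho> k) j \<omega>)\<^sup>2 * (a (\<rho> k) (Suc j) - a (\<rho> k) j)) - ?q\<bar> \<le> d * t + (d * e / 2) / d"
            by (rule clip_square_error_le(1)[OF st d elim(2,3) split(4) Dk]) (use d e in simp)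
          also have "\<dots> < e" using dt d by simp
          finally show "norm ((\<Sum>j<m (\<rho> k). (\<zeta> (\<rho> k) j \<omega>)\<^sup>2 * (a (\<rho> k) (Suc j) - a (\<rho> k) j)) - ?q) < e" by simp
        qed
      qed
    qed
    show "AE \<omega> in M. 0 \<le> (LINT u:{s..t}|lborel. (H u \<omega>)\<^sup>2) \<and> (LINT u:{s..t}|lborel. (H u \<omega>)\<^sup>2) \<le> t - s"
      using \<rho> Hm H1
    proof eventually_elim
      case (elim \<omega>)
      have "\<forall>\<^sub>F k in sequentially. V (\<rho> k) \<omega> < ennreal 1"
        using elim(1) by (rule order_tendstoD(2)) simp
      then obtain k where "V (\<rho> k) \<omega> < ennreal 1" by (auto simp: eventually_sequentially)
      moreover have "?D (\<rho> k) \<omega> \<le> V (\<rho> k) \<omega>" unfolding V_def by simp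
      ultimately have Dk: "?D (\<rho> k) \<omega> \<le> ennreal 1" by (meson le_less_trans less_imp_le)
      show ?case
        using clip_square_error_le(2,3)[OF st zero_less_one elim(2,3) split(4) Dk] by auto
    qed
  qed
qed

end

section \<open>Moments of increments of Ito integrals and of their sums\<close>

text \<open>The Cauchy-Schwarz inequality applied twice.\<close>

lemma sum_power4_le:
  fixes x :: "'b \<Rightarrow> real"
  shows "(\<Sum>i\<in>J. x i) ^ 4 \<le> real (card J) ^ 3 * (\<Sum>i\<in>J. x i ^ 4)"
proof -
  have "((\<Sum>i\<in>J. x i)\<^sup>2)\<^sup>2 \<le> ((\<Sum>i\<in>J. (x i)\<^sup>2) * real (card J))\<^sup>2"
    by (intro power_mono sum_squared_le_sum_of_squares) auto
  also have "\<dots> = (\<Sum>i\<in>J. (x i)\<^sup>2)\<^sup>2 * real (card J) ^ 2" by (simp add: power_mult_distrib)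
  also have "\<dots> \<le> ((\<Sum>i\<in>J. ((x i)\<^sup>2)\<^sup>2) * real (card J)) * real (card J) ^ 2"
    by (intro mult_right_mono sum_squared_le_sum_of_squares) auto
  finally show ?thesis by (simp add: power_mult[symmetric] power4_eq_xxxx power3_eq_cube power2_eq_square mult_ac)
qed

context brownian_setup
begin

text \<open>Each assertion is the corresponding one for step integrals, passed to the limit. The
  uniform fourth moment bound justifies it for first and second moments; the brackets are bounded by
  \<open>t - s\<close>, so dominated convergence handles them.\<close>

lemma ito_increment:
  assumes i: "i \<in> {1..n}" and ito: "is_ito_integral M F (B i) H X"
    and H1: "AE \<omega> in M. AE u in lborel. u \<ge> 0 \<longrightarrow> \<bar>H u \<omega>\<bar> \<le> 1"
    and st: "0 \<le> s" "s < t"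
  shows "(\<lambda>\<omega>. X t \<omega> - X s \<omega>) \<in> borel_measurable (G t)"
    and "integrable P (\<lambda>\<omega>. (X t \<omega> - X s \<omega>) ^ 4)"
    and "E (\<lambda>\<omega>. (X t \<omega> - X s \<omega>) ^ 4) \<le> 96 * (t - s)\<^sup>2"
    and "(\<lambda>\<omega>. LINT u:{s..t}|lborel. (H u \<omega>)\<^sup>2) \<in> borel_measurable P"
    and "AE \<omega> in M. 0 \<le> (LINT u:{s..t}|lborel. (H u \<omega>)\<^sup>2) \<and> (LINT u:{s..t}|lborel. (H u \<omega>)\<^sup>2) \<le> t - s"
    and "\<And>Z K. Z \<in> borel_measurable (G s) \<Longrightarrow> (\<And>\<omega>. \<omega> \<in> space M \<Longrightarrow> \<bar>Z \<omega>\<bar> \<le> K) \<Longrightarrow>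
      E (\<lambda>\<omega>. Z \<omega> * (X t \<omega> - X s \<omega>)) = 0 \<and>
      E (\<lambda>\<omega>. Z \<omega> * (X t \<omega> - X s \<omega>)\<^sup>2) = E (\<lambda>\<omega>. Z \<omega> * (LINT u:{s..t}|lborel. (H u \<omega>)\<^sup>2))"
proof -
  obtain m :: "nat \<Rightarrow> nat" and a :: "nat \<Rightarrow> nat \<Rightarrow> real" and \<zeta> :: "nat \<Rightarrow> nat \<Rightarrow> 'a \<Rightarrow> real"
  where sp: "\<And>r. step_process 1 (m r) (a r) (\<zeta> r)" and a: "\<And>r. s \<le> a r 0" "\<And>r j. a r j \<le> t"
    and limX: "AE \<omega> in M. (\<lambda>r. step_integral i (m r) (a r) (\<zeta> r) \<omega>) \<longlonglongrightarrow> X t \<omega> - X s \<omega>"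
    and limQ: "AE \<omega> in M. (\<lambda>r. \<Sum>j<m r. (\<zeta> r j \<omega>)\<^sup>2 * (a r (Suc j) - a r j)) \<longlonglongrightarrow> (LINT u:{s..t}|lborel. (H u \<omega>)\<^sup>2)"
    and Q: "AE \<omega> in M. 0 \<le> (LINT u:{s..t}|lborel. (H u \<omega>)\<^sup>2) \<and> (LINT u:{s..t}|lborel. (H u \<omega>)\<^sup>2) \<le> t - s"
    using ito_step_approximation[OF i ito H1 st(1) less_imp_le[OF st(2)]] by blast
  let ?I = "\<lambda>r. step_integral i (m r) (a r) (\<zeta> r)"
  let ?Q = "\<lambda>\<omega>. LINT u:{s..t}|lborel. (H u \<omega>)\<^sup>2"
  let ?S = "\<lambda>r \<omega>. \<Sum>j<m r. (\<zeta> r j \<omega>)\<^sup>2 * (a r (Suc j) - a r j)"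
  have IG: "?I r \<in> borel_measurable (G t)" for r
    using step_integral_G[OF i sp[of r]] a(2) by (rule G_mono)
  have IP: "?I r \<in> borel_measurable P" for r using G_P[OF IG] .
  show XG: "(\<lambda>\<omega>. X t \<omega> - X s \<omega>) \<in> borel_measurable (G t)"
    by (rule augment_measurable_AE_lim[OF subalgebra_F IG limX])
  have SG: "?S r \<in> borel_measurable (G t)" for r
  proof -
    have "\<zeta> r j \<in> borel_measurable (G t)" if "j < m r" for j
      by (rule G_mono[OF _ a(2)[of r j]]) (use sp[of r] that in \<open>auto simp: step_process_def\<close>)
    then show ?thesis
      by (intro borel_measurable_sum borel_measurable_times borel_measurable_power) auto
  qed
  note SP = G_P[OF SG]
  show QP: "?Q \<in> borel_measurable P"
    by (rule G_P[OF augment_measurable_AE_lim[OF subalgebra_F SG limQ]])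
  have I4: "integrable P (\<lambda>\<omega>. ?I r \<omega> ^ 4)" for r by (rule step_integral_power_integrable[OF i sp])
  have E4: "E (\<lambda>\<omega>. ?I r \<omega> ^ 4) \<le> 96 * (t - s)\<^sup>2" for r
    using step_integral_fourth_moment[OF i sp[of r], of "t - s"] a(1)[of r] a(2)[of r "m r"] st by simp
  have X4: "integrable P (\<lambda>\<omega>. (X t \<omega> - X s \<omega>) ^ 4) \<and> E (\<lambda>\<omega>. (X t \<omega> - X s \<omega>) ^ 4) \<le> 96 * (t - s)\<^sup>2"
  proof (rule P.AE_lim_expectation_le[OF I4 _ E4])
    show "(\<lambda>\<omega>. (X t \<omega> - X s \<omega>) ^ 4) \<in> borel_measurable P" using G_P[OF XG] by (rule borel_measurable_power)
    show "AE \<omega> in P. (\<lambda>r. ?I r \<omega> ^ 4) \<longlonglongrightarrow> (X t \<omega> - X s \<omega>) ^ 4"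
      using AE_completion[OF limX] by eventually_elim (rule tendsto_power)
  qed simp
  show "integrable P (\<lambda>\<omega>. (X t \<omega> - X s \<omega>) ^ 4)" "E (\<lambda>\<omega>. (X t \<omega> - X s \<omega>) ^ 4) \<le> 96 * (t - s)\<^sup>2"
    using X4 by auto
  show "AE \<omega> in M. 0 \<le> ?Q \<omega> \<and> ?Q \<omega> \<le> t - s" by (rule Q)
  fix Z :: "'a \<Rightarrow> real" and K :: real assume Z: "Z \<in> borel_measurable (G s)" "\<And>\<omega>. \<omega> \<in> space M \<Longrightarrow> \<bar>Z \<omega>\<bar> \<le> K"
  have ZP: "Z \<in> borel_measurable P" "\<And>\<omega>. \<omega> \<in> space P \<Longrightarrow> \<bar>Z \<omega>\<bar> \<le> K" using Z G_P[OF Z(1)] by auto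
  have Za: "Z \<in> borel_measurable (G (a r 0))" for r using G_mono[OF Z(1) a(1)] .
  have m: "E (\<lambda>\<omega>. Z \<omega> * ?I r \<omega>) = 0 \<and> E (\<lambda>\<omega>. Z \<omega> * (?I r \<omega>)\<^sup>2) = E (\<lambda>\<omega>. Z \<omega> * ?S r \<omega>)" for r
    by (rule step_integral_moments[OF i sp Za]) (rule Z(2))
  \<comment> \<open>The product limit lemma is applied with second factor 1, so its common bound
    must also dominate the fourth moment of the constant 1.\<close>
  define C where "C = max 1 (96 * (t - s)\<^sup>2)"
  have C: "96 * (t - s)\<^sup>2 \<le> C" "1 \<le> C" by (auto simp: C_def)
  have "(\<lambda>r. E (\<lambda>\<omega>. Z \<omega> * (?I r \<omega> * 1))) \<longlonglongrightarrow> E (\<lambda>\<omega>. Z \<omega> * ((X t \<omega> - X s \<omega>) * 1))"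
    by (rule P.AE_lim_expectation_product(1)[OF IP I4 order_trans[OF E4 C(1)] G_P[OF XG] AE_completion[OF limX]
      _ _ _ _ _ ZP, where W="\<lambda>_ _. 1"]) (use C in \<open>auto simp: prob_space\<close>)
  then have 1: "E (\<lambda>\<omega>. Z \<omega> * (X t \<omega> - X s \<omega>)) = 0"
    using m by (simp add: LIMSEQ_const_iff)
  have "(\<lambda>r. E (\<lambda>\<omega>. Z \<omega> * (?I r \<omega> * ?I r \<omega>))) \<longlonglongrightarrow> E (\<lambda>\<omega>. Z \<omega> * ((X t \<omega> - X s \<omega>) * (X t \<omega> - X s \<omega>)))"
    by (rule P.AE_lim_expectation_product(1)[OF IP I4 E4 G_P[OF XG] AE_completion[OF limX]
      IP I4 E4 G_P[OF XG] AE_completion[OF limX] ZP])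
  then have l1: "(\<lambda>r. E (\<lambda>\<omega>. Z \<omega> * ?S r \<omega>)) \<longlonglongrightarrow> E (\<lambda>\<omega>. Z \<omega> * (X t \<omega> - X s \<omega>)\<^sup>2)"
    using m by (simp add: power2_eq_square)
  have l2: "(\<lambda>r. E (\<lambda>\<omega>. Z \<omega> * ?S r \<omega>)) \<longlonglongrightarrow> E (\<lambda>\<omega>. Z \<omega> * ?Q \<omega>)"
  proof (rule integral_dominated_convergence[where w="\<lambda>_. K * (t - s)"])
    show "(\<lambda>\<omega>. Z \<omega> * ?Q \<omega>) \<in> borel_measurable P" by (intro borel_measurable_times ZP QP)
    show "(\<lambda>\<omega>. Z \<omega> * ?S r \<omega>) \<in> borel_measurable P" for r by (intro borel_measurable_times ZP SP)
    show "AE \<omega> in P. (\<lambda>r. Z \<omega> * ?S r \<omega>) \<longlonglongrightarrow> Z \<omega> * ?Q \<omega>"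
      using AE_completion[OF limQ] by eventually_elim (intro tendsto_mult tendsto_const)
    show "AE \<omega> in P. norm (Z \<omega> * ?S r \<omega>) \<le> K * (t - s)" for r
    proof (rule AE_I2)
      fix \<omega> assume w: "\<omega> \<in> space P"
      have nn: "0 \<le> a r (Suc j) - a r j" if "j < m r" for j
        using step_process_mono[OF sp[of r], of j "Suc j"] that by simp
      have s0: "0 \<le> ?S r \<omega>" by (rule sum_nonneg) (use nn in auto)
      have "?S r \<omega> \<le> (\<Sum>j<m r. a r (Suc j) - a r j)"
      proof (rule sum_mono)
        fix j assume j: "j \<in> {..<m r}"
        then have "(\<zeta> r j \<omega>)\<^sup>2 \<le> 1" using sp[of r] w by (auto simp: step_process_def abs_square_le_1)
        then show "(\<zeta> r j \<omega>)\<^sup>2 * (a r (Suc j) - a r j) \<le> a r (Suc j) - a r j"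
          using nn[of j] j mult_right_mono[of "(\<zeta> r j \<omega>)\<^sup>2" 1 "a r (Suc j) - a r j"] by simp
      qed
      also have "\<dots> = a r (m r) - a r 0" by (rule sum_lessThan_telescope)
      also have "\<dots> \<le> t - s" using a(1)[of r] a(2)[of r "m r"] by simp
      finally show "norm (Z \<omega> * ?S r \<omega>) \<le> K * (t - s)"
        using s0 ZP(2)[OF w] unfolding real_norm_def abs_mult by (intro mult_mono) auto
    qed
  qed simp
  have "E (\<lambda>\<omega>. Z \<omega> * (X t \<omega> - X s \<omega>)\<^sup>2) = E (\<lambda>\<omega>. Z \<omega> * ?Q \<omega>)"
    by (rule LIMSEQ_unique[OF l1 l2])
  then show "E (\<lambda>\<omega>. Z \<omega> * (X t \<omega> - X s \<omega>)) = 0 \<and>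
      E (\<lambda>\<omega>. Z \<omega> * (X t \<omega> - X s \<omega>)\<^sup>2) = E (\<lambda>\<omega>. Z \<omega> * ?Q \<omega>)" using 1 by blast
qed

lemma ito_integral_G:
  assumes i: "i \<in> {1..n}" and ito: "is_ito_integral M F (B i) H X"
    and H1: "AE \<omega> in M. AE u in lborel. u \<ge> 0 \<longrightarrow> \<bar>H u \<omega>\<bar> \<le> 1" and t: "0 \<le> t"
  shows "X t \<in> borel_measurable (G t)"
proof (cases "t = 0")
  case True
  have "AE \<omega> in M. 0 = X t \<omega>" using ito_integral_zero[OF ito] True by auto
  then show ?thesis by (rule augment_measurable_AE_cong[OF subalgebra_F borel_measurable_const])
next
  case False
  then have "0 < t" using t by simp
  have "AE \<omega> in M. X t \<omega> - X 0 \<omega> = X t \<omega>" using ito_integral_zero[OF ito] by auto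
  with ito_increment(1)[OF i ito H1 order_refl \<open>0 < t\<close>] show ?thesis
    by (rule augment_measurable_AE_cong[OF subalgebra_F])
qed

text \<open>Orthogonality of integrals against different coordinates; with it the bracket of a sum
  of integrals is the sum of the brackets.\<close>

lemma ito_cross:
  assumes il: "i \<in> {1..n}" "l \<in> {1..n}" "i \<noteq> l"
    and ito: "is_ito_integral M F (B i) H X" "is_ito_integral M F (B l) H' X'"
    and H1: "AE \<omega> in M. AE u in lborel. u \<ge> 0 \<longrightarrow> \<bar>H u \<omega>\<bar> \<le> 1"
      "AE \<omega> in M. AE u in lborel. u \<ge> 0 \<longrightarrow> \<bar>H' u \<omega>\<bar> \<le> 1"
    and st: "0 \<le> s" "s < t"
    and Z: "Z \<in> borel_measurable (G s)" "\<And>\<omega>. \<omega> \<in> space M \<Longrightarrow> \<bar>Z \<omega>\<bar> \<le> K"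
  shows "E (\<lambda>\<omega>. Z \<omega> * ((X t \<omega> - X s \<omega>) * (X' t \<omega> - X' s \<omega>))) = 0"
    and "integrable P (\<lambda>\<omega>. (X t \<omega> - X s \<omega>) * (X' t \<omega> - X' s \<omega>))"
proof -
  obtain m :: "nat \<Rightarrow> nat" and a :: "nat \<Rightarrow> nat \<Rightarrow> real" and \<zeta> :: "nat \<Rightarrow> nat \<Rightarrow> 'a \<Rightarrow> real"
  where sp: "\<And>r. step_process 1 (m r) (a r) (\<zeta> r)" and a: "\<And>r. s \<le> a r 0" "\<And>r j. a r j \<le> t"
    and limX: "AE \<omega> in M. (\<lambda>r. step_integral i (m r) (a r) (\<zeta> r) \<omega>) \<longlonglongrightarrow> X t \<omega> - X s \<omega>"
    by (rule ito_step_approximation[OF il(1) ito(1) H1(1) st(1) less_imp_le[OF st(2)]]) (rule that)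
  obtain m' :: "nat \<Rightarrow> nat" and a' :: "nat \<Rightarrow> nat \<Rightarrow> real" and \<zeta>' :: "nat \<Rightarrow> nat \<Rightarrow> 'a \<Rightarrow> real"
  where sp': "\<And>r. step_process 1 (m' r) (a' r) (\<zeta>' r)" and a': "\<And>r. s \<le> a' r 0" "\<And>r j. a' r j \<le> t"
    and limX': "AE \<omega> in M. (\<lambda>r. step_integral l (m' r) (a' r) (\<zeta>' r) \<omega>) \<longlonglongrightarrow> X' t \<omega> - X' s \<omega>"
    by (rule ito_step_approximation[OF il(2) ito(2) H1(2) st(1) less_imp_le[OF st(2)]]) (rule that)
  note XP = G_P[OF ito_increment(1)[OF il(1) ito(1) H1(1) st]] G_P[OF ito_increment(1)[OF il(2) ito(2) H1(2) st]]
  have e: "E (\<lambda>\<omega>. step_integral i (m r) (a r) (\<zeta> r) \<omega> ^ 4) \<le> 96 * (t - s)\<^sup>2"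
    "E (\<lambda>\<omega>. step_integral l (m' r) (a' r) (\<zeta>' r) \<omega> ^ 4) \<le> 96 * (t - s)\<^sup>2" for r
    using step_integral_fourth_moment[OF il(1) sp[of r], of "t - s"] a(1)[of r] a(2)[of r "m r"]
      step_integral_fourth_moment[OF il(2) sp'[of r], of "t - s"] a'(1)[of r] a'(2)[of r "m' r"] st by auto
  note L = P.AE_lim_expectation_product[OF G_P[OF step_integral_G[OF il(1) sp]] step_integral_power_integrable[OF il(1) sp]
      e(1) XP(1) AE_completion[OF limX]
      G_P[OF step_integral_G[OF il(2) sp']] step_integral_power_integrable[OF il(2) sp']
      e(2) XP(2) AE_completion[OF limX'] G_P[OF Z(1)] Z(2)]
  show "integrable P (\<lambda>\<omega>. (X t \<omega> - X s \<omega>) * (X' t \<omega> - X' s \<omega>))" using L(2) by simp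
  have "E (\<lambda>\<omega>. Z \<omega> * (step_integral i (m r) (a r) (\<zeta> r) \<omega> * step_integral l (m' r) (a' r) (\<zeta>' r) \<omega>)) = 0" for r
    by (rule step_integral_cross[OF il sp sp' Z a(1) a'(1)])
  then show "E (\<lambda>\<omega>. Z \<omega> * ((X t \<omega> - X s \<omega>) * (X' t \<omega> - X' s \<omega>))) = 0"
    using L(1) by (simp add: LIMSEQ_const_iff)
qed

text \<open>The index set \<open>J\<close> is arbitrary, so the result serves the lowest particles
  and, after reflection, the highest ones. The power of \<open>n\<close> comes from
  \<open>sum_power4_le\<close>, with one more factor for the number of summands.\<close>

lemma ito_sum_moments:
  fixes H X :: "nat \<Rightarrow> real \<Rightarrow> 'a \<Rightarrow> real"
  assumes J: "J \<subseteq> {1..n}" and ito: "\<And>i. i \<in> J \<Longrightarrow> is_ito_integral M F (B i) (H i) (X i)"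
    and H1: "\<And>i. i \<in> J \<Longrightarrow> AE \<omega> in M. AE u in lborel. u \<ge> 0 \<longrightarrow> \<bar>H i u \<omega>\<bar> \<le> 1"
    and st: "0 \<le> s" "s < t"
  defines "D \<equiv> \<lambda>\<omega>. (\<Sum>i\<in>J. X i t \<omega>) - (\<Sum>i\<in>J. X i s \<omega>)"
    and "Q \<equiv> \<lambda>\<omega>. \<Sum>i\<in>J. LINT u:{s..t}|lborel. (H i u \<omega>)\<^sup>2"
  shows "integrable P (\<lambda>\<omega>. D \<omega> ^ 4)" and "E (\<lambda>\<omega>. D \<omega> ^ 4) \<le> 96 * real n ^ 4 * (t - s)\<^sup>2"
    and "Q \<in> borel_measurable P" and "AE \<omega> in M. 0 \<le> Q \<omega> \<and> Q \<omega> \<le> real n * (t - s)"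
    and "\<And>Z K. Z \<in> borel_measurable (G s) \<Longrightarrow> (\<And>\<omega>. \<omega> \<in> space M \<Longrightarrow> \<bar>Z \<omega>\<bar> \<le> K) \<Longrightarrow>
      E (\<lambda>\<omega>. Z \<omega> * D \<omega>) = 0 \<and> E (\<lambda>\<omega>. Z \<omega> * (D \<omega>)\<^sup>2) = E (\<lambda>\<omega>. Z \<omega> * Q \<omega>)"
proof -
  have fin: "finite J" using J finite_subset by blast
  have card: "real (card J) \<le> real n" using card_mono[OF _ J] by simp
  let ?d = "\<lambda>i \<omega>. X i t \<omega> - X i s \<omega>" and ?q = "\<lambda>i \<omega>. LINT u:{s..t}|lborel. (H i u \<omega>)\<^sup>2"
  have Deq: "D \<omega> = (\<Sum>i\<in>J. ?d i \<omega>)" for \<omega> by (simp add: D_def sum_subtractf)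
  note inc = ito_increment[OF subsetD[OF J] ito H1 st]
  have dP: "?d i \<in> borel_measurable P" if "i \<in> J" for i using G_P[OF inc(1)[OF that that that]] .
  have d4: "integrable P (\<lambda>\<omega>. (?d i \<omega>) ^ 4)" "E (\<lambda>\<omega>. (?d i \<omega>) ^ 4) \<le> 96 * (t - s)\<^sup>2" if "i \<in> J" for i
    using inc(2,3)[OF that that that] by auto
  have DP: "D \<in> borel_measurable P" unfolding Deq[abs_def] using dP by auto
  have bi: "integrable P (\<lambda>\<omega>. real (card J) ^ 3 * (\<Sum>i\<in>J. (?d i \<omega>) ^ 4))" using d4 by simp
  show i4: "integrable P (\<lambda>\<omega>. D \<omega> ^ 4)"
  proof (rule Bochner_Integration.integrable_bound[OF bi])
    show "AE \<omega> in P. norm (D \<omega> ^ 4) \<le> norm (real (card J) ^ 3 * (\<Sum>i\<in>J. (?d i \<omega>) ^ 4))"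
    proof (rule AE_I2)
      fix \<omega>
      have "D \<omega> ^ 4 \<le> real (card J) ^ 3 * (\<Sum>i\<in>J. (?d i \<omega>) ^ 4)"
        unfolding Deq by (rule sum_power4_le)
      then show "norm (D \<omega> ^ 4) \<le> norm (real (card J) ^ 3 * (\<Sum>i\<in>J. (?d i \<omega>) ^ 4))" by simp
    qed
  qed (use DP in simp)
  show "E (\<lambda>\<omega>. D \<omega> ^ 4) \<le> 96 * real n ^ 4 * (t - s)\<^sup>2"
  proof -
    have "E (\<lambda>\<omega>. D \<omega> ^ 4) \<le> E (\<lambda>\<omega>. real (card J) ^ 3 * (\<Sum>i\<in>J. (?d i \<omega>) ^ 4))"
      by (rule integral_mono[OF i4 bi]) (simp only: Deq sum_power4_le)
    also have "\<dots> = real (card J) ^ 3 * (\<Sum>i\<in>J. E (\<lambda>\<omega>. (?d i \<omega>) ^ 4))"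
      using d4 by simp
    also have "\<dots> \<le> real (card J) ^ 3 * (\<Sum>i\<in>J. 96 * (t - s)\<^sup>2)"
      using d4 by (intro mult_left_mono sum_mono) auto
    also have "\<dots> = 96 * real (card J) ^ 4 * (t - s)\<^sup>2"
      by (simp add: power4_eq_xxxx power3_eq_cube)
    also have "\<dots> \<le> 96 * real n ^ 4 * (t - s)\<^sup>2"
      using power_mono[OF card, of 4] by (intro mult_right_mono) auto
    finally show ?thesis .
  qed
  have qP: "?q i \<in> borel_measurable P" if "i \<in> J" for i by (rule inc(4)[OF that that that])
  show "Q \<in> borel_measurable P" unfolding Q_def using qP by auto
  have qAE: "AE \<omega> in M. \<forall>i\<in>J. 0 \<le> ?q i \<omega> \<and> ?q i \<omega> \<le> t - s"
    using fin inc(5) by (simp add: AE_finite_all)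
  then show "AE \<omega> in M. 0 \<le> Q \<omega> \<and> Q \<omega> \<le> real n * (t - s)"
  proof eventually_elim
    case (elim \<omega>)
    have "Q \<omega> \<le> (\<Sum>i\<in>J. t - s)" unfolding Q_def using elim by (intro sum_mono) auto
    also have "\<dots> \<le> real n * (t - s)" using card st by (simp add: mult_right_mono)
    finally show ?case unfolding Q_def using elim by (auto intro!: sum_nonneg)
  qed
  fix Z :: "'a \<Rightarrow> real" and K :: real assume Z: "Z \<in> borel_measurable (G s)" "\<And>\<omega>. \<omega> \<in> space M \<Longrightarrow> \<bar>Z \<omega>\<bar> \<le> K"
  have ZP: "Z \<in> borel_measurable P" "\<And>\<omega>. \<omega> \<in> space P \<Longrightarrow> \<bar>Z \<omega>\<bar> \<le> K" using Z G_P[OF Z(1)] by auto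
  have dint: "integrable P (\<lambda>\<omega>. ?d i \<omega>)" "integrable P (\<lambda>\<omega>. ?d i \<omega> * ?d i \<omega>)" if "i \<in> J" for i
  proof -
    have b: "\<bar>x\<bar> \<le> 1 + x ^ 4" "\<bar>x * x\<bar> \<le> 1 + x ^ 4" for x :: real
    proof -
      have 1: "2 * \<bar>x\<bar> \<le> 1 + x\<^sup>2" using zero_le_power2[of "\<bar>x\<bar> - 1"] by (simp add: power2_diff)
      have 2: "2 * x\<^sup>2 \<le> 1 + x ^ 4" using zero_le_power2[of "x\<^sup>2 - 1"] by (simp add: power2_diff)
      have 3: "0 \<le> x ^ 4" "0 \<le> x\<^sup>2" "\<bar>x * x\<bar> = x\<^sup>2" by (auto simp: power2_eq_square)
      show "\<bar>x\<bar> \<le> 1 + x ^ 4" using 1 2 3(1) by linarith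
      show "\<bar>x * x\<bar> \<le> 1 + x ^ 4" using 2 3 by linarith
    qed
    have i1: "integrable P (\<lambda>\<omega>. 1 + (?d i \<omega>) ^ 4)" using d4(1)[OF that] by simp
    show "integrable P (\<lambda>\<omega>. ?d i \<omega>)"
      by (rule Bochner_Integration.integrable_bound[OF i1 dP[OF that]]) (use b(1) in \<open>auto intro!: AE_I2\<close>)
    show "integrable P (\<lambda>\<omega>. ?d i \<omega> * ?d i \<omega>)"
      by (rule Bochner_Integration.integrable_bound[OF i1 borel_measurable_times[OF dP[OF that] dP[OF that]]])
        (use b(2) in \<open>auto intro!: AE_I2\<close>)
  qed
  have cross: "E (\<lambda>\<omega>. Z \<omega> * (?d i \<omega> * ?d l \<omega>)) = 0" "integrable P (\<lambda>\<omega>. ?d i \<omega> * ?d l \<omega>)"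
    if "i \<in> J" "l \<in> J" "i \<noteq> l" for i l
    using ito_cross[OF subsetD[OF J that(1)] subsetD[OF J that(2)] that(3) ito[OF that(1)] ito[OF that(2)]
       H1[OF that(1)] H1[OF that(2)] st Z] by auto
  have pint: "integrable P (\<lambda>\<omega>. ?d i \<omega> * ?d l \<omega>)" if "i \<in> J" "l \<in> J" for i l
    using that cross(2)[of i l] dint(2)[of i] by (cases "i = l") auto
  have Zp: "integrable P (\<lambda>\<omega>. Z \<omega> * (?d i \<omega> * ?d l \<omega>))" if "i \<in> J" "l \<in> J" for i l
    by (rule integrable_bounded_mult[OF pint[OF that] ZP])
  have Z1: "integrable P (\<lambda>\<omega>. Z \<omega> * ?d i \<omega>)" if "i \<in> J" for i
    by (rule integrable_bounded_mult[OF dint(1)[OF that] ZP])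
  have mom: "E (\<lambda>\<omega>. Z \<omega> * ?d i \<omega>) = 0" "E (\<lambda>\<omega>. Z \<omega> * (?d i \<omega>)\<^sup>2) = E (\<lambda>\<omega>. Z \<omega> * ?q i \<omega>)" if "i \<in> J" for i
    using inc(6)[OF that that that Z] by auto
  have Zq: "integrable P (\<lambda>\<omega>. Z \<omega> * ?q i \<omega>)" if "i \<in> J" for i
  proof (rule integrable_bounded_mult[OF _ ZP])
    show "integrable P (?q i)"
    proof (rule P.integrable_const_bound[OF _ qP[OF that], of "t - s"])
      show "AE \<omega> in P. norm (?q i \<omega>) \<le> t - s"
        using AE_completion[OF inc(5)[OF that that that]] by eventually_elim auto
    qed
  qed
  have "E (\<lambda>\<omega>. Z \<omega> * D \<omega>) = (\<Sum>i\<in>J. E (\<lambda>\<omega>. Z \<omega> * ?d i \<omega>))"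
    unfolding Deq sum_distrib_left by (rule Bochner_Integration.integral_sum) (rule Z1)
  then have 1: "E (\<lambda>\<omega>. Z \<omega> * D \<omega>) = 0" using mom by simp
  have "E (\<lambda>\<omega>. Z \<omega> * (D \<omega>)\<^sup>2) = E (\<lambda>\<omega>. \<Sum>i\<in>J. \<Sum>l\<in>J. Z \<omega> * (?d i \<omega> * ?d l \<omega>))"
    unfolding Deq power2_eq_square sum_product by (simp only: sum_distrib_left)
  also have "\<dots> = (\<Sum>i\<in>J. E (\<lambda>\<omega>. \<Sum>l\<in>J. Z \<omega> * (?d i \<omega> * ?d l \<omega>)))"
    by (rule Bochner_Integration.integral_sum) (use Zp in \<open>auto intro!: Bochner_Integration.integrable_sum\<close>)
  also have "\<dots> = (\<Sum>i\<in>J. \<Sum>l\<in>J. E (\<lambda>\<omega>. Z \<omega> * (?d i \<omega> * ?d l \<omega>)))"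
    by (intro sum.cong refl Bochner_Integration.integral_sum) (use Zp in auto)
  \<comment> \<open>Orthogonality kills the off-diagonal terms, and the isometry evaluates the
    diagonal.\<close>
  also have "\<dots> = (\<Sum>i\<in>J. \<Sum>l\<in>J. if l = i then E (\<lambda>\<omega>. Z \<omega> * ?q i \<omega>) else 0)"
    by (intro sum.cong refl) (use cross(1) mom(2) in \<open>auto simp: power2_eq_square\<close>)
  also have "\<dots> = (\<Sum>i\<in>J. E (\<lambda>\<omega>. Z \<omega> * ?q i \<omega>))" using fin by simp
  also have "\<dots> = E (\<lambda>\<omega>. Z \<omega> * Q \<omega>)"
    unfolding Q_def sum_distrib_left using Zq by (subst Bochner_Integration.integral_sum) auto
  finally show "E (\<lambda>\<omega>. Z \<omega> * D \<omega>) = 0 \<and> E (\<lambda>\<omega>. Z \<omega> * (D \<omega>)\<^sup>2) = E (\<lambda>\<omega>. Z \<omega> * Q \<omega>)"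
    using 1 by blast
qed

end

section \<open>A truncated logarithm and its Taylor bound\<close>

lemma ln_add_one_lower:
  fixes u :: real
  assumes "u \<ge> - (1/2)"
  shows "ln (1 + u) \<ge> u - u\<^sup>2 / 2 - \<bar>u\<bar> ^ 3"
proof (cases "u \<ge> 0")
  case True
  let ?g = "\<lambda>x::real. ln (1 + x) - x + x\<^sup>2 / 2"
  have a: "?g 0 \<le> ?g u"
  proof (rule DERIV_nonneg_imp_nondecreasing[OF True])
    fix x :: real assume x: "0 \<le> x" "x \<le> u"
    have "(?g has_real_derivative (1 / (1 + x) - 1 + x)) (at x)"
      using x by (auto intro!: derivative_eq_intros)
    moreover have "1 / (1 + x) - 1 + x = x\<^sup>2 / (1 + x)" using x by (simp add: field_simps power2_eq_square)
    ultimately show "\<exists>y. (?g has_real_derivative y) (at x) \<and> 0 \<le> y" using x by (intro exI[of _ "x\<^sup>2 / (1 + x)"]) auto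
  qed
  from a have b: "0 \<le> ln (1 + u) - u + u\<^sup>2 / 2" by simp
  have c: "0 \<le> \<bar>u\<bar> ^ 3" by simp
  show ?thesis using b c by linarith
next
  case False
  let ?h = "\<lambda>x::real. ln (1 + x) - x + x\<^sup>2 / 2 - x ^ 3"
  have "?h u \<ge> ?h 0"
  proof (rule DERIV_nonpos_imp_nonincreasing[where f="?h"])
    show "u \<le> 0" using False by simp
    fix x :: real assume x: "u \<le> x" "x \<le> 0"
    then have x1: "1 + x \<ge> 1/2" using assms by simp
    have "(?h has_real_derivative (1 / (1 + x) - 1 + x - 3 * x\<^sup>2)) (at x)"
      using x1 by (auto intro!: derivative_eq_intros)
    moreover have "1 / (1 + x) - 1 + x - 3 * x\<^sup>2 \<le> 0"
    proof -
      have "1 / (1 + x) - 1 + x = x\<^sup>2 * (1 / (1 + x))" using x1 by (simp add: field_simps power2_eq_square)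
      also have "\<dots> \<le> x\<^sup>2 * 3" using x1 by (intro mult_left_mono) (auto simp: field_simps)
      finally show ?thesis by simp
    qed
    ultimately show "\<exists>y. (?h has_real_derivative y) (at x) \<and> y \<le> 0" by blast
  qed
  moreover have "\<bar>u\<bar> ^ 3 = - (u ^ 3)" using False by (simp add: power3_eq_cube abs_if)
  ultimately show ?thesis by simp
qed

text \<open>The logarithm made bounded, so that all its expectations are finite. The factors 1/2 and
  2 leave room beyond [\<epsilon>, \<kappa>]: an increment of at most half the current value never
  reaches the truncation.\<close>

definition clog :: "real \<Rightarrow> real \<Rightarrow> real \<Rightarrow> real" where
  "clog \<epsilon> \<kappa> y = ln (max (\<epsilon> / 2) (min y (2 * \<kappa>)))"

lemma clog_measurable [measurable]: "clog \<epsilon> \<kappa> \<in> borel_measurable borel"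
  unfolding clog_def by measurable

lemma clog_bounds:
  assumes "0 < \<epsilon>" "\<epsilon> \<le> \<kappa>"
  shows "ln (\<epsilon> / 2) \<le> clog \<epsilon> \<kappa> y" "clog \<epsilon> \<kappa> y \<le> ln (2 * \<kappa>)" "y < \<epsilon> \<Longrightarrow> clog \<epsilon> \<kappa> y \<le> ln \<epsilon>"
    "\<epsilon> \<le> y \<Longrightarrow> y \<le> \<kappa> \<Longrightarrow> clog \<epsilon> \<kappa> y = ln y"
  using assms by (auto simp: clog_def ln_le_cancel_iff max_def min_def)

text \<open>Small relative increments obey the Taylor bound of the logarithm. Large ones are
  absorbed by the cubic term, since \<open>clog\<close> is bounded. Both ask only for a large
  \<open>K\<close>, which may depend on \<epsilon> because the cubic terms vanish as the grid is
  refined.\<close>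

lemma clog_taylor:
  assumes e: "0 < \<epsilon>" "\<epsilon> \<le> \<kappa>"
  defines "K \<equiv> (5 + 8 * ln (4 * \<kappa> / \<epsilon>)) / \<epsilon> ^ 3"
  shows "K \<ge> 0"
    and "\<epsilon> \<le> y \<Longrightarrow> y \<le> \<kappa> \<Longrightarrow> clog \<epsilon> \<kappa> (y + a) - clog \<epsilon> \<kappa> y \<ge> a / y - a\<^sup>2 / (2 * y\<^sup>2) - K * \<bar>a\<bar> ^ 3"
proof -
  have l0: "ln (4 * \<kappa> / \<epsilon>) \<ge> 0" using e by (simp add: field_simps)
  then show "K \<ge> 0" using e by (simp add: K_def)
  assume y: "\<epsilon> \<le> y" "y \<le> \<kappa>"
  have y0: "y > 0" using y e by simp
  define u where "u = a / y"
  define K3 where "K3 = 5 + 8 * ln (4 * \<kappa> / \<epsilon>)"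
  have K3: "K3 \<ge> 1" using l0 by (simp add: K3_def)
  have au: "a = y * u" using y0 by (simp add: u_def)
  have main: "clog \<epsilon> \<kappa> (y + a) - clog \<epsilon> \<kappa> y \<ge> u - u\<^sup>2 / 2 - K3 * \<bar>u\<bar> ^ 3"
  proof (cases "\<bar>u\<bar> \<le> 1/2")
    case True
    then have u: "u \<ge> - (1/2)" "u \<le> 1/2" by auto
    have "y * u \<ge> y * (- (1/2))" "y * u \<le> y * (1/2)"
      by (rule mult_left_mono[OF u(1) less_imp_le[OF y0]], rule mult_left_mono[OF u(2) less_imp_le[OF y0]])
    then have "\<epsilon> / 2 \<le> y + a" "y + a \<le> 2 * \<kappa>" unfolding au using y e by linarith+
    then have "clog \<epsilon> \<kappa> (y + a) = ln (y * (1 + u))" by (simp add: clog_def au distrib_left)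
    also have "\<dots> = ln y + ln (1 + u)" using y0 u by (intro ln_mult_pos) auto
    finally have 1: "clog \<epsilon> \<kappa> (y + a) - clog \<epsilon> \<kappa> y = ln (1 + u)"
      using clog_bounds(4)[OF e y] by simp
    have "\<bar>u\<bar> ^ 3 \<le> K3 * \<bar>u\<bar> ^ 3" using K3 mult_right_mono[of 1 K3 "\<bar>u\<bar> ^ 3"] by simp
    then show ?thesis unfolding 1 using ln_add_one_lower[OF u(1)] by linarith
  next
    case False
    \<comment> \<open>Now \<open>\<bar>u\<bar> ^ 3\<close> is at least 1/8. The constant 8 in front
      of the logarithm pays for the whole oscillation of \<open>clog\<close>, and 5 pays for
      \<open>u - u\<^sup>2 / 2 \<le> 1/2\<close>.\<close>
    have "(1/2) ^ 3 \<le> \<bar>u\<bar> ^ 3" using False by (intro power_mono) auto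
    then have "K3 * (1/8) \<le> K3 * \<bar>u\<bar> ^ 3" using K3 by (intro mult_left_mono) (auto simp: power3_eq_cube)
    then have k: "1/2 + ln (4 * \<kappa> / \<epsilon>) \<le> K3 * \<bar>u\<bar> ^ 3" by (simp add: K3_def)
    have q: "u - u\<^sup>2 / 2 \<le> 1/2" using zero_le_power2[of "u - 1"] by (simp add: power2_diff)
    have "ln (4 * \<kappa> / \<epsilon>) = ln (2 * \<kappa>) - ln (\<epsilon> / 2)"
      using e ln_divide_pos[of "2 * \<kappa>" "\<epsilon> / 2"] by simp
    then show ?thesis using k q clog_bounds(1)[OF e, of "y + a"] clog_bounds(2)[OF e, of y] by linarith
  qed
  have "\<bar>u\<bar> ^ 3 = \<bar>a\<bar> ^ 3 / y ^ 3" using y0 by (simp add: u_def power_divide abs_divide)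
  also have "\<dots> \<le> \<bar>a\<bar> ^ 3 / \<epsilon> ^ 3" using e y by (intro divide_left_mono power_mono mult_pos_pos zero_less_power) auto
  finally have "K3 * \<bar>u\<bar> ^ 3 \<le> K3 * (\<bar>a\<bar> ^ 3 / \<epsilon> ^ 3)" using K3 by (intro mult_left_mono) auto
  also have "\<dots> = K * \<bar>a\<bar> ^ 3" by (simp add: K_def K3_def)
  finally have "K3 * \<bar>u\<bar> ^ 3 \<le> K * \<bar>a\<bar> ^ 3" .
  moreover have "u = a / y" "u\<^sup>2 / 2 = a\<^sup>2 / (2 * y\<^sup>2)" by (simp_all add: u_def power_divide)
  ultimately show "clog \<epsilon> \<kappa> (y + a) - clog \<epsilon> \<kappa> y \<ge> a / y - a\<^sup>2 / (2 * y\<^sup>2) - K * \<bar>a\<bar> ^ 3" using main by linarith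
qed

lemma stopped_telescope:
  fixes g :: "nat \<Rightarrow> real"
  assumes "\<And>i j. i \<le> j \<Longrightarrow> D j \<Longrightarrow> D i"
  shows "\<exists>J\<le>N. (\<Sum>j<N. if D j then g (Suc j) - g j else 0) = g J - g 0 \<and> (\<forall>j<J. D j) \<and> (J < N \<longrightarrow> \<not> D J)"
proof (induction N)
  case (Suc N)
  then obtain J where J: "J \<le> N" "(\<Sum>j<N. if D j then g (Suc j) - g j else 0) = g J - g 0"
    "\<forall>j<J. D j" "J < N \<longrightarrow> \<not> D J" by auto
  show ?case
  proof (cases "D N")
    case True
    then have "J = N" using J assms[of J N] by force
    then show ?thesis using J True by (intro exI[of _ "Suc N"]) (auto simp: less_Suc_eq)
  next
    case False
    then show ?thesis using J by (intro exI[of _ J]) (auto simp: less_Suc_eq le_less)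
  qed
qed simp

text \<open>Optional stopping for one discrete path: the increments summed while \<open>D\<close>
  holds telescope. If the sum stops by entering the low region, the end value is at most
  \<open>b\<close> instead of \<open>T\<close>, which is the gain subtracted on the right. If
  \<open>D\<close> fails at once the sum is empty, hence the assumption
  \<open>y \<le> T\<close>.\<close>

lemma stopped_telescope_le:
  fixes g :: "nat \<Rightarrow> real"
  assumes dec: "\<And>i j. i \<le> j \<Longrightarrow> D j \<Longrightarrow> D i" and g: "\<And>j. g j \<le> T" "D 0 \<Longrightarrow> y \<le> g 0" and yT: "y \<le> T"
    and stop: "\<And>j. low j \<Longrightarrow> g j \<le> b" "\<And>j. low j \<Longrightarrow> \<not> D j"
  shows "(\<Sum>j<N. if D j then g (Suc j) - g j else 0) \<le> (T - y) - (if \<exists>j<N. D j \<and> low (Suc j) then T - b else 0)"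
proof -
  have "\<exists>J\<le>N. (\<Sum>j<N. if D j then g (Suc j) - g j else 0) = g J - g 0 \<and> (\<forall>j<J. D j) \<and> (J < N \<longrightarrow> \<not> D J)"
    by (rule stopped_telescope) (rule dec)
  then obtain J where J: "J \<le> N" "(\<Sum>j<N. if D j then g (Suc j) - g j else 0) = g J - g 0"
    "\<forall>j<J. D j" "J < N \<longrightarrow> \<not> D J" by (elim exE conjE)
  show ?thesis
  proof (cases "\<exists>j<N. D j \<and> low (Suc j)")
    case True
    then obtain j where j: "j < N" "D j" "low (Suc j)" by auto
    have "J = Suc j"
    proof (rule antisym)
      show "J \<le> Suc j" using J(3) stop(2)[OF j(3)] by (meson not_less_eq_eq not_le)
      show "Suc j \<le> J" using J(1,4) j dec[of J j] by (metis less_eq_Suc_le not_less_eq_eq le_less_trans not_le)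
    qed
    then have "g J \<le> b" using stop(1)[OF j(3)] by simp
    moreover have "D 0" using dec[of 0 j] j by simp
    ultimately show ?thesis using True J(2) g(2) by simp
  next
    case False
    show ?thesis
    proof (cases "D 0")
      case True
      then show ?thesis using False J(2) g by (smt (verit))
    next
      case F: False
      then have "\<not> D j" for j using dec[of 0 j] by blast
      then show ?thesis using False yT by simp
    qed
  qed
qed

lemma (in brownian_setup) G_sets_P: "S \<in> sets (G s) \<Longrightarrow> S \<in> sets P"
  using subalgebra_completion_augment[OF subalgebra_F, of "ennreal s"] unfolding subalgebra_def by blast

section \<open>The logarithmic barrier: a semimartingale with controlled logarithmic drift avoids
  0\<close>

text \<open>An abstract version of the supermartingale argument for log Y with Y = Y0 + X +
  \<Gamma>: \<open>X\<close> is a martingale with bracket \<open>q\<close>, \<Gamma> has finite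
  variation dominated by the increasing \<open>V\<close>, and \<open>A t\<close> is the event that
  the control is still valid at time \<open>t\<close>. Condition \<open>drift\<close> says that the
  formal drift of log Y is at least -dV. The step \<open>h\<close> may depend on the path and on
  \<epsilon>, but \<open>V\<close> and its bound \<open>CV\<close> do not depend on
  \<epsilon>.\<close>

locale log_barrier = brownian_setup M F n B
  for M :: "'a measure" and F :: "ennreal \<Rightarrow> 'a measure" and n B +
  fixes X \<Gamma> V :: "real \<Rightarrow> 'a \<Rightarrow> real" and Y0 :: "'a \<Rightarrow> real" and q :: "real \<Rightarrow> real \<Rightarrow> 'a \<Rightarrow> real"
    and A :: "real \<Rightarrow> 'a set" and \<tau> \<kappa> y0 C4 CQ CV :: real
  assumes pos: "0 < \<tau>" "0 < y0" "y0 \<le> \<kappa>" "0 \<le> C4" "0 \<le> CQ" "0 \<le> CV"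
    and adapted: "\<And>t. 0 \<le> t \<Longrightarrow> X t \<in> borel_measurable (G t)" "\<And>t. 0 \<le> t \<Longrightarrow> \<Gamma> t \<in> borel_measurable (G t)"
      "Y0 \<in> borel_measurable (G 0)" "\<And>t. 0 \<le> t \<Longrightarrow> A t \<in> sets (G t)"
    and X4: "\<And>s t. 0 \<le> s \<Longrightarrow> s < t \<Longrightarrow> integrable P (\<lambda>\<omega>. (X t \<omega> - X s \<omega>) ^ 4)"
      "\<And>s t. 0 \<le> s \<Longrightarrow> s < t \<Longrightarrow> E (\<lambda>\<omega>. (X t \<omega> - X s \<omega>) ^ 4) \<le> C4 * (t - s)\<^sup>2"
    and q_bounds: "\<And>s t. 0 \<le> s \<Longrightarrow> s < t \<Longrightarrow> q s t \<in> borel_measurable P"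
      "\<And>s t. 0 \<le> s \<Longrightarrow> s < t \<Longrightarrow> AE \<omega> in M. 0 \<le> q s t \<omega> \<and> q s t \<omega> \<le> CQ * (t - s)"
    and X_moments: "\<And>s t Z K. 0 \<le> s \<Longrightarrow> s < t \<Longrightarrow> Z \<in> borel_measurable (G s) \<Longrightarrow>
        (\<And>\<omega>. \<omega> \<in> space M \<Longrightarrow> \<bar>Z \<omega>\<bar> \<le> K) \<Longrightarrow>
        E (\<lambda>\<omega>. Z \<omega> * (X t \<omega> - X s \<omega>)) = 0 \<and>
        E (\<lambda>\<omega>. Z \<omega> * (X t \<omega> - X s \<omega>)\<^sup>2) = E (\<lambda>\<omega>. Z \<omega> * q s t \<omega>)"
    and V: "AE \<omega> in M. continuous_on {0..\<tau>} (\<lambda>t. V t \<omega>) \<and> V \<tau> \<omega> - V 0 \<omega> \<le> CV \<and>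
        (\<forall>s t. 0 \<le> s \<and> s \<le> t \<and> t \<le> \<tau> \<longrightarrow> \<bar>\<Gamma> t \<omega> - \<Gamma> s \<omega>\<bar> \<le> V t \<omega> - V s \<omega>)"
    and alive: "AE \<omega> in M. \<forall>t\<in>{0..\<tau>}. \<omega> \<in> A t \<longrightarrow> Y0 \<omega> + X t \<omega> + \<Gamma> t \<omega> \<le> \<kappa>"
      "AE \<omega> in M. \<omega> \<in> A 0 \<longrightarrow> y0 \<le> Y0 \<omega> + X 0 \<omega> + \<Gamma> 0 \<omega>"
    and drift: "AE \<omega> in M. \<forall>\<epsilon>>0. \<exists>h>0. \<forall>s t. 0 \<le> s \<and> s < t \<and> t \<le> \<tau> \<and> t - s < h \<and> \<omega> \<in> A s \<and>
        \<epsilon> \<le> Y0 \<omega> + X s \<omega> + \<Gamma> s \<omega> \<longrightarrow>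
        - (V t \<omega> - V s \<omega>) \<le> (\<Gamma> t \<omega> - \<Gamma> s \<omega>) / (Y0 \<omega> + X s \<omega> + \<Gamma> s \<omega>) -
           q s t \<omega> / (2 * (Y0 \<omega> + X s \<omega> + \<Gamma> s \<omega>)\<^sup>2)"
begin

definition Y where "Y t \<omega> = Y0 \<omega> + X t \<omega> + \<Gamma> t \<omega>"

definition grid :: "nat \<Rightarrow> nat \<Rightarrow> real" where "grid N j = \<tau> * real j / real N"

lemma grid: 
  "0 \<le> grid N j" "grid N 0 = 0" "N > 0 \<Longrightarrow> grid N j < grid N (Suc j)" "N > 0 \<Longrightarrow> grid N (Suc j) - grid N j = \<tau> / N"
  "j \<le> N \<Longrightarrow> grid N j \<le> \<tau>" "N > 0 \<Longrightarrow> grid N N = \<tau>" "i \<le> j \<Longrightarrow> grid N i \<le> grid N j"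
proof -
  show "0 \<le> grid N j" "grid N 0 = 0" "N > 0 \<Longrightarrow> grid N j < grid N (Suc j)"
    "N > 0 \<Longrightarrow> grid N (Suc j) - grid N j = \<tau> / N" "N > 0 \<Longrightarrow> grid N N = \<tau>"
    using pos(1) by (auto simp: grid_def field_simps)
  show "grid N j \<le> \<tau>" if "j \<le> N"
    using that pos(1) by (cases "N = 0") (auto simp: grid_def field_simps)
  show "grid N i \<le> grid N j" if "i \<le> j"
    unfolding grid_def using that pos(1) by (intro divide_right_mono mult_left_mono) auto
qed

lemma Y_G: "0 \<le> s \<Longrightarrow> s \<le> t \<Longrightarrow> Y s \<in> borel_measurable (G t)"
  unfolding Y_def[abs_def]
  using G_mono[OF adapted(1), of s t] G_mono[OF adapted(2), of s t] G_mono[OF adapted(3), of t] by simp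

definition running :: "real \<Rightarrow> nat \<Rightarrow> nat \<Rightarrow> 'a set" where
  "running \<epsilon> N j = {\<omega>\<in>space M. \<forall>l\<le>j. \<omega> \<in> A (grid N l) \<and> \<epsilon> \<le> Y (grid N l) \<omega>}"

lemma running_G: "running \<epsilon> N j \<in> sets (G (grid N j))"
proof -
  have "{\<omega>\<in>space (G (grid N j)). \<omega> \<in> A (grid N l) \<and> \<epsilon> \<le> Y (grid N l) \<omega>} \<in> sets (G (grid N j))" if "l \<le> j" for l
  proof -
    have [measurable]: "Y (grid N l) \<in> borel_measurable (G (grid N j))"
      using grid that by (intro Y_G) auto
    have [measurable]: "A (grid N l) \<in> sets (G (grid N j))"
      using adapted(4)[OF grid(1)] subalgebra_G[OF grid(7)[OF that]] by (auto simp: subalgebra_def)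
    show ?thesis by measurable
  qed
  then have "{\<omega>\<in>space (G (grid N j)). \<forall>l\<in>{..j}. \<omega> \<in> A (grid N l) \<and> \<epsilon> \<le> Y (grid N l) \<omega>} \<in> sets (G (grid N j))"
    by (intro sets.sets_Collect_finite_All) auto
  moreover have "running \<epsilon> N j = {\<omega>\<in>space (G (grid N j)). \<forall>l\<in>{..j}. \<omega> \<in> A (grid N l) \<and> \<epsilon> \<le> Y (grid N l) \<omega>}"
    by (auto simp: running_def)
  ultimately show ?thesis by (simp only:)
qed

lemma running_mono: "i \<le> j \<Longrightarrow> \<omega> \<in> running \<epsilon> N j \<Longrightarrow> \<omega> \<in> running \<epsilon> N i"
  by (auto simp: running_def)

definition hit :: "real \<Rightarrow> nat \<Rightarrow> 'a set" where
  "hit \<epsilon> N = {\<omega>\<in>space M. \<exists>j<N. \<omega> \<in> running \<epsilon> N j \<and> Y (grid N (Suc j)) \<omega> < \<epsilon>}"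

lemma hit_P: "hit \<epsilon> N \<in> sets P"
proof -
  have "{\<omega>\<in>space P. \<omega> \<in> running \<epsilon> N j \<and> Y (grid N (Suc j)) \<omega> < \<epsilon>} \<in> sets P" for j
  proof -
    have [measurable]: "running \<epsilon> N j \<in> sets P"
      by (rule G_sets_P[OF running_G])
    have [measurable]: "Y (grid N (Suc j)) \<in> borel_measurable P" by (rule G_P[OF Y_G[OF grid(1) order_refl]])
    show ?thesis by measurable
  qed
  then have "{\<omega>\<in>space P. \<exists>j\<in>{..<N}. \<omega> \<in> running \<epsilon> N j \<and> Y (grid N (Suc j)) \<omega> < \<epsilon>} \<in> sets P"
    by (intro sets.sets_Collect_finite_Ex) auto
  moreover have "hit \<epsilon> N = {\<omega>\<in>space P. \<exists>j\<in>{..<N}. \<omega> \<in> running \<epsilon> N j \<and> Y (grid N (Suc j)) \<omega> < \<epsilon>}"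
    by (auto simp: hit_def)
  ultimately show ?thesis by (simp only:)
qed

text \<open>Main estimate: the constant on the right does not depend on \<open>\<epsilon>\<close>.\<close>

lemma V_mono: "AE \<omega> in M. \<forall>s t. 0 \<le> s \<and> s \<le> t \<and> t \<le> \<tau> \<longrightarrow> 0 \<le> V t \<omega> - V s \<omega>"
  using V
proof eventually_elim
  case (elim \<omega>)
  then show ?case by (meson abs_ge_zero order_trans)
qed

lemma sum_increments_V:
  assumes "N > 0"
  shows "(\<Sum>j<N. V (grid N (Suc j)) \<omega> - V (grid N j) \<omega>) = V \<tau> \<omega> - V 0 \<omega>"
  using sum_lessThan_telescope[of "\<lambda>j. V (grid N j) \<omega>" N] assms by (simp add: grid)

text \<open>A continuous process of finite variation has vanishing quadratic variation: each squared
  increment is at most the largest increment of \<open>V\<close> times its own. The second part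
  supplies the dominating constant for taking expectations.\<close>

lemma quadratic_increments_\<Gamma>:
  "AE \<omega> in M. (\<lambda>N. \<Sum>j<N. (\<Gamma> (grid N (Suc j)) \<omega> - \<Gamma> (grid N j) \<omega>)\<^sup>2) \<longlonglongrightarrow> 0"
  "AE \<omega> in M. \<forall>N. (\<Sum>j<N. (\<Gamma> (grid N (Suc j)) \<omega> - \<Gamma> (grid N j) \<omega>)\<^sup>2) \<le> CV\<^sup>2"
proof -
  have main: "AE \<omega> in M. \<forall>e>0. \<exists>h>0. \<forall>N>0. \<tau> / real N < h \<longrightarrow>
     (\<Sum>j<N. (\<Gamma> (grid N (Suc j)) \<omega> - \<Gamma> (grid N j) \<omega>)\<^sup>2) \<le> e * CV"
    using V V_mono
  proof eventually_elim
    case (elim \<omega>)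
    show ?case
    proof (intro allI impI)
      fix e :: real assume e: "e > 0"
      have "uniformly_continuous_on {0..\<tau>} (\<lambda>t. V t \<omega>)"
        using elim(1) by (intro compact_uniformly_continuous) auto
      then obtain h where h: "h > 0" "\<And>s t. s \<in> {0..\<tau>} \<Longrightarrow> t \<in> {0..\<tau>} \<Longrightarrow> dist s t < h \<Longrightarrow> dist (V s \<omega>) (V t \<omega>) < e"
        using e unfolding uniformly_continuous_on_def by metis
      show "\<exists>h>0. \<forall>N>0. \<tau> / real N < h \<longrightarrow>
        (\<Sum>j<N. (\<Gamma> (grid N (Suc j)) \<omega> - \<Gamma> (grid N j) \<omega>)\<^sup>2) \<le> e * CV"
      proof (intro exI[of _ h] conjI h(1) allI impI)
        fix N :: nat assume N: "N > 0" "\<tau> / real N < h"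
        have "(\<Sum>j<N. (\<Gamma> (grid N (Suc j)) \<omega> - \<Gamma> (grid N j) \<omega>)\<^sup>2) \<le> (\<Sum>j<N. e * (V (grid N (Suc j)) \<omega> - V (grid N j) \<omega>))"
        proof (rule sum_mono)
          fix j assume j: "j \<in> {..<N}"
          have g: "0 \<le> grid N j" "grid N j \<le> grid N (Suc j)" "grid N (Suc j) \<le> \<tau>" "grid N j \<le> \<tau>"
            using grid(1) grid(3)[OF N(1), of j] grid(5)[of "Suc j" N] grid(5)[of j N] j by (auto simp: less_imp_le)
          have "dist (V (grid N j) \<omega>) (V (grid N (Suc j)) \<omega>) < e"
            using g grid(1)[of N "Suc j"] grid(4)[OF N(1), of j] N(2) by (intro h(2)) (auto simp: dist_real_def)
          then have d: "V (grid N (Suc j)) \<omega> - V (grid N j) \<omega> \<le> e" by (auto simp: dist_real_def)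
          have a: "\<bar>\<Gamma> (grid N (Suc j)) \<omega> - \<Gamma> (grid N j) \<omega>\<bar> \<le> V (grid N (Suc j)) \<omega> - V (grid N j) \<omega>"
            using elim(1) g by blast
          have "(\<Gamma> (grid N (Suc j)) \<omega> - \<Gamma> (grid N j) \<omega>)\<^sup>2 = \<bar>\<Gamma> (grid N (Suc j)) \<omega> - \<Gamma> (grid N j) \<omega>\<bar> * \<bar>\<Gamma> (grid N (Suc j)) \<omega> - \<Gamma> (grid N j) \<omega>\<bar>"
            by (simp add: power2_eq_square)
          also have "\<dots> \<le> e * (V (grid N (Suc j)) \<omega> - V (grid N j) \<omega>)"
            using a d by (intro mult_mono) auto
          finally show "(\<Gamma> (grid N (Suc j)) \<omega> - \<Gamma> (grid N j) \<omega>)\<^sup>2 \<le> e * (V (grid N (Suc j)) \<omega> - V (grid N j) \<omega>)" .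
        qed
        also have "\<dots> = e * (V \<tau> \<omega> - V 0 \<omega>)"
          by (simp add: sum_distrib_left[symmetric] sum_increments_V[OF N(1)])
        also have "\<dots> \<le> e * CV" using elim(1) e by (intro mult_left_mono) auto
        finally show "(\<Sum>j<N. (\<Gamma> (grid N (Suc j)) \<omega> - \<Gamma> (grid N j) \<omega>)\<^sup>2) \<le> e * CV" .
      qed
    qed
  qed
  show "AE \<omega> in M. (\<lambda>N. \<Sum>j<N. (\<Gamma> (grid N (Suc j)) \<omega> - \<Gamma> (grid N j) \<omega>)\<^sup>2) \<longlonglongrightarrow> 0"
    using main
  proof eventually_elim
    case (elim \<omega>)
    show ?case
    proof (rule LIMSEQ_I)
      fix r :: real assume r: "r > 0"
      then have "r / (CV + 1) > 0" using pos by simp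
      then obtain h where h: "h > 0" "\<And>N. N > 0 \<Longrightarrow> \<tau> / real N < h \<Longrightarrow>
        (\<Sum>j<N. (\<Gamma> (grid N (Suc j)) \<omega> - \<Gamma> (grid N j) \<omega>)\<^sup>2) \<le> r / (CV + 1) * CV" using elim by blast
      obtain N0 :: nat where N0: "\<tau> / h < real N0" using reals_Archimedean2 by blast
      have "norm ((\<Sum>j<N. (\<Gamma> (grid N (Suc j)) \<omega> - \<Gamma> (grid N j) \<omega>)\<^sup>2) - 0) < r" if "N \<ge> N0" for N
      proof -
        have "\<tau> / h < real N" using N0 that by simp
        moreover have "0 < \<tau> / h" using pos h by simp
        ultimately have "0 < real N" by linarith
        then have N: "N > 0" "\<tau> / real N < h" using h(1) \<open>\<tau> / h < real N\<close>
          by (auto simp: pos_divide_less_eq mult.commute)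
        have "r / (CV + 1) * CV < r" using r pos by (simp add: field_simps)
        then show ?thesis using h(2)[OF N] by (simp add: sum_nonneg)
      qed
      then show "\<exists>no. \<forall>N\<ge>no. norm ((\<Sum>j<N. (\<Gamma> (grid N (Suc j)) \<omega> - \<Gamma> (grid N j) \<omega>)\<^sup>2) - 0) < r" by blast
    qed
  qed
  show "AE \<omega> in M. \<forall>N. (\<Sum>j<N. (\<Gamma> (grid N (Suc j)) \<omega> - \<Gamma> (grid N j) \<omega>)\<^sup>2) \<le> CV\<^sup>2"
    using V V_mono
  proof eventually_elim
    case (elim \<omega>)
    show ?case
    proof
      fix N :: nat
      show "(\<Sum>j<N. (\<Gamma> (grid N (Suc j)) \<omega> - \<Gamma> (grid N j) \<omega>)\<^sup>2) \<le> CV\<^sup>2"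
      proof (cases "N > 0")
        case True
        have "(\<Sum>j<N. (\<Gamma> (grid N (Suc j)) \<omega> - \<Gamma> (grid N j) \<omega>)\<^sup>2) \<le> (\<Sum>j<N. CV * (V (grid N (Suc j)) \<omega> - V (grid N j) \<omega>))"
        proof (rule sum_mono)
          fix j assume j: "j \<in> {..<N}"
          have g: "0 \<le> grid N j" "grid N j \<le> grid N (Suc j)" "grid N (Suc j) \<le> \<tau>" "grid N j \<le> \<tau>"
            using grid(1) grid(3)[OF True, of j] grid(5)[of "Suc j" N] grid(5)[of j N] j by (auto simp: less_imp_le)
          have "0 \<le> V (grid N j) \<omega> - V 0 \<omega>" "0 \<le> V \<tau> \<omega> - V (grid N (Suc j)) \<omega>"
            using elim(2) g grid(1)[of N "Suc j"] by auto
          then have d: "V (grid N (Suc j)) \<omega> - V (grid N j) \<omega> \<le> CV" using elim(1) by linarith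
          have a: "\<bar>\<Gamma> (grid N (Suc j)) \<omega> - \<Gamma> (grid N j) \<omega>\<bar> \<le> V (grid N (Suc j)) \<omega> - V (grid N j) \<omega>"
            using elim(1) g by blast
          have "(\<Gamma> (grid N (Suc j)) \<omega> - \<Gamma> (grid N j) \<omega>)\<^sup>2 = \<bar>\<Gamma> (grid N (Suc j)) \<omega> - \<Gamma> (grid N j) \<omega>\<bar> * \<bar>\<Gamma> (grid N (Suc j)) \<omega> - \<Gamma> (grid N j) \<omega>\<bar>"
            by (simp add: power2_eq_square)
          also have "\<dots> \<le> CV * (V (grid N (Suc j)) \<omega> - V (grid N j) \<omega>)"
            using a d by (intro mult_mono) auto
          finally show "(\<Gamma> (grid N (Suc j)) \<omega> - \<Gamma> (grid N j) \<omega>)\<^sup>2 \<le> CV * (V (grid N (Suc j)) \<omega> - V (grid N j) \<omega>)" .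
        qed
        also have "\<dots> = CV * (V \<tau> \<omega> - V 0 \<omega>)"
          by (simp add: sum_distrib_left[symmetric] sum_increments_V[OF True])
        also have "\<dots> \<le> CV * CV" using elim(1) pos by (intro mult_left_mono) auto
        finally show ?thesis by (simp add: power2_eq_square)
      qed simp
    qed
  qed
qed

end

text \<open>Here \<open>x\<close> is a martingale increment and \<open>g\<close> one of finite
  variation. By Young's inequality, mixed and cubic terms reduce to three quantities that are
  harmless after summing over the grid: a small multiple of \<open>x\<^sup>2\<close>, a fourth
  power, and \<open>g\<^sup>2\<close>.\<close>

lemma taylor_remainder_le:
  fixes x g :: real
  assumes c: "c \<ge> 0" "K \<ge> 0" and d: "d > 0" and g: "\<bar>g\<bar> \<le> C"
  shows "c / 2 * (2 * (\<bar>x\<bar> * \<bar>g\<bar>) + g\<^sup>2) + K * \<bar>x + g\<bar> ^ 3 \<le>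
    (c + 4 * K) * (2 * d * x\<^sup>2 + x ^ 4 / d + (1 / d + 1 + C) * g\<^sup>2)"
proof -
  have yo: "u * v \<le> d * u\<^sup>2 + v\<^sup>2 / d" for u v :: real
  proof -
    have "a * v \<le> a\<^sup>2 + v\<^sup>2" for a :: real
    proof -
      have "2 * (a * v) \<le> a\<^sup>2 + v\<^sup>2" using zero_le_power2[of "a - v"] by (simp add: power2_diff)
      moreover have "0 \<le> a\<^sup>2 + v\<^sup>2" by simp
      ultimately show ?thesis by linarith
    qed
    from this[of "d * u"] have "d * (u * v) \<le> d * (d * u\<^sup>2 + v\<^sup>2 / d)" using d
      by (simp add: distrib_left power2_eq_square mult_ac)
    then show ?thesis using d by simp
  qed
  let ?S = "2 * d * x\<^sup>2 + x ^ 4 / d + (1 / d + 1 + C) * g\<^sup>2"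
  have C0: "C \<ge> 0" using g by linarith
  have n: "0 \<le> d * x\<^sup>2" "0 \<le> x ^ 4 / d" "0 \<le> g\<^sup>2 / d" "0 \<le> g\<^sup>2" "0 \<le> C * g\<^sup>2" using d C0 by auto
  have S: "?S = 2 * (d * x\<^sup>2) + x ^ 4 / d + g\<^sup>2 / d + g\<^sup>2 + C * g\<^sup>2" by (simp add: algebra_simps)
  have aux1: "1 / 2 * (2 * p + w) \<le> 2 * a + b + v + w + z"
    if "p \<le> a + v" "0 \<le> a" "0 \<le> b" "0 \<le> v" "0 \<le> w" "0 \<le> z" for p a b v w z :: real
    using that by simp
  have aux2: "p \<le> 4 * (2 * a + b + v + w + z)"
    if "p \<le> 4 * (r + s)" "r \<le> a + b" "s \<le> z" "0 \<le> a" "0 \<le> b" "0 \<le> v" "0 \<le> w" "0 \<le> z" for p a b v w z r s :: real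
    using that by simp
  have xg: "\<bar>x\<bar> * \<bar>g\<bar> \<le> d * x\<^sup>2 + g\<^sup>2 / d" using yo[of "\<bar>x\<bar>" "\<bar>g\<bar>"] by simp
  have "1/2 * (2 * (\<bar>x\<bar> * \<bar>g\<bar>) + g\<^sup>2) \<le> ?S" unfolding S by (rule aux1[OF xg n])
  then have 1: "c * (1/2 * (2 * (\<bar>x\<bar> * \<bar>g\<bar>) + g\<^sup>2)) \<le> c * ?S" using c by (intro mult_left_mono)
  have x3: "\<bar>x\<bar> ^ 3 \<le> d * x\<^sup>2 + x ^ 4 / d"
    using yo[of "\<bar>x\<bar>" "x\<^sup>2"] by (simp add: power3_eq_cube power2_eq_square power4_eq_xxxx)
  have "\<bar>g\<bar> ^ 3 = \<bar>g\<bar> * g\<^sup>2" by (simp add: power3_eq_cube power2_eq_square)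
  also have "\<dots> \<le> C * g\<^sup>2" using g by (intro mult_right_mono) auto
  finally have g3: "\<bar>g\<bar> ^ 3 \<le> C * g\<^sup>2" .
  have cube: "(u + v) ^ 3 \<le> 4 * (u ^ 3 + v ^ 3)" if "u \<ge> 0" "v \<ge> 0" for u v :: real
  proof -
    have "0 \<le> 3 * ((u + v) * (u - v)\<^sup>2)" using that by simp
    also have "\<dots> = 4 * (u ^ 3 + v ^ 3) - (u + v) ^ 3"
      by (simp add: power3_eq_cube power2_eq_square algebra_simps)
    finally show ?thesis by simp
  qed
  have "\<bar>x + g\<bar> ^ 3 \<le> (\<bar>x\<bar> + \<bar>g\<bar>) ^ 3" by (intro power_mono abs_triangle_ineq) auto
  also have "\<dots> \<le> 4 * (\<bar>x\<bar> ^ 3 + \<bar>g\<bar> ^ 3)" by (rule cube) auto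
  finally have xg3: "\<bar>x + g\<bar> ^ 3 \<le> 4 * (\<bar>x\<bar> ^ 3 + \<bar>g\<bar> ^ 3)" .
  have "\<bar>x + g\<bar> ^ 3 \<le> 4 * ?S" unfolding S by (rule aux2[OF xg3 x3 g3 n])
  then have 2: "K * \<bar>x + g\<bar> ^ 3 \<le> K * (4 * ?S)" using c by (intro mult_left_mono)
  have f: "c / 2 * p = c * (1/2 * p)" "(c + 4 * K) * p = c * p + K * (4 * p)" for p :: real
    by (simp_all add: algebra_simps)
  show ?thesis unfolding f by (rule add_mono[OF 1 2])
qed

context log_barrier
begin

text \<open>The expectation of the stopped sum of increments of
  \<open>clog \<epsilon> \<kappa> (Y t)\<close> is estimated in two ways. Telescoping gives the
  upper bound that involves \<open>hit\<close>. The Taylor bound gives a lower bound, in which the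
  martingale terms vanish, the drift costs at most \<open>CV\<close>, and the remainders cost at
  most 2 on a fine grid. Only the left side depends on \<epsilon>.\<close>

lemma hit_probability_bound:
  assumes e: "0 < \<epsilon>" "\<epsilon> \<le> y0"
  shows "\<forall>\<^sub>F N in sequentially. P.prob (hit \<epsilon> N) * ln (2 * \<kappa> / \<epsilon>) \<le> ln (2 * \<kappa> / y0) + CV + 2"
proof -
  have ek: "\<epsilon> \<le> \<kappa>" using e pos by simp
  define K where "K = (5 + 8 * ln (4 * \<kappa> / \<epsilon>)) / \<epsilon> ^ 3"
  note taylor = clog_taylor[OF e(1) ek, folded K_def]
  let ?f = "clog \<epsilon> \<kappa>"
  define T where "T = ln (2 * \<kappa>)"
  define L where "L = ln (\<epsilon> / 2)"
  note fb = clog_bounds[OF e(1) ek, folded T_def L_def]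
  define c0 where "c0 = 1 / \<epsilon>\<^sup>2 + 4 * K"
  have c0: "c0 > 0" using e taylor(1) by (auto simp: c0_def intro!: add_pos_nonneg)
  \<comment> \<open>The total expected quadratic variation of \<open>X\<close> is at most
    \<open>CQ * \<tau>\<close>, so this choice keeps the contribution of
    \<open>2 * d * x\<^sup>2\<close> below 1/2 for every grid.\<close>
  define d where "d = 1 / (4 * c0 * (CQ * \<tau> + 1))"
  have CQt: "0 \<le> CQ * \<tau>" using pos by simp
  have d: "d > 0" using c0 CQt by (auto simp: d_def)
  have dhalf: "c0 * (2 * d * (CQ * \<tau>)) \<le> 1/2"
  proof -
    have eq: "c0 * (2 * (1 / (4 * c0 * (m + 1))) * m) = (m / (m + 1)) / 2" if "0 \<le> m" for m
      using c0 that by auto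
    have "m / (m + 1) / 2 \<le> 1/2" if "0 \<le> m" for m :: real
      using divide_right_mono[of "m / (m + 1)" 1 2] that by simp
    from this[OF CQt] show ?thesis unfolding d_def eq[OF CQt] .
  qed
  define c3 where "c3 = 1 / d + 1 + CV"
  define ind where "ind N j \<omega> = (indicator (running \<epsilon> N j) \<omega> :: real)" for N j \<omega>
  define Z1 where "Z1 N j \<omega> = ind N j \<omega> / Y (grid N j) \<omega>" for N j \<omega>
  define Z2 where "Z2 N j \<omega> = ind N j \<omega> / (2 * (Y (grid N j) \<omega>)\<^sup>2)" for N j \<omega>
  define dX where "dX N j \<omega> = X (grid N (Suc j)) \<omega> - X (grid N j) \<omega>" for N j \<omega>
  define dG where "dG N j \<omega> = \<Gamma> (grid N (Suc j)) \<omega> - \<Gamma> (grid N j) \<omega>" for N j \<omega>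
  define dQ where "dQ N j = q (grid N j) (grid N (Suc j))" for N j
  \<comment> \<open>Discrete version of the integrated drift of log Y: the increment of \<Gamma>
    over Y minus the bracket increment over twice its square, while running.\<close>
  define W where "W N \<omega> = (\<Sum>j<N. Z1 N j \<omega> * dG N j \<omega> - Z2 N j \<omega> * dQ N j \<omega>)" for N \<omega>
  define R where "R N j \<omega> = c0 * (2 * d * (dX N j \<omega>)\<^sup>2 + dX N j \<omega> ^ 4 / d + c3 * (dG N j \<omega>)\<^sup>2)" for N j \<omega>
  define U where "U N \<omega> = (\<Sum>j<N. ind N j \<omega> * (?f (Y (grid N (Suc j)) \<omega>) - ?f (Y (grid N j) \<omega>)))" for N \<omega>
  have YG: "Y (grid N j) \<in> borel_measurable (G (grid N j))" for N j by (rule Y_G[OF grid(1) order_refl])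
  have indG: "ind N j \<in> borel_measurable (G (grid N j))" for N j
    unfolding ind_def[abs_def] by (rule borel_measurable_indicator[OF running_G])
  have Z1G: "Z1 N j \<in> borel_measurable (G (grid N j))" for N j
    unfolding Z1_def[abs_def] using YG indG by (intro borel_measurable_divide)
  have Z2G: "Z2 N j \<in> borel_measurable (G (grid N j))" for N j
    unfolding Z2_def[abs_def] using YG indG
    by (intro borel_measurable_divide borel_measurable_times borel_measurable_power borel_measurable_const)
  note [measurable] = G_P[OF YG] G_P[OF indG] G_P[OF Z1G] G_P[OF Z2G]
  have XP: "X (grid N j) \<in> borel_measurable P" "\<Gamma> (grid N j) \<in> borel_measurable P" for N j
    using G_P[OF adapted(1)[OF grid(1)]] G_P[OF adapted(2)[OF grid(1)]] by auto
  have [measurable]: "dX N j \<in> borel_measurable P" "dG N j \<in> borel_measurable P" for N j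
    unfolding dX_def[abs_def] dG_def[abs_def] using XP by (auto intro: borel_measurable_diff)
  have run: "\<epsilon> \<le> Y (grid N j) \<omega>" if "\<omega> \<in> running \<epsilon> N j" for N j \<omega> using that by (auto simp: running_def)
  have Z1b: "\<bar>Z1 N j \<omega>\<bar> \<le> 1 / \<epsilon>" for N j \<omega>
  proof (cases "\<omega> \<in> running \<epsilon> N j")
    case True
    then show ?thesis using run[OF True] e by (auto simp: Z1_def ind_def frac_le)
  qed (use e in \<open>simp add: Z1_def ind_def\<close>)
  have Z2b: "0 \<le> Z2 N j \<omega>" "\<bar>Z2 N j \<omega>\<bar> \<le> 1 / \<epsilon>\<^sup>2 / 2" for N j \<omega>
  proof -
    show "0 \<le> Z2 N j \<omega>" by (simp add: Z2_def ind_def)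
    show "\<bar>Z2 N j \<omega>\<bar> \<le> 1 / \<epsilon>\<^sup>2 / 2"
    proof (cases "\<omega> \<in> running \<epsilon> N j")
      case True
      have "\<epsilon>\<^sup>2 \<le> (Y (grid N j) \<omega>)\<^sup>2" using run[OF True] e by (intro power_mono) auto
      then have "1 / (2 * (Y (grid N j) \<omega>)\<^sup>2) \<le> 1 / (2 * \<epsilon>\<^sup>2)" using e by (intro frac_le) auto
      then show ?thesis using True by (simp add: Z2_def ind_def)
    qed (use e in \<open>simp add: Z2_def ind_def\<close>)
  qed
  have AEq: "AE \<omega> in M. \<forall>N j. 0 < N \<longrightarrow> 0 \<le> dQ N j \<omega> \<and> dQ N j \<omega> \<le> CQ * (\<tau> / N)"
  proof -
    have "AE \<omega> in M. 0 < N \<longrightarrow> 0 \<le> dQ N j \<omega> \<and> dQ N j \<omega> \<le> CQ * (\<tau> / N)" for N j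
      using q_bounds(2)[OF grid(1)[of N j] grid(3)[of N j]] grid(4)[of N j] by (cases "0 < N") (auto simp: dQ_def)
    then show ?thesis by (simp add: AE_all_countable)
  qed
  have AEG: "AE \<omega> in M. \<forall>N j. j < N \<longrightarrow> \<bar>dG N j \<omega>\<bar> \<le> V (grid N (Suc j)) \<omega> - V (grid N j) \<omega> \<and> \<bar>dG N j \<omega>\<bar> \<le> CV"
    using V V_mono
  proof eventually_elim
    case (elim \<omega>)
    show ?case
    proof (intro allI impI)
      fix N j :: nat assume j: "j < N"
      have g: "0 \<le> grid N j" "grid N j \<le> grid N (Suc j)" "grid N (Suc j) \<le> \<tau>" "0 \<le> grid N (Suc j)" "grid N j \<le> \<tau>"
        using grid(1) grid(3)[of N j] grid(5)[of "Suc j" N] grid(5)[of j N] j by (auto simp: less_imp_le)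
      have "0 \<le> V (grid N j) \<omega> - V 0 \<omega>" "0 \<le> V \<tau> \<omega> - V (grid N (Suc j)) \<omega>" using elim(2) g by auto
      moreover have "\<bar>dG N j \<omega>\<bar> \<le> V (grid N (Suc j)) \<omega> - V (grid N j) \<omega>" using elim(1) g unfolding dG_def by blast
      ultimately show "\<bar>dG N j \<omega>\<bar> \<le> V (grid N (Suc j)) \<omega> - V (grid N j) \<omega> \<and> \<bar>dG N j \<omega>\<bar> \<le> CV"
        using elim(1) by linarith
    qed
  qed
  have dX4: "integrable P (\<lambda>\<omega>. dX N j \<omega> ^ 4)" "E (\<lambda>\<omega>. dX N j \<omega> ^ 4) \<le> C4 * (\<tau> / N)\<^sup>2" if "N > 0" for N j
    using X4[OF grid(1)[of N j] grid(3)[OF that, of j]] unfolding grid(4)[OF that] by (auto simp: dX_def)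
  have dX1: "integrable P (dX N j)" "integrable P (\<lambda>\<omega>. (dX N j \<omega>)\<^sup>2)" if "N > 0" for N j
  proof -
    have b: "\<bar>x\<bar> \<le> 1 + x ^ 4" "\<bar>x\<^sup>2\<bar> \<le> 1 + x ^ 4" for x :: real
    proof -
      have 1: "2 * \<bar>x\<bar> \<le> 1 + x\<^sup>2" using zero_le_power2[of "\<bar>x\<bar> - 1"] by (simp add: power2_diff)
      have 2: "2 * x\<^sup>2 \<le> 1 + x ^ 4" using zero_le_power2[of "x\<^sup>2 - 1"] by (simp add: power2_diff)
      have 3: "0 \<le> x ^ 4" "0 \<le> x\<^sup>2" "\<bar>x\<^sup>2\<bar> = x\<^sup>2" by auto
      show "\<bar>x\<bar> \<le> 1 + x ^ 4" using 1 2 3(1) by linarith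
      show "\<bar>x\<^sup>2\<bar> \<le> 1 + x ^ 4" using 2 3 by linarith
    qed
    have i1: "integrable P (\<lambda>\<omega>. 1 + dX N j \<omega> ^ 4)" using dX4(1)[OF that] by simp
    show "integrable P (dX N j)"
      by (rule Bochner_Integration.integrable_bound[OF i1]) (use b(1) in \<open>auto intro!: AE_I2\<close>)
    show "integrable P (\<lambda>\<omega>. (dX N j \<omega>)\<^sup>2)"
      by (rule Bochner_Integration.integrable_bound[OF i1]) (use b(2) in \<open>auto intro!: AE_I2\<close>)
  qed
  have dQP [measurable]: "dQ N j \<in> borel_measurable P" if "N > 0" for N j
    unfolding dQ_def by (rule q_bounds(1)[OF grid(1) grid(3)[OF that]])
  have dQi: "integrable P (dQ N j)" if "N > 0" for N j
  proof (rule P.integrable_const_bound[of _ "CQ * (\<tau> / N)"])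
    show "AE \<omega> in P. norm (dQ N j \<omega>) \<le> CQ * (\<tau> / N)"
      using AE_completion[OF AEq] by eventually_elim (use that in auto)
  qed (rule dQP[OF that])
  have dGi: "integrable P (dG N j)" "integrable P (\<lambda>\<omega>. (dG N j \<omega>)\<^sup>2)" if "j < N" for N j
  proof -
    have b: "AE \<omega> in P. \<bar>dG N j \<omega>\<bar> \<le> CV" using AE_completion[OF AEG] by eventually_elim (use that in auto)
    show "integrable P (dG N j)"
      by (rule P.integrable_const_bound[of _ CV]) (use b in auto)
    show "integrable P (\<lambda>\<omega>. (dG N j \<omega>)\<^sup>2)"
    proof (rule P.integrable_const_bound[of _ "CV\<^sup>2"])
      show "AE \<omega> in P. norm ((dG N j \<omega>)\<^sup>2) \<le> CV\<^sup>2"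
        using b
      proof eventually_elim
        case (elim \<omega>)
        then show ?case using power_mono[of "\<bar>dG N j \<omega>\<bar>" CV 2] by simp
      qed
    qed measurable
  qed
  have mom: "E (\<lambda>\<omega>. Z1 N j \<omega> * dX N j \<omega>) = 0" "E (\<lambda>\<omega>. Z2 N j \<omega> * (dX N j \<omega>)\<^sup>2) = E (\<lambda>\<omega>. Z2 N j \<omega> * dQ N j \<omega>)"
    "E (\<lambda>\<omega>. (dX N j \<omega>)\<^sup>2) = E (dQ N j)" if "N > 0" for N j
    using X_moments[OF grid(1) grid(3)[OF that] Z1G Z1b] X_moments[OF grid(1) grid(3)[OF that] Z2G Z2b(2)]
      X_moments[OF grid(1) grid(3)[OF that], of "\<lambda>_. 1" j 1]
    by (auto simp: dX_def[abs_def] dQ_def)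
  have dX2le: "E (\<lambda>\<omega>. (dX N j \<omega>)\<^sup>2) \<le> CQ * (\<tau> / N)" if "N > 0" for N j
  proof -
    have "E (dQ N j) \<le> E (\<lambda>_. CQ * (\<tau> / N))"
      by (rule integral_mono_AE[OF dQi[OF that]]) (use AE_completion[OF AEq] that in \<open>auto elim: eventually_mono\<close>)
    then show ?thesis using mom(3)[OF that] by (simp add: prob_space)
  qed
  have i1: "integrable P (\<lambda>\<omega>. Z1 N j \<omega> * dX N j \<omega>)" "integrable P (\<lambda>\<omega>. Z2 N j \<omega> * (dX N j \<omega>)\<^sup>2)"
    "integrable P (\<lambda>\<omega>. Z2 N j \<omega> * dQ N j \<omega>)" "integrable P (\<lambda>\<omega>. Z1 N j \<omega> * dG N j \<omega>)" "integrable P (R N j)"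
    if "j < N" for N j
  proof -
    have N: "N > 0" using that by simp
    show "integrable P (\<lambda>\<omega>. Z1 N j \<omega> * dX N j \<omega>)" by (rule integrable_bounded_mult[OF dX1(1)[OF N] _ Z1b]) measurable
    show "integrable P (\<lambda>\<omega>. Z2 N j \<omega> * (dX N j \<omega>)\<^sup>2)" by (rule integrable_bounded_mult[OF dX1(2)[OF N] _ Z2b(2)]) measurable
    show "integrable P (\<lambda>\<omega>. Z2 N j \<omega> * dQ N j \<omega>)" by (rule integrable_bounded_mult[OF dQi[OF N] _ Z2b(2)]) measurable
    show "integrable P (\<lambda>\<omega>. Z1 N j \<omega> * dG N j \<omega>)" by (rule integrable_bounded_mult[OF dGi(1)[OF that] _ Z1b]) measurable
    show "integrable P (R N j)" unfolding R_def[abs_def]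
      using dX1(2)[OF N] dX4(1)[OF N] dGi(2)[OF that]
      by (intro integrable_mult_right Bochner_Integration.integrable_add integrable_divide) auto
  qed
  have Ui: "integrable P (\<lambda>\<omega>. ind N j \<omega> * (?f (Y (grid N (Suc j)) \<omega>) - ?f (Y (grid N j) \<omega>)))" for N j
  proof (rule P.integrable_const_bound[of _ "T - L"])
    show "AE \<omega> in P. norm (ind N j \<omega> * (?f (Y (grid N (Suc j)) \<omega>) - ?f (Y (grid N j) \<omega>))) \<le> T - L"
    proof (rule AE_I2)
      fix \<omega>
      have "\<bar>?f (Y (grid N (Suc j)) \<omega>) - ?f (Y (grid N j) \<omega>)\<bar> \<le> T - L"
        using fb(1,2)[of "Y (grid N (Suc j)) \<omega>"] fb(1,2)[of "Y (grid N j) \<omega>"] by linarith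
      moreover have "0 \<le> T - L" using fb(1,2)[of 0] by linarith
      ultimately show "norm (ind N j \<omega> * (?f (Y (grid N (Suc j)) \<omega>) - ?f (Y (grid N j) \<omega>))) \<le> T - L"
        by (cases "\<omega> \<in> running \<epsilon> N j") (simp_all add: ind_def)
    qed
  qed measurable
  have low: "AE \<omega> in M. \<forall>N j. j < N \<longrightarrow>
      Z1 N j \<omega> * dX N j \<omega> + (Z1 N j \<omega> * dG N j \<omega> - Z2 N j \<omega> * dQ N j \<omega>) -
        (Z2 N j \<omega> * (dX N j \<omega>)\<^sup>2 - Z2 N j \<omega> * dQ N j \<omega>) - R N j \<omega>
      \<le> ind N j \<omega> * (?f (Y (grid N (Suc j)) \<omega>) - ?f (Y (grid N j) \<omega>))"
    using AEG alive(1)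
  proof eventually_elim
    case (elim \<omega>)
    show ?case
    proof (intro allI impI)
      fix N j :: nat assume j: "j < N"
      let ?x = "dX N j \<omega>" and ?g = "dG N j \<omega>" and ?y = "Y (grid N j) \<omega>"
      have gC: "\<bar>?g\<bar> \<le> CV" using elim(1) j by blast
      note rem = taylor_remainder_le[OF _ taylor(1) d gC, of "1 / \<epsilon>\<^sup>2" ?x]
      have R0: "R N j \<omega> = (1 / \<epsilon>\<^sup>2 + 4 * K) * (2 * d * ?x\<^sup>2 + ?x ^ 4 / d + (1 / d + 1 + CV) * ?g\<^sup>2)"
        by (simp add: R_def c0_def c3_def)
      show "Z1 N j \<omega> * ?x + (Z1 N j \<omega> * ?g - Z2 N j \<omega> * dQ N j \<omega>) -
        (Z2 N j \<omega> * ?x\<^sup>2 - Z2 N j \<omega> * dQ N j \<omega>) - R N j \<omega>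
        \<le> ind N j \<omega> * (?f (Y (grid N (Suc j)) \<omega>) - ?f ?y)"
      proof (cases "\<omega> \<in> running \<epsilon> N j")
        case True
        have "\<omega> \<in> A (grid N j)" using True by (auto simp: running_def)
        then have yk: "?y \<le> \<kappa>" using elim(2) grid(1)[of N j] grid(5)[of j N] j by (auto simp: Y_def)
        have Ys: "Y (grid N (Suc j)) \<omega> = ?y + (?x + ?g)" by (simp add: Y_def dX_def dG_def)
        have i: "ind N j \<omega> = 1" using True by (simp add: ind_def)
        have t: "(?x + ?g) / ?y - (?x + ?g)\<^sup>2 / (2 * ?y\<^sup>2) - K * \<bar>?x + ?g\<bar> ^ 3 \<le> ?f (Y (grid N (Suc j)) \<omega>) - ?f ?y"
          unfolding Ys using taylor(2)[OF run[OF True] yk] .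
        have z1: "(?x + ?g) / ?y = Z1 N j \<omega> * ?x + Z1 N j \<omega> * ?g" by (simp add: Z1_def i add_divide_distrib)
        have z2: "(?x + ?g)\<^sup>2 / (2 * ?y\<^sup>2) = Z2 N j \<omega> * ?x\<^sup>2 + Z2 N j \<omega> * (2 * (?x * ?g) + ?g\<^sup>2)"
          by (simp add: Z2_def i power2_sum add_divide_distrib)
        have h2: "Z2 N j \<omega> * (2 * (?x * ?g) + ?g\<^sup>2) \<le> (1 / \<epsilon>\<^sup>2 / 2) * (2 * (\<bar>?x\<bar> * \<bar>?g\<bar>) + ?g\<^sup>2)"
        proof -
          have "Z2 N j \<omega> * (2 * (?x * ?g) + ?g\<^sup>2) \<le> Z2 N j \<omega> * (2 * (\<bar>?x\<bar> * \<bar>?g\<bar>) + ?g\<^sup>2)"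
            using Z2b(1)[of N j \<omega>] abs_ge_self[of "?x * ?g"] by (intro mult_left_mono) (auto simp: abs_mult)
          also have "\<dots> \<le> (1 / \<epsilon>\<^sup>2 / 2) * (2 * (\<bar>?x\<bar> * \<bar>?g\<bar>) + ?g\<^sup>2)"
            using Z2b[of N j \<omega>] by (intro mult_right_mono) auto
          finally show ?thesis .
        qed
        have r: "(1 / \<epsilon>\<^sup>2 / 2) * (2 * (\<bar>?x\<bar> * \<bar>?g\<bar>) + ?g\<^sup>2) + K * \<bar>?x + ?g\<bar> ^ 3 \<le> R N j \<omega>"
          unfolding R0 by (rule rem) simp
        have aux: "a + (b - w) - (u - w) - \<rho> \<le> 1 * f"
          if "v \<le> m" "m + k \<le> \<rho>" "(a + b) - (u + v) - k \<le> f" for a b w u v m k \<rho> f :: real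
          using that by simp
        show ?thesis unfolding i by (rule aux[OF h2 r t[unfolded z1 z2]])
      next
        case False
        then have i: "Z1 N j \<omega> = 0" "Z2 N j \<omega> = 0" "ind N j \<omega> = 0" by (auto simp: Z1_def Z2_def ind_def)
        have "0 \<le> R N j \<omega>" unfolding R_def using c0 d pos
          by (intro mult_nonneg_nonneg add_nonneg_nonneg divide_nonneg_pos) (auto simp: c3_def)
        then show ?thesis using i by simp
      qed
    qed
  qed
  \<comment> \<open>Two of the sums have zero expectation: the first order martingale term, and the
    difference between the squared martingale increment and the bracket. What is left is the drift
    \<open>W\<close> and the remainders.\<close>
  have lowE: "E (W N) - (\<Sum>j<N. E (R N j)) \<le> E (U N)" for N
  proof -
    let ?t = "\<lambda>j \<omega>. Z1 N j \<omega> * dX N j \<omega> + (Z1 N j \<omega> * dG N j \<omega> - Z2 N j \<omega> * dQ N j \<omega>) -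
        (Z2 N j \<omega> * (dX N j \<omega>)\<^sup>2 - Z2 N j \<omega> * dQ N j \<omega>) - R N j \<omega>"
    have ti: "integrable P (?t j)" if "j < N" for j
      using i1[OF that] by (intro Bochner_Integration.integrable_add Bochner_Integration.integrable_diff) auto
    have "E (W N) - (\<Sum>j<N. E (R N j)) = (\<Sum>j<N. E (\<lambda>\<omega>. Z1 N j \<omega> * dG N j \<omega> - Z2 N j \<omega> * dQ N j \<omega>)) - (\<Sum>j<N. E (R N j))"
      unfolding W_def[abs_def] using i1 by (subst Bochner_Integration.integral_sum) auto
    also have "\<dots> = (\<Sum>j<N. E (?t j))"
      unfolding sum_subtractf[symmetric]
    proof (intro sum.cong refl)
      fix j assume "j \<in> {..<N}"
      then have j: "j < N" "N > 0" by auto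
      show "E (\<lambda>\<omega>. Z1 N j \<omega> * dG N j \<omega> - Z2 N j \<omega> * dQ N j \<omega>) - E (R N j) = E (?t j)"
        using i1[OF j(1)] mom(1,2)[OF j(2), of j] by simp
    qed
    also have "\<dots> = E (\<lambda>\<omega>. \<Sum>j<N. ?t j \<omega>)"
      using ti by (subst Bochner_Integration.integral_sum) auto
    also have "\<dots> \<le> E (U N)"
    proof (rule integral_mono_AE)
      show "integrable P (\<lambda>\<omega>. \<Sum>j<N. ?t j \<omega>)" using ti by (intro Bochner_Integration.integrable_sum) auto
      show "integrable P (U N)" unfolding U_def[abs_def] using Ui by (intro Bochner_Integration.integrable_sum)
      show "AE \<omega> in P. (\<Sum>j<N. ?t j \<omega>) \<le> U N \<omega>"
        using AE_completion[OF low]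
      proof eventually_elim
        case (elim \<omega>)
        then show ?case unfolding U_def by (intro sum_mono) auto
      qed
    qed
    finally show ?thesis .
  qed
  have upE: "E (U N) \<le> (T - ln y0) - P.prob (hit \<epsilon> N) * (T - ln \<epsilon>)" for N
  proof -
    have hi: "integrable P (\<lambda>\<omega>. indicator (hit \<epsilon> N) \<omega> * (T - ln \<epsilon>))"
      using hit_P[of \<epsilon> N] P.emeasure_finite by (intro integrable_mult_left) (auto simp: less_top[symmetric])
    have "E (U N) \<le> E (\<lambda>\<omega>. (T - ln y0) - indicator (hit \<epsilon> N) \<omega> * (T - ln \<epsilon>))"
    proof (rule integral_mono_AE)
      show "integrable P (U N)" unfolding U_def[abs_def] using Ui by (intro Bochner_Integration.integrable_sum)
      show "integrable P (\<lambda>\<omega>. (T - ln y0) - indicator (hit \<epsilon> N) \<omega> * (T - ln \<epsilon>))"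
        using hi by (intro Bochner_Integration.integrable_diff) auto
      show "AE \<omega> in P. U N \<omega> \<le> (T - ln y0) - indicator (hit \<epsilon> N) \<omega> * (T - ln \<epsilon>)"
        using AE_completion[OF alive(1)] AE_completion[OF alive(2)] AE_space
      proof eventually_elim
        case (elim \<omega>)
        have "U N \<omega> = (\<Sum>j<N. if \<omega> \<in> running \<epsilon> N j then ?f (Y (grid N (Suc j)) \<omega>) - ?f (Y (grid N j) \<omega>) else 0)"
          unfolding U_def by (intro sum.cong) (auto simp: ind_def)
        also have "\<dots> \<le> (T - ln y0) -
          (if \<exists>j<N. \<omega> \<in> running \<epsilon> N j \<and> Y (grid N (Suc j)) \<omega> < \<epsilon> then T - ln \<epsilon> else 0)"
        proof (rule stopped_telescope_le)
          show "\<omega> \<in> running \<epsilon> N i" if "i \<le> j" "\<omega> \<in> running \<epsilon> N j" for i j using running_mono that by blast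
          show "?f (Y (grid N j) \<omega>) \<le> T" for j by (rule fb(2))
          show "ln y0 \<le> T" unfolding T_def using pos by simp
          show "?f (Y (grid N j) \<omega>) \<le> ln \<epsilon>" if "Y (grid N j) \<omega> < \<epsilon>" for j by (rule fb(3)[OF that])
          show "\<omega> \<notin> running \<epsilon> N j" if "Y (grid N j) \<omega> < \<epsilon>" for j using run that by fastforce
          show "ln y0 \<le> ?f (Y (grid N 0) \<omega>)" if r: "\<omega> \<in> running \<epsilon> N 0"
          proof -
            have "\<omega> \<in> A 0" using r by (auto simp: running_def grid)
            then have y: "y0 \<le> Y 0 \<omega>" "Y 0 \<omega> \<le> \<kappa>" using elim(1,2) pos by (auto simp: Y_def)
            then show ?thesis using fb(4)[of "Y 0 \<omega>"] e pos by (simp add: grid(2))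
          qed
        qed
        also have "(if \<exists>j<N. \<omega> \<in> running \<epsilon> N j \<and> Y (grid N (Suc j)) \<omega> < \<epsilon> then T - ln \<epsilon> else 0) =
           indicator (hit \<epsilon> N) \<omega> * (T - ln \<epsilon>)"
          using elim(3) by (auto simp: hit_def indicator_def)
        finally show ?case .
      qed
    qed
    also have "\<dots> = (T - ln y0) - P.prob (hit \<epsilon> N) * (T - ln \<epsilon>)"
    proof -
      have "E (\<lambda>\<omega>. indicator (hit \<epsilon> N) \<omega> * (T - ln \<epsilon>)) = P.prob (hit \<epsilon> N) * (T - ln \<epsilon>)"
        using hit_P[of \<epsilon> N] sets.sets_into_space[OF hit_P[of \<epsilon> N]] by (simp add: Int_absorb2)
      then show ?thesis using hi by (subst Bochner_Integration.integral_diff) (auto simp: prob_space)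
    qed
    finally show ?thesis .
  qed
  have gN: "(\<lambda>N. E (\<lambda>\<omega>. \<Sum>j<N. (dG N j \<omega>)\<^sup>2)) \<longlonglongrightarrow> E (\<lambda>\<omega>. 0)"
  proof (rule integral_dominated_convergence[where w="\<lambda>_. CV\<^sup>2"])
    show "AE \<omega> in P. (\<lambda>N. \<Sum>j<N. (dG N j \<omega>)\<^sup>2) \<longlonglongrightarrow> 0"
      unfolding dG_def by (rule AE_completion[OF quadratic_increments_\<Gamma>(1)])
    show "AE \<omega> in P. norm (\<Sum>j<N. (dG N j \<omega>)\<^sup>2) \<le> CV\<^sup>2" for N
      using AE_completion[OF quadratic_increments_\<Gamma>(2)]
      by eventually_elim (simp add: dG_def sum_nonneg)
  qed (auto simp del: integrable_const intro!: P.integrable_const)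
  have RN: "(\<Sum>j<N. E (R N j)) \<le> 1/2 + c0 * (C4 * \<tau>\<^sup>2 / d / N + c3 * E (\<lambda>\<omega>. \<Sum>j<N. (dG N j \<omega>)\<^sup>2))" if N: "N > 0" for N
  proof -
    have "(\<Sum>j<N. E (R N j)) = (\<Sum>j<N. c0 * (2 * d * E (\<lambda>\<omega>. (dX N j \<omega>)\<^sup>2) + E (\<lambda>\<omega>. dX N j \<omega> ^ 4) / d + c3 * E (\<lambda>\<omega>. (dG N j \<omega>)\<^sup>2)))"
      unfolding R_def[abs_def] using dX1(2)[OF N] dX4(1)[OF N] dGi(2) by (intro sum.cong refl) simp
    also have "\<dots> \<le> (\<Sum>j<N. c0 * (2 * d * (CQ * (\<tau> / N)) + C4 * (\<tau> / N)\<^sup>2 / d + c3 * E (\<lambda>\<omega>. (dG N j \<omega>)\<^sup>2)))"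
      using c0 d dX2le[OF N] dX4(2)[OF N]
      by (intro sum_mono mult_left_mono add_mono divide_right_mono order_refl) auto
    also have "\<dots> = c0 * (N * (2 * d * (CQ * (\<tau> / N))) + N * (C4 * (\<tau> / N)\<^sup>2 / d) + c3 * (\<Sum>j<N. E (\<lambda>\<omega>. (dG N j \<omega>)\<^sup>2)))"
      unfolding sum_distrib_left[symmetric] sum.distrib by simp
    finally have le: "(\<Sum>j<N. E (R N j)) \<le> c0 * (N * (2 * d * (CQ * (\<tau> / N))) + N * (C4 * (\<tau> / N)\<^sup>2 / d) +
      c3 * (\<Sum>j<N. E (\<lambda>\<omega>. (dG N j \<omega>)\<^sup>2)))" .
    have e1: "N * (2 * d * (CQ * (\<tau> / N))) = 2 * d * (CQ * \<tau>)" using N by simp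
    have e2: "N * (C4 * (\<tau> / N)\<^sup>2 / d) = C4 * \<tau>\<^sup>2 / d / N" using N by (simp add: power2_eq_square)
    have e3: "(\<Sum>j<N. E (\<lambda>\<omega>. (dG N j \<omega>)\<^sup>2)) = E (\<lambda>\<omega>. \<Sum>j<N. (dG N j \<omega>)\<^sup>2)"
      using dGi(2) by (subst Bochner_Integration.integral_sum) auto
    from le[unfolded e1 e2 e3]
    have "(\<Sum>j<N. E (R N j)) \<le> c0 * (2 * d * (CQ * \<tau>)) + c0 * (C4 * \<tau>\<^sup>2 / d / N + c3 * E (\<lambda>\<omega>. \<Sum>j<N. (dG N j \<omega>)\<^sup>2))"
      by (simp only: distrib_left add.assoc)
    then show ?thesis using dhalf by linarith
  qed
  have "(\<lambda>N. c0 * (C4 * \<tau>\<^sup>2 / d / real N + c3 * E (\<lambda>\<omega>. \<Sum>j<N. (dG N j \<omega>)\<^sup>2))) \<longlonglongrightarrow> c0 * (0 + c3 * 0)"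
    using gN by (intro tendsto_mult tendsto_add tendsto_const lim_const_over_n) simp
  then have evR: "\<forall>\<^sub>F N in sequentially. c0 * (C4 * \<tau>\<^sup>2 / d / real N + c3 * E (\<lambda>\<omega>. \<Sum>j<N. (dG N j \<omega>)\<^sup>2)) < 1/2"
    by (rule order_tendstoD(2)) simp
  \<comment> \<open>This constant grows as \<epsilon> decreases, but it serves only as a dominating
    bound while \<epsilon> is fixed.\<close>
  define Ce where "Ce = CV / \<epsilon> + CQ * \<tau> / \<epsilon>\<^sup>2"
  have Wb: "AE \<omega> in M. \<forall>N. \<bar>W N \<omega>\<bar> \<le> Ce"
    using AEG AEq V
  proof eventually_elim
    case (elim \<omega>)
    show ?case
    proof
      fix N :: nat
      show "\<bar>W N \<omega>\<bar> \<le> Ce"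
      proof (cases "N > 0")
        case N: True
        have "\<bar>W N \<omega>\<bar> \<le> (\<Sum>j<N. \<bar>Z1 N j \<omega> * dG N j \<omega> - Z2 N j \<omega> * dQ N j \<omega>\<bar>)" unfolding W_def by (rule sum_abs)
        also have "\<dots> \<le> (\<Sum>j<N. (1 / \<epsilon>) * (V (grid N (Suc j)) \<omega> - V (grid N j) \<omega>) + (1 / \<epsilon>\<^sup>2 / 2) * (CQ * (\<tau> / N)))"
        proof (rule sum_mono)
          fix j assume j: "j \<in> {..<N}"
          have "\<bar>Z1 N j \<omega> * dG N j \<omega>\<bar> \<le> (1 / \<epsilon>) * (V (grid N (Suc j)) \<omega> - V (grid N j) \<omega>)"
            unfolding abs_mult using Z1b elim(1) j e by (intro mult_mono) auto
          moreover have "\<bar>Z2 N j \<omega> * dQ N j \<omega>\<bar> \<le> (1 / \<epsilon>\<^sup>2 / 2) * (CQ * (\<tau> / N))"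
            unfolding abs_mult using Z2b(2) elim(2) N e by (intro mult_mono) auto
          ultimately show "\<bar>Z1 N j \<omega> * dG N j \<omega> - Z2 N j \<omega> * dQ N j \<omega>\<bar> \<le>
            (1 / \<epsilon>) * (V (grid N (Suc j)) \<omega> - V (grid N j) \<omega>) + (1 / \<epsilon>\<^sup>2 / 2) * (CQ * (\<tau> / N))" by linarith
        qed
        also have "\<dots> = (1 / \<epsilon>) * (V \<tau> \<omega> - V 0 \<omega>) + N * ((1 / \<epsilon>\<^sup>2 / 2) * (CQ * (\<tau> / N)))"
          unfolding sum.distrib sum_distrib_left[symmetric] sum_increments_V[OF N] by simp
        finally have "\<bar>W N \<omega>\<bar> \<le> (1 / \<epsilon>) * (V \<tau> \<omega> - V 0 \<omega>) + N * ((1 / \<epsilon>\<^sup>2 / 2) * (CQ * (\<tau> / N)))" .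
        moreover have "N * ((1 / \<epsilon>\<^sup>2 / 2) * (CQ * (\<tau> / N))) = CQ * \<tau> / \<epsilon>\<^sup>2 / 2" using N by simp
        moreover have "(1 / \<epsilon>) * (V \<tau> \<omega> - V 0 \<omega>) \<le> (1 / \<epsilon>) * CV" using elim(3) e by (intro mult_left_mono) auto
        moreover have "0 \<le> CQ * \<tau> / \<epsilon>\<^sup>2" using CQt by simp
        ultimately show ?thesis unfolding Ce_def by simp
      next
        case False
        then show ?thesis using pos e CQt by (simp add: W_def Ce_def)
      qed
    qed
  qed
  have WP: "W N \<in> borel_measurable P" for N
    unfolding W_def[abs_def] using i1(3,4) by (intro borel_measurable_sum borel_measurable_diff) (auto dest: borel_measurable_integrable)
  \<comment> \<open>The inequality for the drift holds only on grids finer than a path-dependent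
    \<open>h\<close>. So \<open>W N\<close> is at least \<open>- CV\<close> for all large
    \<open>N\<close> on almost every path, and the defect is removed by dominated
    convergence.\<close>
  have "(\<lambda>N. E (\<lambda>\<omega>. max 0 (- CV - W N \<omega>))) \<longlonglongrightarrow> E (\<lambda>\<omega>. 0)"
  proof (rule integral_dominated_convergence[where w="\<lambda>_. Ce"])
    show "AE \<omega> in P. norm (max 0 (- CV - W N \<omega>)) \<le> Ce" for N
      using AE_completion[OF Wb]
    proof eventually_elim
      case (elim \<omega>)
      then have "\<bar>W N \<omega>\<bar> \<le> Ce" by blast
      then show ?case using pos(6) by (auto simp: max_def)
    qed
    show "AE \<omega> in P. (\<lambda>N. max 0 (- CV - W N \<omega>)) \<longlonglongrightarrow> 0"
      using AE_completion[OF drift] AE_completion[OF V]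
    proof eventually_elim
      case (elim \<omega>)
      from elim(1)[folded Y_def, rule_format, OF e(1)]
      obtain h where h0: "h > 0" and h1: "\<forall>s t. 0 \<le> s \<and> s < t \<and> t \<le> \<tau> \<and> t - s < h \<and> \<omega> \<in> A s \<and> \<epsilon> \<le> Y s \<omega> \<longrightarrow>
        - (V t \<omega> - V s \<omega>) \<le> (\<Gamma> t \<omega> - \<Gamma> s \<omega>) / Y s \<omega> - q s t \<omega> / (2 * (Y s \<omega>)\<^sup>2)"
        by (elim exE conjE)
      have h: "h > 0" "\<And>s t. 0 \<le> s \<Longrightarrow> s < t \<Longrightarrow> t \<le> \<tau> \<Longrightarrow> t - s < h \<Longrightarrow> \<omega> \<in> A s \<Longrightarrow> \<epsilon> \<le> Y s \<omega> \<Longrightarrow>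
        - (V t \<omega> - V s \<omega>) \<le> (\<Gamma> t \<omega> - \<Gamma> s \<omega>) / Y s \<omega> - q s t \<omega> / (2 * (Y s \<omega>)\<^sup>2)"
        by (rule h0) (rule h1[rule_format], intro conjI)
      have Vm: "0 \<le> V t \<omega> - V s \<omega>" if "0 \<le> s" "s \<le> t" "t \<le> \<tau>" for s t
        using elim(2) that by (meson abs_ge_zero order_trans)
      obtain N0 :: nat where N0: "\<tau> / h < real N0" using reals_Archimedean2 by blast
      have "max 0 (- CV - W N \<omega>) = 0" if "N \<ge> N0" for N
      proof -
        have "\<tau> / h < real N" using N0 that by simp
        moreover have "0 < \<tau> / h" using pos h by simp
        ultimately have "0 < real N" by linarith
        then have N: "N > 0" "\<tau> / real N < h" using h(1) \<open>\<tau> / h < real N\<close>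
          by (auto simp: pos_divide_less_eq mult.commute)
        have "- (V \<tau> \<omega> - V 0 \<omega>) = (\<Sum>j<N. - (V (grid N (Suc j)) \<omega> - V (grid N j) \<omega>))"
          by (simp only: sum_negf sum_increments_V[OF N(1)])
        also have "\<dots> \<le> W N \<omega>"
          unfolding W_def
        proof (rule sum_mono)
          fix j assume j: "j \<in> {..<N}"
          have g: "0 \<le> grid N j" "grid N j < grid N (Suc j)" "grid N (Suc j) \<le> \<tau>" "grid N (Suc j) - grid N j < h"
            using grid(1) grid(3)[OF N(1), of j] grid(5)[of "Suc j" N] grid(4)[OF N(1), of j] j N by auto
          show "- (V (grid N (Suc j)) \<omega> - V (grid N j) \<omega>) \<le> Z1 N j \<omega> * dG N j \<omega> - Z2 N j \<omega> * dQ N j \<omega>"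
          proof (cases "\<omega> \<in> running \<epsilon> N j")
            case True
            then have "\<omega> \<in> A (grid N j)" "\<epsilon> \<le> Y (grid N j) \<omega>" by (auto simp: running_def)
            from h(2)[OF g this] show ?thesis
              using True by (simp add: Z1_def Z2_def ind_def dG_def dQ_def)
          next
            case False
            then show ?thesis using Vm[OF g(1) less_imp_le[OF g(2)] g(3)] by (simp add: Z1_def Z2_def ind_def)
          qed
        qed
        finally show ?thesis using elim(2) by simp
      qed
      then have "\<forall>\<^sub>F N in sequentially. max 0 (- CV - W N \<omega>) = 0" by (auto simp: eventually_sequentially)
      then show ?case by (rule tendsto_eventually)
    qed
  qed (use WP in \<open>auto intro!: borel_measurable_max borel_measurable_diff\<close>)
  then have evW: "\<forall>\<^sub>F N in sequentially. E (\<lambda>\<omega>. max 0 (- CV - W N \<omega>)) < 1"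
    by (intro order_tendstoD(2)[of _ "E (\<lambda>\<omega>. 0)"]) simp_all
  have Wlow: "- CV - E (\<lambda>\<omega>. max 0 (- CV - W N \<omega>)) \<le> E (W N)" for N
  proof -
    have Wi: "integrable P (W N)"
      by (rule P.integrable_const_bound[of _ Ce]) (use AE_completion[OF Wb] WP in \<open>auto elim: eventually_mono\<close>)
    have mi: "integrable P (\<lambda>\<omega>. max 0 (- CV - W N \<omega>))" using Wi by (intro integrable_max) auto
    have "- CV - E (\<lambda>\<omega>. max 0 (- CV - W N \<omega>)) = E (\<lambda>\<omega>. - CV - max 0 (- CV - W N \<omega>))"
      using mi by (subst Bochner_Integration.integral_diff) (auto simp: prob_space)
    also have "\<dots> \<le> E (W N)" using Wi mi by (intro integral_mono) auto
    finally show ?thesis .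
  qed
  show ?thesis
    using evR evW eventually_gt_at_top[of 0]
  proof eventually_elim
    case (elim N)
    have "P.prob (hit \<epsilon> N) * (T - ln \<epsilon>) \<le> (T - ln y0) + CV + 2"
      using lowE[of N] upE[of N] Wlow[of N] RN[OF elim(3)] elim(1,2) by linarith
    moreover have "T - ln \<epsilon> = ln (2 * \<kappa> / \<epsilon>)" "T - ln y0 = ln (2 * \<kappa> / y0)"
      using pos e unfolding T_def by (simp_all add: ln_divide_pos)
    ultimately show ?case by simp
  qed
qed

end

context log_barrier
begin

text \<open>The limit inferior over grids. It stands in for the continuous-time event of dropping
  below \<epsilon> and is measurable by construction.\<close>

definition always_hit :: "real \<Rightarrow> 'a set" where
  "always_hit \<epsilon> = (\<Union>m. \<Inter>N\<in>{m..}. hit \<epsilon> N)"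

lemma always_hit_P: "always_hit \<epsilon> \<in> sets P"
  unfolding always_hit_def by (intro sets.countable_UN sets.countable_INT) (use hit_P in auto)

lemma always_hit_probability:
  assumes e: "0 < \<epsilon>" "\<epsilon> \<le> y0"
  shows "P.prob (always_hit \<epsilon>) * ln (2 * \<kappa> / \<epsilon>) \<le> ln (2 * \<kappa> / y0) + CV + 2"
proof -
  have l: "0 \<le> ln (2 * \<kappa> / \<epsilon>)" using e pos by (simp add: field_simps)
  let ?I = "\<lambda>m. \<Inter>N\<in>{m..}. hit \<epsilon> N"
  have I: "?I m \<in> sets P" for m by (intro sets.countable_INT) (use hit_P in auto)
  have "incseq ?I" by (rule incseq_SucI) auto
  then have "(\<lambda>m. P.prob (?I m)) \<longlonglongrightarrow> P.prob (always_hit \<epsilon>)"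
    unfolding always_hit_def using I by (intro P.finite_Lim_measure_incseq) auto
  then have "(\<lambda>m. P.prob (?I m) * ln (2 * \<kappa> / \<epsilon>)) \<longlonglongrightarrow> P.prob (always_hit \<epsilon>) * ln (2 * \<kappa> / \<epsilon>)"
    by (intro tendsto_mult tendsto_const)
  moreover have "\<forall>\<^sub>F m in sequentially. P.prob (?I m) * ln (2 * \<kappa> / \<epsilon>) \<le> ln (2 * \<kappa> / y0) + CV + 2"
    using hit_probability_bound[OF e]
  proof eventually_elim
    case (elim m)
    have "P.prob (?I m) \<le> P.prob (hit \<epsilon> m)" using hit_P by (intro P.finite_measure_mono) auto
    then have "P.prob (?I m) * ln (2 * \<kappa> / \<epsilon>) \<le> P.prob (hit \<epsilon> m) * ln (2 * \<kappa> / \<epsilon>)"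
      using l by (intro mult_right_mono)
    then show ?case using elim by linarith
  qed
  ultimately show ?thesis by (rule tendsto_upperbound) simp
qed

text \<open>Once the mesh is smaller than \<open>t - s\<close>, some grid point falls into the
  interval where Y is below \<epsilon>. The first grid point below \<epsilon> is then reached while
  everything is still under control.\<close>

lemma always_hitI:
  assumes \<omega>: "\<omega> \<in> space M" and e: "0 < \<epsilon>" "\<epsilon> \<le> Y 0 \<omega>"
    and st: "0 \<le> s" "s < t" "t \<le> \<tau>" "\<And>u. u \<in> {0..t} \<Longrightarrow> \<omega> \<in> A u" "\<And>u. u \<in> {s..t} \<Longrightarrow> Y u \<omega> < \<epsilon>"
  shows "\<omega> \<in> always_hit \<epsilon>"
proof -
  obtain N0 :: nat where N0: "\<tau> / (t - s) < real N0" using reals_Archimedean2 by blast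
  have "\<omega> \<in> hit \<epsilon> N" if "N \<ge> N0" for N
  proof -
    have tN: "\<tau> / (t - s) < real N" using N0 that by simp
    moreover have "0 < \<tau> / (t - s)" using pos st by simp
    ultimately have "0 < real N" by linarith
    then have N: "N > 0" "\<tau> / real N < t - s" using tN st
      by (auto simp: pos_divide_less_eq mult.commute)
    \<comment> \<open>The first grid index at or after \<open>s\<close>; its point overshoots
      \<open>s\<close> by less than one mesh width.\<close>
    define j where "j = nat \<lceil>s * N / \<tau>\<rceil>"
    have sN: "0 \<le> s * N / \<tau>" using st pos by simp
    have j1: "s * N / \<tau> \<le> real j" "real j < s * N / \<tau> + 1"
      using sN by (auto simp: j_def) linarith
    have gj: "s \<le> grid N j" "grid N j < t"
    proof -
      have "\<tau> / N * (s * N / \<tau>) \<le> \<tau> / N * real j" using j1(1) pos by (intro mult_left_mono) auto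
      then show "s \<le> grid N j" using pos N by (simp add: grid_def)
      have "\<tau> / N * real j < \<tau> / N * (s * N / \<tau> + 1)" using j1(2) pos N by (intro mult_strict_left_mono) auto
      also have "\<dots> = s + \<tau> / N" using pos N by (simp add: distrib_left)
      finally show "grid N j < t" using N by (simp add: grid_def)
    qed
    have "grid N j < grid N N" using gj st by (simp add: grid(6)[OF N(1)])
    then have jN: "j < N" using grid(7)[of N j N] by (meson not_le)
    have low: "Y (grid N j) \<omega> < \<epsilon>" using st(5)[of "grid N j"] gj by simp
    define i where "i = (LEAST i. Y (grid N i) \<omega> < \<epsilon>)"
    have i: "Y (grid N i) \<omega> < \<epsilon>" unfolding i_def by (rule LeastI[of _ j]) (rule low)
    have ij: "i \<le> j" unfolding i_def by (rule Least_le) (rule low)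
    have i0: "i \<noteq> 0" using i e by (auto simp: grid(2) intro: ccontr)
    have before: "\<epsilon> \<le> Y (grid N l) \<omega>" if "l < i" for l
      using not_less_Least[of l "\<lambda>i. Y (grid N i) \<omega> < \<epsilon>"] that unfolding i_def by simp
    have "\<omega> \<in> running \<epsilon> N (i - 1)"
      unfolding running_def
    proof (safe intro!: \<omega>)
      fix l assume l: "l \<le> i - 1"
      have "grid N l \<le> grid N j" using l ij by (intro grid(7)) auto
      then show "\<omega> \<in> A (grid N l)" using gj grid(1) by (intro st(4)) auto
      show "\<epsilon> \<le> Y (grid N l) \<omega>" using before[of l] l i0 by simp
    qed
    then show ?thesis
      unfolding hit_def using i i0 ij jN \<omega> by (intro CollectI conjI exI[of _ "i - 1"]) auto
  qed
  then show ?thesis unfolding always_hit_def by blast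
qed

text \<open>With \<epsilon> = y0 exp (-r) the factor \<open>ln (2 * \<kappa> / \<epsilon>)\<close>
  is at least \<open>r\<close>, while the bound does not depend on \<open>r\<close>. The event of
  dropping below all these levels therefore has probability zero.\<close>

lemma no_hit:
  "AE \<omega> in M. \<not> (\<forall>\<epsilon>. 0 < \<epsilon> \<and> \<epsilon> \<le> y0 \<longrightarrow>
     (\<exists>s t. 0 \<le> s \<and> s < t \<and> t \<le> \<tau> \<and> (\<forall>u\<in>{0..t}. \<omega> \<in> A u) \<and> (\<forall>u\<in>{s..t}. Y u \<omega> < \<epsilon>)))"
proof -
  define e where "e r = y0 * exp (- real r)" for r :: nat
  have e: "0 < e r" "e r \<le> y0" for r using pos by (auto simp: e_def)
  define c where "c = ln (2 * \<kappa> / y0) + CV + 2"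
  let ?C = "\<Inter>r. always_hit (e r)"
  have C: "?C \<in> sets P" by (intro sets.countable_INT) (use always_hit_P in auto)
  have "P.prob ?C * real r \<le> c" for r
  proof -
    have "ln (2 * \<kappa> / e r) = ln (2 * \<kappa> / y0) + real r"
      using pos by (simp add: e_def ln_divide_pos ln_mult_pos)
    moreover have "0 \<le> ln (2 * \<kappa> / y0)" using pos by (simp add: field_simps)
    ultimately have "real r \<le> ln (2 * \<kappa> / e r)" by simp
    then have "P.prob ?C * real r \<le> P.prob (always_hit (e r)) * ln (2 * \<kappa> / e r)"
      using always_hit_P by (intro mult_mono P.finite_measure_mono) auto
    then show ?thesis using always_hit_probability[OF e, of r] by (simp add: c_def)
  qed
  then have "P.prob ?C \<le> 0"
    by (metis ex_less_of_nat_mult mult.commute not_le)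
  then have "P.prob ?C = 0" using measure_nonneg[of P ?C] by linarith
  then have "?C \<in> null_sets P" using C by (auto simp: null_sets_def P.emeasure_eq_measure simp del: emeasure_completion)
  then have "AE \<omega> in P. \<omega> \<notin> ?C" by (rule AE_not_in)
  then have "AE \<omega> in M. \<omega> \<notin> ?C" by (simp add: AE_completion_iff)
  then show ?thesis
    using alive(2) AE_space
  proof eventually_elim
    case (elim \<omega>)
    show ?case
    proof
      assume a: "\<forall>\<epsilon>. 0 < \<epsilon> \<and> \<epsilon> \<le> y0 \<longrightarrow>
     (\<exists>s t. 0 \<le> s \<and> s < t \<and> t \<le> \<tau> \<and> (\<forall>u\<in>{0..t}. \<omega> \<in> A u) \<and> (\<forall>u\<in>{s..t}. Y u \<omega> < \<epsilon>))"
      have "\<omega> \<in> always_hit (e r)" for r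
      proof -
        obtain s t where st: "0 \<le> s" "s < t" "t \<le> \<tau>" "\<forall>u\<in>{0..t}. \<omega> \<in> A u" "\<forall>u\<in>{s..t}. Y u \<omega> < e r"
          using a e[of r] by meson
        have "\<omega> \<in> A 0" using st by auto
        then have "y0 \<le> Y 0 \<omega>" using elim(2) by (simp add: Y_def)
        then show ?thesis using st e[of r] elim(3) by (intro always_hitI[of \<omega> "e r" s t]) auto
      qed
      then show False using elim(1) by blast
    qed
  qed
qed

end

section \<open>Riemann sums and adaptedness of time integrals\<close>

lemma step_function_value:
  fixes a x :: "nat \<Rightarrow> real"
  assumes mo: "mono_on {..m} a" and j: "j < m" "u \<in> {a j<..a (Suc j)}"
  shows "(\<Sum>l<m. x l * indicator {a l<..a (Suc l)} u) = x j"
proof -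
  have o: "indicator {a l<..a (Suc l)} u = (0::real)" if "l < m" "l \<noteq> j" for l
  proof (cases "l < j")
    case True
    then have "a (Suc l) \<le> a j" using mo j that by (auto simp: mono_on_def)
    then show ?thesis using j by auto
  next
    case False
    then have "a (Suc j) \<le> a l" using mo j that by (auto simp: mono_on_def)
    then show ?thesis using j by auto
  qed
  have "(\<Sum>l<m. x l * indicator {a l<..a (Suc l)} u) = (\<Sum>l<m. if l = j then x j else 0)"
    using o j by (intro sum.cong) auto
  then show ?thesis using j by simp
qed

text \<open>Riemann sums with left endpoints use only values from the past, so they transfer
  adaptedness to the integral. One discontinuity is allowed because integrands cut off at
  \<open>T\<close> may jump there.\<close>

lemma riemann_sum_tendsto:
  fixes f :: "real \<Rightarrow> real"
  assumes t: "0 < t" and b: "\<And>s. s \<in> {0..t} \<Longrightarrow> \<bar>f s\<bar> \<le> C"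
    and cont: "\<And>s. s \<in> {0..t} \<Longrightarrow> s \<noteq> c \<Longrightarrow> continuous (at s within {0..t}) f"
  shows "(\<lambda>N. \<Sum>j<N. f (t * real j / real N) * (t / real N)) \<longlonglongrightarrow> (LINT s:{0..t}|lborel. f s)"
    and "set_integrable lborel {0..t} f"
proof -
  let ?a = "\<lambda>N j. t * real j / real N"
  let ?s = "\<lambda>N u. \<Sum>j<N. f (?a N j) * indicator {?a N j<..?a N (Suc j)} u"
  have mo: "mono_on {..N} (?a N)" for N using t by (auto simp: mono_on_def intro!: divide_right_mono)
  have I: "has_bochner_integral lborel (?s N) (\<Sum>j<N. f (?a N j) * (t / real N))" for N
  proof -
    have "?a N (Suc j) - ?a N j = t / N" for j by (simp add: distrib_left add_divide_distrib)
    then show ?thesis using step_function_integral[OF mo, of "\<lambda>j. f (?a N j)" N] by simp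
  qed
  have val: "\<exists>j<N. u \<in> {?a N j<..?a N (Suc j)}" if N: "N > 0" and u: "u \<in> {0<..t}" for N u
  proof -
    define j where "j = nat (\<lceil>u * N / t\<rceil> - 1)"
    have p: "0 < u * N / t" using u N t by simp
    then have "0 < \<lceil>u * N / t\<rceil>" by simp
    then have j: "real j < u * N / t" "u * N / t \<le> real (Suc j)"
      unfolding j_def by linarith+
    have "u * N / t \<le> N" using u t N by (simp add: field_simps)
    then have "real j < real N" using j(1) by linarith
    moreover have "?a N j < u" "u \<le> ?a N (Suc j)"
      using j t N by (auto simp: field_simps)
    ultimately show ?thesis by auto
  qed
  have bs: "\<bar>?s N u\<bar> \<le> C * indicator {0..t} u" for N u
  proof (cases "\<exists>j<N. u \<in> {?a N j<..?a N (Suc j)}")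
    case True
    then obtain j where j: "j < N" "u \<in> {?a N j<..?a N (Suc j)}" by auto
    have N: "N > 0" using j by simp
    have a0: "0 \<le> ?a N j" using t by simp
    have "t * real (Suc j) \<le> t * real N" using j(1) t by (intro mult_left_mono) auto
    then have aj: "?a N (Suc j) \<le> t" using N by (simp add: pos_divide_le_eq)
    have "u \<in> {0..t}" using j(2) a0 aj by auto
    moreover have "?a N j \<in> {0..t}" using j(2) a0 aj by auto
    ultimately show ?thesis using step_function_value[OF mo j, of "\<lambda>j. f (?a N j)"] b by simp
  next
    case False
    then have z: "?s N u = 0" by (intro sum.neutral) auto
    have "0 \<le> C" using b[of 0] t by (auto intro: order_trans[OF abs_ge_zero])
    then show ?thesis unfolding z by simp
  qed
  have lim: "(\<lambda>N. ?s N u) \<longlonglongrightarrow> indicator {0..t} u * f u" if u: "u \<noteq> 0" "u \<noteq> c" for u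
  proof (cases "u \<in> {0<..t}")
    case True
    show ?thesis
    proof (rule LIMSEQ_I)
      fix r :: real assume r: "r > 0"
      have "continuous (at u within {0..t}) f" using cont[of u] True u by auto
      then obtain d where d: "d > 0" "\<And>v. v \<in> {0..t} \<Longrightarrow> dist v u < d \<Longrightarrow> dist (f v) (f u) < r"
        using r unfolding continuous_within_eps_delta by blast
      obtain N0 :: nat where N0: "t / d < real N0" using reals_Archimedean2 by blast
      have "norm (?s N u - indicator {0..t} u * f u) < r" if "N \<ge> N0" for N
      proof -
        have tN: "t / d < real N" using N0 that by simp
        moreover have "0 < t / d" using t d by simp
        ultimately have "0 < real N" by linarith
        then have N: "N > 0" "t / real N < d" using tN d(1)
          by (auto simp: pos_divide_less_eq mult.commute)
        obtain j where j: "j < N" "u \<in> {?a N j<..?a N (Suc j)}" using val[OF N(1) True] by blast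
        have "?a N (Suc j) - ?a N j = t / N" by (simp add: distrib_left add_divide_distrib)
        then have "dist (?a N j) u < d" using j(2) N(2) by (auto simp: dist_real_def)
        moreover have "0 \<le> ?a N j" using t by simp
        then have "?a N j \<in> {0..t}" using j(2) True by auto
        ultimately have "dist (f (?a N j)) (f u) < r" by (intro d(2))
        then show ?thesis using step_function_value[OF mo j, of "\<lambda>j. f (?a N j)"] True by (simp add: dist_real_def)
      qed
      then show "\<exists>no. \<forall>N\<ge>no. norm (?s N u - indicator {0..t} u * f u) < r" by blast
    qed
  next
    case False
    then have "u \<notin> {0..t}" using u by auto
    moreover have "?s N u = 0" for N using bs[of N u] \<open>u \<notin> {0..t}\<close> by simp
    ultimately show ?thesis by simp
  qed
  have limAE: "AE u in lborel. (\<lambda>N. ?s N u) \<longlonglongrightarrow> indicator {0..t} u * f u"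
    using AE_lborel_singleton[of 0] AE_lborel_singleton[of c] by eventually_elim (rule lim)
  have sm: "?s N \<in> borel_measurable lborel" for N using I[of N] by (auto simp: has_bochner_integral_iff)
  have Ci: "integrable lborel (\<lambda>u. C * indicator {0..t} u)"
    using t by (intro integrable_mult_right) (simp add: integrable_indicator_iff)
  \<comment> \<open>Measurability of \<open>f\<close> is obtained here: away from the two points 0
    and \<open>c\<close> it is a pointwise limit of step functions.\<close>
  have "(\<lambda>u. if u = 0 \<or> u = c then indicator {0..t} u * f u else lim (\<lambda>N. ?s N u)) \<in> borel_measurable lborel"
  proof -
    have m: "(\<lambda>u. if u \<in> {0, c} then indicator {0..t} 0 * f 0 * (indicator {0} u) +
       indicator {0..t} c * f c * indicator {c} u * (indicator (-{0}) u) else lim (\<lambda>N. ?s N u)) \<in> borel_measurable lborel"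
      using sm by measurable
    have e: "(\<lambda>u. if u \<in> {0, c} then indicator {0..t} 0 * f 0 * (indicator {0} u) +
       indicator {0..t} c * f c * indicator {c} u * (indicator (-{0}) u) else lim (\<lambda>N. ?s N u)) =
       (\<lambda>u. if u = 0 \<or> u = c then indicator {0..t} u * f u else lim (\<lambda>N. ?s N u))"
      by (cases "c = 0") (auto simp: fun_eq_iff)
    show ?thesis using m unfolding e .
  qed
  moreover have e: "(\<lambda>u. if u = 0 \<or> u = c then indicator {0..t} u * f u else lim (\<lambda>N. ?s N u)) = (\<lambda>u. indicator {0..t} u * f u)"
    using lim by (auto simp: fun_eq_iff intro!: limI)
  ultimately have fm: "(\<lambda>u. indicator {0..t} u * f u) \<in> borel_measurable lborel" by (simp only: e)
  have bAE: "AE u in lborel. norm (?s N u) \<le> C * indicator {0..t} u" for N using bs by (intro AE_I2) simp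
  show "set_integrable lborel {0..t} f"
    unfolding set_integrable_def
    using integrable_dominated_convergence[OF fm sm Ci limAE bAE] by simp
  have "(\<lambda>N. integral\<^sup>L lborel (?s N)) \<longlonglongrightarrow> (LINT u|lborel. indicator {0..t} u * f u)"
    by (rule integral_dominated_convergence[OF fm sm Ci limAE bAE])
  moreover have "integral\<^sup>L lborel (?s N) = (\<Sum>j<N. f (t * real j / real N) * (t / real N))" for N
    using I[of N] by (simp add: has_bochner_integral_iff)
  ultimately show "(\<lambda>N. \<Sum>j<N. f (t * real j / real N) * (t / real N)) \<longlonglongrightarrow> (LINT s:{0..t}|lborel. f s)"
    by (simp add: set_lebesgue_integral_def)
qed

lemma (in brownian_setup) integral_adapted:
  fixes \<phi> :: "real \<Rightarrow> 'a \<Rightarrow> real"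
  assumes t: "0 < t" and G: "\<And>s. 0 \<le> s \<Longrightarrow> \<phi> s \<in> borel_measurable (G s)"
    and "AE \<omega> in M. (\<forall>s\<in>{0..t}. \<bar>\<phi> s \<omega>\<bar> \<le> C) \<and>
      (\<exists>c. \<forall>s\<in>{0..t}. s \<noteq> c \<longrightarrow> continuous (at s within {0..t}) (\<lambda>s. \<phi> s \<omega>))"
  shows "(\<lambda>\<omega>. LINT s:{0..t}|lborel. \<phi> s \<omega>) \<in> borel_measurable (G t)"
proof (rule augment_measurable_AE_lim[OF subalgebra_F])
  show "AE \<omega> in M. (\<lambda>N. \<Sum>j<N. \<phi> (t * real j / real N) \<omega> * (t / real N)) \<longlonglongrightarrow> (LINT s:{0..t}|lborel. \<phi> s \<omega>)"
    using assms(3)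
  proof eventually_elim
    case (elim \<omega>)
    then obtain c where "\<And>s. s \<in> {0..t} \<Longrightarrow> s \<noteq> c \<Longrightarrow> continuous (at s within {0..t}) (\<lambda>s. \<phi> s \<omega>)" by blast
    then show ?case using elim by (intro riemann_sum_tendsto(1)[OF t, of _ C c]) auto
  qed
  show "(\<lambda>\<omega>. \<Sum>j<N. \<phi> (t * real j / real N) \<omega> * (t / real N)) \<in> borel_measurable (G t)" for N
  proof (intro borel_measurable_sum borel_measurable_times borel_measurable_const)
    fix j assume j: "j \<in> {..<N}"
    have "t * real j \<le> t * real N" using j t by (intro mult_left_mono) auto
    then have "t * real j / real N \<le> t" using j by (simp add: pos_divide_le_eq)
    moreover have "0 \<le> t * real j / real N" using t by simp
    ultimately show "\<phi> (t * real j / real N) \<in> borel_measurable (G t)" using G_mono[OF G] by blast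
  qed
qed

lemma AE_lborel_interval_ex:
  fixes a b :: real
  assumes "AE s in lborel. Q s" "a < b"
  shows "\<exists>s\<in>{a<..<b}. Q s"
proof (rule ccontr)
  assume "\<not> ?thesis"
  then have "AE s in lborel. s \<notin> {a<..<b}" using assms(1) by (auto elim!: eventually_mono)
  then have "{a<..<b} \<in> null_sets lborel" by (subst (asm) AE_iff_null_sets[symmetric]) auto
  then show False using assms(2) by (simp add: null_sets_def)
qed

lemma set_integral_split:
  fixes f :: "real \<Rightarrow> real"
  assumes f: "set_integrable lborel {0..t} f" and s: "0 \<le> s" "s \<le> t"
  shows "(LINT u:{0..t}|lborel. f u) - (LINT u:{0..s}|lborel. f u) = (LINT u:{s..t}|lborel. f u)"
proof -
  have i: "set_integrable lborel {0..s} f" "set_integrable lborel {s..t} f"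
    using s by (auto intro!: set_integrable_subset[OF f])
  have h: "f integrable_on {0..t}" using set_borel_integral_eq_integral(1)[OF f] .
  show ?thesis
    using Henstock_Kurzweil_Integration.integral_combine[OF s h] set_borel_integral_eq_integral(2)[OF f]
      set_borel_integral_eq_integral(2)[OF i(1)] set_borel_integral_eq_integral(2)[OF i(2)] by simp
qed

lemma set_integral_continuous:
  fixes f :: "real \<Rightarrow> real"
  assumes f: "set_integrable lborel {0..t} f"
  shows "continuous_on {0..t} (\<lambda>s. LINT u:{0..s}|lborel. f u)"
proof -
  have h: "f integrable_on {0..t}" using set_borel_integral_eq_integral(1)[OF f] .
  have e: "(LINT u:{0..s}|lborel. f u) = integral {0..s} f" if "s \<in> {0..t}" for s
    using that by (intro set_borel_integral_eq_integral(2) set_integrable_subset[OF f]) auto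
  show ?thesis
    by (rule continuous_on_eq[OF indefinite_integral_continuous_1[OF h]]) (rule e[symmetric])
qed

lemma set_integral_const_Icc: "s \<le> t \<Longrightarrow> (LINT u:{s..t}|lborel. (c::real)) = c * (t - s)"
  by (simp add: set_lebesgue_integral_def measure_def)

lemma set_integrable_const_Icc: "set_integrable lborel {s..t::real} (\<lambda>_. c::real)"
proof -
  have "integrable lborel (indicator {s..t} :: real \<Rightarrow> real)"
    by (rule integrable_real_indicator) (auto simp: emeasure_lborel_Icc_eq)
  then show ?thesis unfolding set_integrable_def by simp
qed

lemma ennreal_less_dense:
  assumes "ennreal t < T" "0 \<le> t"
  shows "\<exists>t'>t. ennreal t' < T"
proof -
  obtain y where y: "ennreal t < y" "y < T" using dense[OF assms(1)] by blast
  obtain r where "y = ennreal r" "0 \<le> r" using y(2) by (cases y) auto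
  then show ?thesis using y assms by (auto simp: ennreal_less_iff)
qed

section \<open>Pathwise analysis of the Jacobi system\<close>

text \<open>One fixed trajectory. What does not involve expectations or measurability in \<omega> is
  proved here deterministically and later applied to almost every \<omega>; \<open>x\<close> is the
  path of the stochastic integrals.\<close>

locale jacobi_path =
  fixes n :: nat and p q \<beta> :: real and l x :: "nat \<Rightarrow> real \<Rightarrow> real" and T :: ennreal
  assumes pars: "0 < \<beta>" "0 \<le> p" "0 \<le> q"
    and l_cont: "\<And>i. i \<in> {1..n} \<Longrightarrow> continuous_on {t. 0 \<le> t \<and> ennreal t < T} (l i)"
    and strict_order: "AE t in lborel. 0 \<le> t \<and> ennreal t < T \<longrightarrow>
        0 \<le> l 1 t \<and> strict_mono_on {1..n} (\<lambda>i. l i t) \<and> l n t \<le> 1"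
    and drift_int: "\<And>i t. i \<in> {1..n} \<Longrightarrow> 0 \<le> t \<Longrightarrow> ennreal t < T \<Longrightarrow>
        set_integrable lborel {0..t} (\<lambda>s. jacobi_drift n p q \<beta> (\<lambda>j. l j s) i)"
    and x_cont: "\<And>i. i \<in> {1..n} \<Longrightarrow> continuous_on {0..} (x i)"
    and l_eq: "\<And>i t. i \<in> {1..n} \<Longrightarrow> 0 \<le> t \<Longrightarrow> ennreal t < T \<Longrightarrow>
        l i t = l i 0 + x i t + (LINT s:{0..t}|lborel. jacobi_drift n p q \<beta> (\<lambda>j. l j s) i)"
begin

abbreviation live :: "real \<Rightarrow> bool" where "live t \<equiv> 0 \<le> t \<and> ennreal t < T"

lemma live_le: "live t \<Longrightarrow> 0 \<le> s \<Longrightarrow> s \<le> t \<Longrightarrow> live s"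
  by (auto intro: le_less_trans[OF ennreal_leI])

text \<open>Strict order holds at almost every time, hence at times converging to \<open>t\<close>
  from the right and still below \<open>T\<close>; continuity turns it into weak order at
  \<open>t\<close>. Approaching from the right also covers \<open>t = 0\<close>.\<close>

lemma weak_order:
  assumes t: "live t" and i: "i \<in> {1..n}" "j \<in> {1..n}" "i \<le> j"
  shows "0 \<le> l i t" "l i t \<le> l j t" "l j t \<le> 1"
proof -
  obtain t' where t': "t < t'" "ennreal t' < T" using ennreal_less_dense t by blast
  have "\<exists>s\<in>{t<..<min t' (t + 1 / real (Suc N))}. live s \<longrightarrow> 0 \<le> l 1 s \<and> strict_mono_on {1..n} (\<lambda>i. l i s) \<and> l n s \<le> 1" for N
    using t' by (intro AE_lborel_interval_ex[OF strict_order]) auto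
  then obtain s where s: "\<And>N. t < s N" "\<And>N. s N < t'" "\<And>N. s N < t + 1 / real (Suc N)"
    "\<And>N. live (s N) \<longrightarrow> 0 \<le> l 1 (s N) \<and> strict_mono_on {1..n} (\<lambda>i. l i (s N)) \<and> l n (s N) \<le> 1"
    by (metis greaterThanLessThan_iff min_less_iff_conj)
  have ls: "live (s N)" for N
  proof -
    have "ennreal (s N) \<le> ennreal t'" using s(2)[of N] by (intro ennreal_leI) simp
    then have "ennreal (s N) < T" using t'(2) by (rule le_less_trans)
    moreover have "0 \<le> s N" using s(1)[of N] t by linarith
    ultimately show ?thesis by blast
  qed
  have st: "s \<longlonglongrightarrow> t"
  proof (rule tendsto_sandwich[OF _ _ tendsto_const])
    show "\<forall>\<^sub>F N in sequentially. t \<le> s N" using s(1) by (intro always_eventually) (auto intro: less_imp_le)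
    show "\<forall>\<^sub>F N in sequentially. s N \<le> t + 1 / real (Suc N)" using s(3) by (intro always_eventually) (auto intro: less_imp_le)
    show "(\<lambda>N. t + 1 / real (Suc N)) \<longlonglongrightarrow> t" using tendsto_add[OF tendsto_const LIMSEQ_Suc[OF lim_1_over_n]] by simp
  qed
  have lim: "(\<lambda>N. l i (s N)) \<longlonglongrightarrow> l i t" if "i \<in> {1..n}" for i
    by (rule continuous_on_tendsto_compose[OF l_cont[OF that] st]) (use t ls in auto)
  have ord: "l i (s N) \<le> l j (s N)" if "i \<in> {1..n}" "j \<in> {1..n}" "i \<le> j" for i j N
    using s(4)[of N] ls[of N] that by (cases "i = j") (auto simp: strict_mono_on_def intro: less_imp_le)
  have n1: "1 \<in> {1..n}" "n \<in> {1..n}" using i by auto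
  show "l i t \<le> l j t" by (rule LIMSEQ_le[OF lim[OF i(1)] lim[OF i(2)]]) (use ord[OF i] in auto)
  have "0 \<le> l i (s N)" for N
    using s(4)[of N] ls[of N] ord[OF n1(1) i(1), of N] i by auto
  then show "0 \<le> l i t" by (intro LIMSEQ_le_const[OF lim[OF i(1)]]) auto
  have "l j (s N) \<le> 1" for N
    using s(4)[of N] ls[of N] ord[OF i(2) n1(2), of N] i by auto
  then show "l j t \<le> 1" by (intro LIMSEQ_le_const2[OF lim[OF i(2)]]) auto
qed

definition S :: "nat \<Rightarrow> real \<Rightarrow> real" where "S k t = (\<Sum>i=1..k. l i t)"
text \<open>The singular part of the push that the outer particles exert on the first
  \<open>k\<close>. Each such interaction also has a constant part -1; these
  \<open>k * (n - k)\<close> units are included in \<open>c k\<close>, which explains its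
  form.\<close>

definition \<nu> :: "nat \<Rightarrow> real \<Rightarrow> real" where
  "\<nu> k s = 2 * \<beta> * (\<Sum>i=1..k. \<Sum>j=k+1..n. l i s * (1 - l j s) / (l j s - l i s))"
definition c :: "nat \<Rightarrow> real" where "c k = \<beta> * k * (p - n + k)"
definition b :: real where "b = \<beta> * (p + q)"
text \<open>Extension by zero from \<open>T\<close> on, so that \<open>N\<close> is defined,
  continuous and nondecreasing on the whole half-line.\<close>

definition \<nu>\<^sub>0 :: "nat \<Rightarrow> real \<Rightarrow> real" where "\<nu>\<^sub>0 k s = (if live s then \<nu> k s else 0)"
definition d\<^sub>0 :: "nat \<Rightarrow> real \<Rightarrow> real" where "d\<^sub>0 k s = (if live s then c k - b * S k s else 0)"
definition N :: "nat \<Rightarrow> real \<Rightarrow> real" where "N k t = (LINT s:{0..t}|lborel. \<nu>\<^sub>0 k s)"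

lemma b_nonneg: "0 \<le> b" using pars by (simp add: b_def)

lemma S_bounds: "live t \<Longrightarrow> k \<le> n \<Longrightarrow> 0 \<le> S k t \<and> S k t \<le> k"
proof -
  assume t: "live t" and k: "k \<le> n"
  have "0 \<le> l i t \<and> l i t \<le> 1" if "i \<in> {1..k}" for i using weak_order[OF t, of i i] that k by auto
  note b = this
  have "0 \<le> S k t" unfolding S_def by (rule sum_nonneg) (use b in blast)
  moreover have "S k t \<le> (\<Sum>i=1..k. 1)" unfolding S_def by (rule sum_mono) (use b in blast)
  ultimately show ?thesis by simp
qed

lemma l_le_S: "live t \<Longrightarrow> i \<in> {1..k} \<Longrightarrow> k \<le> n \<Longrightarrow> l i t \<le> S k t"
  unfolding S_def using weak_order[of t] by (intro member_le_sum) auto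

lemma S_cont: "k \<le> n \<Longrightarrow> continuous_on {t. live t} (S k)"
  unfolding S_def by (intro continuous_on_sum l_cont) auto

text \<open>Interactions between two of the first \<open>k\<close> particles cancel in pairs. The
  others split as -1 minus twice a nonnegative quotient, because the numerator equals
  \<open>(l j s - l i s) + 2 * (l i s * (1 - l j s))\<close>.\<close>

lemma drift_sum:
  assumes k: "k \<le> n" and st: "strict_mono_on {1..n} (\<lambda>i. l i s)"
  shows "(\<Sum>i=1..k. jacobi_drift n p q \<beta> (\<lambda>j. l j s) i) = c k - b * S k s - \<nu> k s"
proof -
  define g where "g i j = (l i s * (1 - l j s) + l j s * (1 - l i s)) / (l i s - l j s)" for i j
  have anti: "g i j = - g j i" for i j
    unfolding g_def by (cases "l i s = l j s") (simp_all add: field_simps)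
  have inner: "(\<Sum>i=1..k. \<Sum>j\<in>{1..k}-{i}. g i j) = 0"
  proof -
    let ?Z = "\<Sum>i=1..k. \<Sum>j=1..k. g i j"
    have gii: "g i i = 0" for i by (simp add: g_def)
    have e: "(\<Sum>i=1..k. \<Sum>j\<in>{1..k}-{i}. g i j) = ?Z"
      by (rule sum.cong[OF refl], rule sum.mono_neutral_left) (auto simp: gii)
    have "?Z = (\<Sum>i=1..k. \<Sum>j=1..k. g j i)" by (rule sum.swap)
    also have "\<dots> = (\<Sum>i=1..k. \<Sum>j=1..k. - g i j)" using anti by (intro sum.cong refl)
    also have "\<dots> = - ?Z" by (simp add: sum_negf)
    finally have "?Z = 0" by simp
    then show ?thesis using e by simp
  qed
  have outer: "(\<Sum>i=1..k. \<Sum>j=k+1..n. g i j) = - (k * (real n - k)) - \<nu> k s / \<beta>"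
  proof -
    have "g i j = - 1 - 2 * (l i s * (1 - l j s) / (l j s - l i s))" if "i \<in> {1..k}" "j \<in> {k+1..n}" for i j
    proof -
      have "l i s < l j s" using st that k by (auto simp: strict_mono_on_def)
      then show ?thesis unfolding g_def by (simp add: field_simps)
    qed
    then have "(\<Sum>i=1..k. \<Sum>j=k+1..n. g i j) = (\<Sum>i=1..k. \<Sum>j=k+1..n. - 1 - 2 * (l i s * (1 - l j s) / (l j s - l i s)))"
      by (intro sum.cong refl) auto
    moreover have "(\<Sum>i=1..k. \<Sum>j=k+1..n. - 1 - 2 * h i j) = - (k * (real n - k)) - 2 * (\<Sum>i=1..k. \<Sum>j=k+1..n. h i j)"
      for h :: "nat \<Rightarrow> nat \<Rightarrow> real"
    proof -
      have "(\<Sum>i=1..k. \<Sum>j=k+1..n. - 1 - 2 * h i j) = (\<Sum>i=1..k. - (real n - k) - 2 * (\<Sum>j=k+1..n. h i j))"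
        using k by (intro sum.cong refl) (simp add: sum_subtractf sum_distrib_left of_nat_diff)
      also have "\<dots> = - (k * (real n - k)) - 2 * (\<Sum>i=1..k. \<Sum>j=k+1..n. h i j)"
        unfolding sum_subtractf sum_distrib_left[symmetric] by (simp add: right_diff_distrib)
      finally show ?thesis .
    qed
    moreover have "2 * (\<Sum>i=1..k. \<Sum>j=k+1..n. l i s * (1 - l j s) / (l j s - l i s)) = \<nu> k s / \<beta>"
      using pars by (simp add: \<nu>_def)
    ultimately show ?thesis by (simp only:)
  qed
  have split: "(\<Sum>j\<in>{1..n}-{i}. g i j) = (\<Sum>j\<in>{1..k}-{i}. g i j) + (\<Sum>j=k+1..n. g i j)" if "i \<in> {1..k}" for i
  proof -
    have e: "{1..n} - {i} = ({1..k} - {i}) \<union> {k+1..n}" using that k by auto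
    show ?thesis unfolding e by (rule sum.union_disjoint) auto
  qed
  have "(\<Sum>i=1..k. jacobi_drift n p q \<beta> (\<lambda>j. l j s) i) =
    (\<Sum>i=1..k. \<beta> * (p - (p + q) * l i s + ((\<Sum>j\<in>{1..k}-{i}. g i j) + (\<Sum>j=k+1..n. g i j))))"
    unfolding jacobi_drift_def g_def[symmetric]
  proof (intro sum.cong refl)
    fix i assume "i \<in> {1..k}"
    from split[OF this] show "\<beta> * (p - (p + q) * l i s + (\<Sum>j\<in>{1..n}-{i}. g i j)) =
      \<beta> * (p - (p + q) * l i s + ((\<Sum>j\<in>{1..k}-{i}. g i j) + (\<Sum>j=k+1..n. g i j)))" by (simp only:)
  qed
  also have "\<dots> = \<beta> * (k * p - (p + q) * S k s + ((\<Sum>i=1..k. \<Sum>j\<in>{1..k}-{i}. g i j) + (\<Sum>i=1..k. \<Sum>j=k+1..n. g i j)))"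
    by (simp add: sum_distrib_left[symmetric] sum.distrib sum_subtractf S_def)
  also have "\<dots> = c k - b * S k s - \<nu> k s"
    unfolding inner outer using pars by (simp add: c_def b_def algebra_simps)
  finally show ?thesis .
qed

lemma \<nu>_nonneg:
  assumes "0 \<le> l 1 s \<and> strict_mono_on {1..n} (\<lambda>i. l i s) \<and> l n s \<le> 1" "k \<le> n"
  shows "0 \<le> \<nu> k s" and "\<And>i j. i \<in> {1..k} \<Longrightarrow> j \<in> {k+1..n} \<Longrightarrow> 0 \<le> l i s \<and> l i s < l j s \<and> l j s \<le> 1"
proof -
  show *: "0 \<le> l i s \<and> l i s < l j s \<and> l j s \<le> 1" if "i \<in> {1..k}" "j \<in> {k+1..n}" for i j
  proof -
    have st: "strict_mono_on {1..n} (\<lambda>i. l i s)" using assms by blast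
    then have mo: "mono_on {1..n} (\<lambda>i. l i s)" by (rule strict_mono_on_imp_mono_on)
    have "l i s < l j s" using strict_mono_onD[OF st, of i j] that assms by auto
    moreover have "l 1 s \<le> l i s" using mono_onD[OF mo, of 1 i] that assms(2) by auto
    moreover have "l j s \<le> l n s" using mono_onD[OF mo, of j n] that assms(2) by auto
    ultimately show ?thesis using assms by auto
  qed
  have "0 \<le> l i s * (1 - l j s) / (l j s - l i s)" if "i \<in> {1..k}" "j \<in> {k+1..n}" for i j
    using *[OF that] by simp
  then show "0 \<le> \<nu> k s" unfolding \<nu>_def using pars by (intro mult_nonneg_nonneg sum_nonneg) auto
qed

lemma \<nu>\<^sub>0_nonneg: "k \<le> n \<Longrightarrow> AE s in lborel. 0 \<le> \<nu>\<^sub>0 k s"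
  using strict_order by eventually_elim (auto simp: \<nu>\<^sub>0_def intro: \<nu>_nonneg)

lemma d\<^sub>0_bound: "k \<le> n \<Longrightarrow> \<bar>d\<^sub>0 k s\<bar> \<le> \<bar>c k\<bar> + b * k"
proof (cases "live s")
  case True
  assume k: "k \<le> n"
  note S = S_bounds[OF True k]
  have "0 \<le> b * S k s" "b * S k s \<le> b * k" using S b_nonneg by (auto intro: mult_left_mono)
  then show ?thesis using True unfolding d\<^sub>0_def by simp
next
  case False
  then have "d\<^sub>0 k s = 0" unfolding d\<^sub>0_def by (rule if_not_P)
  then show ?thesis using b_nonneg by simp
qed

lemma d\<^sub>0_measurable: "k \<le> n \<Longrightarrow> d\<^sub>0 k \<in> borel_measurable borel"
proof -
  assume k: "k \<le> n"
  have m: "{t. live t} \<in> sets borel" by measurable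
  have "(\<lambda>s. indicator {t. live t} s *\<^sub>R (c k - b * S k s)) \<in> borel_measurable borel"
    by (intro borel_measurable_continuous_on_indicator m continuous_intros S_cont k)
  moreover have "(\<lambda>s. indicator {t. live t} s *\<^sub>R (c k - b * S k s)) = d\<^sub>0 k"
    by (auto simp: d\<^sub>0_def fun_eq_iff)
  ultimately show ?thesis by simp
qed

lemma d\<^sub>0_integrable: "k \<le> n \<Longrightarrow> set_integrable lborel {s..t} (d\<^sub>0 k)"
  unfolding set_integrable_def
  by (rule Bochner_Integration.integrable_bound[OF set_integrable_const_Icc[of s t "\<bar>c k\<bar> + b * k", unfolded set_integrable_def]])
    (use d\<^sub>0_measurable d\<^sub>0_bound in \<open>auto intro!: AE_I2 simp: indicator_def order_trans[OF _ abs_ge_self]\<close>)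

lemma \<nu>\<^sub>0_measurable: "k \<le> n \<Longrightarrow> \<nu>\<^sub>0 k \<in> borel_measurable borel"
proof -
  assume k: "k \<le> n"
  have lm: "l i \<in> borel_measurable (restrict_space borel {t. live t})" if "i \<in> {1..n}" for i
    by (rule borel_measurable_continuous_on_restrict[OF l_cont[OF that]])
  have m: "{t. live t} \<in> sets borel" by measurable
  have "\<nu> k \<in> borel_measurable (restrict_space borel {t. live t})"
    unfolding \<nu>_def using lm k
    by (intro borel_measurable_times borel_measurable_sum borel_measurable_divide borel_measurable_diff borel_measurable_const) auto
  then have "(\<lambda>s. indicator {t. live t} s *\<^sub>R \<nu> k s) \<in> borel_measurable borel"
    using borel_measurable_restrict_space_iff[of "{t. live t}" borel "\<nu> k"] m by simp
  moreover have "(\<lambda>s. indicator {t. live t} s *\<^sub>R \<nu> k s) = \<nu>\<^sub>0 k" by (auto simp: \<nu>\<^sub>0_def fun_eq_iff)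
  ultimately show ?thesis by simp
qed

text \<open>Almost everywhere \<open>\<nu>\<^sub>0\<close> is the difference of the bounded
  \<open>d\<^sub>0\<close> and the summed drifts, so it inherits their integrability.\<close>

lemma S_decomposition_live:
  assumes k: "k \<le> n" and t: "live t"
  shows "set_integrable lborel {0..t} (\<nu>\<^sub>0 k)"
    and "S k t = S k 0 + (\<Sum>i=1..k. x i t) + (LINT s:{0..t}|lborel. d\<^sub>0 k s) - N k t"
proof -
  let ?D = "\<lambda>i s. jacobi_drift n p q \<beta> (\<lambda>j. l j s) i"
  have di: "set_integrable lborel {0..t} (?D i)" if "i \<in> {1..k}" for i using drift_int t k that by auto
  have sumi: "set_integrable lborel {0..t} (\<lambda>s. \<Sum>i=1..k. ?D i s)"
    unfolding set_integrable_def scaleR_sum_right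
    by (rule Bochner_Integration.integrable_sum) (use di[unfolded set_integrable_def] in blast)
  have diff: "set_integrable lborel {0..t} (\<lambda>s. d\<^sub>0 k s - (\<Sum>i=1..k. ?D i s))"
    using set_integral_diff(1)[OF d\<^sub>0_integrable[OF k] sumi] .
  have ae: "AE s in lborel. s \<in> {0..t} \<longrightarrow> \<nu>\<^sub>0 k s = d\<^sub>0 k s - (\<Sum>i=1..k. ?D i s)"
    using strict_order
  proof eventually_elim
    case (elim s)
    show ?case
    proof
      assume "s \<in> {0..t}"
      then have ls: "live s" using live_le[OF t] by auto
      then have "(\<Sum>i=1..k. ?D i s) = c k - b * S k s - \<nu> k s" using elim by (intro drift_sum[OF k]) auto
      then show "\<nu>\<^sub>0 k s = d\<^sub>0 k s - (\<Sum>i=1..k. ?D i s)" using ls by (simp add: \<nu>\<^sub>0_def d\<^sub>0_def)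
    qed
  qed
  note \<nu>m = \<nu>\<^sub>0_measurable[OF k]
  show ni: "set_integrable lborel {0..t} (\<nu>\<^sub>0 k)"
    unfolding set_integrable_def
  proof (rule Bochner_Integration.integrable_bound[OF diff[unfolded set_integrable_def]])
    show "AE s in lborel. norm (indicat_real {0..t} s *\<^sub>R \<nu>\<^sub>0 k s) \<le> norm (indicat_real {0..t} s *\<^sub>R (d\<^sub>0 k s - (\<Sum>i=1..k. ?D i s)))"
      using ae by eventually_elim (auto simp: indicator_def)
  qed (use \<nu>m in measurable)
  have "N k t = (LINT s:{0..t}|lborel. d\<^sub>0 k s - (\<Sum>i=1..k. ?D i s))"
    unfolding N_def set_lebesgue_integral_def
  proof (rule integral_cong_AE)
    show "(\<lambda>s. indicat_real {0..t} s *\<^sub>R \<nu>\<^sub>0 k s) \<in> borel_measurable lborel" using \<nu>m by measurable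
    show "(\<lambda>s. indicat_real {0..t} s *\<^sub>R (d\<^sub>0 k s - (\<Sum>i = 1..k. ?D i s))) \<in> borel_measurable lborel"
      using diff unfolding set_integrable_def by (rule borel_measurable_integrable)
    show "AE s in lborel. indicat_real {0..t} s *\<^sub>R \<nu>\<^sub>0 k s = indicat_real {0..t} s *\<^sub>R (d\<^sub>0 k s - (\<Sum>i = 1..k. ?D i s))"
      using ae by eventually_elim (auto simp: indicator_def)
  qed
  also have "\<dots> = (LINT s:{0..t}|lborel. d\<^sub>0 k s) - (LINT s:{0..t}|lborel. \<Sum>i=1..k. ?D i s)"
    by (rule set_integral_diff(2)[OF d\<^sub>0_integrable[OF k] sumi])
  also have "(LINT s:{0..t}|lborel. \<Sum>i=1..k. ?D i s) = (\<Sum>i=1..k. LINT s:{0..t}|lborel. ?D i s)"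
    using di unfolding set_integrable_def set_lebesgue_integral_def
    by (simp only: scaleR_sum_right) (intro Bochner_Integration.integral_sum, auto)
  also have "\<dots> = (\<Sum>i=1..k. l i t - l i 0 - x i t)"
    using l_eq t k by (intro sum.cong refl) auto
  also have "\<dots> = S k t - S k 0 - (\<Sum>i=1..k. x i t)" by (simp add: S_def sum_subtractf)
  finally show "S k t = S k 0 + (\<Sum>i=1..k. x i t) + (LINT s:{0..t}|lborel. d\<^sub>0 k s) - N k t" by simp
qed

text \<open>\<open>N\<close> stays bounded up to \<open>T\<close> because \<open>S\<close>, the martingale part and the bounded drift do.\<close>

lemma N_live_bound:
  assumes k: "k \<le> n" and t: "0 \<le> t"
  shows "\<exists>C\<ge>0. \<forall>s\<in>{0..t}. live s \<longrightarrow> N k s \<le> C"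
proof -
  have "continuous_on {0..t} (\<lambda>s. \<Sum>i=1..k. x i s)"
    using k by (intro continuous_on_sum) (auto intro: continuous_on_subset[OF x_cont])
  then have "compact ((\<lambda>s. \<Sum>i=1..k. x i s) ` {0..t})" by (intro compact_continuous_image) auto
  then obtain K where K: "\<And>s. s \<in> {0..t} \<Longrightarrow> \<bar>\<Sum>i=1..k. x i s\<bar> \<le> K"
    using compact_imp_bounded bounded_iff by (metis imageI real_norm_def)
  have K0: "0 \<le> K" using K[of 0] t by (auto intro: order_trans[OF abs_ge_zero])
  let ?d = "\<bar>c k\<bar> + b * k"
  have d: "0 \<le> ?d" using b_nonneg by simp
  show ?thesis
  proof (intro exI[of _ "k + K + ?d * t"] conjI ballI impI)
    show "0 \<le> k + K + ?d * t" using K0 d t by simp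
    fix s assume s: "s \<in> {0..t}" "live s"
    have l0: "live 0" by (rule live_le[OF s(2)]) (use s in auto)
    have "(LINT u:{0..s}|lborel. d\<^sub>0 k u) \<le> (LINT u:{0..s}|lborel. ?d)"
      by (intro set_integral_mono d\<^sub>0_integrable k set_integrable_const_Icc) (use d\<^sub>0_bound[OF k] in \<open>auto simp: abs_le_iff\<close>)
    also have "\<dots> = ?d * (s - 0)" using s by (intro set_integral_const_Icc) auto
    also have "\<dots> \<le> ?d * t" using s d by (intro mult_left_mono) auto
    finally have "(LINT u:{0..s}|lborel. d\<^sub>0 k u) \<le> ?d * t" .
    then show "N k s \<le> k + K + ?d * t"
      using S_decomposition_live(2)[OF k s(2)] S_bounds[OF s(2) k] S_bounds[OF l0 k] K[OF s(1)] by linarith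
  qed
qed

text \<open>Integrability of the drift is assumed only strictly before \<open>T\<close>. The bound
  of \<open>N_live_bound\<close> is uniform there, so Fatou's lemma along intervals ending at
  \<open>r - 1 / real (Suc m)\<close> reaches \<open>T\<close> itself.\<close>

lemma \<nu>\<^sub>0_integrable:
  assumes k: "k \<le> n"
  shows "set_integrable lborel {0..t} (\<nu>\<^sub>0 k)"
proof (cases "live t \<or> t < 0")
  case True
  then show ?thesis using S_decomposition_live(1)[OF k] by (auto simp: set_integrable_def)
next
  case False
  then have t: "0 \<le> t" "T \<le> ennreal t" by (auto simp: not_less)
  then obtain r where r: "T = ennreal r" "0 \<le> r" by (cases T) (auto simp: top_unique)
  have rt: "r \<le> t" using r t by simp
  obtain C where C: "0 \<le> C" "\<And>s. s \<in> {0..t} \<Longrightarrow> live s \<Longrightarrow> N k s \<le> C" using N_live_bound[OF k t(1)] by blast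
  let ?f = "\<lambda>m s. indicator {0..r - 1 / real (Suc m)} s * \<nu>\<^sub>0 k s"
  have lv: "live s \<longleftrightarrow> 0 \<le> s \<and> s < r" for s using r by (auto simp: ennreal_less_iff)
  have nn: "(\<integral>\<^sup>+s. ennreal (?f m s) \<partial>lborel) \<le> ennreal C" for m
  proof (cases "0 \<le> r - 1 / real (Suc m)")
    case True
    then have lm: "live (r - 1 / real (Suc m))" unfolding lv by simp
    have "(\<integral>\<^sup>+s. ennreal (?f m s) \<partial>lborel) = ennreal (N k (r - 1 / real (Suc m)))"
      using S_decomposition_live(1)[OF k lm] \<nu>\<^sub>0_nonneg[OF k]
      unfolding N_def set_lebesgue_integral_def set_integrable_def
      by (subst nn_integral_eq_integral) (auto elim!: eventually_mono)
    also have "\<dots> \<le> ennreal C"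
    proof (intro ennreal_leI C(2) lm)
      have "0 \<le> 1 / real (Suc m)" by simp
      then have "r - 1 / real (Suc m) \<le> t" using rt by linarith
      then show "r - 1 / real (Suc m) \<in> {0..t}" using True by simp
    qed
    finally show ?thesis .
  next
    case False
    then show ?thesis by simp
  qed
  have meas [measurable]: "\<nu>\<^sub>0 k \<in> borel_measurable borel" by (rule \<nu>\<^sub>0_measurable[OF k])
  have "(\<integral>\<^sup>+s. ennreal (indicator {0..t} s * \<nu>\<^sub>0 k s) \<partial>lborel) = (\<integral>\<^sup>+s. liminf (\<lambda>m. ennreal (?f m s)) \<partial>lborel)"
  proof (rule nn_integral_cong)
    fix s :: real
    have "\<forall>\<^sub>F m in sequentially. ennreal (?f m s) = ennreal (indicator {0..t} s * \<nu>\<^sub>0 k s)"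
    proof (cases "live s")
      case True
      then have sr: "0 \<le> s" "s < r" unfolding lv by auto
      have "(\<lambda>m. 1 / real (Suc m)) \<longlonglongrightarrow> 0" using LIMSEQ_Suc[OF lim_1_over_n] by simp
      then have "\<forall>\<^sub>F m in sequentially. 1 / real (Suc m) < r - s" using sr by (intro order_tendstoD(2)) auto
      then show ?thesis by eventually_elim (use sr rt in \<open>auto simp: indicator_def\<close>)
    next
      case False
      then have "\<nu>\<^sub>0 k s = 0" unfolding \<nu>\<^sub>0_def by (rule if_not_P)
      then show ?thesis by simp
    qed
    then have "(\<lambda>m. ennreal (?f m s)) \<longlonglongrightarrow> ennreal (indicator {0..t} s * \<nu>\<^sub>0 k s)" by (rule tendsto_eventually)
    then show "ennreal (indicator {0..t} s * \<nu>\<^sub>0 k s) = liminf (\<lambda>m. ennreal (?f m s))"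
      by (simp add: lim_imp_Liminf)
  qed
  also have "\<dots> \<le> liminf (\<lambda>m. \<integral>\<^sup>+s. ennreal (?f m s) \<partial>lborel)" by (intro nn_integral_liminf) measurable
  also have "\<dots> \<le> liminf (\<lambda>m::nat. ennreal C)" by (intro Liminf_mono always_eventually allI nn)
  also have "\<dots> = ennreal C" by (simp add: Liminf_const)
  finally have le: "(\<integral>\<^sup>+s. ennreal (indicator {0..t} s * \<nu>\<^sub>0 k s) \<partial>lborel) \<le> ennreal C" .
  have "integrable lborel (\<lambda>s. indicator {0..t} s * \<nu>\<^sub>0 k s)"
  proof (rule integrableI_nonneg)
    show "AE s in lborel. 0 \<le> indicator {0..t} s * \<nu>\<^sub>0 k s"
      using \<nu>\<^sub>0_nonneg[OF k] by eventually_elim simp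
    show "(\<integral>\<^sup>+s. ennreal (indicator {0..t} s * \<nu>\<^sub>0 k s) \<partial>lborel) < \<infinity>" by (rule le_less_trans[OF le]) simp
  qed measurable
  then show ?thesis by (simp add: set_integrable_def)
qed

lemma N_diff:
  assumes k: "k \<le> n" and s: "0 \<le> s" "s \<le> t"
  shows "N k t - N k s = (LINT u:{s..t}|lborel. \<nu>\<^sub>0 k u)" "0 \<le> N k t - N k s" "N k 0 = 0"
proof -
  show e: "N k t - N k s = (LINT u:{s..t}|lborel. \<nu>\<^sub>0 k u)"
    unfolding N_def by (rule set_integral_split[OF \<nu>\<^sub>0_integrable[OF k] s])
  have "0 \<le> (LINT u:{s..t}|lborel. \<nu>\<^sub>0 k u)"
    unfolding set_lebesgue_integral_def
  proof (rule integral_nonneg_AE)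
    show "AE u in lborel. 0 \<le> indicat_real {s..t} u *\<^sub>R \<nu>\<^sub>0 k u"
      using \<nu>\<^sub>0_nonneg[OF k] by eventually_elim simp
  qed
  then show "0 \<le> N k t - N k s" using e by simp
  have "(LINT u:{0..0}|lborel. \<nu>\<^sub>0 k u) = 0"
    using set_borel_integral_eq_integral(2)[OF \<nu>\<^sub>0_integrable[OF k, of 0]] by simp
  then show "N k 0 = 0" by (simp add: N_def)
qed

lemma N_cont: "k \<le> n \<Longrightarrow> continuous_on {0..t} (N k)"
  unfolding N_def by (intro set_integral_continuous \<nu>\<^sub>0_integrable)

text \<open>\<open>S\<close> is defined only before \<open>T\<close>, but the right side of its
  decomposition is continuous on all of [0, t] and hence uniformly continuous. The modulus
  \<open>h\<close> therefore does not deteriorate near \<open>T\<close>.\<close>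

lemma S_uniform:
  assumes k: "k \<le> n" and "0 < \<delta>"
  shows "\<exists>h>0. \<forall>s u. live s \<and> live u \<and> s \<le> t \<and> u \<le> t \<and> \<bar>u - s\<bar> < h \<longrightarrow> \<bar>S k u - S k s\<bar> < \<delta>"
proof -
  let ?R = "\<lambda>s. S k 0 + (\<Sum>i=1..k. x i s) + (LINT u:{0..s}|lborel. d\<^sub>0 k u) - N k s"
  have "continuous_on {0..t} (\<lambda>s. \<Sum>i=1..k. x i s)"
    using k by (intro continuous_on_sum) (auto intro: continuous_on_subset[OF x_cont])
  then have "continuous_on {0..t} ?R"
    by (intro continuous_on_add continuous_on_diff continuous_on_const set_integral_continuous d\<^sub>0_integrable N_cont k)
  then have "uniformly_continuous_on {0..t} ?R" by (intro compact_uniformly_continuous) auto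
  then obtain h where h: "h > 0" "\<And>s u. s \<in> {0..t} \<Longrightarrow> u \<in> {0..t} \<Longrightarrow> dist u s < h \<Longrightarrow> dist (?R u) (?R s) < \<delta>"
    using assms(2) unfolding uniformly_continuous_on_def by metis
  show ?thesis
  proof (intro exI[of _ h] conjI h(1) allI impI)
    fix s u assume a: "live s \<and> live u \<and> s \<le> t \<and> u \<le> t \<and> \<bar>u - s\<bar> < h"
    then have "dist (?R u) (?R s) < \<delta>" by (intro h(2)) (auto simp: dist_real_def)
    then show "\<bar>S k u - S k s\<bar> < \<delta>"
      using S_decomposition_live(2)[OF k, of s] S_decomposition_live(2)[OF k, of u] a by (simp add: dist_real_def)
  qed
qed

lemma l_Suc_uniform:
  assumes k: "k < n" and \<delta>: "0 < \<delta>"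
  shows "\<exists>h>0. \<forall>s u. live s \<and> live u \<and> s \<le> t \<and> u \<le> t \<and> \<bar>u - s\<bar> < h \<longrightarrow> \<bar>l (Suc k) u - l (Suc k) s\<bar> < \<delta>"
proof -
  obtain h1 where h1: "h1 > 0" "\<And>s u. live s \<and> live u \<and> s \<le> t \<and> u \<le> t \<and> \<bar>u - s\<bar> < h1 \<longrightarrow> \<bar>S k u - S k s\<bar> < \<delta> / 2"
    using S_uniform[of k "\<delta> / 2" t] k \<delta> by auto
  obtain h2 where h2: "h2 > 0" "\<And>s u. live s \<and> live u \<and> s \<le> t \<and> u \<le> t \<and> \<bar>u - s\<bar> < h2 \<longrightarrow> \<bar>S (Suc k) u - S (Suc k) s\<bar> < \<delta> / 2"
    using S_uniform[of "Suc k" "\<delta> / 2" t] k \<delta> by auto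
  have e: "l (Suc k) u = S (Suc k) u - S k u" for u by (simp add: S_def)
  show ?thesis
  proof (intro exI[of _ "min h1 h2"] conjI allI impI)
    show "0 < min h1 h2" using h1 h2 by simp
    fix s u assume a: "live s \<and> live u \<and> s \<le> t \<and> u \<le> t \<and> \<bar>u - s\<bar> < min h1 h2"
    then have "\<bar>S k u - S k s\<bar> < \<delta> / 2" "\<bar>S (Suc k) u - S (Suc k) s\<bar> < \<delta> / 2"
      using h1(2)[of s u] h2(2)[of s u] by auto
    then show "\<bar>l (Suc k) u - l (Suc k) s\<bar> < \<delta>" unfolding e by linarith
  qed
qed

end

context jacobi_path
begin

text \<open>Denominators are kept above \<open>1 / real (Suc L)\<close>, which makes the interaction
  continuous in time. Riemann sums then apply, and \<open>N\<close> becomes a limit of adapted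
  integrals.\<close>

definition \<nu>\<^sub>L :: "nat \<Rightarrow> nat \<Rightarrow> real \<Rightarrow> real" where
  "\<nu>\<^sub>L k L s = 2 * \<beta> * (\<Sum>i=1..k. \<Sum>j=k+1..n. l i s * (1 - l j s) / max (l j s - l i s) (1 / real (Suc L)))"

lemma \<nu>\<^sub>L_cont: "k \<le> n \<Longrightarrow> continuous_on {t. live t} (\<nu>\<^sub>L k L)"
proof -
  assume k: "k \<le> n"
  have m: "max (l j s - l i s) (1 / real (Suc L)) \<noteq> 0" for i j s
  proof -
    have "0 < 1 / real (Suc L)" by simp
    then have "0 < max (l j s - l i s) (1 / real (Suc L))" by (simp only: less_max_iff_disj simp_thms)
    then show ?thesis by (rule less_imp_neq[symmetric])
  qed
  show ?thesis
    unfolding \<nu>\<^sub>L_def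
    by (intro continuous_on_mult continuous_on_const continuous_on_sum continuous_on_divide continuous_on_diff
        continuous_on_max l_cont ballI m) (use k in auto)
qed

lemma \<nu>\<^sub>L_bound:
  assumes k: "k \<le> n" and s: "live s"
  shows "0 \<le> \<nu>\<^sub>L k L s" "\<nu>\<^sub>L k L s \<le> 2 * \<beta> * (\<Sum>i=1..k. \<Sum>j=k+1..n. real (Suc L))"
proof -
  have t: "0 \<le> l i s * (1 - l j s) / max (l j s - l i s) (1 / real (Suc L)) \<and>
     l i s * (1 - l j s) / max (l j s - l i s) (1 / real (Suc L)) \<le> real (Suc L)"
    if "i \<in> {1..k}" "j \<in> {k+1..n}" for i j
  proof -
    have b: "0 \<le> l i s" "l i s \<le> 1" "0 \<le> l j s" "l j s \<le> 1"
      using weak_order[OF s, of i i] weak_order[OF s, of j j] that k by auto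
    have p: "0 < 1 / real (Suc L)" by simp
    have "l i s * (1 - l j s) \<le> 1 * 1" using b by (intro mult_mono) auto
    then have "l i s * (1 - l j s) / max (l j s - l i s) (1 / real (Suc L)) \<le> 1 / (1 / real (Suc L))"
      using b by (intro frac_le) auto
    then show ?thesis using b by (auto intro!: divide_nonneg_nonneg simp: le_max_iff_disj)
  qed
  show "0 \<le> \<nu>\<^sub>L k L s" unfolding \<nu>\<^sub>L_def using pars t by (intro mult_nonneg_nonneg sum_nonneg) auto
  have "(\<Sum>i=1..k. \<Sum>j=k+1..n. l i s * (1 - l j s) / max (l j s - l i s) (1 / real (Suc L))) \<le>
    (\<Sum>i=1..k. \<Sum>j=k+1..n. real (Suc L))"
    by (intro sum_mono) (use t in blast)
  then show "\<nu>\<^sub>L k L s \<le> 2 * \<beta> * (\<Sum>i=1..k. \<Sum>j=k+1..n. real (Suc L))"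
    unfolding \<nu>\<^sub>L_def using pars by (intro mult_left_mono) auto
qed

lemma N_limit:
  assumes k: "k \<le> n"
  shows "(\<lambda>L. LINT s:{0..t}|lborel. (if live s then \<nu>\<^sub>L k L s else 0)) \<longlonglongrightarrow> N k t"
  unfolding N_def set_lebesgue_integral_def
proof (rule integral_dominated_convergence[where w="\<lambda>s. indicator {0..t} s *\<^sub>R \<nu>\<^sub>0 k s"])
  show "(\<lambda>s. indicat_real {0..t} s *\<^sub>R \<nu>\<^sub>0 k s) \<in> borel_measurable lborel"
    using \<nu>\<^sub>0_measurable[OF k] by measurable
  show "integrable lborel (\<lambda>s. indicat_real {0..t} s *\<^sub>R \<nu>\<^sub>0 k s)"
    using \<nu>\<^sub>0_integrable[OF k] by (simp add: set_integrable_def)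
  have m: "{t. live t} \<in> sets borel" by measurable
  show "(\<lambda>s. indicat_real {0..t} s *\<^sub>R (if live s then \<nu>\<^sub>L k L s else 0)) \<in> borel_measurable lborel" for L
  proof -
    have "(\<lambda>s. indicator {t. live t} s *\<^sub>R \<nu>\<^sub>L k L s) \<in> borel_measurable borel"
      by (intro borel_measurable_continuous_on_indicator m \<nu>\<^sub>L_cont k)
    moreover have "(\<lambda>s. indicator {t. live t} s *\<^sub>R \<nu>\<^sub>L k L s) = (\<lambda>s. if live s then \<nu>\<^sub>L k L s else 0)"
      by (auto simp: fun_eq_iff)
    ultimately have "(\<lambda>s. if live s then \<nu>\<^sub>L k L s else 0) \<in> borel_measurable borel" by (simp only:)
    then show ?thesis by measurable
  qed
  show "AE s in lborel. (\<lambda>L. indicat_real {0..t} s *\<^sub>R (if live s then \<nu>\<^sub>L k L s else 0)) \<longlonglongrightarrow> indicat_real {0..t} s *\<^sub>R \<nu>\<^sub>0 k s"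
    using strict_order
  proof eventually_elim
    case (elim s)
    show ?case
    proof (cases "live s")
      case True
      note o = \<nu>_nonneg(2)[OF elim[rule_format, OF True] k]
      have "(\<lambda>L. \<nu>\<^sub>L k L s) \<longlonglongrightarrow> \<nu> k s"
        unfolding \<nu>\<^sub>L_def \<nu>_def
      proof (intro tendsto_mult tendsto_sum tendsto_const)
        fix i j assume ij: "i \<in> {1..k}" "j \<in> {k+1..n}"
        have d: "0 < l j s - l i s" using o[OF ij] by simp
        have "(\<lambda>L. 1 / real (Suc L)) \<longlonglongrightarrow> 0" using LIMSEQ_Suc[OF lim_1_over_n] by simp
        then have "\<forall>\<^sub>F L in sequentially. 1 / real (Suc L) < l j s - l i s" using d by (rule order_tendstoD(2))
        then have "\<forall>\<^sub>F L in sequentially. l i s * (1 - l j s) / max (l j s - l i s) (1 / real (Suc L)) =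
          l i s * (1 - l j s) / (l j s - l i s)" by eventually_elim (simp add: max_def)
        then show "(\<lambda>L. l i s * (1 - l j s) / max (l j s - l i s) (1 / real (Suc L))) \<longlonglongrightarrow> l i s * (1 - l j s) / (l j s - l i s)"
          by (rule tendsto_eventually)
      qed
      then show ?thesis using True by (auto simp: \<nu>\<^sub>0_def intro!: tendsto_mult)
    next
      case False
      then have "\<nu>\<^sub>0 k s = 0" unfolding \<nu>\<^sub>0_def by (rule if_not_P)
      then show ?thesis using False by (simp only: if_False scaleR_zero_right tendsto_const)
    qed
  qed
  show "AE s in lborel. norm (indicat_real {0..t} s *\<^sub>R (if live s then \<nu>\<^sub>L k L s else 0)) \<le> indicat_real {0..t} s *\<^sub>R \<nu>\<^sub>0 k s" for L
    using strict_order
  proof eventually_elim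
    case (elim s)
    show ?case
    proof (cases "live s")
      case True
      note o = \<nu>_nonneg(2)[OF elim[rule_format, OF True] k]
      have "(\<Sum>i=1..k. \<Sum>j=k+1..n. l i s * (1 - l j s) / max (l j s - l i s) (1 / real (Suc L))) \<le>
        (\<Sum>i=1..k. \<Sum>j=k+1..n. l i s * (1 - l j s) / (l j s - l i s))"
      proof (intro sum_mono)
        fix i j assume ij: "i \<in> {1..k}" "j \<in> {k+1..n}"
        show "l i s * (1 - l j s) / max (l j s - l i s) (1 / real (Suc L)) \<le> l i s * (1 - l j s) / (l j s - l i s)"
          using o[OF ij] by (intro divide_left_mono mult_pos_pos mult_nonneg_nonneg) (auto simp: less_max_iff_disj)
      qed
      then have "\<nu>\<^sub>L k L s \<le> \<nu> k s" unfolding \<nu>\<^sub>L_def \<nu>_def using pars by (intro mult_left_mono) auto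
      then show ?thesis using True \<nu>\<^sub>L_bound(1)[OF k True, of L] by (simp add: \<nu>\<^sub>0_def mult_left_mono)
    next
      case False
      then have "\<nu>\<^sub>0 k s = 0" unfolding \<nu>\<^sub>0_def by (rule if_not_P)
      then show ?thesis using False by (simp only: if_False scaleR_zero_right norm_zero order_refl)
    qed
  qed
qed

text \<open>The singular part of the drift of \<open>S\<close> is controlled by \<open>S\<close> itself as long as the particle \<open>k + 1\<close>
  stays away from \<open>0\<close>.\<close>

lemma \<nu>_le:
  assumes o: "0 \<le> l 1 s \<and> strict_mono_on {1..n} (\<lambda>i. l i s) \<and> l n s \<le> 1" and k: "k \<le> n"
    and m: "0 < m" "k = n \<or> 1 / m \<le> l (Suc k) s"
  shows "\<nu> k s \<le> S k s * m * (2 * \<beta> * (k * (real n - k)) + 2 * \<nu> k s)"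
proof -
  note ord = \<nu>_nonneg(2)[OF o k]
  have li: "l i s \<le> S k s" if ij: "i \<in> {1..k}" "j \<in> {k+1..n}" for i j
    unfolding S_def using that(1)
  proof (rule member_le_sum)
    show "0 \<le> l h s" if "h \<in> {1..k} - {i}" for h using ord[of h j] that ij by auto
  qed simp
  have mo: "mono_on {1..n} (\<lambda>i. l i s)" using o strict_mono_on_imp_mono_on by blast
  let ?h = "\<lambda>i j. l i s * (1 - l j s) / (l j s - l i s)"
  have t: "?h i j \<le> S k s * m * (1 + 2 * ?h i j)" if ij: "i \<in> {1..k}" "j \<in> {k+1..n}" for i j
  proof -
    note b = ord[OF ij]
    have "l (Suc k) s \<le> l j s" using mono_onD[OF mo, of "Suc k" j] ij by auto
    then have "1 / m \<le> l j s" using m ij by auto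
    then have mj: "1 \<le> m * l j s" using m(1) by (simp add: field_simps)
    have S0: "0 \<le> S k s" using li[OF ij] b by linarith
    have "?h i j \<le> S k s * (1 - l j s) / (l j s - l i s)"
      using li[OF ij] b by (intro divide_right_mono mult_right_mono) auto
    also have "\<dots> = S k s * ((1 - l j s) / (l j s - l i s))" by simp
    also have "\<dots> \<le> S k s * (m * (1 + 2 * ?h i j))"
    proof (rule mult_left_mono[OF _ S0])
      \<comment> \<open>Since \<open>m * l j s\<close> is at least 1, \<open>1 - l j s\<close> is at
        most \<open>m\<close> times the numerator of the full interaction. So the quotient left
        after pulling out \<open>S k s\<close> is again controlled by the interaction, whose time
        integral is finite.\<close>
      have "1 - l j s \<le> 1 - l i s" using b by simp
      also have "\<dots> \<le> (m * l j s) * (1 - l i s)" using mj b mult_right_mono[of 1 "m * l j s" "1 - l i s"] by simp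
      also have "\<dots> \<le> m * (l j s * (1 - l i s) + l i s * (1 - l j s))"
      proof -
        have "0 \<le> m * (l i s * (1 - l j s))" using b m by simp
        then show ?thesis by (simp add: distrib_left mult.assoc)
      qed
      finally have "1 - l j s \<le> m * (l j s * (1 - l i s) + l i s * (1 - l j s))" .
      then have "(1 - l j s) / (l j s - l i s) \<le> m * (l j s * (1 - l i s) + l i s * (1 - l j s)) / (l j s - l i s)"
        using b by (intro divide_right_mono) auto
      also have "\<dots> = m * (1 + 2 * ?h i j)"
      proof -
        have e: "l j s * (1 - l i s) + l i s * (1 - l j s) = (l j s - l i s) + 2 * (l i s * (1 - l j s))"
          by (simp add: algebra_simps)
        have aux: "m * (g + 2 * w) / g = m * (1 + 2 * (w / g))" if "g \<noteq> 0" for g w :: real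
          using that by (simp add: field_simps)
        show ?thesis unfolding e by (rule aux) (use b in auto)
      qed
      finally show "(1 - l j s) / (l j s - l i s) \<le> m * (1 + 2 * ?h i j)" .
    qed
    finally show ?thesis by (simp add: mult.assoc)
  qed
  have "(\<Sum>i=1..k. \<Sum>j=k+1..n. ?h i j) \<le> (\<Sum>i=1..k. \<Sum>j=k+1..n. S k s * m * (1 + 2 * ?h i j))"
    by (intro sum_mono t)
  also have "\<dots> = S k s * m * (k * (real n - k) + 2 * (\<Sum>i=1..k. \<Sum>j=k+1..n. ?h i j))"
    unfolding sum_distrib_left[symmetric] sum.distrib using k by (simp add: of_nat_diff)
  finally have "2 * \<beta> * (\<Sum>i=1..k. \<Sum>j=k+1..n. ?h i j) \<le> 2 * \<beta> * (S k s * m * (k * (real n - k) + 2 * (\<Sum>i=1..k. \<Sum>j=k+1..n. ?h i j)))"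
    using pars by (intro mult_left_mono) auto
  then show ?thesis unfolding \<nu>_def by (simp add: algebra_simps)
qed

text \<open>Density of the bracket of the martingale part of \<open>S\<close>. Its bound
  \<open>4 * S k s\<close> is what turns into the threshold 2 for \<open>c k\<close>.\<close>

definition q\<^sub>0 :: "nat \<Rightarrow> real \<Rightarrow> real" where
  "q\<^sub>0 k s = (if live s then \<Sum>i=1..k. 4 * (l i s * (1 - l i s)) else 0)"

lemma q\<^sub>0_bound: "k \<le> n \<Longrightarrow> 0 \<le> q\<^sub>0 k s" "k \<le> n \<Longrightarrow> live s \<Longrightarrow> q\<^sub>0 k s \<le> 4 * S k s"
proof -
  assume k: "k \<le> n"
  have b: "0 \<le> l i s" "l i s \<le> 1" if "live s" "i \<in> {1..k}" for i
    using weak_order[OF that(1), of i i] that k by auto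
  show "0 \<le> q\<^sub>0 k s"
  proof (cases "live s")
    case True
    have "0 \<le> (\<Sum>i=1..k. 4 * (l i s * (1 - l i s)))" by (intro sum_nonneg) (use b[OF True] in auto)
    then show ?thesis using True by (simp add: q\<^sub>0_def)
  next
    case False
    then have "q\<^sub>0 k s = 0" unfolding q\<^sub>0_def by (rule if_not_P)
    then show ?thesis by simp
  qed
  assume l: "live s"
  have "(\<Sum>i=1..k. 4 * (l i s * (1 - l i s))) \<le> (\<Sum>i=1..k. 4 * l i s)"
  proof (intro sum_mono mult_left_mono)
    fix i assume "i \<in> {1..k}"
    from b[OF l this] show "l i s * (1 - l i s) \<le> l i s" using mult_left_le[of "1 - l i s" "l i s"] by simp
  qed simp
  then show "q\<^sub>0 k s \<le> 4 * S k s" using l by (simp add: q\<^sub>0_def S_def sum_distrib_left)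
qed

lemma q\<^sub>0_integrable:
  assumes k: "k \<le> n"
  shows "set_integrable lborel {s..t} (q\<^sub>0 k)"
proof -
  have m: "{t. live t} \<in> sets borel" by measurable
  have "(\<lambda>s. indicator {t. live t} s *\<^sub>R (\<Sum>i=1..k. 4 * (l i s * (1 - l i s)))) \<in> borel_measurable borel"
    using k by (intro borel_measurable_continuous_on_indicator m continuous_intros l_cont) auto
  moreover have "(\<lambda>s. indicator {t. live t} s *\<^sub>R (\<Sum>i=1..k. 4 * (l i s * (1 - l i s)))) = q\<^sub>0 k"
    by (auto simp: q\<^sub>0_def fun_eq_iff)
  ultimately have qm: "q\<^sub>0 k \<in> borel_measurable borel" by (simp only:)
  have qb: "q\<^sub>0 k u \<le> 4 * real k" for u
  proof (cases "live u")
    case True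
    then show ?thesis using q\<^sub>0_bound(2)[OF k True] S_bounds[OF True k] by simp
  next
    case False
    then have "q\<^sub>0 k u = 0" unfolding q\<^sub>0_def by (rule if_not_P)
    then show ?thesis by simp
  qed
  show ?thesis
    unfolding set_integrable_def
  proof (rule Bochner_Integration.integrable_bound[OF set_integrable_const_Icc[of s t "4 * real k", unfolded set_integrable_def]])
    show "AE u in lborel. norm (indicat_real {s..t} u *\<^sub>R q\<^sub>0 k u) \<le> norm (indicat_real {s..t} u *\<^sub>R (4 * real k))"
      using qb q\<^sub>0_bound(1)[OF k] by (intro AE_I2) (simp add: indicator_def)
  qed (use qm in measurable)
qed

text \<open>The finite variation part of \<open>S\<close>, with the singular contribution frozen
  once it has reached \<open>m\<close>. The cap makes the total variation deterministically bounded,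
  and before the cap is reached nothing changes.\<close>

definition \<Gamma> :: "nat \<Rightarrow> real \<Rightarrow> real \<Rightarrow> real" where
  "\<Gamma> k m t = (LINT s:{0..t}|lborel. d\<^sub>0 k s) - min (N k t) m"

definition c1 :: "nat \<Rightarrow> real \<Rightarrow> real" where
  "c1 k m = 1 + 2 * b + 2 * m * (2 * \<beta> * (k * (real n - k))) + \<bar>c k\<bar> + b * k"

text \<open>One increasing process with two tasks: it dominates the variation of \<Gamma> and the
  negative part of the drift of log S. In \<open>c1\<close> the last two terms serve the first task
  and the others the second; in the factor \<open>4 * m + 1\<close> the 1 serves the first and
  \<open>4 * m\<close> the second.\<close>

definition V :: "nat \<Rightarrow> real \<Rightarrow> real \<Rightarrow> real" where
  "V k m t = c1 k m * t + (4 * m + 1) * min (N k t) m"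

lemma min_N_mono: "k \<le> n \<Longrightarrow> 0 \<le> s \<Longrightarrow> s \<le> t \<Longrightarrow> min (N k s) m \<le> min (N k t) m"
  using N_diff(2)[of k s t] by auto

lemma c1_ge:
  assumes "k \<le> n" "0 < m"
  shows "\<bar>c k\<bar> + b * k \<le> c1 k m" "1 + 2 * b + 2 * m * (2 * \<beta> * (k * (real n - k))) \<le> c1 k m" "0 \<le> c1 k m"
proof -
  have "0 \<le> 2 * m * (2 * \<beta> * (k * (real n - k)))" using assms pars by simp
  moreover have "0 \<le> b * k" using b_nonneg by simp
  ultimately show "\<bar>c k\<bar> + b * k \<le> c1 k m" "1 + 2 * b + 2 * m * (2 * \<beta> * (k * (real n - k))) \<le> c1 k m" "0 \<le> c1 k m"
    using b_nonneg unfolding c1_def by linarith+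
qed

lemma \<Gamma>_variation:
  assumes k: "k \<le> n" and m: "0 < m" and s: "0 \<le> s" "s \<le> t"
  shows "\<bar>\<Gamma> k m t - \<Gamma> k m s\<bar> \<le> V k m t - V k m s"
proof -
  have e: "(LINT u:{0..t}|lborel. d\<^sub>0 k u) - (LINT u:{0..s}|lborel. d\<^sub>0 k u) = (LINT u:{s..t}|lborel. d\<^sub>0 k u)"
    by (rule set_integral_split[OF d\<^sub>0_integrable[OF k] s])
  let ?d = "\<bar>c k\<bar> + b * k"
  have db: "- ?d \<le> d\<^sub>0 k u" "d\<^sub>0 k u \<le> ?d" for u using d\<^sub>0_bound[OF k, of u] by linarith+
  have 1: "(LINT u:{s..t}|lborel. d\<^sub>0 k u) \<le> (LINT u:{s..t}|lborel. ?d)"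
    by (intro set_integral_mono d\<^sub>0_integrable[OF k] set_integrable_const_Icc db)
  have 2: "(LINT u:{s..t}|lborel. - ?d) \<le> (LINT u:{s..t}|lborel. d\<^sub>0 k u)"
    by (intro set_integral_mono d\<^sub>0_integrable[OF k] set_integrable_const_Icc db)
  have 3: "\<bar>LINT u:{s..t}|lborel. d\<^sub>0 k u\<bar> \<le> ?d * (t - s)"
    using 1 2 unfolding set_integral_const_Icc[OF s(2)] mult_minus_left by linarith
  have 4: "?d * (t - s) \<le> c1 k m * (t - s)" using c1_ge(1)[OF k m] s by (intro mult_right_mono) auto
  let ?M = "min (N k t) m - min (N k s) m"
  have M: "0 \<le> ?M" using min_N_mono[OF k s] by simp
  have "0 \<le> 4 * m * ?M" using M m by (intro mult_nonneg_nonneg) auto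
  then have 5: "?M \<le> (4 * m + 1) * ?M" by (simp add: distrib_right)
  have "\<Gamma> k m t - \<Gamma> k m s = (LINT u:{s..t}|lborel. d\<^sub>0 k u) - ?M" unfolding \<Gamma>_def e[symmetric] by simp
  moreover have "V k m t - V k m s = c1 k m * (t - s) + (4 * m + 1) * ?M" unfolding V_def by (simp add: algebra_simps)
  ultimately show ?thesis using 3 4 5 M by linarith
qed

lemma V_cont: "k \<le> n \<Longrightarrow> continuous_on {0..t} (V k m)"
  unfolding V_def by (intro continuous_intros N_cont)

lemma V_total: "k \<le> n \<Longrightarrow> 0 < m \<Longrightarrow> 0 \<le> t \<Longrightarrow> V k m t - V k m 0 \<le> c1 k m * t + (4 * m + 1) * m"
proof -
  assume k: "k \<le> n" and m: "0 < m" "0 \<le> t"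
  have e: "V k m 0 = 0" using N_diff(3)[OF k, of 0 0] m by (simp add: V_def)
  have "(4 * m + 1) * min (N k t) m \<le> (4 * m + 1) * m" using m by (intro mult_left_mono) auto
  then show ?thesis unfolding e V_def[of k m t] by simp
qed

text \<open>With y = S(s), the regular part of the drift of log S is at least 2 (y - S(u)) / y^2 - b
  S(u) / y; here \<open>2 \<le> c k\<close> meets the bracket bound. For \<open>u\<close> close to
  \<open>s\<close> this exceeds \<open>- (1 + 2 * b)\<close>. The singular part divided by y is
  bounded through \<open>\<nu>_le\<close>. The bound \<open>2 / m\<close> at time \<open>s\<close>
  leaves particle \<open>k + 1\<close> above \<open>1 / m\<close> during the whole step.\<close>

lemma drift_lower:
  assumes k: "k \<le> n" and ck: "2 \<le> c k" and m: "0 < m" and \<epsilon>: "0 < \<epsilon>"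
  shows "\<exists>h>0. \<forall>s t. 0 \<le> s \<and> s < t \<and> t \<le> \<tau> \<and> t - s < h \<and> live s \<and> N k s < m \<and>
      (k = n \<or> 2 / m \<le> l (Suc k) s) \<and> \<epsilon> \<le> S k s \<longrightarrow>
      - (V k m t - V k m s) \<le> (\<Gamma> k m t - \<Gamma> k m s) / S k s - (LINT u:{s..t}|lborel. q\<^sub>0 k u) / (2 * (S k s)\<^sup>2)"
proof -
  \<comment> \<open>The first bound keeps \<open>S k u\<close> below twice \<open>S k s\<close>; the
    second makes \<open>2 * (S k s - S k u)\<close> at least minus the square of
    \<open>S k s\<close>.\<close>
  define \<delta> where "\<delta> = min \<epsilon> (\<epsilon>\<^sup>2 / 2)"
  have \<delta>: "0 < \<delta>" "\<delta> \<le> \<epsilon>" "\<delta> \<le> \<epsilon>\<^sup>2 / 2" using \<epsilon> by (auto simp: \<delta>_def)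
  obtain h1 where h1: "h1 > 0" "\<And>s u. live s \<and> live u \<and> s \<le> \<tau> \<and> u \<le> \<tau> \<and> \<bar>u - s\<bar> < h1 \<Longrightarrow> \<bar>S k u - S k s\<bar> < \<delta>"
    using S_uniform[OF k \<delta>(1), of \<tau>] by blast
  have "\<exists>h2>0. \<forall>s u. k < n \<longrightarrow> live s \<and> live u \<and> s \<le> \<tau> \<and> u \<le> \<tau> \<and> \<bar>u - s\<bar> < h2 \<longrightarrow> \<bar>l (Suc k) u - l (Suc k) s\<bar> < 1 / m"
  proof (cases "k < n")
    case True
    then show ?thesis using l_Suc_uniform[OF True, of "1 / m" \<tau>] m by simp
  next
    case False
    then show ?thesis by (intro exI[of _ 1]) simp
  qed
  then obtain h2 where h2: "h2 > 0" "\<And>s u. k < n \<Longrightarrow> live s \<and> live u \<and> s \<le> \<tau> \<and> u \<le> \<tau> \<and> \<bar>u - s\<bar> < h2 \<Longrightarrow> \<bar>l (Suc k) u - l (Suc k) s\<bar> < 1 / m"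
    by blast
  let ?C = "2 * \<beta> * (k * (real n - k))"
  have C0: "0 \<le> ?C" using pars k by simp
  show ?thesis
  proof (intro exI[of _ "min h1 h2"] conjI allI impI)
    show "0 < min h1 h2" using h1 h2 by simp
    fix s t assume a: "0 \<le> s \<and> s < t \<and> t \<le> \<tau> \<and> t - s < min h1 h2 \<and> live s \<and> N k s < m \<and>
      (k = n \<or> 2 / m \<le> l (Suc k) s) \<and> \<epsilon> \<le> S k s"
    let ?y = "S k s"
    have y: "\<epsilon> \<le> ?y" "0 < ?y" using a \<epsilon> by auto
    have st: "0 \<le> s" "s \<le> t" using a by auto
    have near: "\<bar>S k u - ?y\<bar> < \<delta>" "k = n \<or> 1 / m \<le> l (Suc k) u" if u: "u \<in> {s..t}" "live u" for u
    proof -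
      show "\<bar>S k u - ?y\<bar> < \<delta>" using a u by (intro h1(2)) auto
      show "k = n \<or> 1 / m \<le> l (Suc k) u"
      proof (cases "k = n")
        case False
        then have kn: "k < n" using k by simp
        have "\<bar>l (Suc k) u - l (Suc k) s\<bar> < 1 / m" using a u by (intro h2(2)[OF kn]) auto
        moreover have "2 / m \<le> l (Suc k) s" using a False by simp
        moreover have "2 / m = 1 / m + 1 / m" by simp
        ultimately show ?thesis by linarith
      qed simp
    qed
    have S2: "0 \<le> S k u" "S k u \<le> 2 * ?y" if u: "u \<in> {s..t}" "live u" for u
      using near(1)[OF u] S_bounds[OF u(2) k] \<delta>(2) y by auto
    have dens: "- (1 + 2 * b) \<le> d\<^sub>0 k u / ?y - q\<^sub>0 k u / (2 * ?y\<^sup>2)" if u: "u \<in> {s..t}" for u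
    proof (cases "live u")
      case True
      have q: "q\<^sub>0 k u / (2 * ?y\<^sup>2) \<le> (4 * S k u) / (2 * ?y\<^sup>2)"
        using q\<^sub>0_bound(2)[OF k True] by (intro divide_right_mono) auto
      have d: "(2 - b * S k u) / ?y \<le> d\<^sub>0 k u / ?y"
        using ck y True by (intro divide_right_mono) (auto simp: d\<^sub>0_def)
      have bs: "b * S k u / ?y \<le> b * 2"
      proof -
        have "b * S k u \<le> b * (2 * ?y)" using S2[OF u True] b_nonneg by (intro mult_left_mono)
        then have "b * S k u / ?y \<le> b * (2 * ?y) / ?y" using y by (intro divide_right_mono) auto
        then show ?thesis using y by simp
      qed
      have "?y - S k u \<ge> - (?y\<^sup>2 / 2)"
      proof -
        have "\<epsilon>\<^sup>2 \<le> ?y\<^sup>2" using y \<epsilon> by (intro power_mono) auto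
        then show ?thesis using near(1)[OF u True] \<delta>(3) by linarith
      qed
      then have "2 * (?y - S k u) / ?y\<^sup>2 \<ge> 2 * (- (?y\<^sup>2 / 2)) / ?y\<^sup>2"
        by (intro divide_right_mono mult_left_mono) auto
      then have g: "- 1 \<le> 2 * (?y - S k u) / ?y\<^sup>2" using y by simp
      have e: "(2 - b * S k u) / ?y - (4 * S k u) / (2 * ?y\<^sup>2) = 2 * (?y - S k u) / ?y\<^sup>2 - b * S k u / ?y"
        using y by (simp add: field_simps power2_eq_square)
      have aux: "- (1 + 2 * b) \<le> D - Q" if "E1 - E2 = G - H" "Q \<le> E2" "E1 \<le> D" "H \<le> b * 2" "- 1 \<le> G"
        for D Q E1 E2 G H :: real using that by simp
      show ?thesis by (rule aux[OF e q d bs g])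
    next
      case False
      then have "d\<^sub>0 k u = 0" "q\<^sub>0 k u = 0" unfolding d\<^sub>0_def q\<^sub>0_def by (simp_all only: if_False)
      then show ?thesis using b_nonneg by simp
    qed
    have ii: "set_integrable lborel {s..t} (\<lambda>u. d\<^sub>0 k u / ?y)" "set_integrable lborel {s..t} (\<lambda>u. q\<^sub>0 k u / (2 * ?y\<^sup>2))"
      using d\<^sub>0_integrable[OF k] q\<^sub>0_integrable[OF k] by auto
    have "(LINT u:{s..t}|lborel. - (1 + 2 * b)) \<le> (LINT u:{s..t}|lborel. d\<^sub>0 k u / ?y - q\<^sub>0 k u / (2 * ?y\<^sup>2))"
      by (intro set_integral_mono set_integrable_const_Icc set_integral_diff(1) ii dens)
    then have I1: "- (1 + 2 * b) * (t - s) \<le> (LINT u:{s..t}|lborel. d\<^sub>0 k u) / ?y - (LINT u:{s..t}|lborel. q\<^sub>0 k u) / (2 * ?y\<^sup>2)"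
      unfolding set_integral_const_Icc[OF st(2)] set_integral_diff(2)[OF ii] by simp
    let ?M = "min (N k t) m - min (N k s) m"
    \<comment> \<open>The capped increment is the integral of the singular drift over [s, r], where
      \<open>r\<close> is the end of the step or, when the cap is crossed, a time at which
      \<open>N\<close> equals \<open>m\<close>; the pointwise bound is then integrated over this
      interval.\<close>
    have "\<exists>r\<in>{s..t}. N k r = min (N k t) m"
    proof (cases "N k t \<le> m")
      case True
      then show ?thesis using st by (intro bexI[of _ t]) auto
    next
      case False
      have "\<exists>r\<ge>s. r \<le> t \<and> N k r = m"
        by (rule IVT') (use a False st continuous_on_subset[OF N_cont[OF k, of t], of "{s..t}"] in auto)
      then show ?thesis using False by auto
    qed
    then obtain r where r: "s \<le> r" "r \<le> t" "N k r = min (N k t) m" by auto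
    have Ms: "min (N k s) m = N k s" using a by simp
    have M: "?M = (LINT u:{s..r}|lborel. \<nu>\<^sub>0 k u)"
      unfolding Ms r(3)[symmetric] by (rule N_diff(1)[OF k st(1) r(1)])
    have ni: "set_integrable lborel {s..r} (\<nu>\<^sub>0 k)"
      by (rule set_integrable_subset[OF \<nu>\<^sub>0_integrable[OF k, of r]]) (use st in auto)
    have wi: "set_integrable lborel {s..r} (\<lambda>u. 2 * ?y * m * ?C + 4 * ?y * m * \<nu>\<^sub>0 k u)"
      by (intro set_integral_add(1) set_integrable_const_Icc set_integrable_mult_right ni)
    have "(LINT u:{s..r}|lborel. \<nu>\<^sub>0 k u) \<le> (LINT u:{s..r}|lborel. 2 * ?y * m * ?C + 4 * ?y * m * \<nu>\<^sub>0 k u)"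
    proof (rule set_integral_mono_AE[OF ni wi])
      show "AE u in lborel. u \<in> {s..r} \<longrightarrow> \<nu>\<^sub>0 k u \<le> 2 * ?y * m * ?C + 4 * ?y * m * \<nu>\<^sub>0 k u"
        using strict_order
      proof eventually_elim
        case (elim u)
        show ?case
        proof
          assume u': "u \<in> {s..r}"
          then have u: "u \<in> {s..t}" using r by auto
          show "\<nu>\<^sub>0 k u \<le> 2 * ?y * m * ?C + 4 * ?y * m * \<nu>\<^sub>0 k u"
          proof (cases "live u")
            case True
            note o = elim[rule_format, OF True]
            have n0: "0 \<le> \<nu> k u" by (rule \<nu>_nonneg(1)[OF o k])
            have "\<nu> k u \<le> S k u * m * (?C + 2 * \<nu> k u)" by (rule \<nu>_le[OF o k m near(2)[OF u True]])
            also have "\<dots> \<le> (2 * ?y) * m * (?C + 2 * \<nu> k u)"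
              using S2[OF u True] m n0 C0 by (intro mult_right_mono) auto
            finally have "\<nu> k u \<le> 2 * ?y * m * ?C + 4 * ?y * m * \<nu> k u" by (simp add: algebra_simps)
            then show ?thesis using True by (simp add: \<nu>\<^sub>0_def)
          next
            case False
            then have "\<nu>\<^sub>0 k u = 0" unfolding \<nu>\<^sub>0_def by (rule if_not_P)
            then show ?thesis using y m C0 by simp
          qed
        qed
      qed
    qed
    also have "\<dots> = (LINT u:{s..r}|lborel. 2 * ?y * m * ?C) + (LINT u:{s..r}|lborel. 4 * ?y * m * \<nu>\<^sub>0 k u)"
      by (intro set_integral_add(2) set_integrable_const_Icc set_integrable_mult_right ni)
    also have "\<dots> = 2 * ?y * m * ?C * (r - s) + 4 * ?y * m * ?M"
      unfolding set_integral_const_Icc[OF r(1)] M by simp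
    finally have M2: "?M \<le> 2 * ?y * m * ?C * (r - s) + 4 * ?y * m * ?M" unfolding M[symmetric] .
    have "2 * ?y * m * ?C * (r - s) \<le> 2 * ?y * m * ?C * (t - s)" using r y m C0 by (intro mult_left_mono) auto
    then have "?M \<le> ?y * (2 * m * ?C * (t - s) + 4 * m * ?M)" using M2 by (simp add: algebra_simps)
    then have "?M / ?y \<le> ?y * (2 * m * ?C * (t - s) + 4 * m * ?M) / ?y" using y by (intro divide_right_mono) auto
    then have M3: "?M / ?y \<le> 2 * m * ?C * (t - s) + 4 * m * ?M" using y by simp
    have e: "(LINT u:{0..t}|lborel. d\<^sub>0 k u) - (LINT u:{0..s}|lborel. d\<^sub>0 k u) = (LINT u:{s..t}|lborel. d\<^sub>0 k u)"
      by (rule set_integral_split[OF d\<^sub>0_integrable[OF k] st])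
    have "\<Gamma> k m t - \<Gamma> k m s = (LINT u:{s..t}|lborel. d\<^sub>0 k u) - ?M" unfolding \<Gamma>_def e[symmetric] by simp
    then have G: "(\<Gamma> k m t - \<Gamma> k m s) / ?y = (LINT u:{s..t}|lborel. d\<^sub>0 k u) / ?y - ?M / ?y" by (simp add: diff_divide_distrib)
    have V: "V k m t - V k m s = c1 k m * (t - s) + (4 * m + 1) * ?M" unfolding V_def by (simp add: algebra_simps)
    have M0: "0 \<le> ?M" using min_N_mono[OF k st] by simp
    have c: "(1 + 2 * b + 2 * m * ?C) * (t - s) \<le> c1 k m * (t - s)"
      using c1_ge(2)[OF k m] st by (intro mult_right_mono) auto
    have e2: "(1 + 2 * b + 2 * m * ?C) * (t - s) = (1 + 2 * b) * (t - s) + 2 * m * ?C * (t - s)"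
      "(4 * m + 1) * ?M = 4 * m * ?M + ?M" by (rule distrib_right) (simp add: distrib_right)
    have aux: "- (X + Y) \<le> D - Mq - Q" if "- A1 \<le> D - Q" "Mq \<le> A2 + A3" "A1 + A2 \<le> X" "Y = A3 + A4" "0 \<le> A4"
      for X Y D Mq Q A1 A2 A3 A4 :: real using that by linarith
    show "- (V k m t - V k m s) \<le> (\<Gamma> k m t - \<Gamma> k m s) / S k s - (LINT u:{s..t}|lborel. q\<^sub>0 k u) / (2 * (S k s)\<^sup>2)"
      unfolding V G
      by (rule aux[OF I1[unfolded mult_minus_left] M3 c[unfolded e2(1)] e2(2) M0])
  qed
qed

end

context jacobi_path
begin

text \<open>Cutting off at \<open>T\<close> creates at most one discontinuity. If \<open>T\<close>
  is infinite, \<open>enn2real T\<close> is 0 and the excluded point is simply the origin.\<close>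

lemma continuous_live:
  assumes g: "continuous_on {t. live t} g" and s: "s \<in> {0..t}" "s \<noteq> enn2real T"
  shows "continuous (at s within {0..t}) (\<lambda>s. if live s then g s else (0::real))"
proof (cases "live s")
  case True
  then obtain s' where s': "s < s'" "ennreal s' < T" using ennreal_less_dense by blast
  show ?thesis
    unfolding continuous_within_eps_delta
  proof (intro allI impI)
    fix e :: real assume e: "e > 0"
    have "s \<in> {t. live t}" using True by simp
    from g[unfolded continuous_on_iff, rule_format, OF this e]
    obtain d where d0: "d > 0" and d1: "\<forall>u\<in>{t. live t}. dist u s < d \<longrightarrow> dist (g u) (g s) < e"
      by (elim exE conjE)
    have d: "d > 0" "\<And>u. live u \<Longrightarrow> dist u s < d \<Longrightarrow> dist (g u) (g s) < e"
      using d0 by (assumption, use d1 in blast)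
    show "\<exists>d>0. \<forall>u\<in>{0..t}. dist u s < d \<longrightarrow> dist (if live u then g u else 0) (if live s then g s else 0) < e"
    proof (intro exI[of _ "min d (s' - s)"] conjI ballI impI)
      show "0 < min d (s' - s)" using d s' by simp
      fix u assume u: "u \<in> {0..t}" "dist u s < min d (s' - s)"
      then have "u \<le> s'" by (auto simp: dist_real_def)
      then have "ennreal u < T" using s'(2) ennreal_leI[of u s'] by (simp add: le_less_trans)
      then have lu: "live u" using u by simp
      show "dist (if live u then g u else 0) (if live s then g s else 0) < e"
        using d(2)[OF lu] u lu True by simp
    qed
  qed
next
  case False
  then have Ts: "T \<le> ennreal s" "0 \<le> s" using s by (auto simp: not_less)
  then obtain r where r: "T = ennreal r" "0 \<le> r" by (cases T) (auto simp: top_unique)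
  then have rs: "r < s" using Ts s(2) by simp
  show ?thesis
    unfolding continuous_within_eps_delta
  proof (intro allI impI exI[of _ "s - r"] conjI ballI)
    fix e :: real and u assume e: "e > 0" and u: "u \<in> {0..t}" "dist u s < s - r"
    have "r < u" using u by (auto simp: dist_real_def)
    then have "\<not> live u" using r by (auto simp: ennreal_less_iff)
    then show "dist (if live u then g u else 0) (if live s then g s else 0) < e" using False e by (simp only: if_False dist_self)
  qed (use rs in simp)
qed

lemma q_single_integrable:
  assumes "i \<in> {1..n}"
  shows "set_integrable lborel {s..t} (\<lambda>u. if live u then 4 * (l i u * (1 - l i u)) else 0)"
proof -
  let ?f = "\<lambda>u. if live u then 4 * (l i u * (1 - l i u)) else 0"
  have m: "{t. live t} \<in> sets borel" by measurable
  have "(\<lambda>u. indicator {t. live t} u *\<^sub>R (4 * (l i u * (1 - l i u)))) \<in> borel_measurable borel"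
    using assms by (intro borel_measurable_continuous_on_indicator m continuous_intros l_cont) auto
  moreover have "(\<lambda>u. indicator {t. live t} u *\<^sub>R (4 * (l i u * (1 - l i u)))) = ?f"
    by (auto simp: fun_eq_iff)
  ultimately have qm: "?f \<in> borel_measurable borel" by (simp only:)
  have qb: "\<bar>?f u\<bar> \<le> 4" for u
  proof (cases "live u")
    case True
    have b: "0 \<le> l i u" "l i u \<le> 1" using weak_order[OF True, of i i] assms by auto
    then have "l i u * (1 - l i u) \<le> 1 * 1" by (intro mult_mono) auto
    then show ?thesis using True b by simp
  next
    case False
    then show ?thesis by (simp only: if_False)
  qed
  show ?thesis
    unfolding set_integrable_def
  proof (rule Bochner_Integration.integrable_bound[OF set_integrable_const_Icc[of s t "4", unfolded set_integrable_def]])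
    show "AE u in lborel. norm (indicat_real {s..t} u *\<^sub>R ?f u) \<le> norm (indicat_real {s..t} u *\<^sub>R (4::real))"
    proof (rule AE_I2)
      fix u
      show "norm (indicat_real {s..t} u *\<^sub>R ?f u) \<le> norm (indicat_real {s..t} u *\<^sub>R (4::real))"
        using qb[of u] unfolding norm_scaleR by (intro mult_left_mono) auto
    qed
  qed (use qm in measurable)
qed

lemma q\<^sub>0_sum:
  assumes k: "k \<le> n"
  shows "(\<Sum>i=1..k. LINT u:{s..t}|lborel. (if live u then 4 * (l i u * (1 - l i u)) else 0)) = (LINT u:{s..t}|lborel. q\<^sub>0 k u)"
proof -
  have e: "q\<^sub>0 k u = (\<Sum>i=1..k. if live u then 4 * (l i u * (1 - l i u)) else 0)" for u
    unfolding q\<^sub>0_def by (cases "live u") (simp_all only: simp_thms if_True if_False sum.neutral_const)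
  show ?thesis
    unfolding set_lebesgue_integral_def e scaleR_sum_right
    by (rule Bochner_Integration.integral_sum[symmetric])
      (use q_single_integrable k in \<open>auto simp: set_integrable_def simp del: real_scaleR_def\<close>)
qed

end

section \<open>The random system: adaptedness and verification of the barrier conditions\<close>

text \<open>The properties are stated so that they survive reflection: moments for sums over
  arbitrary index sets, and the integrand only through its square. The link between \<open>X\<close>
  and the Brownian motion is reduced to these moment identities.\<close>

locale jacobi_solution = brownian_setup M F n B
  for M :: "'a measure" and F :: "ennreal \<Rightarrow> 'a measure" and n B +
  fixes p q \<beta> :: real and lam X H :: "nat \<Rightarrow> real \<Rightarrow> 'a \<Rightarrow> real" and T :: "'a \<Rightarrow> ennreal"
  assumes pars: "0 < \<beta>" "0 \<le> p" "0 \<le> q"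
    and path: "AE \<omega> in M. jacobi_path n p q \<beta> (\<lambda>i t. lam i t \<omega>) (\<lambda>i t. X i t \<omega>) (T \<omega>)"
    and X0: "AE \<omega> in M. \<forall>i\<in>{1..n}. X i 0 \<omega> = 0"
    and live_G: "\<And>t. 0 \<le> t \<Longrightarrow> {\<omega>\<in>space M. ennreal t < T \<omega>} \<in> sets (G t)"
    and lam_G: "\<And>i t. i \<in> {1..n} \<Longrightarrow> 0 \<le> t \<Longrightarrow> (\<lambda>\<omega>. if ennreal t < T \<omega> then lam i t \<omega> else 0) \<in> borel_measurable (G t)"
    and X_G: "\<And>i t. i \<in> {1..n} \<Longrightarrow> 0 \<le> t \<Longrightarrow> X i t \<in> borel_measurable (G t)"
    and H_sq: "AE \<omega> in M. \<forall>i\<in>{1..n}. \<forall>u\<ge>0. (H i u \<omega>)\<^sup>2 = (if ennreal u < T \<omega> then 4 * (lam i u \<omega> * (1 - lam i u \<omega>)) else 0)"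
    and fourth_moment: "\<And>J s t. J \<subseteq> {1..n} \<Longrightarrow> 0 \<le> s \<Longrightarrow> s < t \<Longrightarrow>
        integrable P (\<lambda>\<omega>. ((\<Sum>i\<in>J. X i t \<omega>) - (\<Sum>i\<in>J. X i s \<omega>)) ^ 4) \<and>
        E (\<lambda>\<omega>. ((\<Sum>i\<in>J. X i t \<omega>) - (\<Sum>i\<in>J. X i s \<omega>)) ^ 4) \<le> 96 * real n ^ 4 * (t - s)\<^sup>2"
    and variation: "\<And>J s t. J \<subseteq> {1..n} \<Longrightarrow> 0 \<le> s \<Longrightarrow> s < t \<Longrightarrow>
        (\<lambda>\<omega>. \<Sum>i\<in>J. LINT u:{s..t}|lborel. (H i u \<omega>)\<^sup>2) \<in> borel_measurable P \<and>
        (AE \<omega> in M. 0 \<le> (\<Sum>i\<in>J. LINT u:{s..t}|lborel. (H i u \<omega>)\<^sup>2) \<and>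
           (\<Sum>i\<in>J. LINT u:{s..t}|lborel. (H i u \<omega>)\<^sup>2) \<le> real n * (t - s))"
    and martingale: "\<And>J s t Z K. J \<subseteq> {1..n} \<Longrightarrow> 0 \<le> s \<Longrightarrow> s < t \<Longrightarrow> Z \<in> borel_measurable (G s) \<Longrightarrow>
        (\<And>\<omega>. \<omega> \<in> space M \<Longrightarrow> \<bar>Z \<omega>\<bar> \<le> K) \<Longrightarrow>
        E (\<lambda>\<omega>. Z \<omega> * ((\<Sum>i\<in>J. X i t \<omega>) - (\<Sum>i\<in>J. X i s \<omega>))) = 0 \<and>
        E (\<lambda>\<omega>. Z \<omega> * ((\<Sum>i\<in>J. X i t \<omega>) - (\<Sum>i\<in>J. X i s \<omega>))\<^sup>2) =
        E (\<lambda>\<omega>. Z \<omega> * (\<Sum>i\<in>J. LINT u:{s..t}|lborel. (H i u \<omega>)\<^sup>2))"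
begin

definition S :: "nat \<Rightarrow> real \<Rightarrow> 'a \<Rightarrow> real" where "S k t \<omega> = (\<Sum>i=1..k. lam i t \<omega>)"

lemma path_S: "jacobi_path.S (\<lambda>i t. lam i t \<omega>) k t = S k t \<omega>"
  if "jacobi_path n p q \<beta> (\<lambda>i t. lam i t \<omega>) (\<lambda>i t. X i t \<omega>) (T \<omega>)"
  using jacobi_path.S_def[OF that] by (simp add: S_def)

lemma live_measurable:
  assumes "0 \<le> t" and f: "f \<in> borel_measurable (G t)" and eq: "\<And>\<omega>. ennreal t < T \<omega> \<Longrightarrow> f \<omega> = g \<omega>"
  shows "(\<lambda>\<omega>. if ennreal t < T \<omega> then g \<omega> else (0::real)) \<in> borel_measurable (G t)"
proof -
  have "(\<lambda>\<omega>. if ennreal t < T \<omega> then f \<omega> else 0) \<in> borel_measurable (G t)"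
    by (rule measurable_If) (use f live_G[OF assms(1)] in auto)
  moreover have "(\<lambda>\<omega>. if ennreal t < T \<omega> then f \<omega> else 0) = (\<lambda>\<omega>. if ennreal t < T \<omega> then g \<omega> else 0)"
    using eq by (auto simp: fun_eq_iff)
  ultimately show ?thesis by (simp only:)
qed

lemma singleton_integral: "set_lebesgue_integral lborel {0::real} f = (0::real)"
proof -
  have "AE s in lborel. indicat_real {0} s *\<^sub>R f s = 0"
    using AE_lborel_singleton[of 0] by eventually_elim auto
  then show ?thesis unfolding set_lebesgue_integral_def by (rule integral_eq_zero_AE)
qed

lemma live_integral_adapted:
  fixes g :: "real \<Rightarrow> 'a \<Rightarrow> real" and C :: real
  assumes t: "0 \<le> t" and g: "\<And>s. 0 \<le> s \<Longrightarrow> (\<lambda>\<omega>. if ennreal s < T \<omega> then g s \<omega> else 0) \<in> borel_measurable (G s)"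
    and b: "AE \<omega> in M. \<forall>s\<ge>0. ennreal s < T \<omega> \<longrightarrow> \<bar>g s \<omega>\<bar> \<le> C" and C: "0 \<le> C"
    and c: "AE \<omega> in M. continuous_on {t. 0 \<le> t \<and> ennreal t < T \<omega>} (\<lambda>s. g s \<omega>)"
  shows "(\<lambda>\<omega>. LINT s:{0..t}|lborel. (if 0 \<le> s \<and> ennreal s < T \<omega> then g s \<omega> else 0)) \<in> borel_measurable (G t)"
proof (cases "t = 0")
  case True
  show ?thesis unfolding True by (simp add: singleton_integral)
next
  case False
  show ?thesis
  proof (rule integral_adapted)
    show "0 < t" using False t by simp
    show "(\<lambda>\<omega>. if 0 \<le> s \<and> ennreal s < T \<omega> then g s \<omega> else 0) \<in> borel_measurable (G s)" if "0 \<le> s" for s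
      using g[OF that] that by simp
    show "AE \<omega> in M. (\<forall>s\<in>{0..t}. \<bar>if 0 \<le> s \<and> ennreal s < T \<omega> then g s \<omega> else 0\<bar> \<le> C) \<and>
       (\<exists>c. \<forall>s\<in>{0..t}. s \<noteq> c \<longrightarrow>
          continuous (at s within {0..t}) (\<lambda>s. if 0 \<le> s \<and> ennreal s < T \<omega> then g s \<omega> else 0))"
      using path b c
    proof eventually_elim
      case (elim \<omega>)
      show ?case
      proof (intro conjI exI[of _ "enn2real (T \<omega>)"] ballI impI)
        show "\<bar>if 0 \<le> s \<and> ennreal s < T \<omega> then g s \<omega> else 0\<bar> \<le> C" for s
          using elim(2) C by simp
        show "continuous (at s within {0..t}) (\<lambda>s. if 0 \<le> s \<and> ennreal s < T \<omega> then g s \<omega> else 0)"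
          if "s \<in> {0..t}" "s \<noteq> enn2real (T \<omega>)" for s
          by (rule jacobi_path.continuous_live[OF elim(1) elim(3) that])
      qed
    qed
  qed
qed

definition N :: "nat \<Rightarrow> real \<Rightarrow> 'a \<Rightarrow> real" where
  "N k t \<omega> = jacobi_path.N n \<beta> (\<lambda>i t. lam i t \<omega>) (T \<omega>) k t"
definition \<Gamma> :: "nat \<Rightarrow> real \<Rightarrow> real \<Rightarrow> 'a \<Rightarrow> real" where
  "\<Gamma> k m t \<omega> = jacobi_path.\<Gamma> n p q \<beta> (\<lambda>i t. lam i t \<omega>) (T \<omega>) k m t"
definition V :: "nat \<Rightarrow> real \<Rightarrow> real \<Rightarrow> 'a \<Rightarrow> real" where
  "V k m t \<omega> = jacobi_path.V n p q \<beta> (\<lambda>i t. lam i t \<omega>) (T \<omega>) k m t"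

text \<open>The regularised interactions are bounded and continuous before \<open>T\<close>, so
  their time integrals are adapted; \<open>N\<close> is their limit by
  \<open>N_limit\<close>.\<close>

lemma N_G:
  assumes k: "k \<le> n" and t: "0 \<le> t"
  shows "N k t \<in> borel_measurable (G t)"
proof (rule augment_measurable_AE_lim[OF subalgebra_F])
  let ?v = "\<lambda>L s \<omega>. 2 * \<beta> * (\<Sum>i=1..k. \<Sum>j=k+1..n. lam i s \<omega> * (1 - lam j s \<omega>) / max (lam j s \<omega> - lam i s \<omega>) (1 / real (Suc L)))"
  let ?lm = "\<lambda>i s \<omega>. if ennreal s < T \<omega> then lam i s \<omega> else 0"
  have e: "jacobi_path.\<nu>\<^sub>L n \<beta> (\<lambda>i t. lam i t \<omega>) k L s = ?v L s \<omega>"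
    if "jacobi_path n p q \<beta> (\<lambda>i t. lam i t \<omega>) (\<lambda>i t. X i t \<omega>) (T \<omega>)" for \<omega> L s
    by (rule jacobi_path.\<nu>\<^sub>L_def[OF that])
  show "(\<lambda>\<omega>. LINT s:{0..t}|lborel. (if 0 \<le> s \<and> ennreal s < T \<omega> then ?v L s \<omega> else 0)) \<in> borel_measurable (G t)" for L
  proof (rule live_integral_adapted[OF t, where C="2 * \<beta> * (\<Sum>i=1..k. \<Sum>j=k+1..n. real (Suc L))"])
    fix s :: real assume s: "0 \<le> s"
    have m: "?lm i s \<in> borel_measurable (G s)" if "i \<in> {1..n}" for i by (rule lam_G[OF that s])
    show "(\<lambda>\<omega>. if ennreal s < T \<omega> then ?v L s \<omega> else 0) \<in> borel_measurable (G s)"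
    proof (rule live_measurable[OF s])
      show "(\<lambda>\<omega>. 2 * \<beta> * (\<Sum>i=1..k. \<Sum>j=k+1..n. ?lm i s \<omega> * (1 - ?lm j s \<omega>) / max (?lm j s \<omega> - ?lm i s \<omega>) (1 / real (Suc L)))) \<in> borel_measurable (G s)"
        using k by (intro borel_measurable_times borel_measurable_sum borel_measurable_divide borel_measurable_diff
          borel_measurable_max borel_measurable_const m) auto
    qed simp
  next
    show "AE \<omega> in M. \<forall>s\<ge>0. ennreal s < T \<omega> \<longrightarrow> \<bar>?v L s \<omega>\<bar> \<le> 2 * \<beta> * (\<Sum>i=1..k. \<Sum>j=k+1..n. real (Suc L))"
      using path
    proof eventually_elim
      case (elim \<omega>)
      show ?case
      proof (intro allI impI)
        fix s :: real assume s: "0 \<le> s" "ennreal s < T \<omega>"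
        then have "0 \<le> s \<and> ennreal s < T \<omega>" by simp
        from jacobi_path.\<nu>\<^sub>L_bound[OF elim k this, of L]
        show "\<bar>?v L s \<omega>\<bar> \<le> 2 * \<beta> * (\<Sum>i=1..k. \<Sum>j=k+1..n. real (Suc L))" unfolding e[OF elim] by linarith
      qed
    qed
    show "AE \<omega> in M. continuous_on {t. 0 \<le> t \<and> ennreal t < T \<omega>} (\<lambda>s. ?v L s \<omega>)"
      using path
    proof eventually_elim
      case (elim \<omega>)
      have "jacobi_path.\<nu>\<^sub>L n \<beta> (\<lambda>i t. lam i t \<omega>) k L = (\<lambda>s. ?v L s \<omega>)" by (rule ext) (rule e[OF elim])
      with jacobi_path.\<nu>\<^sub>L_cont[OF elim k, of L] show ?case by (simp only:)
    qed
    show "0 \<le> 2 * \<beta> * (\<Sum>i=1..k. \<Sum>j=k+1..n. real (Suc L))" using pars by (intro mult_nonneg_nonneg sum_nonneg) auto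
  qed
  show "AE \<omega> in M. (\<lambda>L. LINT s:{0..t}|lborel. (if 0 \<le> s \<and> ennreal s < T \<omega> then ?v L s \<omega> else 0)) \<longlonglongrightarrow> N k t \<omega>"
    using path
  proof eventually_elim
    case (elim \<omega>)
    from jacobi_path.N_limit[OF elim k, of t] show ?case unfolding e[OF elim] N_def .
  qed
qed

lemma S_live_G: "k \<le> n \<Longrightarrow> 0 \<le> s \<Longrightarrow> (\<lambda>\<omega>. if ennreal s < T \<omega> then S k s \<omega> else 0) \<in> borel_measurable (G s)"
proof (rule live_measurable)
  assume a: "k \<le> n" "0 \<le> s"
  show "(\<lambda>\<omega>. \<Sum>i=1..k. if ennreal s < T \<omega> then lam i s \<omega> else 0) \<in> borel_measurable (G s)"
    using a by (intro borel_measurable_sum lam_G) auto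
qed (auto simp: S_def)

lemma \<Gamma>_G:
  assumes k: "k \<le> n" and t: "0 \<le> t"
  shows "\<Gamma> k m t \<in> borel_measurable (G t)"
proof -
  let ?c = "jacobi_path.c n p \<beta> k" and ?b = "jacobi_path.b p q \<beta>"
  let ?d = "\<lambda>s \<omega>. ?c - ?b * S k s \<omega>"
  have e: "jacobi_path.d\<^sub>0 n p q \<beta> (\<lambda>i t. lam i t \<omega>) (T \<omega>) k s = (if 0 \<le> s \<and> ennreal s < T \<omega> then ?d s \<omega> else 0)"
    if "jacobi_path n p q \<beta> (\<lambda>i t. lam i t \<omega>) (\<lambda>i t. X i t \<omega>) (T \<omega>)" for \<omega> s
    unfolding jacobi_path.d\<^sub>0_def[OF that] path_S[OF that] ..
  have 1: "(\<lambda>\<omega>. LINT s:{0..t}|lborel. (if 0 \<le> s \<and> ennreal s < T \<omega> then ?d s \<omega> else 0)) \<in> borel_measurable (G t)"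
  proof (rule live_integral_adapted[OF t, where C="\<bar>?c\<bar> + \<bar>?b * k\<bar>"])
    fix s :: real assume s: "0 \<le> s"
    show "(\<lambda>\<omega>. if ennreal s < T \<omega> then ?d s \<omega> else 0) \<in> borel_measurable (G s)"
    proof (rule live_measurable[OF s])
      show "(\<lambda>\<omega>. ?c - ?b * (if ennreal s < T \<omega> then S k s \<omega> else 0)) \<in> borel_measurable (G s)"
        by (intro borel_measurable_diff borel_measurable_times borel_measurable_const S_live_G[OF k s])
    qed simp
  next
    show "AE \<omega> in M. \<forall>s\<ge>0. ennreal s < T \<omega> \<longrightarrow> \<bar>?d s \<omega>\<bar> \<le> \<bar>?c\<bar> + \<bar>?b * k\<bar>"
      using path
    proof eventually_elim
      case (elim \<omega>)
      show ?case
      proof (intro allI impI)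
        fix s :: real assume s: "0 \<le> s" "ennreal s < T \<omega>"
        have "\<bar>if 0 \<le> s \<and> ennreal s < T \<omega> then ?d s \<omega> else 0\<bar> \<le> \<bar>?c\<bar> + ?b * k"
          using jacobi_path.d\<^sub>0_bound[OF elim k, of s] unfolding e[OF elim] .
        then have "\<bar>?d s \<omega>\<bar> \<le> \<bar>?c\<bar> + ?b * k" using s by simp
        then show "\<bar>?d s \<omega>\<bar> \<le> \<bar>?c\<bar> + \<bar>?b * k\<bar>" by linarith
      qed
    qed
    show "AE \<omega> in M. continuous_on {t. 0 \<le> t \<and> ennreal t < T \<omega>} (\<lambda>s. ?d s \<omega>)"
      using path
    proof eventually_elim
      case (elim \<omega>)
      have "jacobi_path.S (\<lambda>i t. lam i t \<omega>) k = (\<lambda>s. S k s \<omega>)" by (rule ext) (rule path_S[OF elim])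
      with jacobi_path.S_cont[OF elim k] have "continuous_on {t. 0 \<le> t \<and> ennreal t < T \<omega>} (\<lambda>s. S k s \<omega>)" by (simp only:)
      then show ?case by (intro continuous_on_diff continuous_on_mult continuous_on_const)
    qed
  qed simp
  have 2: "(\<lambda>\<omega>. (LINT s:{0..t}|lborel. (if 0 \<le> s \<and> ennreal s < T \<omega> then ?d s \<omega> else 0)) - min (N k t \<omega>) m) \<in> borel_measurable (G t)"
    using 1 N_G[OF k t] by (intro borel_measurable_diff borel_measurable_min borel_measurable_const)
  show ?thesis
  proof (rule augment_measurable_AE_cong[OF subalgebra_F 2])
    show "AE \<omega> in M. (LINT s:{0..t}|lborel. (if 0 \<le> s \<and> ennreal s < T \<omega> then ?d s \<omega> else 0)) - min (N k t \<omega>) m = \<Gamma> k m t \<omega>"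
      using path
    proof eventually_elim
      case (elim \<omega>)
      show ?case unfolding \<Gamma>_def jacobi_path.\<Gamma>_def[OF elim] e[OF elim] N_def ..
    qed
  qed
qed

text \<open>On this event the cap on the singular drift is inactive, particle \<open>k + 1\<close>
  is high enough for \<open>drift_lower\<close>, and the starting value is at least the level
  \<open>1 / m\<close> used as \<open>y0\<close>. The last condition concerns time 0 only, so it is
  known at every \<open>t\<close>.\<close>

definition A :: "nat \<Rightarrow> real \<Rightarrow> real \<Rightarrow> 'a set" where
  "A k m t = {\<omega>\<in>space M. ennreal t < T \<omega> \<and> N k t \<omega> < m \<and> (k = n \<or> 2 / m \<le> lam (Suc k) t \<omega>) \<and> 1 / m \<le> S k 0 \<omega>}"

lemma live_mono: "ennreal t < T \<omega> \<Longrightarrow> s \<le> t \<Longrightarrow> ennreal s < T \<omega>"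
  by (rule le_less_trans[OF ennreal_leI])

lemma A_G:
  assumes k: "k \<le> n" and t: "0 \<le> t" and m: "0 < m"
  shows "A k m t \<in> sets (G t)"
proof -
  let ?lm = "\<lambda>\<omega>. if ennreal t < T \<omega> then lam (Suc k) t \<omega> else 0"
  let ?S = "\<lambda>\<omega>. if ennreal 0 < T \<omega> then S k 0 \<omega> else 0"
  have [measurable]: "{\<omega>\<in>space (G t). ennreal t < T \<omega>} \<in> sets (G t)" using live_G[OF t] by simp
  have [measurable]: "N k t \<in> borel_measurable (G t)" by (rule N_G[OF k t])
  have [measurable]: "?S \<in> borel_measurable (G t)" by (rule G_mono[OF S_live_G[OF k order_refl] t])
  have l: "{\<omega>\<in>space (G t). k = n \<or> 2 / m \<le> ?lm \<omega>} \<in> sets (G t)"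
  proof (cases "k = n")
    case False
    then have [measurable]: "?lm \<in> borel_measurable (G t)" using k t by (intro lam_G) auto
    show ?thesis by measurable
  qed (use sets.top[of "G t"] in simp)
  have "{\<omega>\<in>space (G t). ennreal t < T \<omega>} \<inter> {\<omega>\<in>space (G t). N k t \<omega> < m} \<inter>
      {\<omega>\<in>space (G t). k = n \<or> 2 / m \<le> ?lm \<omega>} \<inter> {\<omega>\<in>space (G t). 1 / m \<le> ?S \<omega>} \<in> sets (G t)"
    using l by measurable
  moreover have "{\<omega>\<in>space (G t). ennreal t < T \<omega>} \<inter> {\<omega>\<in>space (G t). N k t \<omega> < m} \<inter>
      {\<omega>\<in>space (G t). k = n \<or> 2 / m \<le> ?lm \<omega>} \<inter> {\<omega>\<in>space (G t). 1 / m \<le> ?S \<omega>} = A k m t"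
    unfolding A_def using live_mono[OF _ t] by auto
  ultimately show ?thesis by (simp only:)
qed

definition Y0 :: "nat \<Rightarrow> 'a \<Rightarrow> real" where "Y0 k \<omega> = (if ennreal 0 < T \<omega> then S k 0 \<omega> else 0)"
definition XS :: "nat \<Rightarrow> real \<Rightarrow> 'a \<Rightarrow> real" where "XS k t \<omega> = (\<Sum>i=1..k. X i t \<omega>)"
definition Q :: "nat \<Rightarrow> real \<Rightarrow> real \<Rightarrow> 'a \<Rightarrow> real" where
  "Q k s t \<omega> = (\<Sum>i=1..k. LINT u:{s..t}|lborel. (H i u \<omega>)\<^sup>2)"

text \<open>As long as the cap is not exceeded, the process watched by the barrier is
  \<open>S\<close> itself.\<close>

lemma Y_eq:
  assumes \<omega>: "jacobi_path n p q \<beta> (\<lambda>i t. lam i t \<omega>) (\<lambda>i t. X i t \<omega>) (T \<omega>)"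
    and k: "k \<le> n" and t: "0 \<le> t" "ennreal t < T \<omega>" "N k t \<omega> \<le> m"
  shows "Y0 k \<omega> + XS k t \<omega> + \<Gamma> k m t \<omega> = S k t \<omega>"
proof -
  have l: "0 \<le> t \<and> ennreal t < T \<omega>" using t by simp
  have 0: "ennreal 0 < T \<omega>" by (rule live_mono[OF t(2,1)])
  show ?thesis
    using jacobi_path.S_decomposition_live(2)[OF \<omega> k l] t(3) 0
    unfolding path_S[OF \<omega>] Y0_def XS_def \<Gamma>_def jacobi_path.\<Gamma>_def[OF \<omega>] N_def by simp
qed

text \<open>The total variation constant is the one of \<open>V_total\<close>, the upper level is
  \<open>k\<close> because each of the \<open>k\<close> particles is at most 1, and the bracket is
  at most \<open>n\<close> times the elapsed time.\<close>

lemma barrier: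
  assumes k: "1 \<le> k" "k \<le> n" and ck: "2 \<le> \<beta> * k * (p - n + k)" and m: "1 \<le> m" and \<tau>: "0 < \<tau>"
  shows "log_barrier M F n B (XS k) (\<Gamma> k m) (V k m) (Y0 k) (Q k) (A k m) \<tau> k (1 / m) (96 * real n ^ 4) n
    (jacobi_path.c1 n p q \<beta> k m * \<tau> + (4 * m + 1) * m)"
proof -
  have J: "{1..k} \<subseteq> {1..n}" using k by auto
  have m0: "0 < m" using m by simp
  show ?thesis
  proof (intro log_barrier.intro log_barrier_axioms.intro brownian_setup_axioms)
    show "0 < \<tau>" by fact
    show "0 < 1 / m" using m0 by simp
    have "1 / m \<le> 1" using m by simp
    then show "1 / m \<le> real k" using k by linarith
    show "0 \<le> 96 * real n ^ 4" "0 \<le> real n" by auto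
    show "0 \<le> jacobi_path.c1 n p q \<beta> k m * \<tau> + (4 * m + 1) * m"
    proof -
      \<comment> \<open>The constant is deterministic, but the facts about it live in
        \<open>jacobi_path\<close>; one good trajectory gives access to them.\<close>
      obtain \<omega> where \<omega>: "jacobi_path n p q \<beta> (\<lambda>i t. lam i t \<omega>) (\<lambda>i t. X i t \<omega>) (T \<omega>)"
        using eventually_happens'[OF ae_filter_bot path] by blast
      show ?thesis using jacobi_path.c1_ge(3)[OF \<omega> k(2) m0] \<tau> m0 by simp
    qed
    show "XS k t \<in> borel_measurable (G t)" if "0 \<le> t" for t
      unfolding XS_def[abs_def] using k that by (intro borel_measurable_sum X_G) auto
    show "\<Gamma> k m t \<in> borel_measurable (G t)" if "0 \<le> t" for t by (rule \<Gamma>_G[OF k(2) that])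
    show "Y0 k \<in> borel_measurable (G 0)" unfolding Y0_def[abs_def] by (rule S_live_G[OF k(2) order_refl])
    show "A k m t \<in> sets (G t)" if "0 \<le> t" for t by (rule A_G[OF k(2) that m0])
    fix s t :: real assume st: "0 \<le> s" "s < t"
    show "integrable P (\<lambda>\<omega>. (XS k t \<omega> - XS k s \<omega>) ^ 4)" "E (\<lambda>\<omega>. (XS k t \<omega> - XS k s \<omega>) ^ 4) \<le> 96 * real n ^ 4 * (t - s)\<^sup>2"
      using fourth_moment[OF J st] by (auto simp: XS_def)
    show "Q k s t \<in> borel_measurable P" "AE \<omega> in M. 0 \<le> Q k s t \<omega> \<and> Q k s t \<omega> \<le> real n * (t - s)"
      using variation[OF J st] by (auto simp: Q_def[abs_def])
    fix Z and K :: real assume "Z \<in> borel_measurable (G s)" "\<And>\<omega>. \<omega> \<in> space M \<Longrightarrow> \<bar>Z \<omega>\<bar> \<le> K"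
    from martingale[OF J st this]
    show "E (\<lambda>\<omega>. Z \<omega> * (XS k t \<omega> - XS k s \<omega>)) = 0 \<and>
        E (\<lambda>\<omega>. Z \<omega> * (XS k t \<omega> - XS k s \<omega>)\<^sup>2) = E (\<lambda>\<omega>. Z \<omega> * Q k s t \<omega>)"
      by (simp add: XS_def Q_def)
  next
    show "AE \<omega> in M. continuous_on {0..\<tau>} (\<lambda>t. V k m t \<omega>) \<and>
      V k m \<tau> \<omega> - V k m 0 \<omega> \<le> jacobi_path.c1 n p q \<beta> k m * \<tau> + (4 * m + 1) * m \<and>
      (\<forall>s t. 0 \<le> s \<and> s \<le> t \<and> t \<le> \<tau> \<longrightarrow> \<bar>\<Gamma> k m t \<omega> - \<Gamma> k m s \<omega>\<bar> \<le> V k m t \<omega> - V k m s \<omega>)"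
      using path
    proof eventually_elim
      case (elim \<omega>)
      show ?case
        unfolding V_def \<Gamma>_def
        using jacobi_path.V_cont[OF elim k(2), of \<tau> m] jacobi_path.V_total[OF elim k(2) m0, of \<tau>] \<tau>
          jacobi_path.\<Gamma>_variation[OF elim k(2) m0] by auto
    qed
    show "AE \<omega> in M. \<forall>t\<in>{0..\<tau>}. \<omega> \<in> A k m t \<longrightarrow> Y0 k \<omega> + XS k t \<omega> + \<Gamma> k m t \<omega> \<le> real k"
      using path
    proof eventually_elim
      case (elim \<omega>)
      show ?case
      proof (intro ballI impI)
        fix t assume t: "t \<in> {0..\<tau>}" "\<omega> \<in> A k m t"
        then have a: "0 \<le> t" "ennreal t < T \<omega>" "N k t \<omega> \<le> m" by (auto simp: A_def)
        then have "0 \<le> t \<and> ennreal t < T \<omega>" by simp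
        from jacobi_path.S_bounds[OF elim this k(2)]
        show "Y0 k \<omega> + XS k t \<omega> + \<Gamma> k m t \<omega> \<le> real k"
          unfolding path_S[OF elim] Y_eq[OF elim k(2) a] by simp
      qed
    qed
    show "AE \<omega> in M. \<omega> \<in> A k m 0 \<longrightarrow> 1 / m \<le> Y0 k \<omega> + XS k 0 \<omega> + \<Gamma> k m 0 \<omega>"
      using path
    proof eventually_elim
      case (elim \<omega>)
      show ?case
      proof
        assume t: "\<omega> \<in> A k m 0"
        then have a: "(0::real) \<le> 0" "ennreal 0 < T \<omega>" "N k 0 \<omega> \<le> m" by (auto simp: A_def)
        show "1 / m \<le> Y0 k \<omega> + XS k 0 \<omega> + \<Gamma> k m 0 \<omega>"
          unfolding Y_eq[OF elim k(2) a] using t by (simp add: A_def)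
      qed
    qed
    show "AE \<omega> in M. \<forall>\<epsilon>>0. \<exists>h>0. \<forall>s t. 0 \<le> s \<and> s < t \<and> t \<le> \<tau> \<and> t - s < h \<and> \<omega> \<in> A k m s \<and>
        \<epsilon> \<le> Y0 k \<omega> + XS k s \<omega> + \<Gamma> k m s \<omega> \<longrightarrow>
        - (V k m t \<omega> - V k m s \<omega>) \<le> (\<Gamma> k m t \<omega> - \<Gamma> k m s \<omega>) / (Y0 k \<omega> + XS k s \<omega> + \<Gamma> k m s \<omega>) -
           Q k s t \<omega> / (2 * (Y0 k \<omega> + XS k s \<omega> + \<Gamma> k m s \<omega>)\<^sup>2)"
      using path H_sq
    proof eventually_elim
      case (elim \<omega>)
      note pa = elim(1)
      show ?case
      proof (intro allI impI)
        fix \<epsilon> :: real assume e: "\<epsilon> > 0"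
        have ck': "2 \<le> jacobi_path.c n p \<beta> k" unfolding jacobi_path.c_def[OF pa] using ck .
        from jacobi_path.drift_lower[OF pa k(2) ck' m0 e, of \<tau>, unfolded path_S[OF pa], folded N_def V_def \<Gamma>_def]
        obtain h where h: "h > 0" and h1: "\<forall>s t. 0 \<le> s \<and> s < t \<and> t \<le> \<tau> \<and> t - s < h \<and> (0 \<le> s \<and> ennreal s < T \<omega>) \<and> N k s \<omega> < m \<and>
          (k = n \<or> 2 / m \<le> lam (Suc k) s \<omega>) \<and> \<epsilon> \<le> S k s \<omega> \<longrightarrow>
          - (V k m t \<omega> - V k m s \<omega>) \<le> (\<Gamma> k m t \<omega> - \<Gamma> k m s \<omega>) / S k s \<omega> -
            (LINT u:{s..t}|lborel. jacobi_path.q\<^sub>0 (\<lambda>i t. lam i t \<omega>) (T \<omega>) k u) / (2 * (S k s \<omega>)\<^sup>2)"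
          by (elim exE conjE)
        show "\<exists>h>0. \<forall>s t. 0 \<le> s \<and> s < t \<and> t \<le> \<tau> \<and> t - s < h \<and> \<omega> \<in> A k m s \<and>
          \<epsilon> \<le> Y0 k \<omega> + XS k s \<omega> + \<Gamma> k m s \<omega> \<longrightarrow>
          - (V k m t \<omega> - V k m s \<omega>) \<le> (\<Gamma> k m t \<omega> - \<Gamma> k m s \<omega>) / (Y0 k \<omega> + XS k s \<omega> + \<Gamma> k m s \<omega>) -
             Q k s t \<omega> / (2 * (Y0 k \<omega> + XS k s \<omega> + \<Gamma> k m s \<omega>)\<^sup>2)"
        proof (intro exI[of _ h] conjI h allI impI)
          fix s t assume a: "0 \<le> s \<and> s < t \<and> t \<le> \<tau> \<and> t - s < h \<and> \<omega> \<in> A k m s \<and>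
            \<epsilon> \<le> Y0 k \<omega> + XS k s \<omega> + \<Gamma> k m s \<omega>"
          then have As: "ennreal s < T \<omega>" "N k s \<omega> < m" "k = n \<or> 2 / m \<le> lam (Suc k) s \<omega>" by (auto simp: A_def)
          have y: "Y0 k \<omega> + XS k s \<omega> + \<Gamma> k m s \<omega> = S k s \<omega>"
            by (rule Y_eq[OF pa k(2)]) (use a As in auto)
          have "Q k s t \<omega> = (\<Sum>i=1..k. LINT u:{s..t}|lborel. (if 0 \<le> u \<and> ennreal u < T \<omega> then 4 * (lam i u \<omega> * (1 - lam i u \<omega>)) else 0))"
            unfolding Q_def
          proof (intro sum.cong refl set_lebesgue_integral_cong allI impI)
            fix i u assume i: "i \<in> {1..k}" and u: "u \<in> {s..t}"
            have "0 \<le> u" using u a by auto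
            moreover have "i \<in> {1..n}" using i k by auto
            ultimately show "(H i u \<omega>)\<^sup>2 = (if 0 \<le> u \<and> ennreal u < T \<omega> then 4 * (lam i u \<omega> * (1 - lam i u \<omega>)) else 0)"
              using elim(2) by simp
          qed simp
          also have "\<dots> = (LINT u:{s..t}|lborel. jacobi_path.q\<^sub>0 (\<lambda>i t. lam i t \<omega>) (T \<omega>) k u)"
            by (rule jacobi_path.q\<^sub>0_sum[OF pa k(2)])
          finally have q: "Q k s t \<omega> = (LINT u:{s..t}|lborel. jacobi_path.q\<^sub>0 (\<lambda>i t. lam i t \<omega>) (T \<omega>) k u)" .
          show "- (V k m t \<omega> - V k m s \<omega>) \<le> (\<Gamma> k m t \<omega> - \<Gamma> k m s \<omega>) / (Y0 k \<omega> + XS k s \<omega> + \<Gamma> k m s \<omega>) -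
             Q k s t \<omega> / (2 * (Y0 k \<omega> + XS k s \<omega> + \<Gamma> k m s \<omega>)\<^sup>2)"
            unfolding y q by (rule h1[rule_format]) (use a As y in auto)
        qed
      qed
    qed
  qed
qed

end

section \<open>Positivity of the sums of the lowest particles, by descending induction\<close>

context jacobi_solution
begin

text \<open>Uniform positivity on \<open>[0,t]\<close> up to \<open>T\<close> also covers the limit at \<open>T\<close>.\<close>

definition positive :: "nat \<Rightarrow> 'a \<Rightarrow> bool" where
  "positive k \<omega> \<longleftrightarrow> (\<forall>t. \<exists>c>0. \<forall>s. 0 \<le> s \<and> s \<le> t \<and> ennreal s < T \<omega> \<longrightarrow> c \<le> S k s \<omega>)"

text \<open>Suppose \<open>S k\<close> comes arbitrarily close to 0 before time \<open>t\<close>. On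
  such a path \<nu> has a finite integral and, by the assumption on \<open>Suc k\<close>, particle
  \<open>k + 1\<close> is bounded below, so the path stays alive for some large \<open>r\<close>. It
  then dips below every level while alive, which \<open>no_hit\<close> excludes.\<close>

lemma positive_step:
  assumes k: "1 \<le> k" "k \<le> n" and ck: "2 \<le> \<beta> * k * (p - n + k)"
    and init: "AE \<omega> in M. 0 < T \<omega> \<longrightarrow> 0 < lam k 0 \<omega>"
    and above: "k = n \<or> (AE \<omega> in M. positive (Suc k) \<omega>)"
  shows "AE \<omega> in M. positive k \<omega>"
proof -
  \<comment> \<open>Caps and horizons run through the naturals only, so a single null set suffices
    and \<open>r\<close> and \<tau> may afterwards be chosen depending on the path.\<close>
  have hit: "AE \<omega> in M. \<forall>r. \<forall>\<tau>. 1 \<le> r \<and> 1 \<le> \<tau> \<longrightarrow> \<not> (\<forall>\<epsilon>. 0 < \<epsilon> \<and> \<epsilon> \<le> 1 / real r \<longrightarrow>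
      (\<exists>s t. 0 \<le> s \<and> s < t \<and> t \<le> real \<tau> \<and> (\<forall>u\<in>{0..t}. \<omega> \<in> A k (real r) u) \<and>
        (\<forall>u\<in>{s..t}. Y0 k \<omega> + XS k u \<omega> + \<Gamma> k (real r) u \<omega> < \<epsilon>)))"
    unfolding AE_all_countable
  proof (intro allI)
    fix r \<tau> :: nat
    show "AE \<omega> in M. 1 \<le> r \<and> 1 \<le> \<tau> \<longrightarrow> \<not> (\<forall>\<epsilon>. 0 < \<epsilon> \<and> \<epsilon> \<le> 1 / real r \<longrightarrow>
      (\<exists>s t. 0 \<le> s \<and> s < t \<and> t \<le> real \<tau> \<and> (\<forall>u\<in>{0..t}. \<omega> \<in> A k (real r) u) \<and>
        (\<forall>u\<in>{s..t}. Y0 k \<omega> + XS k u \<omega> + \<Gamma> k (real r) u \<omega> < \<epsilon>)))"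
    proof (cases "1 \<le> r \<and> 1 \<le> \<tau>")
      case True
      then have rt: "1 \<le> real r" "0 < real \<tau>" by auto
      note lb = barrier[OF k ck rt]
      from log_barrier.no_hit[OF lb] show ?thesis
        unfolding log_barrier.Y_def[OF lb] by eventually_elim simp
    next
      case False
      then show ?thesis by (intro AE_I2 impI) blast
    qed
  qed
  have ab: "AE \<omega> in M. k = n \<or> positive (Suc k) \<omega>" using above by auto
  show ?thesis
    using path hit ab init AE_space
  proof eventually_elim
    case (elim \<omega>)
    note pa = elim(1)
    show ?case
      unfolding positive_def
    proof (rule allI, rule ccontr)
      fix t :: real
      assume no: "\<not> (\<exists>c>0. \<forall>s. 0 \<le> s \<and> s \<le> t \<and> ennreal s < T \<omega> \<longrightarrow> c \<le> S k s \<omega>)"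
      have bad: "\<exists>s. 0 \<le> s \<and> s \<le> t \<and> ennreal s < T \<omega> \<and> S k s \<omega> < \<epsilon>" if "\<epsilon> > 0" for \<epsilon>
        using no that by (meson not_le)
      obtain s1 where s1: "0 \<le> s1" "s1 \<le> t" "ennreal s1 < T \<omega>" using bad[of 1] by auto
      have T0: "ennreal 0 < T \<omega>" by (rule live_mono[OF s1(3,1)])
      then have l0: "0 \<le> (0::real) \<and> ennreal 0 < T \<omega>" by simp
      \<comment> \<open>The extra unit of time makes room for a short interval after a low point
        close to \<open>t\<close>.\<close>
      obtain \<tau> :: nat where \<tau>: "t + 1 \<le> real \<tau>" "1 \<le> \<tau>"
      proof -
        obtain z :: nat where "t + 1 \<le> real z" using real_arch_simple by blast
        then have "t + 1 \<le> real (max z 1)" "1 \<le> max z 1" by auto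
        then show ?thesis by (rule that)
      qed
      have S0: "0 < S k 0 \<omega>"
      proof -
        have "0 < lam k 0 \<omega>" using elim(4) T0 by simp
        moreover have "lam k 0 \<omega> \<le> S k 0 \<omega>"
          using jacobi_path.l_le_S[OF pa l0 _ k(2), of k] k unfolding path_S[OF pa] by simp
        ultimately show ?thesis by simp
      qed
      have "\<exists>c'>0. k = n \<or> (\<forall>s. 0 \<le> s \<and> s \<le> real \<tau> \<and> ennreal s < T \<omega> \<longrightarrow> c' \<le> lam (Suc k) s \<omega>)"
      proof (cases "k = n")
        case True
        then show ?thesis by (intro exI[of _ 1]) simp
      next
        case False
        then have kn: "Suc k \<le> n" using k by simp
        obtain c where c: "c > 0" "\<forall>s. 0 \<le> s \<and> s \<le> real \<tau> \<and> ennreal s < T \<omega> \<longrightarrow> c \<le> S (Suc k) s \<omega>"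
          using elim(3) False unfolding positive_def by blast
        have "c / real (Suc k) \<le> lam (Suc k) s \<omega>" if s: "0 \<le> s" "s \<le> real \<tau>" "ennreal s < T \<omega>" for s
        proof -
          have l: "0 \<le> s \<and> ennreal s < T \<omega>" using s by simp
          have "S (Suc k) s \<omega> \<le> (\<Sum>i=1..Suc k. lam (Suc k) s \<omega>)"
            unfolding S_def
          proof (rule sum_mono)
            fix i assume i: "i \<in> {1..Suc k}"
            show "lam i s \<omega> \<le> lam (Suc k) s \<omega>"
              by (rule jacobi_path.weak_order(2)[OF pa l]) (use i kn in auto)
          qed
          then have "c \<le> real (Suc k) * lam (Suc k) s \<omega>" using c(2) s by force
          then show ?thesis by (simp add: divide_le_eq mult.commute)
        qed
        then show ?thesis using c(1) by (intro exI[of _ "c / real (Suc k)"]) simp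
      qed
      then obtain c' where c': "c' > 0" "k = n \<or> (\<forall>s. 0 \<le> s \<and> s \<le> real \<tau> \<and> ennreal s < T \<omega> \<longrightarrow> c' \<le> lam (Suc k) s \<omega>)"
        by blast
      \<comment> \<open>Large enough for all conditions in \<open>A\<close> at once:
        \<open>N\<close> stays below \<open>r\<close>, \<open>2 / r\<close> is at most the lower
        bound of particle \<open>k + 1\<close>, and \<open>1 / r\<close> is at most the starting
        value.\<close>
      obtain r :: nat where r: "N k \<tau> \<omega> + 1 + 2 / c' + 1 / S k 0 \<omega> \<le> real r"
        using real_arch_simple by blast
      have N0: "0 \<le> N k s \<omega>" "N k s \<omega> \<le> N k \<tau> \<omega>" if "0 \<le> s" "s \<le> real \<tau>" for s
      proof -
        have "N k 0 \<omega> = 0" unfolding N_def by (rule jacobi_path.N_diff(3)[OF pa k(2), of 0 0]) auto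
        then show "0 \<le> N k s \<omega>"
          using jacobi_path.N_diff(2)[OF pa k(2), of 0 s] that by (simp add: N_def)
        show "N k s \<omega> \<le> N k \<tau> \<omega>"
          using jacobi_path.N_diff(2)[OF pa k(2) that] by (simp add: N_def)
      qed
      have pos: "0 < 2 / c'" "0 < 1 / S k 0 \<omega>" "0 \<le> N k \<tau> \<omega>" using c' S0 N0(1)[of "real \<tau>"] by auto
      have r1: "1 \<le> real r" "N k \<tau> \<omega> < real r" "2 / c' \<le> real r" "1 / S k 0 \<omega> \<le> real r" using r pos by linarith+
      have r2: "2 / real r \<le> c'" "1 / real r \<le> S k 0 \<omega>"
        using r1 c' S0 by (auto simp: divide_le_eq mult.commute)
      have alive: "\<omega> \<in> A k (real r) u" if u: "0 \<le> u" "u \<le> real \<tau>" "ennreal u < T \<omega>" for u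
        unfolding A_def
      proof (intro CollectI conjI)
        show "k = n \<or> 2 / real r \<le> lam (Suc k) u \<omega>" using c'(2) r2(1) u by force
        show "N k u \<omega> < real r" using N0(2)[OF u(1,2)] r1 by simp
      qed (use u r2 elim(5) in auto)
      have "\<forall>\<epsilon>. 0 < \<epsilon> \<and> \<epsilon> \<le> 1 / real r \<longrightarrow>
        (\<exists>s t. 0 \<le> s \<and> s < t \<and> t \<le> real \<tau> \<and> (\<forall>u\<in>{0..t}. \<omega> \<in> A k (real r) u) \<and>
          (\<forall>u\<in>{s..t}. Y0 k \<omega> + XS k u \<omega> + \<Gamma> k (real r) u \<omega> < \<epsilon>))"
      proof (intro allI impI)
        fix \<epsilon> assume e: "0 < \<epsilon> \<and> \<epsilon> \<le> 1 / real r"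
        then obtain s where s: "0 \<le> s" "s \<le> t" "ennreal s < T \<omega>" "S k s \<omega> < \<epsilon>" using bad by blast
        obtain s' where s': "s < s'" "ennreal s' < T \<omega>" using ennreal_less_dense[OF s(3,1)] by blast
        have "\<epsilon> - S k s \<omega> > 0" using s by simp
        from jacobi_path.S_uniform[OF pa k(2) this, of "real \<tau>"] obtain h where h: "h > 0"
          and h1: "\<forall>v u. (0 \<le> v \<and> ennreal v < T \<omega>) \<and> (0 \<le> u \<and> ennreal u < T \<omega>) \<and> v \<le> real \<tau> \<and> u \<le> real \<tau> \<and> \<bar>u - v\<bar> < h \<longrightarrow>
            \<bar>S k u \<omega> - S k v \<omega>\<bar> < \<epsilon> - S k s \<omega>"
          unfolding path_S[OF pa] by (elim exE conjE)
        \<comment> \<open>The barrier needs a whole interval below \<epsilon>, not one instant: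
          \<open>t'\<close> is before \<open>T\<close>, at most one unit after \<open>s\<close>, and
          within the modulus of continuity of \<open>S\<close>.\<close>
        define t' where "t' = min s' (s + min 1 (h / 2))"
        have t': "s < t'" "t' \<le> s'" "t' \<le> s + 1" "t' - s < h" using s' h by (auto simp: t'_def min_def)
        have live: "ennreal u < T \<omega>" if "u \<le> t'" for u
          by (rule live_mono[OF s'(2)]) (use that t' in simp)
        have t\<tau>: "t' \<le> real \<tau>" using t' s \<tau> by simp
        show "\<exists>s t. 0 \<le> s \<and> s < t \<and> t \<le> real \<tau> \<and> (\<forall>u\<in>{0..t}. \<omega> \<in> A k (real r) u) \<and>
          (\<forall>u\<in>{s..t}. Y0 k \<omega> + XS k u \<omega> + \<Gamma> k (real r) u \<omega> < \<epsilon>)"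
        proof (rule exI[of _ s], rule exI[of _ t'], intro conjI ballI)
          fix u assume "u \<in> {0..t'}"
          then show "\<omega> \<in> A k (real r) u" using live t\<tau> by (intro alive) auto
        next
          fix u assume u: "u \<in> {s..t'}"
          have lu: "0 \<le> u" "ennreal u < T \<omega>" "u \<le> real \<tau>" using u s live t\<tau> by auto
          have "\<bar>S k u \<omega> - S k s \<omega>\<bar> < \<epsilon> - S k s \<omega>"
            by (rule h1[rule_format]) (use u lu s t' t\<tau> in auto)
          then have "S k u \<omega> < \<epsilon>" by linarith
          moreover have "N k u \<omega> \<le> real r" using N0(2)[OF lu(1,3)] r1 by simp
          ultimately show "Y0 k \<omega> + XS k u \<omega> + \<Gamma> k (real r) u \<omega> < \<epsilon>"
            using Y_eq[OF pa k(2) lu(1,2)] by simp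
        qed (use s t' t\<tau> in auto)
      qed
      moreover have "1 \<le> r" using r1(1) by simp
      ultimately show False using elim(2) \<tau>(2) by blast
    qed
  qed
qed

text \<open>The hypothesis forces \<open>p - n + k\<close> to be positive, so
  \<open>\<beta> * j * (p - n + j)\<close> increases with \<open>j\<close> and all indices from
  \<open>k\<close> to \<open>n\<close> satisfy the same condition. The induction descends from
  \<open>n\<close>, where no outer particle exists.\<close>

lemma positive_collision:
  assumes k: "1 \<le> k" "k \<le> n" and ck: "2 \<le> \<beta> * k * (p - n + k)"
    and init: "AE \<omega> in M. 0 < T \<omega> \<longrightarrow> 0 < lam k 0 \<omega>"
  shows "AE \<omega> in M. positive k \<omega>"
proof -
  have base: "2 \<le> \<beta> * j * (p - n + j)" "AE \<omega> in M. 0 < T \<omega> \<longrightarrow> 0 < lam j 0 \<omega>" if j: "k \<le> j" "j \<le> n" for j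
  proof -
    have "0 < \<beta> * k" using pars k by simp
    moreover have "0 < \<beta> * k * (p - n + k)" using ck by linarith
    ultimately have pk: "0 < p - n + k" by (simp only: zero_less_mult_pos)
    have "\<beta> * k * (p - n + k) \<le> \<beta> * j * (p - n + j)"
      using j pars pk by (intro mult_mono mult_left_mono) auto
    then show "2 \<le> \<beta> * j * (p - n + j)" using ck by linarith
    show "AE \<omega> in M. 0 < T \<omega> \<longrightarrow> 0 < lam j 0 \<omega>"
      using init path
    proof eventually_elim
      case (elim \<omega>)
      show ?case
      proof
        assume T: "0 < T \<omega>"
        then have l: "0 \<le> (0::real) \<and> ennreal 0 < T \<omega>" by simp
        have "lam k 0 \<omega> \<le> lam j 0 \<omega>"
          by (rule jacobi_path.weak_order(2)[OF elim(2) l]) (use j k in auto)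
        then show "0 < lam j 0 \<omega>" using elim(1) T by simp
      qed
    qed
  qed
  have "AE \<omega> in M. positive (n - i) \<omega>" if "k \<le> n - i" for i
    using that
  proof (induction i)
    case 0
    have "AE \<omega> in M. positive n \<omega>" using base[of n] k by (intro positive_step) auto
    then show ?case by simp
  next
    case (Suc i)
    have e: "Suc (n - Suc i) = n - i" using Suc.prems k by simp
    have "AE \<omega> in M. positive (n - i) \<omega>" using Suc by simp
    then have "n - Suc i = n \<or> (AE \<omega> in M. positive (Suc (n - Suc i)) \<omega>)" unfolding e by blast
    then show ?case using base[of "n - Suc i"] Suc.prems k by (intro positive_step) auto
  qed
  from this[of "n - k"] k show ?thesis by simp
qed

end

section \<open>Reflection exchanging 0 with 1 and \<open>p\<close> with \<open>q\<close>\<close>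

text \<open>The numerator of the interaction is invariant under replacing both particles by their
  complements to 1, and the denominator changes sign. Reversing the labels restores the increasing
  order.\<close>

lemma jacobi_drift_reflect:
  assumes i: "i \<in> {1..n}"
  shows "jacobi_drift n q p \<beta> (\<lambda>j. 1 - y (n + 1 - j)) i = - jacobi_drift n p q \<beta> y (n + 1 - i)"
proof -
  let ?a = "n + 1 - i"
  have t: "((1 - u) * (1 - (1 - v)) + (1 - v) * (1 - (1 - u))) / ((1 - u) - (1 - v)) =
    - ((u * (1 - v) + v * (1 - u)) / (u - v))" for u v :: real
  proof -
    have "(1 - u) * (1 - (1 - v)) + (1 - v) * (1 - (1 - u)) = u * (1 - v) + v * (1 - u)" by (simp add: algebra_simps)
    moreover have "(1 - u) - (1 - v) = - (u - v)" by simp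
    ultimately show ?thesis by (simp only: minus_divide_right)
  qed
  have "(\<Sum>j\<in>{1..n} - {i}. ((1 - y ?a) * (1 - (1 - y (n + 1 - j))) + (1 - y (n + 1 - j)) * (1 - (1 - y ?a))) /
      ((1 - y ?a) - (1 - y (n + 1 - j)))) =
    (\<Sum>j\<in>{1..n} - {?a}. - ((y ?a * (1 - y j) + y j * (1 - y ?a)) / (y ?a - y j)))"
    unfolding t
    by (rule sum.reindex_bij_witness[of _ "\<lambda>j. n + 1 - j" "\<lambda>j. n + 1 - j"]) (use i in auto)
  then show ?thesis
    unfolding jacobi_drift_def by (simp add: sum_negf algebra_simps)
qed

lemma jacobi_path_reflect:
  assumes "jacobi_path n p q \<beta> l x T" and n: "1 \<le> n"
  shows "jacobi_path n q p \<beta> (\<lambda>i t. 1 - l (n + 1 - i) t) (\<lambda>i t. - x (n + 1 - i) t) T"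
proof -
  interpret jacobi_path n p q \<beta> l x T by fact
  show ?thesis
  proof
    show "0 < \<beta>" "0 \<le> q" "0 \<le> p" using pars by auto
    fix i assume i: "i \<in> {1..n}"
    then have i': "n + 1 - i \<in> {1..n}" by auto
    show "continuous_on {t. 0 \<le> t \<and> ennreal t < T} (\<lambda>t. 1 - l (n + 1 - i) t)"
      by (intro continuous_on_diff continuous_on_const l_cont i')
    show "continuous_on {0..} (\<lambda>t. - x (n + 1 - i) t)" by (intro continuous_on_minus x_cont i')
    fix t :: real assume t: "0 \<le> t" "ennreal t < T"
    have e: "(\<lambda>s. jacobi_drift n q p \<beta> (\<lambda>j. 1 - l (n + 1 - j) s) i) =
        (\<lambda>s. - jacobi_drift n p q \<beta> (\<lambda>j. l j s) (n + 1 - i))"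
      by (rule ext) (rule jacobi_drift_reflect[OF i])
    show "set_integrable lborel {0..t} (\<lambda>s. jacobi_drift n q p \<beta> (\<lambda>j. 1 - l (n + 1 - j) s) i)"
      unfolding e using drift_int[OF i' t] by (simp add: set_integrable_def)
    show "1 - l (n + 1 - i) t = 1 - l (n + 1 - i) 0 + - x (n + 1 - i) t +
      (LINT s:{0..t}|lborel. jacobi_drift n q p \<beta> (\<lambda>j. 1 - l (n + 1 - j) s) i)"
      unfolding e using l_eq[OF i' t] by (simp add: set_lebesgue_integral_def)
  next
    show "AE t in lborel. 0 \<le> t \<and> ennreal t < T \<longrightarrow>
        0 \<le> 1 - l (n + 1 - 1) t \<and> strict_mono_on {1..n} (\<lambda>i. 1 - l (n + 1 - i) t) \<and> 1 - l (n + 1 - n) t \<le> 1"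
      using strict_order
    proof eventually_elim
      case (elim t)
      show ?case
      proof
        assume "0 \<le> t \<and> ennreal t < T"
        then have o: "0 \<le> l 1 t" "strict_mono_on {1..n} (\<lambda>i. l i t)" "l n t \<le> 1" using elim by auto
        have "strict_mono_on {1..n} (\<lambda>i. 1 - l (n + 1 - i) t)"
        proof (rule strict_mono_onI)
          fix i j assume "i \<in> {1..n}" "j \<in> {1..n}" "i < j"
          then have "l (n + 1 - j) t < l (n + 1 - i) t" by (intro strict_mono_onD[OF o(2)]) auto
          then show "1 - l (n + 1 - i) t < 1 - l (n + 1 - j) t" by simp
        qed
        then show "0 \<le> 1 - l (n + 1 - 1) t \<and> strict_mono_on {1..n} (\<lambda>i. 1 - l (n + 1 - i) t) \<and> 1 - l (n + 1 - n) t \<le> 1"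
          using o by simp
      qed
    qed
  qed
qed

context jacobi_solution
begin

text \<open>The martingale parts change sign and labels, and the squared integrands only labels, so
  sums over \<open>J\<close> become sums over the reflected index set. \<open>B\<close> itself stays
  as it is, since the locale ties \<open>X\<close> to it only through moments.\<close>

lemma reflect:
  assumes n: "1 \<le> n"
  shows "jacobi_solution M F n B q p \<beta> (\<lambda>i t \<omega>. 1 - lam (n + 1 - i) t \<omega>) (\<lambda>i t \<omega>. - X (n + 1 - i) t \<omega>)
    (\<lambda>i. H (n + 1 - i)) T"
proof -
  let ?r = "\<lambda>i. n + 1 - i"
  have sub: "?r ` J \<subseteq> {1..n}" "inj_on ?r J" if "J \<subseteq> {1..n}" for J
    using that by (auto simp: inj_on_def subset_eq)
  have r: "?r i \<in> {1..n}" if "i \<in> {1..n}" for i using that by auto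
  have p4: "(- a) ^ 4 = a ^ 4" for a :: real by simp
  have sumX: "(\<Sum>i\<in>J. - X (?r i) t \<omega>) - (\<Sum>i\<in>J. - X (?r i) s \<omega>) =
     - ((\<Sum>i\<in>?r ` J. X i t \<omega>) - (\<Sum>i\<in>?r ` J. X i s \<omega>))" if "J \<subseteq> {1..n}" for J s t \<omega>
    unfolding sum.reindex[OF sub(2)[OF that]] by (simp add: sum_negf)
  have sumH: "(\<Sum>i\<in>J. LINT u:{s..t}|lborel. (H (?r i) u \<omega>)\<^sup>2) = (\<Sum>i\<in>?r ` J. LINT u:{s..t}|lborel. (H i u \<omega>)\<^sup>2)"
    if "J \<subseteq> {1..n}" for J s t \<omega>
    unfolding sum.reindex[OF sub(2)[OF that]] by simp
  show ?thesis
  proof (intro jacobi_solution.intro jacobi_solution_axioms.intro brownian_setup_axioms)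
    show "0 < \<beta>" "0 \<le> q" "0 \<le> p" using pars by auto
    show "AE \<omega> in M. jacobi_path n q p \<beta> (\<lambda>i t. 1 - lam (?r i) t \<omega>) (\<lambda>i t. - X (?r i) t \<omega>) (T \<omega>)"
      using path
    proof eventually_elim
      case (elim \<omega>)
      show ?case by (rule jacobi_path_reflect[OF elim n])
    qed
    show "AE \<omega> in M. \<forall>i\<in>{1..n}. - X (?r i) 0 \<omega> = 0"
      using X0 by eventually_elim (use r in simp)
    show "{\<omega>\<in>space M. ennreal t < T \<omega>} \<in> sets (G t)" if "0 \<le> t" for t by (rule live_G[OF that])
    show "AE \<omega> in M. \<forall>i\<in>{1..n}. \<forall>u\<ge>0. (H (?r i) u \<omega>)\<^sup>2 =
      (if ennreal u < T \<omega> then 4 * ((1 - lam (?r i) u \<omega>) * (1 - (1 - lam (?r i) u \<omega>))) else 0)"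
      using H_sq
    proof eventually_elim
      case (elim \<omega>)
      show ?case
      proof (intro ballI allI impI)
        fix i u assume "i \<in> {1..n}" "0 \<le> (u::real)"
        then have "(H (?r i) u \<omega>)\<^sup>2 = (if ennreal u < T \<omega> then 4 * (lam (?r i) u \<omega> * (1 - lam (?r i) u \<omega>)) else 0)"
          using elim r by blast
        then show "(H (?r i) u \<omega>)\<^sup>2 =
          (if ennreal u < T \<omega> then 4 * ((1 - lam (?r i) u \<omega>) * (1 - (1 - lam (?r i) u \<omega>))) else 0)"
          by (simp add: mult.commute)
      qed
    qed
    fix i :: nat and t :: real assume i: "i \<in> {1..n}" and t: "0 \<le> t"
    note i' = r[OF i]
    show "(\<lambda>\<omega>. if ennreal t < T \<omega> then 1 - lam (?r i) t \<omega> else 0) \<in> borel_measurable (G t)"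
    proof (rule live_measurable[OF t])
      show "(\<lambda>\<omega>. 1 - (if ennreal t < T \<omega> then lam (?r i) t \<omega> else 0)) \<in> borel_measurable (G t)"
        by (intro borel_measurable_diff borel_measurable_const lam_G i' t)
    qed simp
    show "(\<lambda>\<omega>. - X (?r i) t \<omega>) \<in> borel_measurable (G t)"
      by (intro borel_measurable_uminus X_G i' t)
  next
    fix J s t assume J: "J \<subseteq> {1..n}" and st: "0 \<le> (s::real)" "s < t"
    show "integrable P (\<lambda>\<omega>. ((\<Sum>i\<in>J. - X (?r i) t \<omega>) - (\<Sum>i\<in>J. - X (?r i) s \<omega>)) ^ 4) \<and>
      E (\<lambda>\<omega>. ((\<Sum>i\<in>J. - X (?r i) t \<omega>) - (\<Sum>i\<in>J. - X (?r i) s \<omega>)) ^ 4) \<le> 96 * real n ^ 4 * (t - s)\<^sup>2"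
      unfolding sumX[OF J] p4 by (rule fourth_moment[OF sub(1)[OF J] st])
    show "(\<lambda>\<omega>. \<Sum>i\<in>J. LINT u:{s..t}|lborel. (H (?r i) u \<omega>)\<^sup>2) \<in> borel_measurable P \<and>
        (AE \<omega> in M. 0 \<le> (\<Sum>i\<in>J. LINT u:{s..t}|lborel. (H (?r i) u \<omega>)\<^sup>2) \<and>
           (\<Sum>i\<in>J. LINT u:{s..t}|lborel. (H (?r i) u \<omega>)\<^sup>2) \<le> real n * (t - s))"
      unfolding sumH[OF J] by (rule variation[OF sub(1)[OF J] st])
    fix Z and K :: real assume "Z \<in> borel_measurable (G s)" "\<And>\<omega>. \<omega> \<in> space M \<Longrightarrow> \<bar>Z \<omega>\<bar> \<le> K"
    from martingale[OF sub(1)[OF J] st this]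
    show "E (\<lambda>\<omega>. Z \<omega> * ((\<Sum>i\<in>J. - X (?r i) t \<omega>) - (\<Sum>i\<in>J. - X (?r i) s \<omega>))) = 0 \<and>
        E (\<lambda>\<omega>. Z \<omega> * ((\<Sum>i\<in>J. - X (?r i) t \<omega>) - (\<Sum>i\<in>J. - X (?r i) s \<omega>))\<^sup>2) =
        E (\<lambda>\<omega>. Z \<omega> * (\<Sum>i\<in>J. LINT u:{s..t}|lborel. (H (?r i) u \<omega>)\<^sup>2))"
      unfolding sumX[OF J] sumH[OF J] power2_minus mult_minus_right by simp
  qed
qed

end

section \<open>From local solutions to the locale, and the conclusion\<close>

lemma jacobi_diffusion_bound:
  assumes "0 \<le> (x::real)" "x \<le> 1"
  shows "\<bar>2 * sqrt (x * (1 - x))\<bar> \<le> 1" "(2 * sqrt (x * (1 - x)))\<^sup>2 = 4 * (x * (1 - x))"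
proof -
  have nn: "0 \<le> x * (1 - x)" using assms by simp
  show sq: "(2 * sqrt (x * (1 - x)))\<^sup>2 = 4 * (x * (1 - x))" using nn by (simp add: power_mult_distrib)
  have "4 * (x * (1 - x)) \<le> 1" using zero_le_power2[of "2 * x - 1"] by (simp add: power2_eq_square algebra_simps)
  then show "\<bar>2 * sqrt (x * (1 - x))\<bar> \<le> 1" using sq abs_square_le_1 by metis
qed

text \<open>Almost every path satisfies the deterministic system, so the particles lie in [0, 1] and
  the integrand is bounded by 1; this opens the way to the moment results. At time 0 both integrals
  vanish, which identifies the initial values when \<open>T\<close> is positive.\<close>

lemma (in brownian_setup) jacobi_solution_of_local_solution:
  fixes \<Lambda> :: "nat \<Rightarrow> real \<Rightarrow> 'a \<Rightarrow> real"
  assumes pars: "0 < \<beta>" "0 \<le> p" "0 \<le> q" and sol: "jacobi_local_solution M F B n p q \<beta> \<Lambda>0 \<Lambda> T"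
  defines "H \<equiv> \<lambda>i s \<omega>. if ennreal s < T \<omega> then 2 * sqrt (\<Lambda> i s \<omega> * (1 - \<Lambda> i s \<omega>)) else 0"
  shows "\<exists>X. jacobi_solution M F n B p q \<beta> \<Lambda> X H T"
    and "AE \<omega> in M. 0 < T \<omega> \<longrightarrow> (\<forall>i\<in>{1..n}. \<Lambda> i 0 \<omega> = \<Lambda>0 i \<omega>)"
proof -
  have T: "stopping_time F T" and \<Lambda>F: "\<And>i t. i \<in> {1..n} \<Longrightarrow> 0 \<le> t \<Longrightarrow>
      (\<lambda>\<omega>. if ennreal t < T \<omega> then \<Lambda> i t \<omega> else 0) \<in> borel_measurable (F (ennreal t))"
    and cont: "AE \<omega> in M. \<forall>i\<in>{1..n}. continuous_on {t. 0 \<le> t \<and> ennreal t < T \<omega>} (\<lambda>t. \<Lambda> i t \<omega>)"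
    and order: "AE \<omega> in M. AE t in lborel. 0 \<le> t \<and> ennreal t < T \<omega> \<longrightarrow>
        0 \<le> \<Lambda> 1 t \<omega> \<and> strict_mono_on {1..n} (\<lambda>i. \<Lambda> i t \<omega>) \<and> \<Lambda> n t \<omega> \<le> 1"
    and drift: "AE \<omega> in M. \<forall>i\<in>{1..n}. \<forall>t\<ge>0. ennreal t < T \<omega> \<longrightarrow>
        set_integrable lborel {0..t} (\<lambda>s. jacobi_drift n p q \<beta> (\<lambda>j. \<Lambda> j s \<omega>) i)"
    using sol unfolding jacobi_local_solution_def by (auto simp: AE_finite_all)
  have "\<forall>i\<in>{1..n}. \<exists>X. is_ito_integral M F (B i) (H i) X \<and>
        (AE \<omega> in M. \<forall>t\<ge>0. ennreal t < T \<omega> \<longrightarrow>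
           \<Lambda> i t \<omega> = \<Lambda>0 i \<omega> + X t \<omega> + (LINT s:{0..t}|lborel. jacobi_drift n p q \<beta> (\<lambda>j. \<Lambda> j s \<omega>) i))"
    using sol unfolding jacobi_local_solution_def H_def by blast
  from bchoice[OF this] obtain X where X: "\<forall>i\<in>{1..n}. is_ito_integral M F (B i) (H i) (X i) \<and>
        (AE \<omega> in M. \<forall>t\<ge>0. ennreal t < T \<omega> \<longrightarrow>
           \<Lambda> i t \<omega> = \<Lambda>0 i \<omega> + X i t \<omega> + (LINT s:{0..t}|lborel. jacobi_drift n p q \<beta> (\<lambda>j. \<Lambda> j s \<omega>) i))" ..
  then have ito: "\<And>i. i \<in> {1..n} \<Longrightarrow> is_ito_integral M F (B i) (H i) (X i)" by blast
  have eq: "AE \<omega> in M. \<forall>i\<in>{1..n}. \<forall>t\<ge>0. ennreal t < T \<omega> \<longrightarrow>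
           \<Lambda> i t \<omega> = \<Lambda>0 i \<omega> + X i t \<omega> + (LINT s:{0..t}|lborel. jacobi_drift n p q \<beta> (\<lambda>j. \<Lambda> j s \<omega>) i)"
    using X by (intro AE_finite_allI) auto
  have X0: "AE \<omega> in M. \<forall>i\<in>{1..n}. X i 0 \<omega> = 0"
    using ito_integral_zero[OF ito] by (intro AE_finite_allI) auto
  have Xc: "AE \<omega> in M. \<forall>i\<in>{1..n}. continuous_on {0..} (\<lambda>t. X i t \<omega>)"
    using ito by (intro AE_finite_allI) (auto simp: is_ito_integral_def)
  have start: "AE \<omega> in M. \<forall>i\<in>{1..n}. 0 < T \<omega> \<longrightarrow> \<Lambda> i 0 \<omega> = \<Lambda>0 i \<omega>"
    using eq X0
  proof eventually_elim
    case (elim \<omega>)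
    have z: "set_lebesgue_integral lborel {0::real} f = 0" for f :: "real \<Rightarrow> real"
    proof -
      have "AE s in lborel. indicat_real {0} s *\<^sub>R f s = 0"
        using AE_lborel_singleton[of 0] by eventually_elim auto
      then show ?thesis unfolding set_lebesgue_integral_def by (rule integral_eq_zero_AE)
    qed
    show ?case
    proof (intro ballI impI)
      fix i assume i: "i \<in> {1..n}" and "0 < T \<omega>"
      then have "ennreal 0 < T \<omega>" by simp
      with elim(1) i have "\<Lambda> i 0 \<omega> = \<Lambda>0 i \<omega> + X i 0 \<omega> + (LINT s:{0..0}|lborel. jacobi_drift n p q \<beta> (\<lambda>j. \<Lambda> j s \<omega>) i)"
        by blast
      then show "\<Lambda> i 0 \<omega> = \<Lambda>0 i \<omega>" using elim(2) i z by simp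
    qed
  qed
  then show "AE \<omega> in M. 0 < T \<omega> \<longrightarrow> (\<forall>i\<in>{1..n}. \<Lambda> i 0 \<omega> = \<Lambda>0 i \<omega>)" by eventually_elim blast
  have path: "AE \<omega> in M. jacobi_path n p q \<beta> (\<lambda>i t. \<Lambda> i t \<omega>) (\<lambda>i t. X i t \<omega>) (T \<omega>)"
    using cont order drift eq Xc start
  proof eventually_elim
    case (elim \<omega>)
    show ?case
    proof
      fix i t assume i: "i \<in> {1..n}" and t: "0 \<le> t" "ennreal t < T \<omega>"
      have "0 < T \<omega>" using t(2) by (rule le_less_trans[OF zero_le])
      then have "\<Lambda> i 0 \<omega> = \<Lambda>0 i \<omega>" using elim(6) i by blast
      then show "\<Lambda> i t \<omega> = \<Lambda> i 0 \<omega> + X i t \<omega> + (LINT s:{0..t}|lborel. jacobi_drift n p q \<beta> (\<lambda>j. \<Lambda> j s \<omega>) i)"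
        using elim(4) i t by simp
    qed (use elim pars in auto)
  qed
  have range: "0 \<le> \<Lambda> i u \<omega> \<and> \<Lambda> i u \<omega> \<le> 1"
    if pa: "jacobi_path n p q \<beta> (\<lambda>i t. \<Lambda> i t \<omega>) (\<lambda>i t. X i t \<omega>) (T \<omega>)" and i: "i \<in> {1..n}" and u: "0 \<le> u" "ennreal u < T \<omega>"
    for \<omega> i u
  proof -
    have "0 \<le> u \<and> ennreal u < T \<omega>" using u by simp
    from jacobi_path.weak_order[OF pa this i i order_refl] show ?thesis by simp
  qed
  have H1: "AE \<omega> in M. AE u in lborel. u \<ge> 0 \<longrightarrow> \<bar>H i u \<omega>\<bar> \<le> 1" if i: "i \<in> {1..n}" for i
    using path
  proof eventually_elim
    case (elim \<omega>)
    show ?case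
    proof (intro AE_I2 impI)
      fix u :: real assume "0 \<le> u"
      then show "\<bar>H i u \<omega>\<bar> \<le> 1"
        using range[OF elim i, of u] jacobi_diffusion_bound(1)[of "\<Lambda> i u \<omega>"] by (simp add: H_def)
    qed
  qed
  have "jacobi_solution M F n B p q \<beta> \<Lambda> X H T"
  proof (intro jacobi_solution.intro jacobi_solution_axioms.intro brownian_setup_axioms path X0)
    show "0 < \<beta>" "0 \<le> p" "0 \<le> q" by fact+
    show "{\<omega>\<in>space M. ennreal t < T \<omega>} \<in> sets (G t)" for t
      using stopping_timeD2[OF T, of "ennreal t"] augment_superset[OF subalgebra_F, of "ennreal t"] subalgebra_F[of "ennreal t"]
      by (auto simp: pred_def subalgebra_def)
    show "(\<lambda>\<omega>. if ennreal t < T \<omega> then \<Lambda> i t \<omega> else 0) \<in> borel_measurable (G t)" if "i \<in> {1..n}" "0 \<le> t" for i t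
      by (rule F_G[OF \<Lambda>F[OF that]])
    show "X i t \<in> borel_measurable (G t)" if "i \<in> {1..n}" "0 \<le> t" for i t
      by (rule ito_integral_G[OF that(1) ito[OF that(1)] H1[OF that(1)] that(2)])
    show "AE \<omega> in M. \<forall>i\<in>{1..n}. \<forall>u\<ge>0. (H i u \<omega>)\<^sup>2 = (if ennreal u < T \<omega> then 4 * (\<Lambda> i u \<omega> * (1 - \<Lambda> i u \<omega>)) else 0)"
      using path
    proof eventually_elim
      case (elim \<omega>)
      show ?case
      proof (intro ballI allI impI)
        fix i u assume "i \<in> {1..n}" "0 \<le> (u::real)"
        then show "(H i u \<omega>)\<^sup>2 = (if ennreal u < T \<omega> then 4 * (\<Lambda> i u \<omega> * (1 - \<Lambda> i u \<omega>)) else 0)"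
          using range[OF elim, of i u] jacobi_diffusion_bound(2)[of "\<Lambda> i u \<omega>"] by (simp add: H_def)
      qed
    qed
    fix J s t assume J: "J \<subseteq> {1..n}" and st: "0 \<le> (s::real)" "s < t"
    note mom = ito_sum_moments[OF J ito[OF subsetD[OF J]] H1[OF subsetD[OF J]] st]
    show "integrable P (\<lambda>\<omega>. ((\<Sum>i\<in>J. X i t \<omega>) - (\<Sum>i\<in>J. X i s \<omega>)) ^ 4) \<and>
        E (\<lambda>\<omega>. ((\<Sum>i\<in>J. X i t \<omega>) - (\<Sum>i\<in>J. X i s \<omega>)) ^ 4) \<le> 96 * real n ^ 4 * (t - s)\<^sup>2"
      using mom(1,2) by simp
    show "(\<lambda>\<omega>. \<Sum>i\<in>J. LINT u:{s..t}|lborel. (H i u \<omega>)\<^sup>2) \<in> borel_measurable P \<and>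
        (AE \<omega> in M. 0 \<le> (\<Sum>i\<in>J. LINT u:{s..t}|lborel. (H i u \<omega>)\<^sup>2) \<and>
           (\<Sum>i\<in>J. LINT u:{s..t}|lborel. (H i u \<omega>)\<^sup>2) \<le> real n * (t - s))"
      using mom(3,4) by simp
    fix Z and K :: real assume "Z \<in> borel_measurable (G s)" "\<And>\<omega>. \<omega> \<in> space M \<Longrightarrow> \<bar>Z \<omega>\<bar> \<le> K"
    from mom(5)[OF _ _ this]
    show "E (\<lambda>\<omega>. Z \<omega> * ((\<Sum>i\<in>J. X i t \<omega>) - (\<Sum>i\<in>J. X i s \<omega>))) = 0 \<and>
        E (\<lambda>\<omega>. Z \<omega> * ((\<Sum>i\<in>J. X i t \<omega>) - (\<Sum>i\<in>J. X i s \<omega>))\<^sup>2) =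
        E (\<lambda>\<omega>. Z \<omega> * (\<Sum>i\<in>J. LINT u:{s..t}|lborel. (H i u \<omega>)\<^sup>2))" .
  qed
  then show "\<exists>X. jacobi_solution M F n B p q \<beta> \<Lambda> X H T" by blast
qed

lemma outer_measure_of_AE_zero:
  assumes "AE \<omega> in M. \<not> Q \<omega>"
  shows "outer_measure_of M {\<omega>\<in>space M. Q \<omega>} = 0"
proof -
  have "outer_measure_of M {\<omega>\<in>space M. Q \<omega>} \<le> outer_measure_of M {}"
    by (rule outer_measure_of_mono_AE) (use assms in auto)
  then show ?thesis by simp
qed

context jacobi_solution
begin

text \<open>When \<open>T\<close> is finite, choosing the horizon equal to \<open>T\<close> gives
  one positive lower bound on the whole of [0, T), so the infimum cannot be 0. The last part is the
  same fact in the form needed after reflection, where \<open>S\<close> is a constant minus the sum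
  of the highest particles.\<close>

lemma collision_null:
  assumes "AE \<omega> in M. positive k \<omega>"
  shows "outer_measure_of M {\<omega>\<in>space M. T \<omega> = \<infinity> \<and> (\<exists>t\<ge>0. S k t \<omega> = 0)} = 0"
    and "outer_measure_of M {\<omega>\<in>space M. T \<omega> < \<infinity> \<and>
      (INF t\<in>{t. 0 \<le> t \<and> ennreal t < T \<omega>}. ereal (S k t \<omega>)) = 0} = 0"
    and "outer_measure_of M {\<omega>\<in>space M. T \<omega> < \<infinity> \<and>
      (SUP t\<in>{t. 0 \<le> t \<and> ennreal t < T \<omega>}. ereal (a - S k t \<omega>)) = ereal a} = 0"
proof -
  show "outer_measure_of M {\<omega>\<in>space M. T \<omega> = \<infinity> \<and> (\<exists>t\<ge>0. S k t \<omega> = 0)} = 0"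
  proof (rule outer_measure_of_AE_zero)
    show "AE \<omega> in M. \<not> (T \<omega> = \<infinity> \<and> (\<exists>t\<ge>0. S k t \<omega> = 0))"
      using assms
    proof eventually_elim
      case (elim \<omega>)
      show ?case
      proof safe
        fix t assume T: "T \<omega> = \<infinity>" and t: "0 \<le> t" "S k t \<omega> = 0"
        obtain c where "c > 0" "\<forall>s. 0 \<le> s \<and> s \<le> t \<and> ennreal s < T \<omega> \<longrightarrow> c \<le> S k s \<omega>"
          using elim unfolding positive_def by blast
        then show False using t T by fastforce
      qed
    qed
  qed
  have c: "AE \<omega> in M. T \<omega> < \<infinity> \<longrightarrow> (\<exists>c>0. \<forall>t. 0 \<le> t \<and> ennreal t < T \<omega> \<longrightarrow> c \<le> S k t \<omega>)"
    using assms
  proof eventually_elim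
    case (elim \<omega>)
    show ?case
    proof
      assume "T \<omega> < \<infinity>"
      then obtain r where r: "T \<omega> = ennreal r" "0 \<le> r" by (cases "T \<omega>") auto
      obtain c where c: "c > 0" "\<forall>s. 0 \<le> s \<and> s \<le> r \<and> ennreal s < T \<omega> \<longrightarrow> c \<le> S k s \<omega>"
        using elim unfolding positive_def by blast
      show "\<exists>c>0. \<forall>t. 0 \<le> t \<and> ennreal t < T \<omega> \<longrightarrow> c \<le> S k t \<omega>"
      proof (intro exI[of _ c] conjI c(1) allI impI)
        fix t assume t: "0 \<le> t \<and> ennreal t < T \<omega>"
        then have "t \<le> r" using r ennreal_less_iff[of t r] by auto
        then show "c \<le> S k t \<omega>" using c(2) t by blast
      qed
    qed
  qed
  show "outer_measure_of M {\<omega>\<in>space M. T \<omega> < \<infinity> \<and>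
      (INF t\<in>{t. 0 \<le> t \<and> ennreal t < T \<omega>}. ereal (S k t \<omega>)) = 0} = 0"
  proof (rule outer_measure_of_AE_zero)
    show "AE \<omega> in M. \<not> (T \<omega> < \<infinity> \<and> (INF t\<in>{t. 0 \<le> t \<and> ennreal t < T \<omega>}. ereal (S k t \<omega>)) = 0)"
      using c
    proof eventually_elim
      case (elim \<omega>)
      show ?case
      proof
        assume a: "T \<omega> < \<infinity> \<and> (INF t\<in>{t. 0 \<le> t \<and> ennreal t < T \<omega>}. ereal (S k t \<omega>)) = 0"
        then obtain c where c: "c > 0" "\<forall>t. 0 \<le> t \<and> ennreal t < T \<omega> \<longrightarrow> c \<le> S k t \<omega>" using elim by blast
        have "ereal c \<le> (INF t\<in>{t. 0 \<le> t \<and> ennreal t < T \<omega>}. ereal (S k t \<omega>))"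
          using c(2) by (intro INF_greatest) auto
        then show False using a c(1) by simp
      qed
    qed
  qed
  show "outer_measure_of M {\<omega>\<in>space M. T \<omega> < \<infinity> \<and>
      (SUP t\<in>{t. 0 \<le> t \<and> ennreal t < T \<omega>}. ereal (a - S k t \<omega>)) = ereal a} = 0"
  proof (rule outer_measure_of_AE_zero)
    show "AE \<omega> in M. \<not> (T \<omega> < \<infinity> \<and> (SUP t\<in>{t. 0 \<le> t \<and> ennreal t < T \<omega>}. ereal (a - S k t \<omega>)) = ereal a)"
      using c
    proof eventually_elim
      case (elim \<omega>)
      show ?case
      proof
        assume s: "T \<omega> < \<infinity> \<and> (SUP t\<in>{t. 0 \<le> t \<and> ennreal t < T \<omega>}. ereal (a - S k t \<omega>)) = ereal a"
        then obtain c where c: "c > 0" "\<forall>t. 0 \<le> t \<and> ennreal t < T \<omega> \<longrightarrow> c \<le> S k t \<omega>" using elim by blast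
        have "(SUP t\<in>{t. 0 \<le> t \<and> ennreal t < T \<omega>}. ereal (a - S k t \<omega>)) \<le> ereal (a - c)"
          using c(2) by (intro SUP_least) auto
        then show False using s c(1) by simp
      qed
    qed
  qed
qed

end

theorem proposition2p5:
  fixes M :: "'a measure" and F :: "ennreal \<Rightarrow> 'a measure"
    and B :: "nat \<Rightarrow> real \<Rightarrow> 'a \<Rightarrow> real" and \<Lambda>0 :: "nat \<Rightarrow> 'a \<Rightarrow> real"
    and n k :: nat and p q \<beta> :: real
  assumes "filtered_prob_space M F"
    and "brownian_motion M F n B"
    and "n \<ge> 1" and "p \<ge> 0" and "q \<ge> 0" and "\<beta> > 0" and "k \<in> {1..n}"
    and "prob_space.indep_set M
           (sets (vimage_algebra (space M) (\<lambda>\<omega>. \<lambda>i\<in>{1..n}. \<Lambda>0 i \<omega>) (\<Pi>\<^sub>M i\<in>{1..n}. borel)))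
           (sets (vimage_algebra (space M) (\<lambda>\<omega>. \<lambda>(i, t)\<in>{1..n} \<times> {0..}. B i t \<omega>)
                    (\<Pi>\<^sub>M it\<in>{1..n} \<times> {0..}. borel)))"
    and "AE \<omega> in M. 0 \<le> \<Lambda>0 1 \<omega> \<and> mono_on {1..n} (\<lambda>i. \<Lambda>0 i \<omega>) \<and> \<Lambda>0 n \<omega> \<le> 1"
  shows
    "(\<forall>\<Lambda> T. (AE \<omega> in M. \<Lambda>0 k \<omega> > 0) \<and>
        jacobi_local_solution M F B n p q \<beta> \<Lambda>0 \<Lambda> T \<and>
        real k * \<beta> * (p - real n + real k) \<ge> 2 \<longrightarrow>
        outer_measure_of M {\<omega>\<in>space M. T \<omega> = \<infinity> \<and> (\<exists>t\<ge>0. (\<Sum>i=1..k. \<Lambda> i t \<omega>) = 0)} +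
        outer_measure_of M {\<omega>\<in>space M. T \<omega> < \<infinity> \<and>
          (INF t\<in>{t. 0 \<le> t \<and> ennreal t < T \<omega>}. ereal (\<Sum>i=1..k. \<Lambda> i t \<omega>)) = 0} = 0) \<and>
     (\<forall>\<Lambda> T. (AE \<omega> in M. \<Lambda>0 (n - k + 1) \<omega> < 1) \<and>
        jacobi_local_solution M F B n p q \<beta> \<Lambda>0 \<Lambda> T \<and>
        real k * \<beta> * (q - real n + real k) \<ge> 2 \<longrightarrow>
        outer_measure_of M {\<omega>\<in>space M. T \<omega> = \<infinity> \<and> (\<exists>t\<ge>0. (\<Sum>i=n-k+1..n. \<Lambda> i t \<omega>) = real k)} +
        outer_measure_of M {\<omega>\<in>space M. T \<omega> < \<infinity> \<and>
          (SUP t\<in>{t. 0 \<le> t \<and> ennreal t < T \<omega>}. ereal (\<Sum>i=n-k+1..n. \<Lambda> i t \<omega>)) = ereal (real k)} = 0)"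
proof (intro conjI allI impI)
  interpret brownian_setup M F n B
    by (intro brownian_setup.intro brownian_setup_axioms.intro assms)
  have k: "1 \<le> k" "k \<le> n" using assms by auto
  fix \<Lambda> :: "nat \<Rightarrow> real \<Rightarrow> 'a \<Rightarrow> real" and T :: "'a \<Rightarrow> ennreal"
  {
    assume a: "(AE \<omega> in M. \<Lambda>0 k \<omega> > 0) \<and> jacobi_local_solution M F B n p q \<beta> \<Lambda>0 \<Lambda> T \<and>
        real k * \<beta> * (p - real n + real k) \<ge> 2"
    then have sol: "jacobi_local_solution M F B n p q \<beta> \<Lambda>0 \<Lambda> T" by blast
    obtain H X where J: "jacobi_solution M F n B p q \<beta> \<Lambda> X H T"
      using jacobi_solution_of_local_solution(1)[OF assms(6,4,5) sol] by blast
    interpret J: jacobi_solution M F n B p q \<beta> \<Lambda> X H T by (rule J)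
    have pos: "AE \<omega> in M. J.positive k \<omega>"
    proof (rule J.positive_collision[OF k])
      show "2 \<le> \<beta> * real k * (p - real n + real k)" using a by (simp add: mult.commute)
      have "AE \<omega> in M. 0 < \<Lambda>0 k \<omega>" using a by blast
      then show "AE \<omega> in M. 0 < T \<omega> \<longrightarrow> 0 < \<Lambda> k 0 \<omega>"
        using jacobi_solution_of_local_solution(2)[OF assms(6,4,5) sol]
        by eventually_elim (use k in auto)
    qed
    show "outer_measure_of M {\<omega>\<in>space M. T \<omega> = \<infinity> \<and> (\<exists>t\<ge>0. (\<Sum>i=1..k. \<Lambda> i t \<omega>) = 0)} +
        outer_measure_of M {\<omega>\<in>space M. T \<omega> < \<infinity> \<and>
          (INF t\<in>{t. 0 \<le> t \<and> ennreal t < T \<omega>}. ereal (\<Sum>i=1..k. \<Lambda> i t \<omega>)) = 0} = 0"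
      using J.collision_null(1,2)[OF pos] unfolding J.S_def by simp
  }
  {
    assume a: "(AE \<omega> in M. \<Lambda>0 (n - k + 1) \<omega> < 1) \<and> jacobi_local_solution M F B n p q \<beta> \<Lambda>0 \<Lambda> T \<and>
        real k * \<beta> * (q - real n + real k) \<ge> 2"
    then have sol: "jacobi_local_solution M F B n p q \<beta> \<Lambda>0 \<Lambda> T" by blast
    obtain H X where J: "jacobi_solution M F n B p q \<beta> \<Lambda> X H T"
      using jacobi_solution_of_local_solution(1)[OF assms(6,4,5) sol] by blast
    interpret R: jacobi_solution M F n B q p \<beta> "\<lambda>i t \<omega>. 1 - \<Lambda> (n + 1 - i) t \<omega>" "\<lambda>i t \<omega>. - X (n + 1 - i) t \<omega>"
      "\<lambda>i. H (n + 1 - i)" T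
      by (rule jacobi_solution.reflect[OF J assms(3)])
    have idx: "n + 1 - k = n - k + 1" using k by simp
    \<comment> \<open>The reflected lowest sum is \<open>k\<close> minus the sum of the
      \<open>k\<close> highest particles, so a collision at 1 is a collision at 0 of the reflected
      system.\<close>
    have S: "R.S k t \<omega> = real k - (\<Sum>i=n-k+1..n. \<Lambda> i t \<omega>)" for t \<omega>
    proof -
      have "(\<Sum>i=1..k. \<Lambda> (n + 1 - i) t \<omega>) = (\<Sum>i=n-k+1..n. \<Lambda> i t \<omega>)"
        by (rule sum.reindex_bij_witness[of _ "\<lambda>i. n + 1 - i" "\<lambda>i. n + 1 - i"]) (use k in auto)
      then show ?thesis unfolding R.S_def sum_subtractf by simp
    qed
    have pos: "AE \<omega> in M. R.positive k \<omega>"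
    proof (rule R.positive_collision[OF k])
      show "2 \<le> \<beta> * real k * (q - real n + real k)" using a by (simp add: mult.commute)
      have "AE \<omega> in M. \<Lambda>0 (n - k + 1) \<omega> < 1" using a by blast
      then show "AE \<omega> in M. 0 < T \<omega> \<longrightarrow> 0 < 1 - \<Lambda> (n + 1 - k) 0 \<omega>"
        using jacobi_solution_of_local_solution(2)[OF assms(6,4,5) sol]
        unfolding idx by eventually_elim (use k in auto)
    qed
    have "outer_measure_of M {\<omega>\<in>space M. T \<omega> = \<infinity> \<and> (\<exists>t\<ge>0. (\<Sum>i=n-k+1..n. \<Lambda> i t \<omega>) = real k)} = 0"
      using R.collision_null(1)[OF pos] unfolding S right_minus_eq by (simp only: eq_commute[of "real k"])
    moreover have "outer_measure_of M {\<omega>\<in>space M. T \<omega> < \<infinity> \<and>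
          (SUP t\<in>{t. 0 \<le> t \<and> ennreal t < T \<omega>}. ereal (\<Sum>i=n-k+1..n. \<Lambda> i t \<omega>)) = ereal (real k)} = 0"
      using R.collision_null(3)[OF pos, of "real k"] unfolding S by simp
    ultimately show "outer_measure_of M {\<omega>\<in>space M. T \<omega> = \<infinity> \<and> (\<exists>t\<ge>0. (\<Sum>i=n-k+1..n. \<Lambda> i t \<omega>) = real k)} +
        outer_measure_of M {\<omega>\<in>space M. T \<omega> < \<infinity> \<and>
          (SUP t\<in>{t. 0 \<le> t \<and> ennreal t < T \<omega>}. ereal (\<Sum>i=n-k+1..n. \<Lambda> i t \<omega>)) = ereal (real k)} = 0"
      by simp
  }
qed

end
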